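(* Let $U\subset\mathbb S$ be a patch. Fix an arbitrary $\alpha\in(0,1)$, an arbitrary $\tau\ge\frac12$, and $M>0$. Then, for every $r>1$, there exist constants $C_1=C_1(r,U,\alpha,\tau)>0$, $C_2=C_2(r,U,\alpha,\tau)>0$ (not depending on $M$) and a threshold $\delta=\delta(r,U,\alpha,\tau,M)>0$ such that the following holds: for all $\mathbf f_+\in\mathcal H_+^{(r)}(\mathbb S)$, with associated potential $u_+$ and density $\varphi_+=S_r^{-1}(u_+|_{\mathbb S_r})$, and all $\mathbf f_-\in\mathcal H_-(\mathbb S)$ that satisfy $$\|\mathbf f_-\|_{H^\tau(\mathbb S)^3}\le M,\qquad \|\varphi_+\|_{L^2(\mathbb S_r)}\le M,\qquad \|(\mathbf f_++\mathbf f_-)|_U\|_{L^2(U)^3}<\delta,$$ we have $$\|\mathbf f_+\|_{L^2(\mathbb S)^3}+\|\mathbf f_-\|_{L^2(\mathbb S)^3}\le\Phi\left(\|(\mathbf f_++\mathbf f_-)|_U\|_{L^2(U)^3}\right),$$ where $$\Phi(t)=\begin{cases}C_1M\left|\ln\left(\dfrac{C_2M}{t}\right)\right|^{-\alpha\vartheta_\tau},&0<t<\delta,\\[0.3em] 0,&t=0,\end{cases}\qquad \vartheta_\tau=\frac{\tau}{\tau+\frac12}\in(0,1).$$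
   Context: $\mathbb{S}=\{x\in\mathbb R^3:|x|=1\}$ is the unit sphere, with outward unit normal $\eta(x)=x$ and surface gradient $\nabla_{\mathbb S}$; $\mathbb S_r=\{|x|=r\}$ and $\mathbb B_r=\{|x|<r\}$ in $\mathbb R^3$. A patch $U$ is a non-empty open subregion of $\mathbb{S}$ with connected Lipschitz boundary such that $V=\mathbb{S}\setminus\overline U$ is non-empty. $H^\tau$ denotes the $L^2$-based Sobolev space of order $\tau$. Let $\{Y_{n,k}\}_{n\ge 0,\,|k|\le n}$ be an orthonormal basis of $L^2(\mathbb{S})$ of scalar spherical harmonics ($Y_{n,k}$ of degree $n$) and set $$\mathbf G^{\mathrm{ext}}_{n,k}=\nabla_{\mathbb S}Y_{n,k}+n\,\eta Y_{n,k},\qquad \mathbf G^{\mathrm{int}}_{n,k}=\nabla_{\mathbb S}Y_{n,k}-(n+1)\,\eta Y_{n,k}.$$ The Hardy spaces are the closed subspaces of $L^2(\mathbb S)^3$ $$\mathcal H_+(\mathbb S)=\overline{\mathrm{span}\{\mathbf G^{\mathrm{ext}}_{n,k}:n\ge1,|k|\le n\}}^{L^2(\mathbb S)^3},\qquad \mathcal H_-(\mathbb S)=\overline{\mathrm{span}\{\mathbf G^{\mathrm{int}}_{n,k}:n\ge0,|k|\le n\}}^{L^2(\mathbb S)^3}.$$ Equivalently, $\mathcal H_+(\mathbb S)$ (resp. $\mathcal H_-(\mathbb S)$) consists of the nontangential boundary limits $\nabla u|_{\mathbb S}$ of gradients of functions $u$ harmonic in the open unit ball (resp. harmonic in the complement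 of the closed unit ball with $u(x)\to0$ as $|x|\to\infty$) such that the nontangential maximal function of $\nabla u$ on $\mathbb S$, taken from the respective side, is square-integrable. For $r>1$, the external-source altitude class is $$\mathcal H_+^{(r)}(\mathbb S)=\{\nabla u|_{\mathbb S}:\ \Delta u=0\text{ in }\mathbb B_r,\ \|(\nabla u)_+^M\|_{L^2(\mathbb S_r)^3}<\infty,\ u|_{\mathbb S_r}\in H^1(\mathbb S_r)\}\subset\mathcal H_+(\mathbb S),$$ where $(\nabla u)^M_+$ denotes the nontangential maximal function of $\nabla u$ on $\mathbb S_r$ taken from inside $\mathbb B_r$, and $u|_{\mathbb S_r}$ the boundary trace. A potential associated with $\mathbf f_+\in\mathcal H_+^{(r)}(\mathbb S)$ is a function $u_+$ with the properties listed in this definition and $\mathbf f_+=\nabla u_+|_{\mathbb S}$. The boundary single-layer operator on $\mathbb S_r$ is $S_r\varphi=\frac1{4\pi}\int_{\mathbb S_r}\frac{\varphi(y)}{|\cdot-y|}\,d\sigma(y)$; $S_r:L^2(\mathbb S_r)\to H^1(\mathbb S_r)$ is an isomorphism. Thus $\varphi_+=S_r^{-1}(u_+|_{\mathbb S_r})\in L^2(\mathbb S_r)$ is the unique density with $u_+(x)=\frac1{4\pi}\int_{\mathbb S_r}\frac{\varphi_+(y)}{|x-y|}\,d\sigma(y)$ for $x\in\mathbb B_r$. *)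

theory Defs
  imports "HOL-Analysis.Analysis"
begin

section \<open>Surface measure and square-integrable functions\<close>

text \<open>
  Surface measure on the sphere of radius \<open>r\<close> about the origin in \<open>\<real>\<^sup>3\<close>, by polar coordinates:
  a Borel subset \<open>A\<close> of the sphere has area \<open>3 r\<^sup>2\<close> times the volume of that part of the unit ball
  which the radial projection sends into \<open>A\<close>; the total mass is \<open>4 \<pi> r\<^sup>2\<close>. The underlying space is
  the sphere itself, so values of functions off the sphere are irrelevant.
\<close>

definition sphere_measure :: "real \<Rightarrow> (real^3) measure" where
  "sphere_measure r = scale_measure (ennreal (3 * r\<^sup>2))
     (distr (restrict_space lborel (ball 0 1 - {0})) (restrict_space borel (sphere 0 r))
            (\<lambda>x. (r / norm x) *\<^sub>R x))"

definition L2 :: "'a measure \<Rightarrow> ('a \<Rightarrow> 'b::euclidean_space) set" where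
  "L2 M = {f \<in> borel_measurable M. integrable M (\<lambda>x. (norm (f x))\<^sup>2)}"

definition L2_norm :: "'a measure \<Rightarrow> ('a \<Rightarrow> 'b::euclidean_space) \<Rightarrow> real" where
  "L2_norm M f = sqrt (\<integral>x. (norm (f x))\<^sup>2 \<partial>M)"

definition L2_closed_span ::
    "'a measure \<Rightarrow> 'i set \<Rightarrow> ('i \<Rightarrow> 'a \<Rightarrow> 'b::euclidean_space) \<Rightarrow> ('a \<Rightarrow> 'b) set" where
  "L2_closed_span M I G = {f \<in> L2 M. \<forall>\<epsilon>>0. \<exists>F c. finite F \<and> F \<subseteq> I \<and>
     L2_norm M (\<lambda>x. f x - (\<Sum>i\<in>F. c i *\<^sub>R G i x)) < \<epsilon>}"

section \<open>Gradients and harmonic functions\<close>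

definition grad :: "(real^3 \<Rightarrow> real) \<Rightarrow> real^3 \<Rightarrow> real^3" where
  "grad u x = (\<chi> i. frechet_derivative u (at x) (axis i 1))"

definition laplacian :: "(real^3 \<Rightarrow> real) \<Rightarrow> real^3 \<Rightarrow> real" where
  "laplacian u x = (\<Sum>i\<in>UNIV. grad (\<lambda>y. grad u y $ i) x $ i)"

text \<open>Intended for open \<open>A\<close>: twice continuously differentiable with vanishing Laplacian.\<close>

definition harmonic_on :: "(real^3) set \<Rightarrow> (real^3 \<Rightarrow> real) \<Rightarrow> bool" where
  "harmonic_on A u \<longleftrightarrow>
     (\<forall>x\<in>A. u differentiable (at x)) \<and>
     (\<forall>i. \<forall>x\<in>A. (\<lambda>y. grad u y $ i) differentiable (at x)) \<and>
     (\<forall>i. continuous_on A (grad (\<lambda>y. grad u y $ i))) \<and>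
     (\<forall>x\<in>A. laplacian u x = 0)"

text \<open>
  The surface gradient on the unit sphere is the Euclidean gradient of the extension that is
  constant along rays.
\<close>

definition surface_grad :: "(real^3 \<Rightarrow> real) \<Rightarrow> real^3 \<Rightarrow> real^3" where
  "surface_grad f x = grad (\<lambda>z. f (z /\<^sub>R norm z)) x"

section \<open>Spherical harmonics, Sobolev spaces and the Hardy space\<close>

definition spherical_harmonic :: "nat \<Rightarrow> (real^3 \<Rightarrow> real) \<Rightarrow> bool" where
  "spherical_harmonic n f \<longleftrightarrow> (\<exists>P. real_polynomial_function P \<and>
     (\<forall>c x. P (c *\<^sub>R x) = c ^ n * P x) \<and> harmonic_on UNIV P \<and>
     (\<forall>x \<in> sphere 0 1. f x = P x))"

definition sh_index :: "(nat \<times> int) set" where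
  "sh_index = {(n, k). \<bar>k\<bar> \<le> int n}"

definition sh_basis :: "(nat \<Rightarrow> int \<Rightarrow> real^3 \<Rightarrow> real) \<Rightarrow> bool" where
  "sh_basis Y \<longleftrightarrow>
     (\<forall>(n, k) \<in> sh_index. spherical_harmonic n (Y n k)) \<and>
     (\<forall>(n, k) \<in> sh_index. \<forall>(m, l) \<in> sh_index.
        (\<integral>x. Y n k x * Y m l x \<partial>sphere_measure 1) = (if n = m \<and> k = l then 1 else 0)) \<and>
     L2_closed_span (sphere_measure 1) sh_index (\<lambda>(n, k). Y n k) = L2 (sphere_measure 1)"

text \<open>
  For vector fields the Fourier coefficient is a vector, and its squared norm is the sum over
  the Cartesian components; thus the Sobolev spaces below cover both scalar functions and, as the
  product space, vector fields. The weight \<open>(n + 1/2)\<^sup>2\<close> is the eigenvalue of \<open>1/4\<close> minus the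
  Laplace-Beltrami operator in degree \<open>n\<close>.
\<close>

definition sh_coeff ::
    "(nat \<Rightarrow> int \<Rightarrow> real^3 \<Rightarrow> real) \<Rightarrow> (real^3 \<Rightarrow> 'b::euclidean_space) \<Rightarrow> nat \<Rightarrow> int \<Rightarrow> 'b" where
  "sh_coeff Y f n k = (\<integral>x. Y n k x *\<^sub>R f x \<partial>sphere_measure 1)"

definition sobolev_term ::
    "(nat \<Rightarrow> int \<Rightarrow> real^3 \<Rightarrow> real) \<Rightarrow> real \<Rightarrow> (real^3 \<Rightarrow> 'b::euclidean_space) \<Rightarrow> nat \<Rightarrow> real" where
  "sobolev_term Y \<tau> f n =
     (real n + 1/2) powr (2 * \<tau>) * (\<Sum>k = - int n..int n. (norm (sh_coeff Y f n k))\<^sup>2)"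

definition sobolev ::
    "(nat \<Rightarrow> int \<Rightarrow> real^3 \<Rightarrow> real) \<Rightarrow> real \<Rightarrow> (real^3 \<Rightarrow> 'b::euclidean_space) set" where
  "sobolev Y \<tau> = {f \<in> L2 (sphere_measure 1). summable (sobolev_term Y \<tau> f)}"

definition sobolev_norm ::
    "(nat \<Rightarrow> int \<Rightarrow> real^3 \<Rightarrow> real) \<Rightarrow> real \<Rightarrow> (real^3 \<Rightarrow> 'b::euclidean_space) \<Rightarrow> real" where
  "sobolev_norm Y \<tau> f = sqrt (\<Sum>n. sobolev_term Y \<tau> f n)"

definition G_int :: "(nat \<Rightarrow> int \<Rightarrow> real^3 \<Rightarrow> real) \<Rightarrow> nat \<Rightarrow> int \<Rightarrow> real^3 \<Rightarrow> real^3" where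
  "G_int Y n k x = surface_grad (Y n k) x - ((real n + 1) * Y n k x) *\<^sub>R x"

definition hardy_minus :: "(nat \<Rightarrow> int \<Rightarrow> real^3 \<Rightarrow> real) \<Rightarrow> (real^3 \<Rightarrow> real^3) set" where
  "hardy_minus Y = L2_closed_span (sphere_measure 1) sh_index (\<lambda>(n, k). G_int Y n k)"

section \<open>Nontangential behaviour, single layers and the altitude class\<close>

text \<open>
  Nontangential approach region of aperture 2 at the boundary point \<open>y\<close> of the ball of radius \<open>r\<close>;
  \<open>r - norm x\<close> is the distance of \<open>x\<close> to the sphere.
\<close>

definition nt_region :: "real \<Rightarrow> real^3 \<Rightarrow> (real^3) set" where
  "nt_region r y = {x \<in> ball 0 r. norm (x - y) < 2 * (r - norm x)}"

definition nt_maximal :: "real \<Rightarrow> (real^3 \<Rightarrow> real^3) \<Rightarrow> real^3 \<Rightarrow> ennreal" where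
  "nt_maximal r F y = (SUP x \<in> nt_region r y. ennreal (norm (F x)))"

definition has_boundary_trace :: "real \<Rightarrow> (real^3 \<Rightarrow> real) \<Rightarrow> (real^3 \<Rightarrow> real) \<Rightarrow> bool" where
  "has_boundary_trace r u g \<longleftrightarrow>
     (AE y in sphere_measure r. (u \<longlongrightarrow> g y) (at y within nt_region r y))"

definition single_layer :: "real \<Rightarrow> (real^3 \<Rightarrow> real) \<Rightarrow> real^3 \<Rightarrow> real" where
  "single_layer r \<phi> x = 1 / (4 * pi) * (\<integral>y. \<phi> y / norm (x - y) \<partial>sphere_measure r)"

text \<open>A function on the sphere of radius \<open>r\<close> is in \<open>H\<^sup>1\<close> iff its rescaling to the unit sphere is.\<close>

definition is_potential ::
    "(nat \<Rightarrow> int \<Rightarrow> real^3 \<Rightarrow> real) \<Rightarrow> real \<Rightarrow> (real^3 \<Rightarrow> real^3) \<Rightarrow> (real^3 \<Rightarrow> real) \<Rightarrow> bool" where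
  "is_potential Y r f u \<longleftrightarrow>
     harmonic_on (ball 0 r) u \<and>
     (\<integral>\<^sup>+y. (nt_maximal r (grad u) y)\<^sup>2 \<partial>sphere_measure r) < \<infinity> \<and>
     (\<exists>g. has_boundary_trace r u g \<and> (\<lambda>x. g (r *\<^sub>R x)) \<in> sobolev Y 1) \<and>
     (AE x in sphere_measure 1. f x = grad u x)"

definition hardy_plus_alt ::
    "(nat \<Rightarrow> int \<Rightarrow> real^3 \<Rightarrow> real) \<Rightarrow> real \<Rightarrow> (real^3 \<Rightarrow> real^3) set" where
  "hardy_plus_alt Y r = {f \<in> L2 (sphere_measure 1). \<exists>u. is_potential Y r f u}"

text \<open>\<open>\<phi>\<close> is the (almost everywhere unique) preimage under the single layer of the trace of \<open>u\<close>.\<close>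

definition is_density :: "real \<Rightarrow> (real^3 \<Rightarrow> real) \<Rightarrow> (real^3 \<Rightarrow> real) \<Rightarrow> bool" where
  "is_density r u \<phi> \<longleftrightarrow>
     \<phi> \<in> L2 (sphere_measure r) \<and> has_boundary_trace r u (single_layer r \<phi>)"

section \<open>Patches\<close>

text \<open>
  Near each boundary point \<open>p\<close>, orthogonal projection to the tangent plane at \<open>p\<close> with orthonormal
  basis \<open>e, e'\<close> is a chart of the sphere, in which \<open>U\<close> has to be the strict epigraph of a Lipschitz
  function.
\<close>

definition lipschitz_boundary :: "(real^3) set \<Rightarrow> bool" where
  "lipschitz_boundary U \<longleftrightarrow>
     (\<forall>p \<in> (top_of_set (sphere 0 1)) frontier_of U. \<exists>e e' \<gamma> L \<epsilon>.
        norm e = 1 \<and> norm e' = 1 \<and> e \<bullet> e' = 0 \<and> e \<bullet> p = 0 \<and> e' \<bullet> p = 0 \<and>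
        L-lipschitz_on UNIV \<gamma> \<and> \<epsilon> > 0 \<and>
        (\<forall>x \<in> sphere 0 1 \<inter> ball p \<epsilon>. x \<in> U \<longleftrightarrow> \<gamma> (x \<bullet> e) < x \<bullet> e'))"

definition patch :: "(real^3) set \<Rightarrow> bool" where
  "patch U \<longleftrightarrow> U \<noteq> {} \<and> openin (top_of_set (sphere 0 1)) U \<and> connected U \<and>
     connected ((top_of_set (sphere 0 1)) frontier_of U) \<and> lipschitz_boundary U \<and>
     sphere 0 1 - closure U \<noteq> {}"

section \<open>The stability modulus\<close>

definition stab_exponent :: "real \<Rightarrow> real" where
  "stab_exponent \<tau> = \<tau> / (\<tau> + 1/2)"

definition stab_modulus :: "real \<Rightarrow> real \<Rightarrow> real \<Rightarrow> real \<Rightarrow> real \<Rightarrow> real \<Rightarrow> real" where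
  "stab_modulus C1 C2 M \<alpha> \<tau> t =
     (if t = 0 then 0 else C1 * M * \<bar>ln (C2 * M / t)\<bar> powr (- \<alpha> * stab_exponent \<tau>))"

end

theory Submission
  imports Defs "HOL-Complex_Analysis.Complex_Analysis"
begin

text \<open>
  Pair a field \<open>f\<close> with the gradient in \<open>y\<close> of the Newtonian kernel \<open>1 / norm (w - s *\<^sub>R y)\<close>, \<open>w\<close> on
  the sphere. For \<open>s < 1\<close> this annihilates the fields of internal sources and turns those of external
  sources into a power series in \<open>s\<close> whose \<open>n\<close>-th coefficient is \<open>n\<close> times the degree \<open>n\<close> part
  \<open>P\<^sub>n\<close> of the potential at \<open>w\<close>; for \<open>s > 1\<close> the roles are exchanged and the coefficients
  \<open>n + 1\<close> times \<open>Q\<^sub>n w\<close> of powers of \<open>1 / s\<close> appear. Now let \<open>w\<close> range over a cap well inside the patch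
  \<open>U\<close> and let \<open>s\<close> be complex. The part of the pairing over \<open>\<S> - U\<close> is holomorphic near \<open>s = 1\<close>, and
  the part over \<open>U\<close> is as small as the data. Hence the pairing over the complement agrees up to a small
  error with the first series on one side of \<open>s = 1\<close> and with the second one on the other side, and
  propagation of smallness, first across \<open>s = 1\<close>, then along an annulus, where the difference of the two
  series is a convergent Laurent series thanks to the altitude \<open>r > 1\<close>, bounds all its coefficients by a
  power of the data. So \<open>P\<^sub>n\<close> and \<open>Q\<^sub>n\<close> are small on the cap, and by a Remez inequality for
  homogeneous polynomials on the whole sphere, at the price of a factor exponential in \<open>n\<close>. Degrees
  beyond \<open>N\<close> cost only \<open>M * (N + 1) powr - \<tau>\<close> by the a priori bounds, and \<open>N\<close> proportional to
  \<open>ln (M / t)\<close> balances the two contributions. The resulting exponent \<open>\<tau>\<close> is better than required.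
\<close>

section \<open>Surface measure\<close>

text \<open>At s = 1 the kernel is singular at w itself. Splitting the source integral isolates the
  part over the complement of U, which continues analytically through s = 1 because w stays away
  from it; the part over U is never continued across and is needed only on two small discs around 1
  - d / 2 and 1 + d / 2. The power series in s rest on a single integration by parts on the sphere,
  obtained from rotation invariance of the measure by differentiating along the rotations about the
  three axes. It makes the moments of a harmonic function on concentric spheres solve an Euler
  equation, whose regular solution is a pure power; applied to the Newtonian kernel this replaces an
  addition theorem for spherical harmonics. The altitude acts twice: it lets the external series
  converge beyond the unit circle, and it makes the external tail decay at every Sobolev rate, so
  that the rate of the internal field can be imposed on it. All bounds are linear in M, hence only
  the quotient q = t / M matters, and they are uniform in the orthonormal basis.\<close>

abbreviation sigma :: "(real^3) measure" ("\<sigma>") where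
  "\<sigma> \<equiv> sphere_measure 1"

abbreviation unit_sphere :: "(real^3) set" ("\<S>") where
  "\<S> \<equiv> sphere 0 1"

lemma radial_measurable:
  "(\<lambda>x. (r / norm x) *\<^sub>R x) \<in>
     restrict_space lborel (ball 0 1 - {0}) \<rightarrow>\<^sub>M restrict_space borel (sphere (0::real^3) r)"
  if "0 \<le> r"
proof (rule measurable_restrict_space2)
  show "(\<lambda>x. (r / norm x) *\<^sub>R x) \<in> space (restrict_space lborel (ball 0 1 - {0})) \<rightarrow> sphere (0::real^3) r"
    using that by (auto simp: space_restrict_space)
  show "(\<lambda>x::real^3. (r / norm x) *\<^sub>R x) \<in> borel_measurable (restrict_space lborel (ball 0 1 - {0}))"
    by (intro measurable_restrict_space1) measurable
qed

lemma space_sphere_measure [simp]: "space (sphere_measure r) = sphere 0 r"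
  by (simp add: sphere_measure_def space_restrict_space space_scale_measure)

lemma sets_sphere_measure [simp, measurable_cong]:
  "sets (sphere_measure r) = sets (restrict_space borel (sphere 0 r))"
  by (simp add: sphere_measure_def)

definition cone_part :: "real \<Rightarrow> (real^3) set \<Rightarrow> (real^3) set" where
  "cone_part r A = {x \<in> ball 0 1 - {0}. (r / norm x) *\<^sub>R x \<in> A}"

lemma cone_part_borel:
  assumes "0 \<le> r" "A \<in> sets (restrict_space borel (sphere 0 r))"
  shows "cone_part r A \<in> sets borel"
proof -
  have "cone_part r A = (\<lambda>x. (r / norm x) *\<^sub>R x) -` A \<inter>
      space (restrict_space lborel (ball 0 1 - {0::real^3}))"
    by (auto simp: cone_part_def space_restrict_space)
  also have "\<dots> \<in> sets (restrict_space lborel (ball 0 1 - {0::real^3}))"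
    using radial_measurable[OF assms(1)] assms(2) by (rule measurable_sets)
  finally show ?thesis
    by (subst (asm) sets_restrict_space_iff) auto
qed

lemma emeasure_sphere_measure:
  assumes "0 \<le> r" "A \<in> sets (restrict_space borel (sphere 0 r))"
  shows "emeasure (sphere_measure r) A = ennreal (3 * r\<^sup>2) * emeasure lborel (cone_part r A)"
proof -
  have "(\<lambda>x. (r / norm x) *\<^sub>R x) -` A \<inter> space (restrict_space lborel (ball 0 1 - {0::real^3})) = cone_part r A"
    by (auto simp: cone_part_def space_restrict_space)
  moreover have "emeasure (restrict_space lborel (ball 0 1 - {0})) (cone_part r A) = emeasure lborel (cone_part r A)"
    by (rule emeasure_restrict_space) (auto simp: cone_part_def)
  ultimately show ?thesis
    unfolding sphere_measure_def
    by (subst emeasure_scale_measure, subst emeasure_distr[OF radial_measurable[OF assms(1)] assms(2)]) simp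
qed

lemma finite_measure_sphere: "finite_measure (sphere_measure r)" if "0 \<le> r"
proof (rule finite_measureI)
  have S: "sphere 0 r \<in> sets (restrict_space borel (sphere (0::real^3) r))"
    by (metis sets.top space_restrict_space space_borel inf_top_right)
  have "emeasure lborel (cone_part r (sphere 0 r)) \<le> emeasure lborel (ball (0::real^3) 1)"
    by (rule emeasure_mono) (auto simp: cone_part_def)
  also have "\<dots> < \<infinity>"
    using emeasure_lborel_ball_finite by auto
  finally show "emeasure (sphere_measure r) (space (sphere_measure r)) \<noteq> \<infinity>"
    using emeasure_sphere_measure[OF that S] by (simp add: ennreal_mult_eq_top_iff)
qed

section \<open>Invariance under orthogonal maps and behaviour under dilations\<close>

lemma lborel_distr_orthogonal:
  fixes R :: "real^'n::{finite,wellorder} \<Rightarrow> real^'n::{finite,wellorder}"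
  assumes "orthogonal_transformation R"
  shows "distr lborel lborel R = lborel"
proof -
  have lin: "linear R" and bij: "bij R"
    using assms orthogonal_transformation_linear orthogonal_transformation_bij by auto
  define Q where "Q = inv R"
  have Q: "orthogonal_transformation Q"
    unfolding Q_def using assms by (rule orthogonal_transformation_inv)
  have meas: "R \<in> borel_measurable borel"
    using lin by (intro borel_measurable_continuous_onI linear_continuous_on linear_conv_bounded_linear[THEN iffD1])
  have "lborel = distr lborel borel R"
  proof (rule lborel_eqI)
    fix l u :: "real^'n::{finite,wellorder}"
    assume "\<And>b. b \<in> Basis \<Longrightarrow> l \<bullet> b \<le> u \<bullet> b"
    \<comment> \<open>It suffices to test on boxes. The preimage of a box is its image under the
      inverse map, which is again orthogonal and therefore keeps the volume.\<close>
    have vim: "R -` box l u = Q ` box l u"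
      unfolding Q_def using bij by (simp add: bij_vimage_eq_inv_image)
    have "emeasure (distr lborel borel R) (box l u) = emeasure lborel (Q ` box l u)"
      using meas by (subst emeasure_distr) (auto simp: vim)
    also have "\<dots> = emeasure lebesgue (Q ` box l u)"
      using measurable_sets_borel[OF meas, of "box l u"] by (simp add: vim)
    also have "\<dots> = ennreal (measure lebesgue (Q ` box l u))"
      by (rule emeasure_eq_measure2) (use measurable_orthogonal_image[OF Q, of "box l u"] in auto)
    also have "\<dots> = ennreal (measure lebesgue (box l u))"
      using measure_orthogonal_image[OF Q, of "box l u"] by simp
    also have "\<dots> = ennreal (measure lborel (box l u))"
      by (simp add: measure_completion)
    also have "\<dots> = (\<Prod>b\<in>Basis. (u - l) \<bullet> b)"
      using \<open>\<And>b. b \<in> Basis \<Longrightarrow> l \<bullet> b \<le> u \<bullet> b\<close> by (simp add: measure_lborel_box_eq)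
    finally show "emeasure (distr lborel borel R) (box l u) = (\<Prod>b\<in>Basis. (u - l) \<bullet> b)" .
  qed (simp)
  then show ?thesis
    by (metis distr_cong sets_lborel)
qed

lemma sphere_sets_iff:
  "A \<in> sets (restrict_space borel (sphere (0::real^3) r)) \<longleftrightarrow> A \<subseteq> sphere 0 r \<and> A \<in> sets borel"
  by (subst sets_restrict_space_iff) auto

lemma orthogonal_borel_measurable:
  fixes R :: "real^'n \<Rightarrow> real^'n"
  assumes "orthogonal_transformation R"
  shows "R \<in> borel_measurable borel"
  using orthogonal_transformation_linear[OF assms]
  by (intro borel_measurable_continuous_onI linear_continuous_on linear_conv_bounded_linear[THEN iffD1])

lemma orthogonal_measurable_sphere:
  assumes "orthogonal_transformation R"
  shows "R \<in> sphere_measure r \<rightarrow>\<^sub>M sphere_measure r"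
proof -
  have "R \<in> restrict_space borel (sphere 0 r) \<rightarrow>\<^sub>M restrict_space borel (sphere 0 r)"
    by (intro measurable_restrict_space3 orthogonal_borel_measurable assms)
       (auto simp: orthogonal_transformation_norm[OF assms])
  then show ?thesis
    by (simp cong: measurable_cong_sets)
qed

text \<open>An orthogonal map keeps norms and commutes with scaling, hence with the radial
  projection. So the cone over a preimage is the preimage of the cone, and invariance of Lebesgue
  measure applies.\<close>

lemma sphere_measure_distr_orthogonal:
  assumes R: "orthogonal_transformation R" and r: "0 \<le> r"
  shows "distr (sphere_measure r) (sphere_measure r) R = sphere_measure r"
proof (rule measure_eqI)
  fix A assume A: "A \<in> sets (distr (sphere_measure r) (sphere_measure r) R)"
  then have A': "A \<in> sets (sphere_measure r)" "A \<in> sets (restrict_space borel (sphere 0 r))"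
    by auto
  have lin: "linear R" using R by (rule orthogonal_transformation_linear)
  have nR: "norm (R x) = norm x" for x using R by (rule orthogonal_transformation_norm)
  define B where "B = R -` A \<inter> sphere 0 r"
  have B: "B \<in> sets (restrict_space borel (sphere 0 r))"
    using measurable_sets[OF orthogonal_measurable_sphere[OF R] A'(1)] by (simp add: B_def)
  have "cone_part r B = R -` cone_part r A"
  proof -
    have "R x = 0 \<longleftrightarrow> x = 0" for x
      using nR[of x] by (metis norm_eq_zero)
    moreover have "(r / norm x) *\<^sub>R x \<in> B \<longleftrightarrow> (r / norm x) *\<^sub>R R x \<in> A" if "x \<noteq> 0" for x
      using that r by (auto simp: B_def linear_scale[OF lin])
    ultimately show ?thesis
      by (auto simp: cone_part_def nR)
  qed
  moreover have "emeasure lborel (R -` cone_part r A) = emeasure (distr lborel lborel R) (cone_part r A)"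
    using orthogonal_borel_measurable[OF R] cone_part_borel[OF r A'(2)]
    by (subst emeasure_distr) auto
  ultimately have "emeasure lborel (cone_part r B) = emeasure lborel (cone_part r A)"
    by (simp add: lborel_distr_orthogonal[OF R])
  then show "emeasure (distr (sphere_measure r) (sphere_measure r) R) A = emeasure (sphere_measure r) A"
    using orthogonal_measurable_sphere[OF R] A' r B
    by (subst emeasure_distr) (auto simp: emeasure_sphere_measure B_def)
qed simp

lemma integral_sphere_orthogonal:
  fixes g :: "real^3 \<Rightarrow> 'b::{banach, second_countable_topology}"
  assumes R: "orthogonal_transformation R" and "g \<in> borel_measurable \<sigma>"
  shows "(\<integral>x. g (R x) \<partial>\<sigma>) = (\<integral>x. g x \<partial>\<sigma>)"
  using integral_distr[OF orthogonal_measurable_sphere[OF R] assms(2)]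
    sphere_measure_distr_orthogonal[OF R, of 1] by simp

lemma scaling_measurable_sphere:
  assumes "0 < r"
  shows "(\<lambda>y. r *\<^sub>R y) \<in> \<sigma> \<rightarrow>\<^sub>M sphere_measure r"
proof -
  have "(\<lambda>y. r *\<^sub>R y) \<in> restrict_space borel \<S> \<rightarrow>\<^sub>M restrict_space borel (sphere 0 r)"
    by (intro measurable_restrict_space3) (use assms in auto)
  then show ?thesis
    by (simp cong: measurable_cong_sets)
qed

text \<open>A subset of the sphere of radius r and its rescaling to the unit sphere span the same
  cone, so only the factors 3 r^2 and 3 differ.\<close>

lemma sphere_measure_scaling:
  assumes r: "0 < r"
  shows "sphere_measure r = scale_measure (ennreal (r\<^sup>2)) (distr \<sigma> (sphere_measure r) (\<lambda>y. r *\<^sub>R y))"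
proof (rule measure_eqI)
  fix A assume A: "A \<in> sets (sphere_measure r)"
  then have A': "A \<in> sets (restrict_space borel (sphere 0 r))" by simp
  define B where "B = (\<lambda>y. r *\<^sub>R y) -` A \<inter> \<S>"
  have B: "B \<in> sets (restrict_space borel \<S>)"
    using measurable_sets[OF scaling_measurable_sphere[OF r] A] by (simp add: B_def)
  have "cone_part 1 B = cone_part r A"
    by (auto simp: cone_part_def B_def)
  then have "emeasure (distr \<sigma> (sphere_measure r) (\<lambda>y. r *\<^sub>R y)) A = 3 * emeasure lborel (cone_part r A)"
    using scaling_measurable_sphere[OF r] A B
    by (subst emeasure_distr) (auto simp: emeasure_sphere_measure B_def)
  then show "emeasure (sphere_measure r) A
      = emeasure (scale_measure (ennreal (r\<^sup>2)) (distr \<sigma> (sphere_measure r) (\<lambda>y. r *\<^sub>R y))) A"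
    using r A' by (simp add: emeasure_sphere_measure ennreal_mult mult_ac)
qed simp

lemma nn_integral_sphere_scaling:
  assumes r: "0 < r" and g: "g \<in> borel_measurable (sphere_measure r)"
  shows "(\<integral>\<^sup>+x. g x \<partial>sphere_measure r) = ennreal (r\<^sup>2) * (\<integral>\<^sup>+y. g (r *\<^sub>R y) \<partial>\<sigma>)"
proof -
  have "(\<integral>\<^sup>+x. g x \<partial>sphere_measure r)
      = (\<integral>\<^sup>+x. g x \<partial>scale_measure (ennreal (r\<^sup>2)) (distr \<sigma> (sphere_measure r) (\<lambda>y. r *\<^sub>R y)))"
    using sphere_measure_scaling[OF r] by simp
  also have "\<dots> = ennreal (r\<^sup>2) * (\<integral>\<^sup>+y. g y \<partial>distr \<sigma> (sphere_measure r) (\<lambda>y. r *\<^sub>R y))"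
    by (rule nn_integral_scale_measure) (use g in \<open>simp add: measurable_distr_eq1\<close>)
  also have "\<dots> = ennreal (r\<^sup>2) * (\<integral>\<^sup>+y. g (r *\<^sub>R y) \<partial>\<sigma>)"
    by (subst nn_integral_distr[OF scaling_measurable_sphere[OF r]]) (use g in auto)
  finally show ?thesis .
qed

lemma AE_sphere_scaling:
  assumes r: "0 < r" and "AE x in sphere_measure r. P x"
  shows "AE y in \<sigma>. P (r *\<^sub>R y)"
proof -
  obtain N where N: "\<And>x. x \<in> space (sphere_measure r) - N \<Longrightarrow> P x" "N \<in> null_sets (sphere_measure r)"
    using AE_E3[OF assms(2)] by blast
  have NS: "N \<in> sets (sphere_measure r)" "emeasure (sphere_measure r) N = 0"
    using N by (auto simp: null_sets_def)
  have "ennreal (r\<^sup>2) * emeasure \<sigma> ((\<lambda>y. r *\<^sub>R y) -` N \<inter> \<S>) = 0"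
    using NS(2) scaling_measurable_sphere[OF r] NS(1)
    by (subst (asm) sphere_measure_scaling[OF r]) (simp add: emeasure_distr)
  then have "emeasure \<sigma> ((\<lambda>y. r *\<^sub>R y) -` N \<inter> \<S>) = 0"
    using r by simp
  moreover have "(\<lambda>y. r *\<^sub>R y) -` N \<inter> \<S> \<in> sets \<sigma>"
    using measurable_sets[OF scaling_measurable_sphere[OF r] NS(1)] by simp
  ultimately have "(\<lambda>y. r *\<^sub>R y) -` N \<inter> \<S> \<in> null_sets \<sigma>"
    by (rule null_setsI)
  then show ?thesis
  proof (rule AE_I')
    show "{x \<in> space \<sigma>. \<not> P (r *\<^sub>R x)} \<subseteq> (\<lambda>y. r *\<^sub>R y) -` N \<inter> \<S>"
    proof
      fix y assume "y \<in> {x \<in> space \<sigma>. \<not> P (r *\<^sub>R x)}"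
      then show "y \<in> (\<lambda>y. r *\<^sub>R y) -` N \<inter> \<S>"
        using N(1)[of "r *\<^sub>R y"] r by auto
    qed
  qed
qed

interpretation sigma: finite_measure \<sigma>
  by (rule finite_measure_sphere) simp

lemma continuous_sphere_measurable:
  fixes g :: "real^3 \<Rightarrow> 'b::euclidean_space"
  assumes "continuous_on (sphere 0 r) g"
  shows "g \<in> borel_measurable (sphere_measure r)"
proof -
  have "g \<in> borel_measurable (restrict_space borel (sphere 0 r))"
    using assms by (rule borel_measurable_continuous_on_restrict)
  then show ?thesis
    by (simp cong: measurable_cong_sets)
qed

lemma continuous_sphere_bounded:
  fixes g :: "real^3 \<Rightarrow> 'b::euclidean_space"
  assumes "continuous_on \<S> g"
  obtains B where "B > 0" "\<And>x. x \<in> \<S> \<Longrightarrow> norm (g x) \<le> B"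
proof -
  have "bounded (g ` \<S>)"
    using compact_continuous_image[OF assms compact_sphere] by (rule compact_imp_bounded)
  then show ?thesis using that by (auto simp: bounded_pos)
qed

lemma bounded_sphere_integrable:
  fixes g :: "real^3 \<Rightarrow> 'b::euclidean_space"
  assumes "g \<in> borel_measurable \<sigma>" "\<And>x. x \<in> \<S> \<Longrightarrow> norm (g x) \<le> B"
  shows "integrable \<sigma> g"
  by (rule sigma.integrable_const_bound[where B=B]) (use assms in \<open>auto intro!: AE_I2\<close>)

lemma continuous_sphere_integrable:
  fixes g :: "real^3 \<Rightarrow> 'b::euclidean_space"
  assumes "continuous_on \<S> g"
  shows "integrable \<sigma> g"
  using continuous_sphere_bounded[OF assms] bounded_sphere_integrable[OF continuous_sphere_measurable[OF assms]]
  by metis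

section \<open>Twice differentiable functions and Green's identity on the sphere\<close>

no_notation fps_nth (infixl "$" 75)

text \<open>Dominated convergence for difference quotients, which the mean value inequality on the
  convex set S bounds by w. The parameter lives in a general field because it is an angle or a
  radius in some uses and a complex number in others.\<close>

lemma has_field_derivative_lebesgue_integral:
  fixes k :: "'a::{real_normed_field, euclidean_space} \<Rightarrow> 'y \<Rightarrow> 'a"
  assumes S: "open S" "convex S" "z0 \<in> S"
    and int: "\<And>z. z \<in> S \<Longrightarrow> integrable M (k z)"
    and deriv: "\<And>z y. z \<in> S \<Longrightarrow> y \<in> space M \<Longrightarrow> ((\<lambda>z. k z y) has_field_derivative k' z y) (at z)"
    and bound: "\<And>z y. z \<in> S \<Longrightarrow> y \<in> space M \<Longrightarrow> norm (k' z y) \<le> w y"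
    and w: "integrable M w"
  shows "integrable M (k' z0)"
    and "((\<lambda>z. \<integral>y. k z y \<partial>M) has_field_derivative (\<integral>y. k' z0 y \<partial>M)) (at z0)"
proof -
  have lim: "((\<lambda>z. (k z y - k z0 y) / (z - z0)) \<longlongrightarrow> k' z0 y) (at z0)" if "y \<in> space M" for y
    using deriv[OF S(3) that] by (simp add: has_field_derivative_iff)
  obtain e where e: "e > 0" "ball z0 e \<subseteq> S"
    using S openE by blast
  define t where "t n = z0 + of_real (e / (real n + 2))" for n :: nat
  have tn: "t n \<in> S - {z0}" for n
  proof -
    have "e / (real n + 2) \<noteq> 0" "\<bar>e / (real n + 2)\<bar> < e"
      using e(1) by (auto simp: field_simps add_pos_nonneg)
    then have "norm (of_real (e / (real n + 2)) :: 'a) < e" "t n \<noteq> z0"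
      by (auto simp: t_def simp del: of_real_divide divide_eq_0_iff)
    then show ?thesis using e(2) by (auto simp: t_def dist_norm subset_iff)
  qed
  have t_lim: "filterlim t (at z0) sequentially"
  proof -
    have "(\<lambda>n. e / (real n + 2)) \<longlonglongrightarrow> 0" by real_asymp
    then have "(\<lambda>n. z0 + of_real (e / (real n + 2))) \<longlonglongrightarrow> z0 + of_real 0"
      by (intro tendsto_intros)
    then show ?thesis using tn by (auto simp: filterlim_at t_def[abs_def])
  qed
  show int': "integrable M (k' z0)"
  proof (rule Bochner_Integration.integrable_bound[OF w])
    show "k' z0 \<in> borel_measurable M"
    proof (rule borel_measurable_LIMSEQ_metric)
      show "(\<lambda>y. (k (t n) y - k z0 y) / (t n - z0)) \<in> borel_measurable M" for n
        using int[of "t n"] int[OF S(3)] tn[of n] by (auto intro!: borel_measurable_divide)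
      show "(\<lambda>n. (k (t n) y - k z0 y) / (t n - z0)) \<longlonglongrightarrow> k' z0 y" if "y \<in> space M" for y
        using filterlim_compose[OF lim[OF that] t_lim] .
    qed
    show "AE y in M. norm (k' z0 y) \<le> norm (w y)"
      using bound[OF S(3)] by (force intro!: AE_I2)
  qed
  have quot: "norm ((k z y - k z0 y) / (z - z0)) \<le> w y" if "z \<in> S" "z \<noteq> z0" "y \<in> space M" for z y
  proof -
    have "norm (k z y - k z0 y) \<le> w y * norm (z - z0)"
      by (rule field_differentiable_bound[OF S(2), where f'="\<lambda>z. k' z y"])
         (use deriv bound that S in \<open>auto intro: has_field_derivative_at_within\<close>)
    then show ?thesis using that by (simp add: norm_divide field_simps)
  qed
  have "((\<lambda>z. \<integral>y. (k z y - k z0 y) / (z - z0) \<partial>M) \<longlongrightarrow> (\<integral>y. k' z0 y \<partial>M)) (at z0)"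
  proof (rule tendsto_at_iff_sequentially[THEN iffD2], intro allI impI)
    fix X :: "nat \<Rightarrow> 'a" assume X: "\<forall>i. X i \<in> UNIV - {z0}" "X \<longlonglongrightarrow> z0"
    then obtain N where N: "\<And>n. n \<ge> N \<Longrightarrow> X n \<in> S"
      using S(1,3) by (metis (no_types, lifting) eventually_sequentially topological_tendstoD)
    have X': "filterlim X (at z0) sequentially"
      using X by (auto simp: filterlim_at)
    \<comment> \<open>The shift by N discards the terms of the sequence that may lie outside S,
      where nothing is known about k.\<close>
    have "(\<lambda>n. \<integral>y. (k (X (n + N)) y - k z0 y) / (X (n + N) - z0) \<partial>M) \<longlonglongrightarrow> (\<integral>y. k' z0 y \<partial>M)"
    proof (rule integral_dominated_convergence[where w=w])
      show "k' z0 \<in> borel_measurable M" using int' by simp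
      show "(\<lambda>y. (k (X (n + N)) y - k z0 y) / (X (n + N) - z0)) \<in> borel_measurable M" for n
        using int[of "X (n + N)"] int[OF S(3)] N[of "n + N"] by (auto intro!: borel_measurable_divide)
      show "AE y in M. (\<lambda>n. (k (X (n + N)) y - k z0 y) / (X (n + N) - z0)) \<longlonglongrightarrow> k' z0 y"
        using LIMSEQ_ignore_initial_segment[OF filterlim_compose[OF lim X'], of _ N] by (auto intro!: AE_I2)
      show "AE y in M. norm ((k (X (n + N)) y - k z0 y) / (X (n + N) - z0)) \<le> w y" for n
        using quot[OF N] X(1) by (auto intro!: AE_I2)
    qed (rule w)
    then show "((\<lambda>z. \<integral>y. (k z y - k z0 y) / (z - z0) \<partial>M) \<circ> X) \<longlonglongrightarrow> (\<integral>y. k' z0 y \<partial>M)"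
      unfolding comp_def by (rule LIMSEQ_offset)
  qed
  moreover have "\<forall>\<^sub>F z in at z0. (\<integral>y. (k z y - k z0 y) / (z - z0) \<partial>M)
       = ((\<integral>y. k z y \<partial>M) - (\<integral>y. k z0 y \<partial>M)) / (z - z0)"
  proof -
    have "\<forall>\<^sub>F z in at z0. z \<in> S"
      using S by (simp add: eventually_at_topological) blast
    then show ?thesis
      by eventually_elim (use int S(3) in simp)
  qed
  ultimately show "((\<lambda>z. \<integral>y. k z y \<partial>M) has_field_derivative (\<integral>y. k' z0 y \<partial>M)) (at z0)"
    unfolding has_field_derivative_iff by (rule Lim_transform_eventually)
qed

section \<open>Gradient and Hessian\<close>

lemma grad_eqI: "(u has_derivative (\<lambda>v. g \<bullet> v)) (at x) \<Longrightarrow> grad u x = g"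
  using frechet_derivative_at[of u "\<lambda>v. g \<bullet> v" x, symmetric] by (simp add: grad_def vec_eq_iff inner_axis)

lemma grad_has_derivative:
  assumes "u differentiable (at x)"
  shows "(u has_derivative (\<lambda>v. grad u x \<bullet> v)) (at x)"
proof -
  let ?D = "frechet_derivative u (at x)"
  have D: "(u has_derivative ?D) (at x)"
    using assms by (simp add: frechet_derivative_works)
  then have lin: "linear ?D" by (rule has_derivative_linear)
  have "?D v = grad u x \<bullet> v" for v
  proof -
    have "v = (\<Sum>i\<in>UNIV. v $ i *\<^sub>R axis i 1)"
      using basis_expansion[of v] by (simp add: scalar_mult_eq_scaleR)
    then have "?D v = ?D (\<Sum>i\<in>UNIV. v $ i *\<^sub>R axis i 1)"
      by simp
    also have "\<dots> = (\<Sum>i\<in>UNIV. v $ i *\<^sub>R ?D (axis i 1))"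
      by (simp only: linear_sum[OF lin] linear_scale[OF lin])
    finally have "?D v = (\<Sum>i\<in>UNIV. v $ i *\<^sub>R ?D (axis i 1))" .
    then have "?D v = (\<Sum>i\<in>UNIV. v $ i * ?D (axis i 1))"
      by simp
    then show ?thesis
      by (simp add: grad_def inner_vec_def mult.commute)
  qed
  then have "?D = (\<lambda>v. grad u x \<bullet> v)" by auto
  then show ?thesis using D by simp
qed

text \<open>The derivative of \<open>grad u\<close> at x in direction v. Kept as a linear map in v,
  it can be evaluated along rays and along rotation fields alike.\<close>

definition hess :: "(real^3 \<Rightarrow> real) \<Rightarrow> real^3 \<Rightarrow> real^3 \<Rightarrow> real^3" where
  "hess u x v = (\<chi> i. grad (\<lambda>y. grad u y $ i) x \<bullet> v)"

definition C2_on :: "(real^3) set \<Rightarrow> (real^3 \<Rightarrow> real) \<Rightarrow> bool" where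
  "C2_on A u \<longleftrightarrow>
     (\<forall>x\<in>A. u differentiable (at x)) \<and>
     (\<forall>i. \<forall>x\<in>A. (\<lambda>y. grad u y $ i) differentiable (at x)) \<and>
     (\<forall>i. continuous_on A (grad (\<lambda>y. grad u y $ i)))"

lemma harmonic_on_iff: "harmonic_on A u \<longleftrightarrow> C2_on A u \<and> (\<forall>x\<in>A. laplacian u x = 0)"
  by (auto simp: harmonic_on_def C2_on_def)

lemma C2_on_subset: "C2_on A u \<Longrightarrow> B \<subseteq> A \<Longrightarrow> C2_on B u"
  by (force simp: C2_on_def intro: continuous_on_subset)

lemma harmonic_on_subset: "harmonic_on A u \<Longrightarrow> B \<subseteq> A \<Longrightarrow> harmonic_on B u"
  using C2_on_subset[of A u B] by (auto simp: harmonic_on_iff)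

lemma C2_has_derivative:
  assumes "C2_on A u" "x \<in> A"
  shows "(u has_derivative (\<lambda>v. grad u x \<bullet> v)) (at x)"
    and "(grad u has_derivative hess u x) (at x)"
proof -
  show "(u has_derivative (\<lambda>v. grad u x \<bullet> v)) (at x)"
    using assms by (auto simp: C2_on_def intro: grad_has_derivative)
  have "((\<lambda>y. grad u y $ i) has_derivative (\<lambda>v. hess u x v $ i)) (at x)" for i
    using assms grad_has_derivative[of "\<lambda>y. grad u y $ i" x] by (auto simp: C2_on_def hess_def)
  then have "\<forall>b\<in>Basis. ((\<lambda>y. grad u y \<bullet> b) has_derivative (\<lambda>v. hess u x v \<bullet> b)) (at x)"
    by (auto simp: Basis_vec_def inner_axis)
  then show "(grad u has_derivative hess u x) (at x)"
    by (subst has_derivative_componentwise_within) auto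
qed

lemma C2_continuous:
  assumes "C2_on A u"
  shows "continuous_on A u" "continuous_on A (grad u)"
proof -
  show "continuous_on A u"
    using C2_has_derivative(1)[OF assms] has_derivative_continuous
    by (intro continuous_at_imp_continuous_on ballI) blast
  show "continuous_on A (grad u)"
    using C2_has_derivative(2)[OF assms] has_derivative_continuous
    by (intro continuous_at_imp_continuous_on ballI) blast
qed

lemma C2_continuous_hess:
  assumes "C2_on A u" "continuous_on B p" "continuous_on B v" "p ` B \<subseteq> A"
  shows "continuous_on B (\<lambda>t. hess u (p t) (v t))"
proof -
  have "continuous_on B (\<lambda>t. grad (\<lambda>y. grad u y $ i) (p t))" for i
    by (rule continuous_on_compose2[OF _ assms(2,4)]) (use assms(1) in \<open>simp add: C2_on_def\<close>)
  then show ?thesis unfolding hess_def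
    by (intro continuous_on_vec_lambda continuous_on_inner assms(3))
qed

lemma laplacian_hess: "laplacian u x = (\<Sum>i\<in>UNIV. hess u x (axis i 1) $ i)"
  by (simp add: laplacian_def hess_def inner_axis)

lemma hess_linear: "linear (hess u x)"
  by (rule linearI) (simp_all add: hess_def vec_eq_iff inner_add_right)

section \<open>Rotations about an axis by Rodrigues' formula, and integration by parts on the
  sphere\<close>

definition rot :: "real^3 \<Rightarrow> real \<Rightarrow> real^3 \<Rightarrow> real^3" where
  "rot a t x = cos t *\<^sub>R x + sin t *\<^sub>R cross3 a x + ((1 - cos t) * (a \<bullet> x)) *\<^sub>R a"

lemma orthogonal_rot:
  assumes "norm a = 1"
  shows "orthogonal_transformation (rot a t)"
proof -
  have "linear (rot a t)"
    by (rule linearI)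
       (simp_all add: rot_def cross_add_right cross_mult_right inner_add_right algebra_simps)
  moreover have "norm (rot a t x) = norm x" for x
  proof -
    have a: "a \<bullet> a = 1" using assms by (simp add: dot_square_norm)
    have n: "cross3 a x \<bullet> cross3 a x = x \<bullet> x - (a \<bullet> x)\<^sup>2"
      using norm_cross_dot[of a x] assms
      by (simp add: dot_square_norm power_mult_distrib power2_eq_square)
    have "rot a t x \<bullet> rot a t x = (cos t)\<^sup>2 * (x \<bullet> x) + (sin t)\<^sup>2 * (x \<bullet> x - (a \<bullet> x)\<^sup>2)
        + ((1 - cos t)\<^sup>2 + 2 * cos t * (1 - cos t)) * (a \<bullet> x)\<^sup>2"
      unfolding rot_def inner_add_left inner_add_right inner_scaleR_left inner_scaleR_right
        a n dot_cross_self inner_commute[of x a]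
      by (simp add: power2_eq_square algebra_simps)
    also have "\<dots> = ((sin t)\<^sup>2 + (cos t)\<^sup>2) * (x \<bullet> x) + (1 - ((sin t)\<^sup>2 + (cos t)\<^sup>2)) * (a \<bullet> x)\<^sup>2"
      by (simp add: power2_eq_square algebra_simps del: sin_cos_squared_add sin_cos_squared_add2 sin_cos_squared_add3)
    finally show ?thesis
      by (simp add: norm_eq_sqrt_inner)
  qed
  ultimately show ?thesis
    by (simp add: orthogonal_transformation)
qed

lemma rot_has_vector_derivative:
  assumes "norm a = 1"
  shows "((\<lambda>t. rot a t x) has_vector_derivative cross3 a (rot a t x)) (at t)"
proof -
  have "cross3 a (cross3 a x) = (a \<bullet> x) *\<^sub>R a - x"
    using assms by (simp add: Lagrange dot_square_norm)
  then have eq: "cross3 a (rot a t x) = - sin t *\<^sub>R x + cos t *\<^sub>R cross3 a x + (sin t * (a \<bullet> x)) *\<^sub>R a"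
    by (simp add: rot_def Cross3.right_diff_distrib cross_add_right cross_mult_right scaleR_add_right scaleR_diff_right cross_refl)
  have "((\<lambda>t. rot a t x) has_vector_derivative
      - sin t *\<^sub>R x + cos t *\<^sub>R cross3 a x + (sin t * (a \<bullet> x)) *\<^sub>R a) (at t)"
    unfolding rot_def has_vector_derivative_def
    by (auto intro!: derivative_eq_intros ext simp: algebra_simps)
  then show ?thesis
    by (simp only: eq)
qed

text \<open>The integral of g composed with the rotation by t does not depend on t, and its
  derivative at t = 0, taken under the integral sign, is the left-hand side. This is the divergence
  theorem for the field \<open>cross3 a x\<close>.\<close>

lemma integral_rotational_derivative:
  fixes g :: "real^3 \<Rightarrow> real"
  assumes a: "norm a = 1"
    and deriv: "\<And>x. x \<in> \<S> \<Longrightarrow> (g has_derivative D x) (at x)"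
    and cont: "continuous_on \<S> (\<lambda>x. D x (cross3 a x))"
  shows "(\<integral>x. D x (cross3 a x) \<partial>\<sigma>) = 0"
proof -
  have cg: "continuous_on \<S> g"
    by (intro continuous_at_imp_continuous_on ballI has_derivative_continuous[OF deriv])
  obtain B where B: "\<And>x. x \<in> \<S> \<Longrightarrow> norm (D x (cross3 a x)) \<le> B"
    using continuous_sphere_bounded[OF cont] by blast
  have S: "rot a t x \<in> \<S>" if "x \<in> \<S>" for t x
    using that orthogonal_transformation_norm[OF orthogonal_rot[OF a]] by simp
  have const: "(\<integral>x. g (rot a t x) \<partial>\<sigma>) = (\<integral>x. g x \<partial>\<sigma>)" for t
    by (rule integral_sphere_orthogonal[OF orthogonal_rot[OF a] continuous_sphere_measurable[OF cg]])
  have "((\<lambda>t. \<integral>x. g (rot a t x) \<partial>\<sigma>) has_field_derivative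
      (\<integral>x. D (rot a 0 x) (cross3 a (rot a 0 x)) \<partial>\<sigma>)) (at 0)"
  proof (rule has_field_derivative_lebesgue_integral[where S=UNIV and w="\<lambda>_. B"])
    fix t :: real
    show "integrable \<sigma> (\<lambda>x. g (rot a t x))"
    proof (rule continuous_sphere_integrable, rule continuous_on_compose2[OF cg])
      show "continuous_on \<S> (rot a t)"
        using orthogonal_transformation_linear[OF orthogonal_rot[OF a]]
        by (simp add: linear_continuous_on linear_conv_bounded_linear)
    qed (use S in auto)
    fix y assume y: "y \<in> space \<sigma>"
    have "(g \<circ> (\<lambda>t. rot a t y) has_derivative D (rot a t y) \<circ> (\<lambda>h. h *\<^sub>R cross3 a (rot a t y))) (at t)"
      using rot_has_vector_derivative[OF a, of y t] deriv[OF S, of y t] y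
      by (intro diff_chain_at) (auto simp: has_vector_derivative_def)
    moreover have "linear (D (rot a t y))"
      using deriv[OF S, of y t] y has_derivative_linear by auto
    ultimately show "((\<lambda>t. g (rot a t y)) has_field_derivative D (rot a t y) (cross3 a (rot a t y))) (at t)"
      by (simp add: has_field_derivative_def o_def linear_scale mult_commute_abs)
    show "norm (D (rot a t y) (cross3 a (rot a t y))) \<le> B"
      using B[OF S] y by simp
  qed simp_all
  then have "(\<integral>x. D (rot a 0 x) (cross3 a (rot a 0 x)) \<partial>\<sigma>) = 0"
    unfolding const by (rule DERIV_unique[OF _ DERIV_const])
  then show ?thesis
    by (simp add: rot_def)
qed

lemma cross_axis:
  "cross3 (axis 1 1) x = vector [0, - x$3, x$2]"
  "cross3 (axis 2 1) x = vector [x$3, 0, - x$1]"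
  "cross3 (axis 3 1) x = vector [- x$2, x$1, 0]"
  by (simp_all add: cross3_def axis_def)

text \<open>The fields \<open>cross3 (axis i 1) x\<close> generate the rotations about the three
  axes. Summing over them gives expressions that no longer refer to the axes; this identity and the
  next two do so for the terms that arise in \<open>sphere_green\<close>.\<close>

lemma sum_inner_cross_axis:
  "(\<Sum>i\<in>UNIV. (F \<bullet> cross3 (axis i 1) x) * (g \<bullet> cross3 (axis i 1) x)) = cross3 x F \<bullet> cross3 x g"
  by (simp add: sum_3 inner_vec_def cross_axis) (simp add: cross3_def algebra_simps)

lemma sum_cross_cross_axis:
  "(\<Sum>i\<in>UNIV. g \<bullet> cross3 (axis i 1) (cross3 (axis i 1) x)) = - 2 * (x \<bullet> g)"
  by (simp add: sum_3 inner_vec_def cross_axis algebra_simps)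

lemma sum_hess_cross_axis:
  "(\<Sum>i\<in>UNIV. hess u x (cross3 (axis i 1) x) \<bullet> cross3 (axis i 1) x) = (x \<bullet> x) * laplacian u x - x \<bullet> hess u x x"
  unfolding laplacian_def hess_def
  by (simp add: sum_3 inner_vec_def cross_axis) (simp add: algebra_simps)

text \<open>On the unit sphere the left integrand is the inner product of the surface gradients of f
  and u, both turned by a right angle, and the bracket on the right is minus the Laplace-Beltrami
  operator applied to u. The identity is \<open>integral_rotational_derivative\<close>, summed over
  the axes, for the product of f and the derivative of u along the rotation field.\<close>

lemma sphere_green:
  assumes f: "\<And>x. x \<in> \<S> \<Longrightarrow> (f has_derivative (\<lambda>v. F x \<bullet> v)) (at x)" "continuous_on \<S> F"
    and u: "C2_on A u" "\<S> \<subseteq> A"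
  shows "(\<integral>x. cross3 x (F x) \<bullet> cross3 x (grad u x) \<partial>\<sigma>)
    = (\<integral>x. f x * (x \<bullet> hess u x x + 2 * (x \<bullet> grad u x) - laplacian u x) \<partial>\<sigma>)"
proof -
  define e :: "3 \<Rightarrow> real^3" where "e i = axis i 1" for i
  \<comment> \<open>The derivative in direction v of the product just described. Its last term
    appears because the rotation field moves with x; after summation it yields the first-order term
    2 (x . grad u).\<close>
  define D where "D i x v = (F x \<bullet> v) * (grad u x \<bullet> cross3 (e i) x)
      + f x * (hess u x v \<bullet> cross3 (e i) x + grad u x \<bullet> cross3 (e i) v)" for i x v
  have cf: "continuous_on \<S> f"
    by (intro continuous_at_imp_continuous_on ballI has_derivative_continuous[OF f(1)])
  have cross: "continuous_on X (\<lambda>x. cross3 (p x) (q x))" if "continuous_on X p" "continuous_on X q"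
    for p q :: "real^3 \<Rightarrow> real^3" and X
    using that by (rule continuous_on_cross)
  have cgrad: "continuous_on \<S> (grad u)"
    using C2_continuous(2)[OF u(1)] u(2) by (rule continuous_on_subset)
  have hess: "continuous_on \<S> (\<lambda>x. hess u x (v x))" if "continuous_on \<S> v" for v
    using C2_continuous_hess[OF u(1) continuous_on_id that] u(2) by simp
  have cD: "continuous_on \<S> (\<lambda>x. D i x (cross3 (e i) x))" for i
    unfolding D_def
    by (intro continuous_intros f(2) cf cgrad hess cross)
  have "(\<integral>x. D i x (cross3 (e i) x) \<partial>\<sigma>) = 0" for i
  proof (rule integral_rotational_derivative[where g="\<lambda>x. f x * (grad u x \<bullet> cross3 (e i) x)" and D="D i"])
    show "continuous_on \<S> (\<lambda>x. D i x (cross3 (e i) x))" by (rule cD)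
    show "norm (e i) = 1" by (simp add: e_def)
    fix x assume x: "x \<in> \<S>"
    have bl: "bounded_linear (\<lambda>v. cross3 (e i) v)"
      by (simp add: linear_conv_bounded_linear[symmetric] linear_iff cross_add_right cross_mult_right)
    have "(grad u has_derivative hess u x) (at x)"
      using x u by (intro C2_has_derivative(2)[OF u(1)]) auto
    from has_derivative_mult[OF f(1)[OF x] has_derivative_inner[OF this bounded_linear_imp_has_derivative[OF bl]]]
    show "((\<lambda>x. f x * (grad u x \<bullet> cross3 (e i) x)) has_derivative D i x) (at x)"
      by (rule has_derivative_eq_rhs) (simp add: D_def fun_eq_iff algebra_simps)
  qed
  then have "(\<Sum>i\<in>UNIV. \<integral>x. D i x (cross3 (e i) x) \<partial>\<sigma>) = 0" by simp
  then have "(\<integral>x. (\<Sum>i\<in>UNIV. D i x (cross3 (e i) x)) \<partial>\<sigma>) = 0"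
    by (subst (asm) Bochner_Integration.integral_sum[symmetric]) (auto intro: continuous_sphere_integrable[OF cD])
  moreover have "(\<Sum>i\<in>UNIV. D i x (cross3 (e i) x)) = cross3 x (F x) \<bullet> cross3 x (grad u x)
      - f x * (x \<bullet> hess u x x + 2 * (x \<bullet> grad u x) - laplacian u x)" if "x \<in> \<S>" for x
  proof -
    have "x \<bullet> x = 1" using that by (simp add: dot_square_norm)
    have "(\<Sum>i\<in>UNIV. D i x (cross3 (e i) x))
      = (\<Sum>i\<in>UNIV. (F x \<bullet> cross3 (e i) x) * (grad u x \<bullet> cross3 (e i) x))
        + f x * ((\<Sum>i\<in>UNIV. hess u x (cross3 (e i) x) \<bullet> cross3 (e i) x)
        + (\<Sum>i\<in>UNIV. grad u x \<bullet> cross3 (e i) (cross3 (e i) x)))"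
      by (simp only: D_def sum.distrib sum_distrib_left distrib_left)
    then show ?thesis
      unfolding e_def sum_inner_cross_axis sum_hess_cross_axis sum_cross_cross_axis
      by (simp add: \<open>x \<bullet> x = 1\<close> algebra_simps)
  qed
  ultimately have *: "(\<integral>x. cross3 x (F x) \<bullet> cross3 x (grad u x)
      - f x * (x \<bullet> hess u x x + 2 * (x \<bullet> grad u x) - laplacian u x) \<partial>\<sigma>) = 0"
    using Bochner_Integration.integral_cong[of \<sigma> \<sigma> "\<lambda>x. \<Sum>i\<in>UNIV. D i x (cross3 (e i) x)"
      "\<lambda>x. cross3 x (F x) \<bullet> cross3 x (grad u x)
      - f x * (x \<bullet> hess u x x + 2 * (x \<bullet> grad u x) - laplacian u x)"] by simp
  have "continuous_on \<S> (laplacian u)"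
    unfolding laplacian_hess by (intro continuous_on_sum continuous_on_component hess continuous_on_const)
  then have "integrable \<sigma> (\<lambda>x. f x * (x \<bullet> hess u x x + 2 * (x \<bullet> grad u x) - laplacian u x))"
    by (intro continuous_sphere_integrable continuous_on_mult continuous_on_add continuous_on_diff
        continuous_on_inner cf cgrad hess continuous_on_const continuous_on_id)
  moreover have "integrable \<sigma> (\<lambda>x. cross3 x (F x) \<bullet> cross3 x (grad u x))"
    by (intro continuous_sphere_integrable continuous_on_inner cross continuous_on_id f(2) cgrad)
  ultimately show ?thesis
    using * by simp
qed

section \<open>Solid harmonics\<close>

lemma C2_ray_derivatives:
  assumes "C2_on A u" "\<rho> *\<^sub>R y \<in> A"
  shows "((\<lambda>\<rho>. u (\<rho> *\<^sub>R y)) has_field_derivative (y \<bullet> grad u (\<rho> *\<^sub>R y))) (at \<rho>)"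
    and "((\<lambda>\<rho>. y \<bullet> grad u (\<rho> *\<^sub>R y)) has_field_derivative (y \<bullet> hess u (\<rho> *\<^sub>R y) y)) (at \<rho>)"
proof -
  have ray: "((\<lambda>\<rho>. \<rho> *\<^sub>R y) has_derivative (\<lambda>h. h *\<^sub>R y)) (at \<rho>)"
    by (auto intro!: derivative_eq_intros)
  note D = C2_has_derivative[OF assms]
  show "((\<lambda>\<rho>. u (\<rho> *\<^sub>R y)) has_field_derivative (y \<bullet> grad u (\<rho> *\<^sub>R y))) (at \<rho>)"
    using diff_chain_at[OF ray D(1)]
    by (simp add: has_field_derivative_def o_def inner_commute mult_commute_abs)
  have "((\<lambda>\<rho>. grad u (\<rho> *\<^sub>R y)) has_derivative (\<lambda>h. hess u (\<rho> *\<^sub>R y) (h *\<^sub>R y))) (at \<rho>)"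
    using diff_chain_at[OF ray D(2)] by (simp add: o_def)
  from has_derivative_inner[OF has_derivative_const this, of y]
  show "((\<lambda>\<rho>. y \<bullet> grad u (\<rho> *\<^sub>R y)) has_field_derivative (y \<bullet> hess u (\<rho> *\<^sub>R y) y)) (at \<rho>)"
    by (simp add: has_field_derivative_def linear_scale[OF hess_linear] mult_commute_abs)
qed

lemma C2_scale:
  assumes u: "C2_on A u" and A: "open A" and B: "B = (\<lambda>x. c *\<^sub>R x) -` A"
  shows "x \<in> B \<Longrightarrow> grad (\<lambda>x. u (c *\<^sub>R x)) x = c *\<^sub>R grad u (c *\<^sub>R x)"
    and "x \<in> B \<Longrightarrow> hess (\<lambda>x. u (c *\<^sub>R x)) x v = c\<^sup>2 *\<^sub>R hess u (c *\<^sub>R x) v"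
    and "C2_on B (\<lambda>x. u (c *\<^sub>R x))"
proof -
  have scale: "((\<lambda>x. c *\<^sub>R x) has_derivative (\<lambda>v. c *\<^sub>R v)) (at x)" for x :: "real^3"
    by (auto intro!: derivative_eq_intros)
  have oB: "open B"
    unfolding B by (intro open_vimage A continuous_intros)
  have D1: "((\<lambda>x. u (c *\<^sub>R x)) has_derivative (\<lambda>v. (c *\<^sub>R grad u (c *\<^sub>R x)) \<bullet> v)) (at x)" if "x \<in> B" for x
    using diff_chain_at[OF scale C2_has_derivative(1)[OF u]] that by (simp add: B o_def)
  show g: "grad (\<lambda>x. u (c *\<^sub>R x)) x = c *\<^sub>R grad u (c *\<^sub>R x)" if "x \<in> B" for x
    using D1[OF that] by (rule grad_eqI)
  have D2: "((\<lambda>y. grad (\<lambda>x. u (c *\<^sub>R x)) y $ i) has_derivative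
      (\<lambda>v. (c\<^sup>2 *\<^sub>R grad (\<lambda>y. grad u y $ i) (c *\<^sub>R x)) \<bullet> v)) (at x)" if "x \<in> B" for x i
  proof -
    have "(\<lambda>y. grad u y $ i) differentiable (at (c *\<^sub>R x))"
      using u that by (simp add: C2_on_def B)
    from diff_chain_at[OF scale grad_has_derivative[OF this]]
    have "((\<lambda>y. c * grad u (c *\<^sub>R y) $ i) has_derivative
        (\<lambda>v. c * (grad (\<lambda>y. grad u y $ i) (c *\<^sub>R x) \<bullet> (c *\<^sub>R v)))) (at x)"
      by (intro has_derivative_mult_right) (simp add: o_def)
    then have "((\<lambda>y. c * grad u (c *\<^sub>R y) $ i) has_derivative
        (\<lambda>v. (c\<^sup>2 *\<^sub>R grad (\<lambda>y. grad u y $ i) (c *\<^sub>R x)) \<bullet> v)) (at x)"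
      by (simp add: power2_eq_square mult.assoc)
    then show ?thesis
      by (rule has_derivative_transform_within_open[OF _ oB that]) (simp add: g)
  qed
  have H: "grad (\<lambda>y. grad (\<lambda>x. u (c *\<^sub>R x)) y $ i) x = c\<^sup>2 *\<^sub>R grad (\<lambda>y. grad u y $ i) (c *\<^sub>R x)"
    if "x \<in> B" for x i
    using D2[OF that] by (rule grad_eqI)
  show "hess (\<lambda>x. u (c *\<^sub>R x)) x v = c\<^sup>2 *\<^sub>R hess u (c *\<^sub>R x) v" if "x \<in> B"
    by (simp add: hess_def H[OF that] vec_eq_iff)
  show "C2_on B (\<lambda>x. u (c *\<^sub>R x))"
    unfolding C2_on_def
  proof (intro conjI ballI allI)
    show "(\<lambda>x. u (c *\<^sub>R x)) differentiable (at x)" if "x \<in> B" for x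
      using D1[OF that] by (auto simp: differentiable_def)
    show "(\<lambda>y. grad (\<lambda>x. u (c *\<^sub>R x)) y $ i) differentiable (at x)" if "x \<in> B" for x i
      using D2[OF that] by (auto simp: differentiable_def)
    have "continuous_on B (\<lambda>x. c\<^sup>2 *\<^sub>R grad (\<lambda>y. grad u y $ i) (c *\<^sub>R x))" for i
    proof (rule continuous_on_scaleR[OF continuous_on_const])
      show "continuous_on B (\<lambda>x. grad (\<lambda>y. grad u y $ i) (c *\<^sub>R x))"
        by (rule continuous_on_compose2[of A]) (use u B in \<open>auto simp: C2_on_def intro!: continuous_intros\<close>)
    qed
    then show "continuous_on B (grad (\<lambda>y. grad (\<lambda>x. u (c *\<^sub>R x)) y $ i))" for i
      by (subst continuous_on_cong[OF refl H])
  qed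
qed

lemma harmonic_scale:
  assumes u: "harmonic_on A u" and A: "open A" and B: "B = (\<lambda>x. c *\<^sub>R x) -` A"
  shows "harmonic_on B (\<lambda>x. u (c *\<^sub>R x))"
proof -
  have u2: "C2_on A u" using u by (simp add: harmonic_on_iff)
  have "laplacian (\<lambda>x. u (c *\<^sub>R x)) x = c\<^sup>2 * laplacian u (c *\<^sub>R x)" if "x \<in> B" for x
    by (simp add: laplacian_hess C2_scale(2)[OF u2 A B that] sum_distrib_left)
  then show ?thesis
    using u C2_scale(3)[OF u2 A B] by (auto simp: harmonic_on_iff B)
qed

definition solid_harmonic :: "nat \<Rightarrow> (real^3 \<Rightarrow> real) \<Rightarrow> bool" where
  "solid_harmonic n P \<longleftrightarrow> real_polynomial_function P \<and> (\<forall>c x. P (c *\<^sub>R x) = c ^ n * P x) \<and> harmonic_on UNIV P"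

lemma solid_harmonicD:
  assumes "solid_harmonic n P"
  shows "real_polynomial_function P" "P (c *\<^sub>R x) = c ^ n * P x" "harmonic_on UNIV P" "C2_on UNIV P"
    "continuous_on A P" "(P has_derivative (\<lambda>v. grad P x \<bullet> v)) (at x)" "continuous_on A (grad P)"
proof -
  show "real_polynomial_function P" "P (c *\<^sub>R x) = c ^ n * P x" and h: "harmonic_on UNIV P"
    using assms by (auto simp: solid_harmonic_def)
  then show C: "C2_on UNIV P" by (simp add: harmonic_on_iff)
  show "continuous_on A P" "continuous_on A (grad P)"
    using C2_continuous[OF C] by (auto intro: continuous_on_subset)
  show "(P has_derivative (\<lambda>v. grad P x \<bullet> v)) (at x)"
    using C2_has_derivative(1)[OF C] by simp
qed

lemma solid_harmonic_euler:
  assumes "solid_harmonic n P"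
  shows "x \<bullet> grad P x = real n * P x"
    and "x \<bullet> hess P x x = real n * (real n - 1) * P x"
proof -
  note P = solid_harmonicD[OF assms]
  have eq: "x \<bullet> grad P (\<rho> *\<^sub>R x) = real n * \<rho> ^ (n - 1) * P x" for \<rho>
  proof (rule DERIV_unique[OF C2_ray_derivatives(1)[OF P(4)]])
    have "(\<lambda>\<rho>. P (\<rho> *\<^sub>R x)) = (\<lambda>\<rho>. \<rho> ^ n * P x)"
      by (simp add: P(2))
    then show "((\<lambda>\<rho>. P (\<rho> *\<^sub>R x)) has_field_derivative real n * \<rho> ^ (n - 1) * P x) (at \<rho>)"
      by (auto intro!: derivative_eq_intros)
  qed simp
  show "x \<bullet> grad P x = real n * P x"
    using eq[of 1] by simp
  \<comment> \<open>The truncated subtractions do no harm: for n = 0 and n = 1 one of the two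
    factors in front is 0.\<close>
  have "x \<bullet> hess P (1 *\<^sub>R x) x = real n * (real (n - 1) * 1 ^ (n - 1 - 1)) * P x"
  proof (rule DERIV_unique[OF C2_ray_derivatives(2)[OF P(4)]])
    have "(\<lambda>\<rho>. x \<bullet> grad P (\<rho> *\<^sub>R x)) = (\<lambda>\<rho>. real n * \<rho> ^ (n - 1) * P x)"
      by (simp add: eq)
    then show "((\<lambda>\<rho>. x \<bullet> grad P (\<rho> *\<^sub>R x)) has_field_derivative
        real n * (real (n - 1) * 1 ^ (n - 1 - 1)) * P x) (at 1)"
      by (auto intro!: derivative_eq_intros)
  qed simp
  then show "x \<bullet> hess P x x = real n * (real n - 1) * P x"
    by (cases n) auto
qed

text \<open>Euler's relations turn the bracket of \<open>sphere_green\<close> into n (n - 1) + 2 n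
  times P, so P restricts to an eigenfunction of the Laplace-Beltrami operator.\<close>

lemma sphere_green_solid:
  assumes P: "solid_harmonic n P"
    and f: "\<And>x. x \<in> \<S> \<Longrightarrow> (f has_derivative (\<lambda>v. F x \<bullet> v)) (at x)" "continuous_on \<S> F"
  shows "(\<integral>x. cross3 x (F x) \<bullet> cross3 x (grad P x) \<partial>\<sigma>) = real n * (real n + 1) * (\<integral>x. f x * P x \<partial>\<sigma>)"
proof -
  note D = solid_harmonicD[OF P]
  have "laplacian P x = 0" for x
    using D(3) by (simp add: harmonic_on_iff)
  then have "x \<bullet> hess P x x + 2 * (x \<bullet> grad P x) - laplacian P x = real n * (real n + 1) * P x" for x
    by (simp add: solid_harmonic_euler[OF P] algebra_simps)
  then have "(\<integral>x. cross3 x (F x) \<bullet> cross3 x (grad P x) \<partial>\<sigma>)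
      = (\<integral>x. real n * (real n + 1) * (f x * P x) \<partial>\<sigma>)"
    using sphere_green[OF f D(4)] by (simp add: mult.left_commute)
  then show ?thesis by simp
qed

lemma cross_inner_decomposition:
  assumes "x \<in> \<S>"
  shows "F \<bullet> G = (x \<bullet> F) * (x \<bullet> G) + cross3 x F \<bullet> cross3 x G"
  using assms dot_cross[of x F x G]
  by (simp add: dot_square_norm inner_commute)

lemma compact_product_bound:
  fixes \<phi> :: "'a::euclidean_space \<times> 'b::euclidean_space \<Rightarrow> 'c::euclidean_space"
  assumes "continuous_on (K \<times> L) \<phi>" "compact K" "compact L"
  obtains B where "B > 0" "\<And>x y. x \<in> K \<Longrightarrow> y \<in> L \<Longrightarrow> norm (\<phi> (x, y)) \<le> B"
proof -
  have "bounded (\<phi> ` (K \<times> L))"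
    using compact_continuous_image[OF assms(1) compact_Times[OF assms(2,3)]] by (rule compact_imp_bounded)
  then show ?thesis using that by (auto simp: bounded_pos)
qed

text \<open>The moment \<open>c0\<close> of \<open>u\<close> on spheres of radius \<open>\<rho>\<close> solves Euler's equation
  \<open>\<rho>\<^sup>2 c'' + 2 \<rho> c' = n (n + 1) c\<close>, so by regularity at \<open>0\<close> it is a multiple of \<open>\<rho> ^ n\<close>.\<close>

locale radial =
  fixes R :: real and u :: "real^3 \<Rightarrow> real" and n :: nat and P :: "real^3 \<Rightarrow> real"
  assumes R: "0 < R" and u: "harmonic_on (ball 0 R) u" and P: "solid_harmonic n P"
begin

definition c0 :: "real \<Rightarrow> real" where "c0 \<rho> = (\<integral>y. u (\<rho> *\<^sub>R y) * P y \<partial>\<sigma>)"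
definition c1 :: "real \<Rightarrow> real" where "c1 \<rho> = (\<integral>y. (y \<bullet> grad u (\<rho> *\<^sub>R y)) * P y \<partial>\<sigma>)"
definition c2 :: "real \<Rightarrow> real" where "c2 \<rho> = (\<integral>y. (y \<bullet> hess u (\<rho> *\<^sub>R y) y) * P y \<partial>\<sigma>)"

lemma u_C2: "C2_on (ball 0 R) u"
  using u by (simp add: harmonic_on_iff)

lemma in_ball: "\<bar>\<rho>\<bar> < R \<Longrightarrow> y \<in> \<S> \<Longrightarrow> \<rho> *\<^sub>R y \<in> ball 0 R"
  by simp

lemma continuous_ray:
  assumes "\<bar>\<rho>\<bar> < R"
  shows "continuous_on \<S> (\<lambda>y. u (\<rho> *\<^sub>R y))" "continuous_on \<S> (\<lambda>y. grad u (\<rho> *\<^sub>R y))"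
    "continuous_on \<S> (\<lambda>y. hess u (\<rho> *\<^sub>R y) y)"
proof -
  have sub: "(\<lambda>y. \<rho> *\<^sub>R y) ` \<S> \<subseteq> ball 0 R"
    using in_ball[OF assms] by blast
  have c: "continuous_on \<S> (\<lambda>y. \<rho> *\<^sub>R y)"
    by (intro continuous_intros)
  show "continuous_on \<S> (\<lambda>y. u (\<rho> *\<^sub>R y))"
    by (rule continuous_on_compose2[OF C2_continuous(1)[OF u_C2] c sub])
  show "continuous_on \<S> (\<lambda>y. grad u (\<rho> *\<^sub>R y))"
    by (rule continuous_on_compose2[OF C2_continuous(2)[OF u_C2] c sub])
  show "continuous_on \<S> (\<lambda>y. hess u (\<rho> *\<^sub>R y) y)"
    by (rule C2_continuous_hess[OF u_C2 c continuous_on_id sub])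
qed

lemma deriv_c0: "\<bar>\<rho>\<bar> < R \<Longrightarrow> (c0 has_field_derivative c1 \<rho>) (at \<rho>)"
  and deriv_c1: "\<bar>\<rho>\<bar> < R \<Longrightarrow> (c1 has_field_derivative c2 \<rho>) (at \<rho>)"
proof -
  assume \<rho>: "\<bar>\<rho>\<bar> < R"
  \<comment> \<open>A compact ball inside the domain that contains the radius rho in its interior;
    on it the derivatives of u are bounded, which supplies the constant majorants.\<close>
  define R' where "R' = (\<bar>\<rho>\<bar> + R) / 2"
  have R': "\<bar>\<rho>\<bar> < R'" "R' < R" using \<rho> by (auto simp: R'_def field_simps)
  have sub: "cball 0 R' \<subseteq> ball (0::real^3) R" using R' by auto
  have mem: "\<bar>t\<bar> < R" "t *\<^sub>R y \<in> cball 0 R'" if "t \<in> {-R'<..<R'}" "y \<in> \<S>" for t y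
    using that R' by auto
  have cP: "continuous_on \<S> P" by (rule solid_harmonicD[OF P])
  obtain BP where BP: "BP > 0" "\<And>y. y \<in> \<S> \<Longrightarrow> norm (P y) \<le> BP"
    using continuous_sphere_bounded[OF cP] by blast
  have "bounded (grad u ` cball 0 R')"
    by (intro compact_imp_bounded compact_continuous_image continuous_on_subset[OF C2_continuous(2)[OF u_C2] sub] compact_cball)
  then obtain B1 where B1: "B1 > 0" "\<And>x. x \<in> cball 0 R' \<Longrightarrow> norm (grad u x) \<le> B1"
    by (auto simp: bounded_pos)
  have "continuous_on (cball 0 R' \<times> \<S>) (\<lambda>z. hess u (fst z) (snd z))"
    by (rule C2_continuous_hess[OF u_C2]) (use sub in \<open>auto intro!: continuous_intros\<close>)
  then obtain B2 where B2: "B2 > 0" "\<And>x y. x \<in> cball 0 R' \<Longrightarrow> y \<in> \<S> \<Longrightarrow> norm (hess u x y) \<le> B2"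
    using compact_product_bound[of "cball 0 R'" \<S> "\<lambda>z. hess u (fst z) (snd z)"] by auto
  have in1: "\<bar>y \<bullet> v\<bar> \<le> norm v" if "y \<in> \<S>" for y v :: "real^3"
    using that Cauchy_Schwarz_ineq2[of y v] by simp
  show "(c0 has_field_derivative c1 \<rho>) (at \<rho>)"
    unfolding c0_def c1_def
  proof (rule has_field_derivative_lebesgue_integral[where S="{-R'<..<R'}" and w="\<lambda>_. B1 * BP"])
    fix t assume t: "t \<in> {-R'<..<R'}"
    show "integrable \<sigma> (\<lambda>y. u (t *\<^sub>R y) * P y)"
      using mem(1)[OF t, of "axis 1 1"] by (intro continuous_sphere_integrable continuous_on_mult continuous_ray cP) auto
    fix y assume y: "y \<in> space \<sigma>"
    show "((\<lambda>t. u (t *\<^sub>R y) * P y) has_field_derivative (y \<bullet> grad u (t *\<^sub>R y)) * P y) (at t)"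
      using C2_ray_derivatives(1)[OF u_C2 in_ball, OF mem(1)[OF t]] y by (auto intro: DERIV_cmult_right)
    show "norm ((y \<bullet> grad u (t *\<^sub>R y)) * P y) \<le> B1 * BP"
      using B1(2)[OF mem(2)[OF t]] BP(2) in1[of y "grad u (t *\<^sub>R y)"] y B1(1)
      by (auto simp: abs_mult intro!: mult_mono order_trans[OF in1])
  qed (use R' \<rho> in auto)
  show "(c1 has_field_derivative c2 \<rho>) (at \<rho>)"
    unfolding c1_def c2_def
  proof (rule has_field_derivative_lebesgue_integral[where S="{-R'<..<R'}" and w="\<lambda>_. B2 * BP"])
    fix t assume t: "t \<in> {-R'<..<R'}"
    show "integrable \<sigma> (\<lambda>y. (y \<bullet> grad u (t *\<^sub>R y)) * P y)"
      using mem(1)[OF t, of "axis 1 1"]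
      by (intro continuous_sphere_integrable continuous_on_mult continuous_on_inner continuous_on_id continuous_ray cP) auto
    fix y assume y: "y \<in> space \<sigma>"
    show "((\<lambda>t. (y \<bullet> grad u (t *\<^sub>R y)) * P y) has_field_derivative (y \<bullet> hess u (t *\<^sub>R y) y) * P y) (at t)"
      using C2_ray_derivatives(2)[OF u_C2 in_ball, OF mem(1)[OF t]] y by (auto intro: DERIV_cmult_right)
    show "norm ((y \<bullet> hess u (t *\<^sub>R y) y) * P y) \<le> B2 * BP"
      using B2(2)[OF mem(2)[OF t]] BP(2) in1[of y "hess u (t *\<^sub>R y) y"] y B2(1)
      by (auto simp: abs_mult intro!: mult_mono order_trans[OF in1])
  qed (use R' \<rho> in auto)
qed

text \<open>Green's identity is read twice for the dilation v(x) = u(rho x). With the derivatives on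
  v, which is harmonic, it gives the left side; with the derivatives on P it gives the eigenvalue n
  (n + 1). The tangential integral is the same in both.\<close>

lemma ode:
  assumes \<rho>: "\<bar>\<rho>\<bar> < R"
  shows "\<rho>\<^sup>2 * c2 \<rho> + 2 * \<rho> * c1 \<rho> = real n * (real n + 1) * c0 \<rho>"
proof -
  define B where "B = (\<lambda>x. \<rho> *\<^sub>R x) -` ball (0::real^3) R"
  let ?v = "\<lambda>x. u (\<rho> *\<^sub>R x)"
  note scale = C2_scale[OF u_C2 open_ball B_def]
  have SB: "x \<in> B" if "x \<in> \<S>" for x using in_ball[OF \<rho> that] by (simp add: B_def)
  have hv: "harmonic_on B ?v"
    using u open_ball B_def by (rule harmonic_scale)
  note DP = solid_harmonicD[OF P]
  have "(\<integral>x. cross3 x (grad P x) \<bullet> cross3 x (grad ?v x) \<partial>\<sigma>)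
      = (\<integral>x. P x * (x \<bullet> hess ?v x x + 2 * (x \<bullet> grad ?v x) - laplacian ?v x) \<partial>\<sigma>)"
    using SB by (intro sphere_green[OF DP(6,7) scale(3)]) auto
  also have "\<dots> = (\<integral>x. \<rho>\<^sup>2 * ((x \<bullet> hess u (\<rho> *\<^sub>R x) x) * P x) + 2 * \<rho> * ((x \<bullet> grad u (\<rho> *\<^sub>R x)) * P x) \<partial>\<sigma>)"
    using hv SB by (intro Bochner_Integration.integral_cong) (auto simp: scale(1,2) harmonic_on_iff algebra_simps)
  also have "\<dots> = \<rho>\<^sup>2 * c2 \<rho> + 2 * \<rho> * c1 \<rho>"
    unfolding c1_def c2_def
    by (subst Bochner_Integration.integral_add)
       (auto intro!: integrable_mult_right continuous_sphere_integrable continuous_on_mult continuous_on_inner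
         continuous_on_id continuous_ray[OF \<rho>] DP(5))
  finally have 1: "(\<integral>x. cross3 x (grad P x) \<bullet> cross3 x (grad ?v x) \<partial>\<sigma>) = \<rho>\<^sup>2 * c2 \<rho> + 2 * \<rho> * c1 \<rho>" .
  have "(\<integral>x. cross3 x (grad ?v x) \<bullet> cross3 x (grad P x) \<partial>\<sigma>) = real n * (real n + 1) * (\<integral>x. ?v x * P x \<partial>\<sigma>)"
  proof (rule sphere_green_solid[OF P])
    show "(?v has_derivative (\<lambda>v. grad ?v x \<bullet> v)) (at x)" if "x \<in> \<S>" for x
      using C2_has_derivative(1)[OF scale(3) SB[OF that]] .
    show "continuous_on \<S> (grad ?v)"
      using C2_continuous(2)[OF scale(3)] SB by (auto intro: continuous_on_subset)
  qed
  then show ?thesis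
    using 1 by (simp add: inner_commute c0_def)
qed

text \<open>Euler's operator factors as (rho d/drho - n)(rho d/drho + n + 1). Hence g, the result of
  the second factor, is a multiple of rho^n, and the remaining first-order equation is integrated
  with the factor rho^n.\<close>

lemma radial_power:
  obtains a where "\<And>\<rho>. 0 < \<rho> \<Longrightarrow> \<rho> < R \<Longrightarrow> c0 \<rho> = a * \<rho> ^ n"
    "\<And>\<rho>. 0 < \<rho> \<Longrightarrow> \<rho> < R \<Longrightarrow> \<rho> * c1 \<rho> = real n * a * \<rho> ^ n"
    "\<And>\<rho>. 0 < \<rho> \<Longrightarrow> \<rho> < R \<Longrightarrow> \<rho>\<^sup>2 * c2 \<rho> = real n * (real n - 1) * a * \<rho> ^ n"
proof -
  define g where "g \<rho> = \<rho> * c1 \<rho> + (real n + 1) * c0 \<rho>" for \<rho>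
  have dg: "(g has_field_derivative (\<rho> * c2 \<rho> + (real n + 2) * c1 \<rho>)) (at \<rho>)" if "\<bar>\<rho>\<bar> < R" for \<rho>
    unfolding g_def using deriv_c0[OF that] deriv_c1[OF that]
    by (auto intro!: derivative_eq_intros simp: algebra_simps)
  define q where "q \<rho> = g \<rho> / \<rho> ^ n" for \<rho>
  have dq: "(q has_field_derivative 0) (at \<rho>)" if "0 < \<rho>" "\<rho> < R" for \<rho>
  proof -
    have "\<rho> * (\<rho> * c2 \<rho> + (real n + 2) * c1 \<rho>) = real n * g \<rho>"
      using ode[of \<rho>] that by (simp add: g_def power2_eq_square algebra_simps)
    note X = this
    have eq: "(\<rho> * c2 \<rho> + (real n + 2) * c1 \<rho>) * \<rho> ^ n - g \<rho> * (real n * \<rho> ^ (n - 1)) = 0"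
    proof (cases n)
      case 0
      then show ?thesis using X that by simp
    next
      case (Suc m)
      have "X * \<rho> ^ Suc m = (\<rho> * X) * \<rho> ^ m" for X :: real
        by simp
      then show ?thesis using X Suc by (simp add: mult.commute)
    qed
    have "(q has_field_derivative
        ((\<rho> * c2 \<rho> + (real n + 2) * c1 \<rho>) * \<rho> ^ n - g \<rho> * (real n * \<rho> ^ (n - 1))) / (\<rho> ^ n * \<rho> ^ n)) (at \<rho>)"
      unfolding q_def using that dg[of \<rho>]
      by (auto intro!: derivative_eq_intros)
    then show ?thesis unfolding eq by simp
  qed
  have "\<exists>A. \<forall>\<rho>\<in>{0<..<R}. q \<rho> = A"
    by (rule has_field_derivative_zero_constant) (auto intro: has_field_derivative_at_within dq)
  then obtain A where A: "\<And>\<rho>. \<rho> \<in> {0<..<R} \<Longrightarrow> q \<rho> = A"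
    by blast
  have qA: "q \<rho> = A" if "0 < \<rho>" "\<rho> < R" for \<rho>
    using A that by simp
  then have gA: "g \<rho> = A * \<rho> ^ n" if "0 < \<rho>" "\<rho> < R" for \<rho>
    using qA[OF that] that by (simp add: q_def field_simps)
  \<comment> \<open>Integrating A rho^(2 n) produces the denominator 2 n + 1.\<close>
  define a where "a = A / (2 * real n + 1)"
  have Aa: "A = a * (2 * real n + 1)"
    using of_nat_0_le_iff[of n, where 'a=real] by (simp add: a_def)
  define h where "h \<rho> = \<rho> ^ (n + 1) * c0 \<rho> - a * \<rho> ^ (2 * n + 1)" for \<rho>
  have dh: "(h has_field_derivative (\<rho> ^ n * (g \<rho> - A * \<rho> ^ n))) (at \<rho>)" if "\<bar>\<rho>\<bar> < R" for \<rho>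
  proof -
    have pow: "((\<lambda>\<rho>. \<rho> ^ (k + 1)) has_field_derivative (real (k + 1) * \<rho> ^ k)) (at \<rho>)" for k
      using DERIV_pow[of "k + 1" \<rho> UNIV] by simp
    have "(h has_field_derivative (real (n + 1) * \<rho> ^ n * c0 \<rho> + c1 \<rho> * \<rho> ^ (n + 1)
        - a * (real (2 * n + 1) * \<rho> ^ (2 * n)))) (at \<rho>)"
      unfolding h_def
      by (intro DERIV_diff DERIV_mult DERIV_cmult deriv_c0[OF that] pow)
    moreover have "real (n + 1) * \<rho> ^ n * c0 \<rho> + c1 \<rho> * \<rho> ^ (n + 1) - a * (real (2 * n + 1) * \<rho> ^ (2 * n))
        = \<rho> ^ n * (g \<rho> - A * \<rho> ^ n)"
    proof -
      have "\<rho> ^ (2 * n) = \<rho> ^ n * \<rho> ^ n" by (metis mult_2 power_add)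
      then show ?thesis by (simp add: g_def Aa algebra_simps)
    qed
    ultimately show ?thesis by simp
  qed
  have h0: "h \<rho> = 0" if "0 < \<rho>" "\<rho> < R" for \<rho>
  proof -
    \<comment> \<open>Regularity enters here: \<open>c0\<close> is continuous at the centre and is
      multiplied by a positive power of rho, so h vanishes at 0. This excludes the singular solution
      rho^(- n - 1).\<close>
    have "h \<rho> = h 0"
    proof (rule DERIV_isconst2[where f=h and a=0 and x=\<rho> and b=\<rho>])
      show "continuous_on {0..\<rho>} h"
        using that by (intro continuous_at_imp_continuous_on ballI DERIV_isCont[OF dh]) auto
      show "(h has_field_derivative 0) (at x)" if "0 < x" "x < \<rho>" for x
        using dh[of x] gA[of x] that \<open>\<rho> < R\<close> by simp
      show "0 < \<rho>" "0 \<le> \<rho>" "\<rho> \<le> \<rho>" using that by auto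
    qed
    then show ?thesis by (simp add: h_def)
  qed
  have r0: "c0 \<rho> = a * \<rho> ^ n" if "0 < \<rho>" "\<rho> < R" for \<rho>
  proof -
    have "2 * n + 1 = (n + 1) + n" by simp
    then have "\<rho> ^ (2 * n + 1) = \<rho> ^ (n + 1) * \<rho> ^ n"
      by (metis power_add)
    moreover have "\<rho> ^ (n + 1) * c0 \<rho> = a * \<rho> ^ (2 * n + 1)"
      using h0[OF that] by (simp only: h_def right_minus_eq)
    ultimately have "\<rho> ^ (n + 1) * c0 \<rho> = \<rho> ^ (n + 1) * (a * \<rho> ^ n)"
      by (simp only: mult.left_commute)
    moreover have "\<rho> ^ (n + 1) \<noteq> 0"
      using that by simp
    ultimately show ?thesis
      using mult_left_cancel by blast
  qed
  have r1: "\<rho> * c1 \<rho> = real n * a * \<rho> ^ n" if "0 < \<rho>" "\<rho> < R" for \<rho>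
    using gA[OF that] by (simp add: g_def Aa r0[OF that] algebra_simps)
  have r2: "\<rho>\<^sup>2 * c2 \<rho> = real n * (real n - 1) * a * \<rho> ^ n" if "0 < \<rho>" "\<rho> < R" for \<rho>
    using ode[of \<rho>] r1[OF that] that by (simp add: r0[OF that] algebra_simps)
  show ?thesis using that[of a] r0 r1 r2 by blast
qed

end

text \<open>The moment of P against Q on the sphere of radius rho is proportional to rho^m by
  homogeneity of P and to rho^n by \<open>radial_power\<close>. Comparing rho = 1 with rho = 1/2
  forces it to vanish.\<close>

lemma solid_harmonic_orthogonal:
  assumes P: "solid_harmonic m P" and Q: "solid_harmonic n Q" and "m \<noteq> n"
  shows "(\<integral>y. P y * Q y \<partial>\<sigma>) = 0"
proof -
  interpret rad: radial 2 P n Q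
    using solid_harmonicD(3)[OF P] Q by unfold_locales (auto intro: harmonic_on_subset)
  obtain a where a: "\<And>\<rho>. 0 < \<rho> \<Longrightarrow> \<rho> < 2 \<Longrightarrow> rad.c0 \<rho> = a * \<rho> ^ n"
    using rad.radial_power by metis
  have c: "rad.c0 \<rho> = \<rho> ^ m * rad.c0 1" for \<rho>
  proof -
    have "P (\<rho> *\<^sub>R y) * Q y = \<rho> ^ m * (P y * Q y)" for y
      using solid_harmonicD(2)[OF P, of \<rho> y] by simp
    then have "rad.c0 \<rho> = (\<integral>y. \<rho> ^ m * (P y * Q y) \<partial>\<sigma>)"
      unfolding rad.c0_def by (intro Bochner_Integration.integral_cong) simp_all
    then show ?thesis by (simp add: rad.c0_def)
  qed
  have "rad.c0 1 = a" using a[of 1] by simp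
  moreover have "a * (1/2) ^ n = (1/2) ^ m * a"
  proof -
    have "rad.c0 (1/2) = a * (1/2) ^ n" by (rule a) auto
    then show ?thesis using c[of "1/2"] \<open>rad.c0 1 = a\<close> by metis
  qed
  moreover have "(1/2::real) ^ n \<noteq> (1/2) ^ m"
  proof -
    have "(1/2::real) ^ k < (1/2) ^ l" if "l < k" for k l :: nat
      by (rule power_strict_decreasing) (use that in auto)
    then show ?thesis using \<open>m \<noteq> n\<close> by (metis linorder_neqE_nat less_irrefl)
  qed
  ultimately have "rad.c0 1 = 0"
    by (metis mult.commute mult_left_cancel)
  then show ?thesis by (simp add: rad.c0_def)
qed

text \<open>Split into radial and tangential parts: Euler's relation evaluates the radial derivative
  of P, and \<open>sphere_green_solid\<close> the tangential part.\<close>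

lemma integral_inner_grad_solid:
  assumes P: "solid_harmonic n P"
    and f: "\<And>x. x \<in> \<S> \<Longrightarrow> (f has_derivative (\<lambda>v. F x \<bullet> v)) (at x)" "continuous_on \<S> F"
  shows "(\<integral>x. F x \<bullet> grad P x \<partial>\<sigma>)
    = real n * (\<integral>x. (x \<bullet> F x) * P x \<partial>\<sigma>) + real n * (real n + 1) * (\<integral>x. f x * P x \<partial>\<sigma>)"
proof -
  note D = solid_harmonicD[OF P]
  have "(\<integral>x. F x \<bullet> grad P x \<partial>\<sigma>)
      = (\<integral>x. real n * ((x \<bullet> F x) * P x) + cross3 x (F x) \<bullet> cross3 x (grad P x) \<partial>\<sigma>)"
  proof (intro Bochner_Integration.integral_cong refl)
    fix x assume "x \<in> space \<sigma>"
    then have "F x \<bullet> grad P x = (x \<bullet> F x) * (x \<bullet> grad P x) + cross3 x (F x) \<bullet> cross3 x (grad P x)"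
      by (intro cross_inner_decomposition) simp
    then show "F x \<bullet> grad P x = real n * ((x \<bullet> F x) * P x) + cross3 x (F x) \<bullet> cross3 x (grad P x)"
      by (simp add: solid_harmonic_euler[OF P])
  qed
  also have "\<dots> = real n * (\<integral>x. (x \<bullet> F x) * P x \<partial>\<sigma>) + (\<integral>x. cross3 x (F x) \<bullet> cross3 x (grad P x) \<partial>\<sigma>)"
    by (subst Bochner_Integration.integral_add)
       (auto intro!: integrable_mult_right continuous_sphere_integrable continuous_on_mult continuous_on_inner
         continuous_on_id continuous_on_cross D(5,7) f(2))
  also have "(\<integral>x. cross3 x (F x) \<bullet> cross3 x (grad P x) \<partial>\<sigma>) = real n * (real n + 1) * (\<integral>x. f x * P x \<partial>\<sigma>)"
    by (rule sphere_green_solid[OF P f])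
  finally show ?thesis .
qed

lemma integral_grad_solid_solid:
  assumes P: "solid_harmonic m P" and Q: "solid_harmonic n Q"
  shows "(\<integral>x. grad P x \<bullet> grad Q x \<partial>\<sigma>) = real n * (2 * real n + 1) * (\<integral>x. P x * Q x \<partial>\<sigma>)"
proof -
  have "(\<integral>x. grad P x \<bullet> grad Q x \<partial>\<sigma>)
      = real n * (real m * (\<integral>x. P x * Q x \<partial>\<sigma>)) + real n * (real n + 1) * (\<integral>x. P x * Q x \<partial>\<sigma>)"
    by (subst integral_inner_grad_solid[OF Q solid_harmonicD(6,7)[OF P]])
       (simp_all add: solid_harmonic_euler[OF P] mult.assoc)
  then show ?thesis
    using solid_harmonic_orthogonal[OF P Q] by (cases "m = n") (auto simp: algebra_simps)
qed

section \<open>The Newtonian and the Poisson kernel\<close>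

text \<open>The kernel 1 / |w - y|. As a power of the squared distance it is covered, together with
  its derivatives, by the single rule \<open>powr_sqdist_has_derivative\<close>.\<close>

definition newton :: "real^3 \<Rightarrow> real^3 \<Rightarrow> real" where
  "newton w y = ((w - y) \<bullet> (w - y)) powr (-1/2)"

lemma sqdist_pos: "w \<noteq> y \<Longrightarrow> (w - y) \<bullet> (w - y) > 0" for w y :: "real^3"
  by simp

lemma powr_sqdist_has_derivative:
  fixes w y :: "real^3"
  assumes "w \<noteq> y"
  shows "((\<lambda>y. ((w - y) \<bullet> (w - y)) powr p) has_derivative
    (\<lambda>v. ((- 2 * p * ((w - y) \<bullet> (w - y)) powr (p - 1)) *\<^sub>R (w - y)) \<bullet> v)) (at y)"
proof -
  let ?D = "\<lambda>y. (w - y) \<bullet> (w - y)"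
  have 1: "(?D has_derivative (\<lambda>v. - 2 * ((w - y) \<bullet> v))) (at y)"
    by (auto intro!: derivative_eq_intros simp: inner_commute)
  have 2: "((\<lambda>t. t powr p) has_derivative (\<lambda>h. p * ?D y powr (p - 1) * h)) (at (?D y))"
    using has_real_derivative_powr[OF sqdist_pos[OF assms], of p] by (simp add: has_field_derivative_def)
  show ?thesis
    using diff_chain_at[OF 1 2] by (simp add: o_def mult_ac)
qed

lemma newton_grad:
  assumes "w \<noteq> y"
  shows "(newton w has_derivative (\<lambda>v. grad (newton w) y \<bullet> v)) (at y)"
    and "grad (newton w) y = ((w - y) \<bullet> (w - y)) powr (-3/2) *\<^sub>R (w - y)"
proof -
  have 1: "(newton w has_derivative (\<lambda>v. (((w - y) \<bullet> (w - y)) powr (-3/2) *\<^sub>R (w - y)) \<bullet> v)) (at y)"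
    using powr_sqdist_has_derivative[OF assms, of "-1/2"] by (simp add: newton_def[abs_def])
  then show 2: "grad (newton w) y = ((w - y) \<bullet> (w - y)) powr (-3/2) *\<^sub>R (w - y)"
    by (rule grad_eqI)
  show "(newton w has_derivative (\<lambda>v. grad (newton w) y \<bullet> v)) (at y)"
    using 1 unfolding 2 .
qed

lemma newton_harmonic: "harmonic_on (- {w}) (newton w)"
proof -
  let ?D = "\<lambda>y. (w - y) \<bullet> (w - y)"
  \<comment> \<open>The i-th row of the Hessian. Its trace vanishes because the dimension 3 matches
    the factor 3 in front.\<close>
  define h where "h i y = (3 * ?D y powr (-5/2) * (w - y) $ i) *\<^sub>R (w - y) - ?D y powr (-3/2) *\<^sub>R axis i 1" for i y
  have D: "((\<lambda>y. grad (newton w) y $ i) has_derivative (\<lambda>v. h i y \<bullet> v)) (at y)" if "y \<in> - {w}" for i y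
  proof -
    have c: "((\<lambda>y. (w - y) $ i) has_derivative (\<lambda>v. - (v $ i))) (at y)"
      by (auto intro!: derivative_eq_intros bounded_linear_imp_has_derivative bounded_linear_vec_nth)
    have "((\<lambda>y. ?D y powr (-3/2) * (w - y) $ i) has_derivative (\<lambda>v. h i y \<bullet> v)) (at y)"
      using has_derivative_mult[OF powr_sqdist_has_derivative[of w y "-3/2"] c] that
      by (auto simp: h_def inner_diff_left inner_axis' mult_ac elim!: has_derivative_eq_rhs)
    then show ?thesis
      by (rule has_derivative_transform_within_open[OF _ _ that]) (auto simp: newton_grad)
  qed
  have H: "grad (\<lambda>y. grad (newton w) y $ i) y = h i y" if "y \<in> - {w}" for i y
    using D[OF that] by (rule grad_eqI)
  have "C2_on (- {w}) (newton w)"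
    unfolding C2_on_def
  proof (intro conjI ballI allI)
    show "newton w differentiable (at x)" if "x \<in> - {w}" for x
      using newton_grad(1)[of w x] that by (auto simp: differentiable_def)
    show "(\<lambda>y. grad (newton w) y $ i) differentiable (at x)" if "x \<in> - {w}" for x i
      using D[OF that] by (auto simp: differentiable_def)
    have "continuous_on (- {w}) (h i)" for i
      unfolding h_def by (intro continuous_intros continuous_on_powr) auto
    then show "continuous_on (- {w}) (grad (\<lambda>y. grad (newton w) y $ i))" for i
      by (subst continuous_on_cong[OF refl H])
  qed
  moreover have "laplacian (newton w) y = 0" if "y \<in> - {w}" for y
  proof -
    have "?D y > 0" using that by simp
    have "laplacian (newton w) y = (\<Sum>i\<in>UNIV. h i y $ i)"
      by (simp add: laplacian_def H[OF that])
    also have "\<dots> = 3 * ?D y powr (-5/2) * ?D y - 3 * ?D y powr (-3/2)"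
      by (simp add: h_def sum_3 inner_vec_def axis_def algebra_simps)
    also have "?D y powr (-3/2) = ?D y powr (-5/2) * ?D y"
      using powr_add[of "?D y" "-5/2" 1] \<open>?D y > 0\<close> by simp
    finally show ?thesis by simp
  qed
  ultimately show ?thesis by (simp add: harmonic_on_iff)
qed

section \<open>Area of the unit sphere and distances between its points\<close>

definition total_area :: real where "total_area = measure \<sigma> (space \<sigma>)"

lemma total_area_pos: "total_area > 0"
proof -
  have S: "\<S> \<in> sets (restrict_space borel \<S>)"
    by (simp add: sphere_sets_iff)
  have "cone_part 1 \<S> = ball 0 1 - {0}"
    by (auto simp: cone_part_def)
  then have "emeasure \<sigma> \<S> = 3 * emeasure lborel (ball (0::real^3) 1 - {0})"
    using emeasure_sphere_measure[OF _ S] by simp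
  also have "\<dots> = 3 * emeasure lborel (ball (0::real^3) 1)"
    by (subst emeasure_Diff_null_set) (auto simp: null_sets_def)
  finally have area: "emeasure \<sigma> \<S> = 3 * emeasure lborel (ball (0::real^3) 1)" .
  have "emeasure \<sigma> \<S> \<noteq> 0"
  proof -
    have "unit_ball_vol 3 > (0::real)" by simp
    then have "unit_ball_vol 3 \<noteq> (0::real)" by linarith
    then show ?thesis
      using area emeasure_ball[of 1 "0::real^3"] by simp
  qed
  then show ?thesis
    by (simp add: total_area_def sigma.emeasure_eq_measure zero_less_measure_iff)
qed

lemma sqdist_powr:
  fixes w y :: "real^3"
  assumes "w \<noteq> y"
  shows "((w - y) \<bullet> (w - y)) powr (-1/2) = 1 / norm (w - y)"
    and "((w - y) \<bullet> (w - y)) powr (-3/2) = 1 / norm (w - y) ^ 3"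
proof -
  let ?d = "norm (w - y)"
  have d: "?d > 0" using assms by simp
  have D: "(w - y) \<bullet> (w - y) = ?d powr 2"
    using d by (simp add: dot_square_norm)
  show "((w - y) \<bullet> (w - y)) powr (-1/2) = 1 / ?d"
    unfolding D powr_powr using d by (simp add: powr_minus_divide)
  have "?d powr 3 = ?d ^ 3" using d by simp
  then show "((w - y) \<bullet> (w - y)) powr (-3/2) = 1 / ?d ^ 3"
    unfolding D powr_powr using d by (simp add: powr_minus_divide)
qed

lemma sqdist_sphere:
  fixes w y :: "real^3"
  assumes "w \<in> \<S>" "y \<in> \<S>"
  shows "(norm (w - s *\<^sub>R y))\<^sup>2 = 1 - 2 * s * (w \<bullet> y) + s\<^sup>2"
proof -
  have "w \<bullet> w = 1" "y \<bullet> y = 1" using assms by (auto simp: dot_square_norm)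
  then show ?thesis
    unfolding power2_norm_eq_inner inner_diff_left inner_diff_right inner_scaleR_left inner_scaleR_right
      inner_commute[of y w]
    by (simp add: algebra_simps power2_eq_square)
qed

lemma dist_sphere_lower:
  fixes w y :: "real^3"
  assumes "w \<in> \<S>" "y \<in> \<S>" "0 \<le> s"
  shows "\<bar>1 - s\<bar> \<le> norm (w - s *\<^sub>R y)"
  using assms norm_triangle_ineq3[of w "s *\<^sub>R y"] by simp

lemma dist_sphere_nonzero:
  fixes w y :: "real^3"
  assumes "w \<in> \<S>" "y \<in> \<S>" "0 \<le> s" "s \<noteq> 1"
  shows "w \<noteq> s *\<^sub>R y" "norm (w - s *\<^sub>R y) > 0"
  using dist_sphere_lower[OF assms(1-3)] assms(4) by auto

lemma kernel_continuous:
  fixes g :: "real^3 \<Rightarrow> real"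
  assumes "w \<in> \<S>" "0 \<le> s" "s \<noteq> 1" "continuous_on \<S> g"
  shows "continuous_on \<S> (\<lambda>y. g y / norm (w - s *\<^sub>R y) ^ k)"
proof (intro continuous_on_divide assms(4) continuous_on_power continuous_on_norm continuous_on_diff
    continuous_on_const continuous_on_scaleR continuous_on_id ballI)
  show "norm (w - s *\<^sub>R y) ^ k \<noteq> 0" if "y \<in> \<S>" for y
    using dist_sphere_nonzero(2)[OF assms(1) that assms(2,3)] by simp
qed

text \<open>For w and y on the unit sphere |w - s y| = |s w - y|. So \<open>I1\<close> is, up to a
  factor, the single layer potential of P at the point s w, and for s < 1 the product (1 - s^2)
  \<open>I3\<close> is, up to a factor, its Poisson integral there.\<close>

definition I1 :: "(real^3 \<Rightarrow> real) \<Rightarrow> real^3 \<Rightarrow> real \<Rightarrow> real" where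
  "I1 P w s = (\<integral>y. P y / norm (w - s *\<^sub>R y) \<partial>\<sigma>)"

definition I3 :: "(real^3 \<Rightarrow> real) \<Rightarrow> real^3 \<Rightarrow> real \<Rightarrow> real" where
  "I3 P w s = (\<integral>y. P y / norm (w - s *\<^sub>R y) ^ 3 \<partial>\<sigma>)"

lemma kernel_integrable:
  fixes g :: "real^3 \<Rightarrow> real"
  assumes "w \<in> \<S>" "0 \<le> s" "s \<noteq> 1" "continuous_on \<S> g"
  shows "integrable \<sigma> (\<lambda>y. g y / norm (w - s *\<^sub>R y) ^ k)" "integrable \<sigma> (\<lambda>y. g y / norm (w - s *\<^sub>R y))"
  using continuous_sphere_integrable[OF kernel_continuous[OF assms, of k]]
    continuous_sphere_integrable[OF kernel_continuous[OF assms, of 1]] by simp_all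

text \<open>\<open>newton w\<close> is harmonic in the open unit ball, so the theory of radial
  moments applies to it and its moment is \<open>I1\<close>. The third clause determines the
  constant in degree 0, which later normalizes all others.\<close>

lemma I1_I3_power:
  assumes P: "solid_harmonic n P" and w: "w \<in> \<S>"
  obtains a where "\<And>s. 0 < s \<Longrightarrow> s < 1 \<Longrightarrow> I1 P w s = a * s ^ n"
    "\<And>s. 0 < s \<Longrightarrow> s < 1 \<Longrightarrow> (1 - s\<^sup>2) * I3 P w s = (2 * real n + 1) * a * s ^ n"
    "n = 0 \<Longrightarrow> a = (\<integral>y. P y \<partial>\<sigma>)"
proof -
  have "ball 0 1 \<subseteq> - {w}" using w by auto
  then interpret rad: radial 1 "newton w" n P
    using P newton_harmonic[of w] by unfold_locales (auto intro: harmonic_on_subset)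
  obtain a where a: "\<And>s. 0 < s \<Longrightarrow> s < 1 \<Longrightarrow> rad.c0 s = a * s ^ n"
    "\<And>s. 0 < s \<Longrightarrow> s < 1 \<Longrightarrow> s * rad.c1 s = real n * a * s ^ n"
    using rad.radial_power by metis
  have N: "newton w (s *\<^sub>R y) = 1 / norm (w - s *\<^sub>R y)"
    "grad (newton w) (s *\<^sub>R y) = (1 / norm (w - s *\<^sub>R y) ^ 3) *\<^sub>R (w - s *\<^sub>R y)"
    if "0 \<le> s" "s < 1" "y \<in> \<S>" for s y
  proof -
    have nz: "w \<noteq> s *\<^sub>R y" using dist_sphere_nonzero[OF w that(3,1)] that(2) by auto
    show "newton w (s *\<^sub>R y) = 1 / norm (w - s *\<^sub>R y)"
      unfolding newton_def sqdist_powr[OF nz] ..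
    show "grad (newton w) (s *\<^sub>R y) = (1 / norm (w - s *\<^sub>R y) ^ 3) *\<^sub>R (w - s *\<^sub>R y)"
      unfolding newton_grad(2)[OF nz] sqdist_powr[OF nz] ..
  qed
  have c0: "rad.c0 s = I1 P w s" if "0 \<le> s" "s < 1" for s
    unfolding rad.c0_def I1_def using N(1)[OF that] by (intro Bochner_Integration.integral_cong) auto
  \<comment> \<open>Pointwise, with d = |w - s y|, this is 2 s (d/ds)(1 / d) + 1 / d = (1 - s^2) /
    d^3, a consequence of d^2 = 1 - 2 s (w . y) + s^2.\<close>
  have c1: "2 * (s * rad.c1 s) + I1 P w s = (1 - s\<^sup>2) * I3 P w s" if s: "0 < s" "s < 1" for s
  proof -
    have cP: "continuous_on \<S> P" by (rule solid_harmonicD[OF P])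
    have q: "2 * (s * ((y \<bullet> grad (newton w) (s *\<^sub>R y)) * P y)) = (1 - s\<^sup>2) * (P y / norm (w - s *\<^sub>R y) ^ 3)
        - P y / norm (w - s *\<^sub>R y)" if y: "y \<in> \<S>" for y
    proof -
      define d where "d = norm (w - s *\<^sub>R y)"
      have d: "d > 0" using dist_sphere_nonzero[OF w y] s by (simp add: d_def)
      have yy: "y \<bullet> y = 1" using y by (simp add: dot_square_norm)
      have "y \<bullet> (w - s *\<^sub>R y) = w \<bullet> y - s"
        by (simp add: inner_diff_right yy inner_commute)
      moreover have "2 * s * (w \<bullet> y - s) = (1 - s\<^sup>2) - d\<^sup>2"
        unfolding d_def sqdist_sphere[OF w y] by (simp add: algebra_simps power2_eq_square)
      ultimately have "2 * s * (y \<bullet> (w - s *\<^sub>R y)) = (1 - s\<^sup>2) - d\<^sup>2" by simp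
      moreover have "2 * (s * ((y \<bullet> grad (newton w) (s *\<^sub>R y)) * P y)) = (2 * s * (y \<bullet> (w - s *\<^sub>R y))) * P y / d ^ 3"
        using N(2)[of s y] s y by (simp add: d_def)
      ultimately have "2 * (s * ((y \<bullet> grad (newton w) (s *\<^sub>R y)) * P y)) = ((1 - s\<^sup>2) - d\<^sup>2) * P y / d ^ 3"
        by simp
      also have "\<dots> = (1 - s\<^sup>2) * (P y / d ^ 3) - P y / d"
        using d by (simp add: field_simps power2_eq_square power3_eq_cube)
      finally show ?thesis by (simp add: d_def)
    qed
    have "2 * (s * rad.c1 s) = (\<integral>y. 2 * (s * ((y \<bullet> grad (newton w) (s *\<^sub>R y)) * P y)) \<partial>\<sigma>)"
      by (simp add: rad.c1_def)
    also have "\<dots> = (\<integral>y. (1 - s\<^sup>2) * (P y / norm (w - s *\<^sub>R y) ^ 3) - P y / norm (w - s *\<^sub>R y) \<partial>\<sigma>)"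
      using q by (intro Bochner_Integration.integral_cong) auto
    also have "\<dots> = (1 - s\<^sup>2) * I3 P w s - I1 P w s"
    proof -
      have s1: "0 \<le> s" "s \<noteq> 1" using s by auto
      show ?thesis
        unfolding I1_def I3_def
        by (simp only: Bochner_Integration.integral_diff[OF integrable_mult_right[OF kernel_integrable(1)[OF w s1 cP]]
              kernel_integrable(2)[OF w s1 cP]] integral_mult_right_zero)
    qed
    finally show ?thesis by simp
  qed
  \<comment> \<open>In degree 0 the moment is constant on (0, 1) and continuous at 0, where the
    kernel equals 1. In positive degree the limit at 0 would not determine a.\<close>
  have "a = (\<integral>y. P y \<partial>\<sigma>)" if "n = 0"
  proof -
    have "isCont rad.c0 0"
      using DERIV_isCont[OF rad.deriv_c0[of 0]] by simp
    then have 1: "(rad.c0 \<longlongrightarrow> rad.c0 0) (at_right 0)"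
      unfolding isCont_def by (rule filterlim_mono) (auto simp: at_le)
    have 2: "eventually (\<lambda>s::real. rad.c0 s = a) (at_right 0)"
      using eventually_at_right_real[of 0 1] by (rule eventually_mono) (use a(1) that in auto)
    have "((\<lambda>_. a) \<longlongrightarrow> rad.c0 0) (at_right (0::real))"
      by (rule tendsto_cong[OF 2, THEN iffD1, OF 1])
    then have "rad.c0 0 = a"
      by (simp add: tendsto_const_iff)
    then show ?thesis using c0[of 0] w by (simp add: I1_def)
  qed
  moreover have "I1 P w s = a * s ^ n" if "0 < s" "s < 1" for s
    using a(1)[OF that] c0[of s] that by simp
  moreover have "(1 - s\<^sup>2) * I3 P w s = (2 * real n + 1) * a * s ^ n" if "0 < s" "s < 1" for s
    using a(2)[OF that] c1[OF that] a(1)[OF that] c0[of s] that by (simp add: algebra_simps)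
  ultimately show ?thesis using that by blast
qed

lemma real_polynomial_lipschitz_sphere:
  assumes "solid_harmonic n P"
  obtains L where "L > 0" "\<And>x y. x \<in> \<S> \<Longrightarrow> y \<in> \<S> \<Longrightarrow> \<bar>P x - P y\<bar> \<le> L * norm (x - y)"
proof -
  note D = solid_harmonicD[OF assms]
  have "bounded (grad P ` cball 0 1)"
    by (intro compact_imp_bounded compact_continuous_image D(7) compact_cball)
  then obtain L where L: "L > 0" "\<And>x. x \<in> cball 0 1 \<Longrightarrow> norm (grad P x) \<le> L"
    by (auto simp: bounded_pos)
  have "norm (P x - P y) \<le> L * norm (x - y)" if "x \<in> cball 0 1" "y \<in> cball 0 1" for x y
  proof (rule differentiable_bound[of "cball 0 1" P "\<lambda>x v. grad P x \<bullet> v"])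
    show "(P has_derivative (\<lambda>v. grad P x \<bullet> v)) (at x within cball 0 1)" for x
      using D(6) by (rule has_derivative_at_withinI)
    show "onorm (\<lambda>v. grad P x \<bullet> v) \<le> L" if "x \<in> cball 0 1" for x
    proof (rule onorm_le)
      show "norm (grad P x \<bullet> v) \<le> L * norm v" for v
        using Cauchy_Schwarz_ineq2[of "grad P x" v] L(2)[OF that] mult_right_mono[of _ L "norm v"]
        by (metis norm_ge_zero order_trans real_norm_def)
    qed
  qed (use that in auto)
  then show ?thesis using that[of L] L(1) by simp
qed

lemma solid_harmonic_one: "solid_harmonic 0 (\<lambda>_. 1)"
proof -
  have g: "grad (\<lambda>_. c) x = 0" for c x
    by (rule grad_eqI) simp
  have "harmonic_on UNIV (\<lambda>_. 1)"
    unfolding harmonic_on_def by (simp add: g laplacian_def)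
  then show ?thesis by (simp add: solid_harmonic_def real_polynomial_function.intros)
qed

text \<open>The constant function is the case whose constant can be read off at s = 0; it fixes the
  total mass of both kernels.\<close>

lemma I1_I3_one:
  assumes "w \<in> \<S>" "0 < s" "s < 1"
  shows "I1 (\<lambda>_. 1) w s = total_area" "(1 - s\<^sup>2) * I3 (\<lambda>_. 1) w s = total_area"
proof -
  obtain a where a: "\<And>s. 0 < s \<Longrightarrow> s < 1 \<Longrightarrow> I1 (\<lambda>_. 1) w s = a * s ^ 0"
    "\<And>s. 0 < s \<Longrightarrow> s < 1 \<Longrightarrow> (1 - s\<^sup>2) * I3 (\<lambda>_. 1) w s = (2 * real 0 + 1) * a * s ^ 0"
    "(0::nat) = 0 \<Longrightarrow> a = (\<integral>y. 1 \<partial>\<sigma>)"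
    using I1_I3_power[OF solid_harmonic_one assms(1)] by blast
  have "a = total_area" using a(3) by (simp add: total_area_def)
  then show "I1 (\<lambda>_. 1) w s = total_area" "(1 - s\<^sup>2) * I3 (\<lambda>_. 1) w s = total_area"
    using a(1,2)[OF assms(2,3)] by simp_all
qed

text \<open>Since \<open>(1 - s\<^sup>2) / norm (w - s *\<^sub>R y) ^ 3\<close> is the Poisson kernel, letting \<open>s\<close> tend to \<open>1\<close>
  identifies the constant of \<open>I1_I3_power\<close>.\<close>

lemma I1_I3_inside:
  assumes P: "solid_harmonic n P" and w: "w \<in> \<S>" and s: "0 < s" "s < 1"
  shows "I1 P w s = total_area * P w * s ^ n / (2 * real n + 1)"
    and "(1 - s\<^sup>2) * I3 P w s = total_area * P w * s ^ n"
proof -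
  obtain a where a: "\<And>s. 0 < s \<Longrightarrow> s < 1 \<Longrightarrow> I1 P w s = a * s ^ n"
    "\<And>s. 0 < s \<Longrightarrow> s < 1 \<Longrightarrow> (1 - s\<^sup>2) * I3 P w s = (2 * real n + 1) * a * s ^ n"
    using I1_I3_power[OF P w] by metis
  obtain L where L: "L > 0" "\<And>x y. x \<in> \<S> \<Longrightarrow> y \<in> \<S> \<Longrightarrow> \<bar>P x - P y\<bar> \<le> L * norm (x - y)"
    using real_polynomial_lipschitz_sphere[OF P] by blast
  have cP: "continuous_on \<S> P" by (rule solid_harmonicD[OF P])
  have est: "\<bar>(2 * real n + 1) * a * s ^ n - total_area * P w\<bar> \<le> 2 * L * total_area * sqrt (1 - s\<^sup>2)"
    if s: "0 < s" "s < 1" for s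
  proof -
    \<comment> \<open>The square root of the Poisson weight 1 - s^2; it will turn out to be the rate
      of convergence as s tends to 1.\<close>
    define k where "k = sqrt (1 - s\<^sup>2)"
    have "s\<^sup>2 < 1" using s by (simp add: power_less_one_iff)
    then have k: "k > 0" "k\<^sup>2 = 1 - s\<^sup>2" by (auto simp: k_def)
    have int: "integrable \<sigma> (\<lambda>y. g y / norm (w - s *\<^sub>R y) ^ 3)" "integrable \<sigma> (\<lambda>y. g y / norm (w - s *\<^sub>R y))"
      if "continuous_on \<S> g" for g :: "real^3 \<Rightarrow> real"
      using kernel_integrable[OF w _ _ that] s by auto
    have one: "(1 - s\<^sup>2) * I3 (\<lambda>_. 1) w s = total_area" "I1 (\<lambda>_. 1) w s = total_area"
      using I1_I3_one[OF w s] by auto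
    have "(2 * real n + 1) * a * s ^ n - total_area * P w
        = (1 - s\<^sup>2) * I3 P w s - P w * ((1 - s\<^sup>2) * I3 (\<lambda>_. 1) w s)"
      using a(2)[OF s] one by simp
    also have "\<dots> = (\<integral>y. k\<^sup>2 * (P y / norm (w - s *\<^sub>R y) ^ 3) - P w * (k\<^sup>2 * (1 / norm (w - s *\<^sub>R y) ^ 3)) \<partial>\<sigma>)"
      unfolding I3_def k(2)
      by (simp only: Bochner_Integration.integral_diff[OF integrable_mult_right[OF int(1)[OF cP]]
            integrable_mult_right[OF integrable_mult_right[OF int(1)[OF continuous_on_const]]]] integral_mult_right_zero)
    finally have "\<bar>(2 * real n + 1) * a * s ^ n - total_area * P w\<bar>
        \<le> (\<integral>y. \<bar>k\<^sup>2 * (P y / norm (w - s *\<^sub>R y) ^ 3) - P w * (k\<^sup>2 * (1 / norm (w - s *\<^sub>R y) ^ 3))\<bar> \<partial>\<sigma>)"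
      by simp
    also have "\<dots> \<le> (\<integral>y. (L * k) * (k\<^sup>2 * (1 / norm (w - s *\<^sub>R y) ^ 3)) + (L * k) * (1 / norm (w - s *\<^sub>R y)) \<partial>\<sigma>)"
    proof (rule integral_mono)
      show "integrable \<sigma> (\<lambda>y. \<bar>k\<^sup>2 * (P y / norm (w - s *\<^sub>R y) ^ 3) - P w * (k\<^sup>2 * (1 / norm (w - s *\<^sub>R y) ^ 3))\<bar>)"
        by (intro integrable_abs Bochner_Integration.integrable_diff integrable_mult_right int(1) cP continuous_on_const)
      show "integrable \<sigma> (\<lambda>y. (L * k) * (k\<^sup>2 * (1 / norm (w - s *\<^sub>R y) ^ 3)) + (L * k) * (1 / norm (w - s *\<^sub>R y)))"
        by (intro Bochner_Integration.integrable_add integrable_mult_right int continuous_on_const)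
      fix y assume "y \<in> space \<sigma>"
      then have y: "y \<in> \<S>" by simp
      define d where "d = norm (w - s *\<^sub>R y)"
      have d: "d > 0" using dist_sphere_nonzero[OF w y] s by (simp add: d_def)
      have "norm (w - y) \<le> norm (w - s *\<^sub>R y) + norm (s *\<^sub>R y - y)"
        using norm_triangle_ineq[of "w - s *\<^sub>R y" "s *\<^sub>R y - y"] by simp
      also have "norm (s *\<^sub>R y - y) = 1 - s"
      proof -
        have "s *\<^sub>R y - y = (s - 1) *\<^sub>R y" by (simp add: algebra_simps)
        then show ?thesis using y s by simp
      qed
      also have "1 - s \<le> norm (w - s *\<^sub>R y)"
        using dist_sphere_lower[OF w y, of s] s by simp
      finally have wy: "norm (w - y) \<le> 2 * d" by (simp add: d_def)
      have "\<bar>P y - P w\<bar> \<le> L * norm (w - y)"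
        using L(2)[OF y w] by (simp add: norm_minus_commute)
      also have "\<dots> \<le> L * (2 * d)"
        using wy L(1) by simp
      finally have "\<bar>P y - P w\<bar> * (k\<^sup>2 / d ^ 3) \<le> (L * (2 * d)) * (k\<^sup>2 / d ^ 3)"
        using d by (intro mult_right_mono) auto
      also have "\<dots> = (L * k) * (2 * k / d\<^sup>2)"
        using d by (simp add: field_simps power2_eq_square power3_eq_cube)
      \<comment> \<open>The inequality between arithmetic and geometric mean, in the form (k - d)^2
        >= 0. It is chosen so that the integrals of both terms on the right are known exactly from
        \<open>I1_I3_one\<close>.\<close>
      also have "2 * k / d\<^sup>2 \<le> k\<^sup>2 / d ^ 3 + 1 / d"
      proof -
        have "0 \<le> (k - d)\<^sup>2 / d ^ 3" using d by simp
        also have "\<dots> = k\<^sup>2 / d ^ 3 + 1 / d - 2 * k / d\<^sup>2"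
          using d by (simp add: field_simps power2_eq_square power3_eq_cube)
        finally show ?thesis by simp
      qed
      finally have "\<bar>P y - P w\<bar> * (k\<^sup>2 / d ^ 3) \<le> (L * k) * (k\<^sup>2 / d ^ 3 + 1 / d)"
        using L(1) k(1) by (simp add: mult_left_mono)
      moreover have "k\<^sup>2 * (P y / d ^ 3) - P w * (k\<^sup>2 * (1 / d ^ 3)) = (P y - P w) * (k\<^sup>2 / d ^ 3)"
        by (simp add: left_diff_distrib diff_divide_distrib)
      moreover have "k\<^sup>2 / d ^ 3 \<ge> 0" using d by simp
      ultimately show "\<bar>k\<^sup>2 * (P y / norm (w - s *\<^sub>R y) ^ 3) - P w * (k\<^sup>2 * (1 / norm (w - s *\<^sub>R y) ^ 3))\<bar>
          \<le> (L * k) * (k\<^sup>2 * (1 / norm (w - s *\<^sub>R y) ^ 3)) + (L * k) * (1 / norm (w - s *\<^sub>R y))"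
        unfolding d_def[symmetric] using d by (simp add: abs_mult distrib_left)
    qed
    also have "\<dots> = L * k * (k\<^sup>2 * I3 (\<lambda>_. 1) w s) + L * k * I1 (\<lambda>_. 1) w s"
      unfolding I3_def I1_def
      by (simp only: Bochner_Integration.integral_add[OF integrable_mult_right[OF integrable_mult_right[OF int(1)[OF continuous_on_const]]]
            integrable_mult_right[OF int(2)[OF continuous_on_const]]] integral_mult_right_zero)
    also have "\<dots> = 2 * L * total_area * k"
      using one by (simp add: k(2))
    finally show ?thesis by (simp add: k_def)
  qed
  have "((\<lambda>s. (2 * real n + 1) * a * s ^ n - total_area * P w) \<longlongrightarrow> 0) (at_left (1::real))"
  proof (rule Lim_null_comparison)
    show "\<forall>\<^sub>F s in at_left (1::real). norm ((2 * real n + 1) * a * s ^ n - total_area * P w)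
        \<le> 2 * L * total_area * sqrt (1 - s\<^sup>2)"
      using eventually_at_left_real[OF zero_less_one] by (rule eventually_mono) (use est in auto)
    have "((\<lambda>s::real. 2 * L * total_area * sqrt (1 - s\<^sup>2)) \<longlongrightarrow> 2 * L * total_area * sqrt (1 - 1\<^sup>2)) (at_left 1)"
      by (intro tendsto_intros)
    then show "((\<lambda>s::real. 2 * L * total_area * sqrt (1 - s\<^sup>2)) \<longlongrightarrow> 0) (at_left 1)"
      by simp
  qed
  moreover have "((\<lambda>s. (2 * real n + 1) * a * s ^ n - total_area * P w) \<longlongrightarrow>
      (2 * real n + 1) * a * 1 ^ n - total_area * P w) (at_left (1::real))"
    by (intro tendsto_intros)
  ultimately have "(2 * real n + 1) * a * 1 ^ n - total_area * P w = 0"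
    by (rule tendsto_unique[OF trivial_limit_at_left_real, rotated])
  then have aP: "(2 * real n + 1) * a = total_area * P w"
    by simp
  have nz: "2 * real n + 1 > 0" by (simp add: add_nonneg_pos)
  then have "a = total_area * P w / (2 * real n + 1)"
    using aP by (simp add: field_simps)
  then show "I1 P w s = total_area * P w * s ^ n / (2 * real n + 1)"
    using a(1)[OF s] by simp
  show "(1 - s\<^sup>2) * I3 P w s = total_area * P w * s ^ n"
    using a(2)[OF s] aP by simp
qed

text \<open>Reflection in the unit sphere: it carries the formulas for s < 1 over to s > 1.\<close>

lemma norm_diff_inversion:
  fixes w y :: "real^3"
  assumes "w \<in> \<S>" "y \<in> \<S>" "0 < s"
  shows "norm (w - s *\<^sub>R y) = s * norm (w - (1 / s) *\<^sub>R y)"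
proof (rule power2_eq_imp_eq)
  show "(norm (w - s *\<^sub>R y))\<^sup>2 = (s * norm (w - (1 / s) *\<^sub>R y))\<^sup>2"
    unfolding power_mult_distrib sqdist_sphere[OF assms(1,2)]
    using assms(3) by (simp add: field_simps power2_eq_square)
qed (use assms in auto)

lemma I1_I3_outside:
  assumes P: "solid_harmonic n P" and w: "w \<in> \<S>" and s: "1 < s"
  shows "I1 P w s = total_area * P w / s ^ (n + 1) / (2 * real n + 1)"
    and "(s\<^sup>2 - 1) * I3 P w s = total_area * P w / s ^ (n + 1)"
proof -
  have s': "0 < 1 / s" "1 / s < 1" using s by auto
  have "I1 P w s = (\<integral>y. (1 / s) * (P y / norm (w - (1 / s) *\<^sub>R y)) \<partial>\<sigma>)"
    unfolding I1_def using norm_diff_inversion[OF w, of _ s] s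
    by (intro Bochner_Integration.integral_cong) auto
  also have "\<dots> = (1 / s) * I1 P w (1 / s)"
    unfolding I1_def by (rule integral_mult_right_zero)
  finally show "I1 P w s = total_area * P w / s ^ (n + 1) / (2 * real n + 1)"
    unfolding I1_I3_inside(1)[OF P w s'] by (simp add: power_one_over field_simps)
  have "I3 P w s = (\<integral>y. (1 / s ^ 3) * (P y / norm (w - (1 / s) *\<^sub>R y) ^ 3) \<partial>\<sigma>)"
    unfolding I3_def using norm_diff_inversion[OF w, of _ s] s
    by (intro Bochner_Integration.integral_cong) (auto simp: power_mult_distrib)
  also have "\<dots> = (1 / s ^ 3) * I3 P w (1 / s)"
    unfolding I3_def by (rule integral_mult_right_zero)
  finally have "(s\<^sup>2 - 1) * I3 P w s = (1 / s) * ((1 - (1 / s)\<^sup>2) * I3 P w (1 / s))"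
    using s by (simp add: field_simps power2_eq_square power3_eq_cube)
  then show "(s\<^sup>2 - 1) * I3 P w s = total_area * P w / s ^ (n + 1)"
    unfolding I1_I3_inside(2)[OF P w s'] by (simp add: power_one_over)
qed

section \<open>Orthogonal expansions\<close>

definition ip :: "'a measure \<Rightarrow> ('a \<Rightarrow> 'b::euclidean_space) \<Rightarrow> ('a \<Rightarrow> 'b) \<Rightarrow> real" where
  "ip M f g = (\<integral>x. f x \<bullet> g x \<partial>M)"

lemma L2D: "f \<in> L2 M \<Longrightarrow> f \<in> borel_measurable M" "f \<in> L2 M \<Longrightarrow> integrable M (\<lambda>x. (norm (f x))\<^sup>2)"
  by (auto simp: L2_def)

lemma L2_inner_integrable:
  assumes "f \<in> L2 M" "g \<in> L2 M"
  shows "integrable M (\<lambda>x. f x \<bullet> g x)"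
proof (rule Bochner_Integration.integrable_bound)
  show "integrable M (\<lambda>x. (norm (f x))\<^sup>2 + (norm (g x))\<^sup>2)"
    using assms L2D(2) by (intro Bochner_Integration.integrable_add) auto
  show "(\<lambda>x. f x \<bullet> g x) \<in> borel_measurable M"
    using assms L2D(1) by (intro borel_measurable_inner) auto
  have "\<bar>f x \<bullet> g x\<bar> \<le> (norm (f x))\<^sup>2 + (norm (g x))\<^sup>2" for x
  proof -
    have "\<bar>f x \<bullet> g x\<bar> \<le> norm (f x) * norm (g x)" by (rule Cauchy_Schwarz_ineq2)
    also have "\<dots> \<le> 2 * (norm (f x) * norm (g x))" by simp
    also have "\<dots> \<le> (norm (f x))\<^sup>2 + (norm (g x))\<^sup>2"
      using sum_squares_bound[of "norm (f x)" "norm (g x)"] by (simp add: mult.assoc)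
    finally show ?thesis .
  qed
  then show "AE x in M. norm (f x \<bullet> g x) \<le> norm ((norm (f x))\<^sup>2 + (norm (g x))\<^sup>2)"
    by (intro AE_I2) (simp add: abs_of_nonneg)
qed

lemma L2_scaleR: "f \<in> L2 M \<Longrightarrow> (\<lambda>x. c *\<^sub>R f x) \<in> L2 M"
  by (auto simp: L2_def power_mult_distrib)

lemma L2_add:
  assumes "f \<in> L2 M" "g \<in> L2 M"
  shows "(\<lambda>x. f x + g x) \<in> L2 M"
proof -
  have "(norm (f x + g x))\<^sup>2 = (norm (f x))\<^sup>2 + 2 * (f x \<bullet> g x) + (norm (g x))\<^sup>2" for x
    by (simp add: power2_norm_eq_inner inner_add_left inner_add_right inner_commute)
  moreover have "integrable M (\<lambda>x. (norm (f x))\<^sup>2 + 2 * (f x \<bullet> g x) + (norm (g x))\<^sup>2)"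
    using assms L2D(2) L2_inner_integrable[OF assms]
    by (intro Bochner_Integration.integrable_add integrable_mult_right) auto
  ultimately show ?thesis
    using assms L2D(1) by (auto simp: L2_def)
qed

lemma L2_diff: "f \<in> L2 M \<Longrightarrow> g \<in> L2 M \<Longrightarrow> (\<lambda>x. f x - g x) \<in> L2 M"
  using L2_add[of f M "\<lambda>x. (-1) *\<^sub>R g x"] L2_scaleR[of g M "-1"] by simp

lemma L2_zero: "(\<lambda>x. 0) \<in> L2 M"
  by (simp add: L2_def)

lemma L2_sum: "(\<And>i. i \<in> F \<Longrightarrow> G i \<in> L2 M) \<Longrightarrow> (\<lambda>x. \<Sum>i\<in>F. c i *\<^sub>R G i x) \<in> L2 M"
proof (induction F rule: infinite_finite_induct)
  case (insert j F)
  have "(\<lambda>x. c j *\<^sub>R G j x + (\<Sum>i\<in>F. c i *\<^sub>R G i x)) \<in> L2 M"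
    by (rule L2_add[OF L2_scaleR]) (use insert in auto)
  then show ?case using insert.hyps by simp
qed (simp_all add: L2_zero)

lemma L2_norm_nonneg: "0 \<le> L2_norm M f"
  by (simp add: L2_norm_def)

lemma L2_norm_sq: "(L2_norm M f)\<^sup>2 = ip M f f"
  by (simp add: L2_norm_def ip_def power2_norm_eq_inner)

lemma ip_commute: "ip M f g = ip M g f"
  by (simp add: ip_def inner_commute)

lemma ip_add_right:
  assumes "f \<in> L2 M" "g \<in> L2 M" "h \<in> L2 M"
  shows "ip M f (\<lambda>x. g x + h x) = ip M f g + ip M f h"
  unfolding ip_def inner_add_right
  by (rule Bochner_Integration.integral_add[OF L2_inner_integrable[OF assms(1,2)] L2_inner_integrable[OF assms(1,3)]])

lemma ip_diff_right:
  assumes "f \<in> L2 M" "g \<in> L2 M" "h \<in> L2 M"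
  shows "ip M f (\<lambda>x. g x - h x) = ip M f g - ip M f h"
  unfolding ip_def inner_diff_right
  by (rule Bochner_Integration.integral_diff[OF L2_inner_integrable[OF assms(1,2)] L2_inner_integrable[OF assms(1,3)]])

lemma ip_diff_left:
  assumes "f \<in> L2 M" "g \<in> L2 M" "h \<in> L2 M"
  shows "ip M (\<lambda>x. g x - h x) f = ip M g f - ip M h f"
  using ip_diff_right[OF assms] by (simp add: ip_commute[of M _ f])

lemma ip_scaleR_right: "ip M f (\<lambda>x. c *\<^sub>R g x) = c * ip M f g"
  by (simp add: ip_def)

lemma ip_sum_right:
  assumes f: "f \<in> L2 M" and G: "\<And>i. i \<in> F \<Longrightarrow> G i \<in> L2 M"
  shows "ip M f (\<lambda>x. \<Sum>i\<in>F. c i *\<^sub>R G i x) = (\<Sum>i\<in>F. c i * ip M f (G i))"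
proof -
  have "ip M f (\<lambda>x. \<Sum>i\<in>F. c i *\<^sub>R G i x) = (\<integral>x. (\<Sum>i\<in>F. c i * (f x \<bullet> G i x)) \<partial>M)"
    by (simp add: ip_def inner_sum_right)
  also have "\<dots> = (\<Sum>i\<in>F. \<integral>x. c i * (f x \<bullet> G i x) \<partial>M)"
    by (rule Bochner_Integration.integral_sum) (intro integrable_mult_right L2_inner_integrable f G)
  finally show ?thesis by (simp add: ip_def)
qed

lemma ip_Cauchy_Schwarz:
  assumes f: "f \<in> L2 M" and g: "g \<in> L2 M"
  shows "\<bar>ip M f g\<bar> \<le> L2_norm M f * L2_norm M g"
proof -
  have quad: "0 \<le> ip M f f - 2 * t * ip M f g + t\<^sup>2 * ip M g g" for t
  proof -
    have tg: "(\<lambda>x. t *\<^sub>R g x) \<in> L2 M" by (rule L2_scaleR[OF g])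
    let ?h = "\<lambda>x. f x - t *\<^sub>R g x"
    have h: "?h \<in> L2 M" by (rule L2_diff[OF f tg])
    have "0 \<le> ip M ?h ?h" by (simp add: ip_def)
    also have "ip M ?h ?h = ip M ?h f - t * ip M ?h g"
      unfolding ip_diff_right[OF h f tg] ip_scaleR_right ..
    also have "ip M ?h f = ip M f f - t * ip M f g"
      unfolding ip_diff_left[OF f f tg] ip_commute[of M "\<lambda>x. t *\<^sub>R g x"] ip_scaleR_right ..
    also have "ip M ?h g = ip M f g - t * ip M g g"
      unfolding ip_diff_left[OF g f tg] ip_commute[of M "\<lambda>x. t *\<^sub>R g x"] ip_scaleR_right ..
    finally show ?thesis
      by (simp add: power2_eq_square algebra_simps)
  qed
  have nn: "0 \<le> ip M g g" "0 \<le> ip M f f" by (simp_all add: ip_def)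
  have "(ip M f g)\<^sup>2 \<le> ip M f f * ip M g g"
  proof (cases "ip M g g = 0")
    case True
    have "ip M f g = 0"
    proof (rule ccontr)
      assume "ip M f g \<noteq> 0"
      \<comment> \<open>With g of norm 0 the quadratic is linear in t, and this t gives it the value
        -1.\<close>
      then show False
        using quad[of "(ip M f f + 1) / (2 * ip M f g)"] True by simp
    qed
    then show ?thesis using True by simp
  next
    case False
    then have "ip M g g > 0" using nn by simp
    then show ?thesis
      using quad[of "ip M f g / ip M g g"] by (simp add: field_simps power2_eq_square)
  qed
  also have "\<dots> = (L2_norm M f * L2_norm M g)\<^sup>2"
    by (simp add: power_mult_distrib L2_norm_sq)
  finally show ?thesis
    by (rule abs_le_square_iff[THEN iffD2, THEN order_trans]) (simp add: L2_norm_nonneg)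
qed

lemma L2_norm_triangle:
  assumes f: "f \<in> L2 M" and g: "g \<in> L2 M"
  shows "L2_norm M (\<lambda>x. f x + g x) \<le> L2_norm M f + L2_norm M g"
proof (rule power2_le_imp_le)
  let ?h = "\<lambda>x. f x + g x"
  have h: "?h \<in> L2 M" by (rule L2_add[OF f g])
  have "(L2_norm M ?h)\<^sup>2 = ip M ?h f + ip M ?h g"
    unfolding L2_norm_sq by (rule ip_add_right[OF h f g])
  also have "\<dots> = ip M f f + 2 * ip M f g + ip M g g"
    using ip_add_right[OF f f g] ip_add_right[OF g f g] by (simp add: ip_commute[of M ?h] ip_commute[of M g f])
  also have "\<dots> \<le> (L2_norm M f + L2_norm M g)\<^sup>2"
    using ip_Cauchy_Schwarz[OF f g] by (simp add: power2_sum L2_norm_sq)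
  finally show "(L2_norm M ?h)\<^sup>2 \<le> (L2_norm M f + L2_norm M g)\<^sup>2" .
qed (simp add: L2_norm_nonneg)

lemma L2_norm_scaleR: "L2_norm M (\<lambda>x. c *\<^sub>R f x) = \<bar>c\<bar> * L2_norm M f"
  by (simp add: L2_norm_def power_mult_distrib real_sqrt_mult)

lemma L2_norm_triangle_diff:
  assumes f: "f \<in> L2 M" and g: "g \<in> L2 M"
  shows "L2_norm M f \<le> L2_norm M (\<lambda>x. f x - g x) + L2_norm M g"
  using L2_norm_triangle[OF L2_diff[OF f g] g] by simp

lemma L2_norm_const:
  assumes "finite_measure M"
  shows "(\<lambda>x. c) \<in> L2 M" "L2_norm M (\<lambda>x. c) = norm c * sqrt (measure M (space M))"
proof -
  interpret finite_measure M by (rule assms)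
  show "(\<lambda>x. c) \<in> L2 M" "L2_norm M (\<lambda>x. c) = norm c * sqrt (measure M (space M))"
    by (simp_all add: L2_def L2_norm_def real_sqrt_mult)
qed

lemma L2_norm_norm: "L2_norm M (\<lambda>x. norm (f x)) = L2_norm M f" "f \<in> L2 M \<Longrightarrow> (\<lambda>x. norm (f x)) \<in> L2 M"
  by (auto simp: L2_def L2_norm_def)

lemma L1_le_L2:
  assumes "finite_measure M" "f \<in> L2 M"
  shows "integrable M f" "(\<integral>x. norm (f x) \<partial>M) \<le> sqrt (measure M (space M)) * L2_norm M f"
proof -
  have 1: "(\<lambda>x. 1::real) \<in> L2 M" by (rule L2_norm_const[OF assms(1)])
  have n: "(\<lambda>x. norm (f x)) \<in> L2 M" by (rule L2_norm_norm(2)[OF assms(2)])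
  have "integrable M (\<lambda>x. norm (f x) \<bullet> (1::real))"
    by (rule L2_inner_integrable[OF n 1])
  then show "integrable M f"
    using integrable_norm_iff[OF L2D(1)[OF assms(2)]] by simp
  have "\<bar>ip M (\<lambda>x. 1::real) (\<lambda>x. norm (f x))\<bar> \<le> L2_norm M (\<lambda>x. 1::real) * L2_norm M (\<lambda>x. norm (f x))"
    by (rule ip_Cauchy_Schwarz[OF 1 n])
  then show "(\<integral>x. norm (f x) \<partial>M) \<le> sqrt (measure M (space M)) * L2_norm M f"
    by (simp add: L2_norm_const[OF assms(1)] L2_norm_norm ip_def)
qed

text \<open>Completing the square: the distance splits into a part that no choice of c can change
  and a defect that vanishes for c = q.\<close>

lemma orthogonal_expansion_dist:
  assumes f: "f \<in> L2 M" and G: "\<And>i. i \<in> F \<Longrightarrow> G i \<in> L2 M"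
    and orth: "\<And>i j. i \<in> F \<Longrightarrow> j \<in> F \<Longrightarrow> ip M (G i) (G j) = (if i = j then w i else 0)"
    and q: "\<And>i. i \<in> F \<Longrightarrow> ip M f (G i) = w i * q i"
    and fin: "finite F"
  shows "(L2_norm M (\<lambda>x. f x - (\<Sum>i\<in>F. c i *\<^sub>R G i x)))\<^sup>2
    = (L2_norm M f)\<^sup>2 - (\<Sum>i\<in>F. w i * (q i)\<^sup>2) + (\<Sum>i\<in>F. w i * (c i - q i)\<^sup>2)"
proof -
  let ?S = "\<lambda>x. \<Sum>i\<in>F. c i *\<^sub>R G i x"
  have S: "?S \<in> L2 M" by (rule L2_sum[OF G])
  have fS: "ip M f ?S = (\<Sum>i\<in>F. c i * (w i * q i))"
    by (subst ip_sum_right[OF f G]) (simp_all add: q)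
  have GS: "ip M ?S (G j) = c j * w j" if "j \<in> F" for j
  proof -
    have "ip M ?S (G j) = (\<Sum>i\<in>F. c i * ip M (G j) (G i))"
      by (subst ip_commute) (rule ip_sum_right[OF G[OF that] G])
    also have "\<dots> = (\<Sum>i\<in>F. if i = j then c j * w j else 0)"
      by (rule sum.cong[OF refl]) (use orth that in auto)
    finally show ?thesis using fin that by simp
  qed
  have SS: "ip M ?S ?S = (\<Sum>i\<in>F. c i * (c i * w i))"
    by (subst ip_sum_right[OF S G]) (simp_all add: GS)
  have "(L2_norm M (\<lambda>x. f x - ?S x))\<^sup>2 = ip M f f - 2 * ip M f ?S + ip M ?S ?S"
    unfolding L2_norm_sq ip_diff_right[OF L2_diff[OF f S] f S] ip_diff_left[OF f f S] ip_diff_left[OF S f S]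
    by (simp add: ip_commute[of M ?S f])
  also have "\<dots> = (L2_norm M f)\<^sup>2 - (\<Sum>i\<in>F. 2 * (c i * (w i * q i)) - c i * (c i * w i))"
    by (simp add: fS SS L2_norm_sq sum_subtractf sum_distrib_left)
  also have "(\<Sum>i\<in>F. 2 * (c i * (w i * q i)) - c i * (c i * w i)) = (\<Sum>i\<in>F. w i * (q i)\<^sup>2 - w i * (c i - q i)\<^sup>2)"
    by (rule sum.cong[OF refl]) (simp add: power2_eq_square algebra_simps)
  finally show ?thesis
    by (simp add: sum_subtractf)
qed

section \<open>Truncation by degree and orthogonal expansions\<close>

definition sh_block :: "nat \<Rightarrow> (nat \<times> int) set" where
  "sh_block N = (SIGMA n:{..<N}. {- int n..int n})"

lemma sh_block: "finite (sh_block N)" "sh_block N \<subseteq> sh_index" "M \<le> N \<Longrightarrow> sh_block M \<subseteq> sh_block N"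
  by (auto simp: sh_block_def sh_index_def)

lemma sum_sh_block: "(\<Sum>i\<in>sh_block N. h i) = (\<Sum>n<N. \<Sum>k=-int n..int n. h (n, k))"
  using sum.Sigma[of "{..<N}" "\<lambda>n. {- int n..int n}" "\<lambda>n k. h (n, k)"]
  by (simp add: sh_block_def)

lemma finite_subset_sh_block:
  assumes "finite F" "F \<subseteq> sh_index"
  obtains N where "F \<subseteq> sh_block N"
proof -
  have "(n, k) \<in> sh_block (Suc (Max (fst ` F)))" if "(n, k) \<in> F" for n k
  proof -
    have "n \<le> Max (fst ` F)" using assms(1) that by (intro Max_ge) (auto simp: image_iff intro!: bexI[of _ "(n, k)"])
    then show ?thesis using assms(2) that by (auto simp: sh_block_def sh_index_def)
  qed
  then show ?thesis using that by (meson subrelI)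
qed

text \<open>Three families share this: the scalar basis with weight 1, the gradients of external
  sources and the fields \<open>Gp\<close> of internal ones. The coefficient is fixed by the product
  \<open>w i * q i\<close> and not by a quotient because a weight may be 0: the external gradient of
  degree 0 vanishes.\<close>

locale orthogonal_expansion =
  fixes M :: "'a measure" and G :: "nat \<times> int \<Rightarrow> 'a \<Rightarrow> 'b::euclidean_space" and w :: "nat \<times> int \<Rightarrow> real"
    and f :: "'a \<Rightarrow> 'b" and q :: "nat \<times> int \<Rightarrow> real"
  assumes f: "f \<in> L2 M" and G: "\<And>i. i \<in> sh_index \<Longrightarrow> G i \<in> L2 M"
    and orth: "\<And>i j. i \<in> sh_index \<Longrightarrow> j \<in> sh_index \<Longrightarrow> ip M (G i) (G j) = (if i = j then w i else 0)"
    and q: "\<And>i. i \<in> sh_index \<Longrightarrow> ip M f (G i) = w i * q i"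
begin

lemma block:
  shows "i \<in> sh_block N \<Longrightarrow> G i \<in> L2 M"
    and "i \<in> sh_block N \<Longrightarrow> j \<in> sh_block N \<Longrightarrow> ip M (G i) (G j) = (if i = j then w i else 0)"
    and "i \<in> sh_block N \<Longrightarrow> ip M f (G i) = w i * q i"
  using G orth q sh_block(2)[of N] by (blast, (meson in_mono)+)

definition part :: "nat \<Rightarrow> 'a \<Rightarrow> 'b" where
  "part N x = (\<Sum>i\<in>sh_block N. q i *\<^sub>R G i x)"

lemma part_L2: "part N \<in> L2 M"
  unfolding part_def[abs_def] using G sh_block(2) by (intro L2_sum) auto

lemma w_nonneg: "i \<in> sh_index \<Longrightarrow> 0 \<le> w i"
proof -
  assume "i \<in> sh_index"
  from orth[OF this this] have "w i = ip M (G i) (G i)" by simp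
  then show ?thesis by (simp add: ip_def)
qed

lemma dist_part:
  "(L2_norm M (\<lambda>x. f x - part N x))\<^sup>2 = (L2_norm M f)\<^sup>2 - (\<Sum>i\<in>sh_block N. w i * (q i)\<^sup>2)"
  unfolding part_def
  by (subst orthogonal_expansion_dist[OF f block sh_block(1)]) simp_all

lemma bessel: "(\<Sum>i\<in>sh_block N. w i * (q i)\<^sup>2) \<le> (L2_norm M f)\<^sup>2"
  using dist_part[of N] zero_le_power2[of "L2_norm M (\<lambda>x. f x - part N x)"] by linarith

lemma part_norm: "(L2_norm M (part N))\<^sup>2 = (\<Sum>i\<in>sh_block N. w i * (q i)\<^sup>2)"
proof -
  have "(L2_norm M (\<lambda>x. (\<lambda>_. 0) x - (\<Sum>i\<in>sh_block N. (- q i) *\<^sub>R G i x)))\<^sup>2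
      = (L2_norm M (\<lambda>_. 0 :: 'b))\<^sup>2 - (\<Sum>i\<in>sh_block N. w i * 0\<^sup>2) + (\<Sum>i\<in>sh_block N. w i * (- q i - 0)\<^sup>2)"
    by (rule orthogonal_expansion_dist[OF L2_zero block(1,2) _ sh_block(1)]) (simp_all add: ip_def)
  moreover have "(\<lambda>x. (\<lambda>_. 0) x - (\<Sum>i\<in>sh_block N. (- q i) *\<^sub>R G i x)) = part N"
    by (simp add: part_def[abs_def] sum_negf)
  moreover have "(L2_norm M (\<lambda>_. 0 :: 'b))\<^sup>2 = 0"
    by (simp add: L2_norm_def)
  ultimately show ?thesis by simp
qed

lemma dist_part_mono: "N \<le> N' \<Longrightarrow> L2_norm M (\<lambda>x. f x - part N' x) \<le> L2_norm M (\<lambda>x. f x - part N x)"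
proof (rule power2_le_imp_le)
  assume "N \<le> N'"
  have "(\<Sum>i\<in>sh_block N. w i * (q i)\<^sup>2) \<le> (\<Sum>i\<in>sh_block N'. w i * (q i)\<^sup>2)"
    by (rule sum_mono2) (use sh_block[of N'] sh_block(3)[OF \<open>N \<le> N'\<close>] w_nonneg in \<open>auto intro!: mult_nonneg_nonneg\<close>)
  then show "(L2_norm M (\<lambda>x. f x - part N' x))\<^sup>2 \<le> (L2_norm M (\<lambda>x. f x - part N x))\<^sup>2"
    unfolding dist_part by simp
qed (rule L2_norm_nonneg)

text \<open>A finite combination from the closed span uses indices of some block, and there the
  partial sum is the best approximation. Enlarging the block does not increase the distance.\<close>

lemma part_tendsto:
  assumes "f \<in> L2_closed_span M sh_index G"
  shows "(\<lambda>N. L2_norm M (\<lambda>x. f x - part N x)) \<longlonglongrightarrow> 0"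
proof (rule LIMSEQ_I)
  fix e :: real assume e: "e > 0"
  have "\<forall>\<epsilon>>0. \<exists>F c. finite F \<and> F \<subseteq> sh_index \<and> L2_norm M (\<lambda>x. f x - (\<Sum>i\<in>F. c i *\<^sub>R G i x)) < \<epsilon>"
    using assms by (simp add: L2_closed_span_def)
  from this[rule_format, OF e] obtain F c
    where F: "finite F" "F \<subseteq> sh_index" "L2_norm M (\<lambda>x. f x - (\<Sum>i\<in>F. c i *\<^sub>R G i x)) < e"
    by (elim exE conjE)
  obtain N where N: "F \<subseteq> sh_block N" using finite_subset_sh_block[OF F(1,2)] .
  define c' where "c' i = (if i \<in> F then c i else 0)" for i
  have eq: "(\<Sum>i\<in>sh_block N. c' i *\<^sub>R G i x) = (\<Sum>i\<in>F. c i *\<^sub>R G i x)" for x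
    by (rule sum.mono_neutral_cong_right) (use N sh_block in \<open>auto simp: c'_def\<close>)
  have "(L2_norm M (\<lambda>x. f x - (\<Sum>i\<in>sh_block N. c' i *\<^sub>R G i x)))\<^sup>2
      = (L2_norm M (\<lambda>x. f x - part N x))\<^sup>2 + (\<Sum>i\<in>sh_block N. w i * (c' i - q i)\<^sup>2)"
    unfolding dist_part
    by (rule orthogonal_expansion_dist[OF f block sh_block(1)])
  moreover have "0 \<le> (\<Sum>i\<in>sh_block N. w i * (c' i - q i)\<^sup>2)"
    by (rule sum_nonneg) (use w_nonneg sh_block(2) in \<open>auto intro!: mult_nonneg_nonneg\<close>)
  ultimately have "(L2_norm M (\<lambda>x. f x - part N x))\<^sup>2 \<le> (L2_norm M (\<lambda>x. f x - (\<Sum>i\<in>F. c i *\<^sub>R G i x)))\<^sup>2"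
    by (simp add: eq)
  then have "L2_norm M (\<lambda>x. f x - part N x) \<le> L2_norm M (\<lambda>x. f x - (\<Sum>i\<in>F. c i *\<^sub>R G i x))"
    by (rule power2_le_imp_le) (rule L2_norm_nonneg)
  then have "L2_norm M (\<lambda>x. f x - part N x) < e"
    using F(3) by linarith
  then have "norm (L2_norm M (\<lambda>x. f x - part N' x) - 0) < e" if "N' \<ge> N" for N'
    using dist_part_mono[OF that] L2_norm_nonneg[of M "\<lambda>x. f x - part N' x"] by simp
  then show "\<exists>N. \<forall>N'\<ge>N. norm (L2_norm M (\<lambda>x. f x - part N' x) - 0) < e" by blast
qed

lemma parseval:
  assumes "f \<in> L2_closed_span M sh_index G"
  shows "(\<lambda>n. \<Sum>k=-int n..int n. w (n, k) * (q (n, k))\<^sup>2) sums (L2_norm M f)\<^sup>2"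
proof -
  have "(\<lambda>N. (L2_norm M f)\<^sup>2 - (L2_norm M (\<lambda>x. f x - part N x))\<^sup>2) \<longlonglongrightarrow> (L2_norm M f)\<^sup>2 - 0\<^sup>2"
    by (intro tendsto_intros part_tendsto[OF assms])
  then show ?thesis
    by (simp add: sums_def dist_part sum_sh_block)
qed

lemma ip_part_tendsto:
  assumes "f \<in> L2_closed_span M sh_index G" "g \<in> L2 M"
  shows "(\<lambda>N. ip M g (part N)) \<longlonglongrightarrow> ip M g f"
proof -
  have "(\<lambda>N. ip M g (part N) - ip M g f) \<longlonglongrightarrow> 0"
  proof (rule Lim_null_comparison)
    have "\<bar>ip M g (part N) - ip M g f\<bar> \<le> L2_norm M g * L2_norm M (\<lambda>x. f x - part N x)" for N
    proof -
      have "ip M g (part N) - ip M g f = - ip M g (\<lambda>x. f x - part N x)"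
        using ip_diff_right[OF assms(2) f part_L2] by simp
      then show ?thesis using ip_Cauchy_Schwarz[OF assms(2) L2_diff[OF f part_L2]] by simp
    qed
    then show "\<forall>\<^sub>F N in sequentially. norm (ip M g (part N) - ip M g f) \<le> L2_norm M g * L2_norm M (\<lambda>x. f x - part N x)"
      by simp
    show "(\<lambda>N. L2_norm M g * L2_norm M (\<lambda>x. f x - part N x)) \<longlonglongrightarrow> 0"
      using tendsto_mult_right_zero[OF part_tendsto[OF assms(1)]] .
  qed
  then show ?thesis by (simp add: LIM_zero_iff)
qed

end

lemma continuous_L2:
  fixes g :: "real^3 \<Rightarrow> 'b::euclidean_space"
  assumes "continuous_on \<S> g"
  shows "g \<in> L2 \<sigma>"
  using continuous_sphere_measurable[OF assms] assms
  by (auto simp: L2_def intro!: continuous_sphere_integrable continuous_intros)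

section \<open>Pairing with the gradient of the Newtonian kernel\<close>

text \<open>The gradient in y of 1 / |w - s y|, as \<open>newton_scaled_derivative\<close>
  confirms.\<close>

definition tker :: "real^3 \<Rightarrow> real \<Rightarrow> real^3 \<Rightarrow> real^3" where
  "tker w s y = (s / norm (w - s *\<^sub>R y) ^ 3) *\<^sub>R (w - s *\<^sub>R y)"

text \<open>Dividing by the area cancels the mass of the Poisson kernel, so that solid harmonics
  produce the coefficients n and n + 1 without further constants.\<close>

definition Top :: "real^3 \<Rightarrow> real \<Rightarrow> (real^3 \<Rightarrow> real^3) \<Rightarrow> real" where
  "Top w s f = ip \<sigma> (tker w s) f / total_area"

lemma tker_continuous:
  assumes "w \<in> \<S>" "0 \<le> s" "s \<noteq> 1"
  shows "continuous_on \<S> (tker w s)"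
  unfolding tker_def
  by (intro continuous_intros kernel_continuous[OF assms])

lemma tker_L2:
  assumes "w \<in> \<S>" "0 \<le> s" "s \<noteq> 1"
  shows "tker w s \<in> L2 \<sigma>"
  by (rule continuous_L2[OF tker_continuous[OF assms]])

lemma newton_scaled_derivative:
  assumes w: "w \<in> \<S>" and y: "y \<in> \<S>" and s: "0 \<le> s" "s \<noteq> 1"
  shows "((\<lambda>y. newton w (s *\<^sub>R y)) has_derivative (\<lambda>v. tker w s y \<bullet> v)) (at y)"
proof -
  have nz: "w \<noteq> s *\<^sub>R y" by (rule dist_sphere_nonzero(1)[OF w y s])
  have sc: "((\<lambda>y. s *\<^sub>R y) has_derivative (\<lambda>v. s *\<^sub>R v)) (at y)"
    by (auto intro!: derivative_eq_intros)
  have "grad (newton w) (s *\<^sub>R y) \<bullet> (s *\<^sub>R v) = tker w s y \<bullet> v" for v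
    unfolding newton_grad(2)[OF nz] sqdist_powr[OF nz] tker_def by simp
  then show ?thesis
    using diff_chain_at[OF sc newton_grad(1)[OF nz]] by (simp add: o_def)
qed

lemma newton_scaled: "w \<in> \<S> \<Longrightarrow> y \<in> \<S> \<Longrightarrow> 0 \<le> s \<Longrightarrow> s \<noteq> 1 \<Longrightarrow> newton w (s *\<^sub>R y) = 1 / norm (w - s *\<^sub>R y)"
  using sqdist_powr(1)[OF dist_sphere_nonzero(1)] unfolding newton_def by blast

lemma integral_radial_tker:
  assumes P: "solid_harmonic n P" and w: "w \<in> \<S>" and s: "0 \<le> s" "s \<noteq> 1"
  shows "(\<integral>y. (y \<bullet> tker w s y) * P y \<partial>\<sigma>) = ((1 - s\<^sup>2) * I3 P w s - I1 P w s) / 2"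
proof -
  have cP: "continuous_on \<S> P" by (rule solid_harmonicD[OF P])
  note int = kernel_integrable[OF w s cP]
  have "(\<integral>y. (y \<bullet> tker w s y) * P y \<partial>\<sigma>)
      = (\<integral>y. ((1 - s\<^sup>2) / 2) * (P y / norm (w - s *\<^sub>R y) ^ 3) - (1 / 2) * (P y / norm (w - s *\<^sub>R y)) \<partial>\<sigma>)"
  proof (intro Bochner_Integration.integral_cong refl)
    fix y assume "y \<in> space \<sigma>"
    then have y: "y \<in> \<S>" by simp
    define d where "d = norm (w - s *\<^sub>R y)"
    have d: "d > 0" using dist_sphere_nonzero(2)[OF w y s] by (simp add: d_def)
    have "y \<bullet> y = 1" using y by (simp add: dot_square_norm)
    then have "y \<bullet> (w - s *\<^sub>R y) = w \<bullet> y - s"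
      by (simp add: inner_diff_right inner_commute)
    moreover have "2 * s * (w \<bullet> y - s) = (1 - s\<^sup>2) - d\<^sup>2"
      unfolding d_def sqdist_sphere[OF w y] by (simp add: algebra_simps power2_eq_square)
    ultimately have "s * (y \<bullet> (w - s *\<^sub>R y)) = ((1 - s\<^sup>2) - d\<^sup>2) / 2" by simp
    moreover have "(y \<bullet> tker w s y) * P y = (s * (y \<bullet> (w - s *\<^sub>R y))) * P y / d ^ 3"
      by (simp add: tker_def d_def)
    ultimately have "(y \<bullet> tker w s y) * P y = (((1 - s\<^sup>2) - d\<^sup>2) / 2) * P y / d ^ 3"
      by (simp only:)
    also have "\<dots> = ((1 - s\<^sup>2) / 2) * (P y / d ^ 3) - (1 / 2) * (P y / d)"
      using d by (simp add: field_simps power2_eq_square power3_eq_cube)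
    finally show "(y \<bullet> tker w s y) * P y
        = ((1 - s\<^sup>2) / 2) * (P y / norm (w - s *\<^sub>R y) ^ 3) - (1 / 2) * (P y / norm (w - s *\<^sub>R y))"
      by (simp add: d_def)
  qed
  also have "\<dots> = ((1 - s\<^sup>2) / 2) * I3 P w s - (1 / 2) * I1 P w s"
    unfolding I1_def I3_def
    by (simp only: Bochner_Integration.integral_diff[OF integrable_mult_right[OF int(1)] integrable_mult_right[OF int(2)]]
        integral_mult_right_zero)
  finally show ?thesis by (simp add: field_simps)
qed

text \<open>\<open>integral_inner_grad_solid\<close> with the kernel in the role of f: the pairing
  with a gradient becomes a combination of the two explicit integrals.\<close>

lemma integral_tker_grad:
  assumes P: "solid_harmonic n P" and w: "w \<in> \<S>" and s: "0 \<le> s" "s \<noteq> 1"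
  shows "ip \<sigma> (tker w s) (grad P)
    = real n * (((1 - s\<^sup>2) * I3 P w s - I1 P w s) / 2) + real n * (real n + 1) * I1 P w s"
proof -
  have "ip \<sigma> (tker w s) (grad P) = real n * (\<integral>y. (y \<bullet> tker w s y) * P y \<partial>\<sigma>)
      + real n * (real n + 1) * (\<integral>y. newton w (s *\<^sub>R y) * P y \<partial>\<sigma>)"
    unfolding ip_def
    by (rule integral_inner_grad_solid[OF P newton_scaled_derivative[OF w _ s] tker_continuous[OF w s]])
  also have "(\<integral>y. newton w (s *\<^sub>R y) * P y \<partial>\<sigma>) = I1 P w s"
    unfolding I1_def
    by (intro Bochner_Integration.integral_cong refl) (simp add: newton_scaled[OF w _ s])
  finally show ?thesis
    by (simp only: integral_radial_tker[OF P w s])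
qed

text \<open>Here Y stands for \<open>I1\<close>. The term (1 - s^2) \<open>I3\<close> equals (2 n +
  1) Y for s < 1 and its negative for s > 1; this change of sign is what makes a gradient visible on
  one side of s = 1 and invisible on the other.\<close>

lemma degree_algebra:
  fixes n Y :: real
  shows "n * (((2 * n + 1) * Y - Y) / 2) + n * (n + 1) * Y = n * ((2 * n + 1) * Y)"
    and "n * ((- ((2 * n + 1) * Y) - Y) / 2) + n * (n + 1) * Y = 0"
  by (simp_all add: field_simps)

lemma I_inside:
  assumes P: "solid_harmonic n P" and w: "w \<in> \<S>" and s: "0 < s" "s < 1"
  defines "Y \<equiv> total_area * P w * s ^ n / (2 * real n + 1)"
  shows "I1 P w s = Y" "(1 - s\<^sup>2) * I3 P w s = (2 * real n + 1) * Y"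
    "(2 * real n + 1) * Y = total_area * P w * s ^ n"
proof -
  have nz: "2 * real n + 1 > 0" by (simp add: add_nonneg_pos)
  then show "(2 * real n + 1) * Y = total_area * P w * s ^ n" by (simp add: Y_def)
  then show "I1 P w s = Y" "(1 - s\<^sup>2) * I3 P w s = (2 * real n + 1) * Y"
    using I1_I3_inside[OF P w s] by (simp_all add: Y_def)
qed

lemma I_outside:
  assumes P: "solid_harmonic n P" and w: "w \<in> \<S>" and s: "1 < s"
  defines "Y \<equiv> total_area * P w / s ^ (n + 1) / (2 * real n + 1)"
  shows "I1 P w s = Y" "(1 - s\<^sup>2) * I3 P w s = - ((2 * real n + 1) * Y)"
    "(2 * real n + 1) * Y = total_area * P w / s ^ (n + 1)"
proof -
  have nz: "2 * real n + 1 > 0" by (simp add: add_nonneg_pos)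
  then show Y: "(2 * real n + 1) * Y = total_area * P w / s ^ (n + 1)" by (simp add: Y_def)
  show "I1 P w s = Y" using I1_I3_outside(1)[OF P w s] by (simp add: Y_def)
  have "(1 - s\<^sup>2) * I3 P w s = - ((s\<^sup>2 - 1) * I3 P w s)" by (simp add: algebra_simps)
  then show "(1 - s\<^sup>2) * I3 P w s = - ((2 * real n + 1) * Y)"
    unfolding Y I1_I3_outside(2)[OF P w s] .
qed

lemma Top_grad_inside:
  assumes P: "solid_harmonic n P" and w: "w \<in> \<S>" and s: "0 < s" "s < 1"
  shows "Top w s (grad P) = real n * P w * s ^ n"
proof -
  have s': "0 \<le> s" "s \<noteq> 1" using s by auto
  show ?thesis
    unfolding Top_def integral_tker_grad[OF P w s'] I_inside(1,2)[OF P w s] degree_algebra(1)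
    unfolding I_inside(3)[OF P w s] using total_area_pos by simp
qed

lemma Top_grad_outside:
  assumes P: "solid_harmonic n P" and w: "w \<in> \<S>" and s: "1 < s"
  shows "Top w s (grad P) = 0"
proof -
  have s': "0 \<le> s" "s \<noteq> 1" using s by auto
  show ?thesis
    unfolding Top_def integral_tker_grad[OF P w s'] I_outside(1,2)[OF P w s] degree_algebra(2) by simp
qed

text \<open>Agrees on the unit sphere with \<open>G_int\<close>, since \<open>grad P\<close> is there the surface gradient plus
  \<open>(real n * P x) *\<^sub>R x\<close>.\<close>

definition Gp :: "nat \<Rightarrow> (real^3 \<Rightarrow> real) \<Rightarrow> real^3 \<Rightarrow> real^3" where
  "Gp n P x = grad P x - ((2 * real n + 1) * P x) *\<^sub>R x"

lemma Gp_L2: "solid_harmonic n P \<Longrightarrow> Gp n P \<in> L2 \<sigma>"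
  unfolding Gp_def[abs_def]
  by (intro continuous_L2 continuous_intros solid_harmonicD)

lemma ip_Gp:
  assumes f: "f \<in> L2 \<sigma>" and P: "solid_harmonic n P"
  shows "ip \<sigma> f (Gp n P) = ip \<sigma> f (grad P) - (2 * real n + 1) * (\<integral>y. (y \<bullet> f y) * P y \<partial>\<sigma>)"
proof -
  have 1: "grad P \<in> L2 \<sigma>" "(\<lambda>y. P y *\<^sub>R y) \<in> L2 \<sigma>"
    by (intro continuous_L2 continuous_intros solid_harmonicD[OF P])+
  have "ip \<sigma> f (Gp n P) = ip \<sigma> f (grad P) - ip \<sigma> f (\<lambda>y. (2 * real n + 1) *\<^sub>R (P y *\<^sub>R y))"
    using ip_diff_right[OF f 1(1) L2_scaleR[OF 1(2)], of "2 * real n + 1"]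
    by (simp add: Gp_def[abs_def])
  also have "ip \<sigma> f (\<lambda>y. (2 * real n + 1) *\<^sub>R (P y *\<^sub>R y)) = (2 * real n + 1) * ip \<sigma> f (\<lambda>y. P y *\<^sub>R y)"
    by (rule ip_scaleR_right)
  also have "ip \<sigma> f (\<lambda>y. P y *\<^sub>R y) = (\<integral>y. (y \<bullet> f y) * P y \<partial>\<sigma>)"
    by (simp add: ip_def inner_commute mult.commute)
  finally show ?thesis .
qed

lemma Top_Gp_inside:
  assumes P: "solid_harmonic n P" and w: "w \<in> \<S>" and s: "0 < s" "s < 1"
  shows "Top w s (Gp n P) = 0"
proof -
  have s': "0 \<le> s" "s \<noteq> 1" using s by auto
  have alg: "n * (c * Y) - c * ((c * Y - Y) / 2) = 0" if "c = 2 * n + 1" for n c Y :: real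
    using that by (simp add: field_simps)
  show ?thesis
    unfolding Top_def ip_Gp[OF tker_L2[OF w s'] P] integral_tker_grad[OF P w s'] integral_radial_tker[OF P w s']
      I_inside(1,2)[OF P w s] degree_algebra(1) alg[OF refl] by simp
qed

lemma Top_Gp_outside:
  assumes P: "solid_harmonic n P" and w: "w \<in> \<S>" and s: "1 < s"
  shows "Top w s (Gp n P) = (real n + 1) * P w / s ^ (n + 1)"
proof -
  have s': "0 \<le> s" "s \<noteq> 1" using s by auto
  have alg: "0 - c * ((- (c * Y) - Y) / 2) = (n + 1) * (c * Y)" if "c = 2 * n + 1" for n c Y :: real
    using that by (simp add: field_simps)
  show ?thesis
    unfolding Top_def ip_Gp[OF tker_L2[OF w s'] P] integral_tker_grad[OF P w s'] integral_radial_tker[OF P w s']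
      I_outside(1,2)[OF P w s] degree_algebra(2) alg[OF refl]
    unfolding I_outside(3)[OF P w s] using total_area_pos by simp
qed

lemma Top_bound:
  assumes "w \<in> \<S>" "0 \<le> s" "s \<noteq> 1" "f \<in> L2 \<sigma>"
  shows "\<bar>Top w s f\<bar> \<le> (L2_norm \<sigma> (tker w s) / total_area) * L2_norm \<sigma> f"
  using ip_Cauchy_Schwarz[OF tker_L2[OF assms(1-3)] assms(4)] total_area_pos
  by (simp add: Top_def divide_right_mono)

lemma Top_tendsto:
  assumes w: "w \<in> \<S>" "0 \<le> s" "s \<noteq> 1" and f: "f \<in> L2 \<sigma>" "\<And>N. g N \<in> L2 \<sigma>"
    and lim: "(\<lambda>N. L2_norm \<sigma> (\<lambda>x. f x - g N x)) \<longlonglongrightarrow> 0"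
  shows "(\<lambda>N. Top w s (g N)) \<longlonglongrightarrow> Top w s f"
proof -
  let ?C = "L2_norm \<sigma> (tker w s) / total_area"
  have "(\<lambda>N. Top w s (g N) - Top w s f) \<longlonglongrightarrow> 0"
  proof (rule Lim_null_comparison)
    have "\<bar>Top w s (g N) - Top w s f\<bar> \<le> ?C * L2_norm \<sigma> (\<lambda>x. f x - g N x)" for N
    proof -
      have "Top w s (g N) - Top w s f = - Top w s (\<lambda>x. f x - g N x)"
        by (simp add: Top_def ip_diff_right[OF tker_L2[OF w] f(1) f(2)] diff_divide_distrib)
      then show ?thesis using Top_bound[OF w L2_diff[OF f(1) f(2)]] by simp
    qed
    then show "\<forall>\<^sub>F N in sequentially. norm (Top w s (g N) - Top w s f) \<le> ?C * L2_norm \<sigma> (\<lambda>x. f x - g N x)"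
      by simp
    show "(\<lambda>N. ?C * L2_norm \<sigma> (\<lambda>x. f x - g N x)) \<longlonglongrightarrow> 0"
      using tendsto_mult_right_zero[OF lim] .
  qed
  then show ?thesis by (simp add: LIM_zero_iff)
qed

lemma Top_sum:
  assumes w: "w \<in> \<S>" "0 \<le> s" "s \<noteq> 1" and G: "\<And>i. i \<in> F \<Longrightarrow> G i \<in> L2 \<sigma>"
  shows "Top w s (\<lambda>x. \<Sum>i\<in>F. c i *\<^sub>R G i x) = (\<Sum>i\<in>F. c i * Top w s (G i))"
  by (simp add: Top_def ip_sum_right[OF tker_L2[OF w] G] sum_divide_distrib)

section \<open>Partial derivatives of polynomials and of solid harmonics\<close>

definition pd :: "3 \<Rightarrow> (real^3 \<Rightarrow> real) \<Rightarrow> real^3 \<Rightarrow> real" where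
  "pd i f x = grad f x $ i"

lemma grad_add:
  assumes "f differentiable (at x)" "g differentiable (at x)"
  shows "grad (\<lambda>x. f x + g x) x = grad f x + grad g x"
  using has_derivative_add[OF assms[THEN grad_has_derivative]]
  by (intro grad_eqI) (simp add: inner_add_left)

lemma grad_mult:
  assumes "f differentiable (at x)" "g differentiable (at x)"
  shows "grad (\<lambda>x. f x * g x) x = f x *\<^sub>R grad g x + g x *\<^sub>R grad f x"
  using has_derivative_mult[OF assms[THEN grad_has_derivative]]
  by (intro grad_eqI) (simp add: inner_add_left mult.commute)

lemma grad_linear: "bounded_linear f \<Longrightarrow> grad f x = (\<chi> i. f (axis i 1))"
  using frechet_derivative_at[OF bounded_linear_imp_has_derivative[of f "at x"]] by (simp add: grad_def)

lemma grad_const: "grad (\<lambda>_. c) x = 0"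
  by (rule grad_eqI) simp

lemma pd_polynomial:
  assumes "real_polynomial_function f"
  shows "real_polynomial_function (pd i f)"
  using assms
proof induction
  case (linear f)
  then show ?case
    by (simp add: pd_def[abs_def] grad_linear real_polynomial_function.intros(2))
next
  case (const c)
  show ?case by (simp add: pd_def[abs_def] grad_const real_polynomial_function.intros(2))
next
  case (add f g)
  then show ?case
    by (simp add: pd_def[abs_def] grad_add differentiable_at_real_polynomial_function real_polynomial_function.intros(3))
next
  case (mult f g)
  have "pd i (\<lambda>x. f x * g x) = (\<lambda>x. f x * pd i g x + g x * pd i f x)"
    by (simp add: pd_def[abs_def] grad_mult differentiable_at_real_polynomial_function mult.hyps)
  then show ?case
    using mult by (simp add: real_polynomial_function.intros(3) real_polynomial_function.intros(4))
qed

lemma pd_rules: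
  assumes "real_polynomial_function f" "real_polynomial_function g"
  shows "pd i (\<lambda>x. f x + g x) = (\<lambda>x. pd i f x + pd i g x)"
    and "pd i (\<lambda>x. f x * g x) = (\<lambda>x. f x * pd i g x + g x * pd i f x)"
  using assms
  by (simp_all add: pd_def[abs_def] grad_add grad_mult differentiable_at_real_polynomial_function)

lemma pd_commute:
  assumes "real_polynomial_function f"
  shows "pd i (pd j f) = pd j (pd i f)"
  using assms
proof induction
  case (linear f)
  show ?case
    by (simp add: pd_def[abs_def] grad_linear linear grad_const)
next
  case (const c)
  show ?case by (simp add: pd_def[abs_def] grad_const)
next
  case (add f g)
  then show ?case by (simp add: pd_rules pd_polynomial)
next
  case (mult f g)
  note pp = mult.hyps pd_polynomial[OF mult.hyps(1)] pd_polynomial[OF mult.hyps(2)]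
    real_polynomial_function.intros(4)
  show ?case
    using mult.IH by (simp add: pd_rules pp fun_eq_iff algebra_simps)
qed

lemma laplacian_pd: "laplacian u x = (\<Sum>i\<in>UNIV. pd i (pd i u) x)"
  by (simp add: laplacian_def pd_def[abs_def])

lemma polynomial_C2:
  assumes "real_polynomial_function f"
  shows "C2_on UNIV f"
  unfolding C2_on_def
proof (intro conjI ballI allI)
  show "f differentiable (at x)" for x
    using assms by (rule differentiable_at_real_polynomial_function)
  show "(\<lambda>y. grad f y $ i) differentiable (at x)" for i x
    using differentiable_at_real_polynomial_function[OF pd_polynomial[OF assms]] by (simp add: pd_def[abs_def])
  show "continuous_on UNIV (grad (\<lambda>y. grad f y $ i))" for i
  proof -
    have "continuous_on UNIV (\<lambda>x. pd j (pd i f) x)" for j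
      by (intro continuous_at_imp_continuous_on ballI continuous_real_polymonial_function pd_polynomial assms)
    then have "continuous_on UNIV (\<lambda>x. \<chi> j. pd j (pd i f) x)"
      by (rule continuous_on_vec_lambda)
    moreover have "(\<chi> j. pd j (pd i f) x) = grad (\<lambda>y. grad f y $ i) x" for x
      by (simp add: pd_def[abs_def])
    ultimately show ?thesis by simp
  qed
qed

lemma solid_harmonicI:
  assumes "real_polynomial_function P" "\<And>c x. P (c *\<^sub>R x) = c ^ n * P x" "\<And>x. laplacian P x = 0"
  shows "solid_harmonic n P"
  using assms polynomial_C2[OF assms(1)] by (simp add: solid_harmonic_def harmonic_on_iff)

lemma solid_harmonic_pd:
  assumes "solid_harmonic (Suc n) P"
  shows "solid_harmonic n (pd i P)"
proof (rule solid_harmonicI)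
  note D = solid_harmonicD[OF assms]
  show "real_polynomial_function (pd i P)" by (rule pd_polynomial[OF D(1)])
  show "pd i P (c *\<^sub>R x) = c ^ n * pd i P x" for c x
  proof -
    have ne: "pd i P (c *\<^sub>R x) = c ^ n * pd i P x" if "c \<noteq> 0" for c
    proof -
      have "grad (\<lambda>x. P (c *\<^sub>R x)) x = c *\<^sub>R grad P (c *\<^sub>R x)"
        by (rule C2_scale(1)[OF D(4) open_UNIV]) auto
      moreover have "grad (\<lambda>x. P (c *\<^sub>R x)) x = c ^ Suc n *\<^sub>R grad P x"
        unfolding D(2)
        by (rule grad_eqI) (use has_derivative_mult_right[OF D(6)] in auto)
      ultimately have "c *\<^sub>R grad P (c *\<^sub>R x) = c *\<^sub>R (c ^ n *\<^sub>R grad P x)"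
        by simp
      then have "grad P (c *\<^sub>R x) = c ^ n *\<^sub>R grad P x"
        using that by (metis scaleR_left_imp_eq)
      then show ?thesis by (simp add: pd_def)
    qed
    \<comment> \<open>For c = 0 the factor c cannot be cancelled, so this case is reached from c
      different from 0 by continuity.\<close>
    have cont: "continuous_on UNIV (\<lambda>c. pd i P (c *\<^sub>R x) - c ^ n * pd i P x)"
      unfolding pd_def
      by (intro continuous_intros continuous_on_compose2[OF D(7)[of UNIV]]) auto
    have "((\<lambda>c. pd i P (c *\<^sub>R x) - c ^ n * pd i P x) \<longlongrightarrow> pd i P (0 *\<^sub>R x) - 0 ^ n * pd i P x) (at 0)"
      using cont unfolding continuous_on_eq_continuous_at[OF open_UNIV] isCont_def by blast
    moreover have "((\<lambda>c. pd i P (c *\<^sub>R x) - c ^ n * pd i P x) \<longlongrightarrow> 0) (at 0)"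
      by (rule tendsto_eventually) (auto simp: eventually_at_filter ne)
    ultimately have "pd i P (0 *\<^sub>R x) - 0 ^ n * pd i P x = 0"
      using tendsto_unique[OF trivial_limit_at] by blast
    then show ?thesis using ne by (cases "c = 0") auto
  qed
  show "laplacian (pd i P) x = 0" for x
  proof -
    have z: "pd i (\<lambda>x. 0) x = 0" for x
      by (simp add: pd_def grad_const)
    have p: "real_polynomial_function (pd j (pd j P))" for j
      by (intro pd_polynomial D(1))
    have "laplacian (pd i P) x = (\<Sum>j\<in>UNIV. pd i (pd j (pd j P)) x)"
      unfolding laplacian_pd
      by (intro sum.cong refl) (metis pd_commute pd_polynomial D(1))
    also have "\<dots> = pd i (\<lambda>x. pd 1 (pd 1 P) x + (pd 2 (pd 2 P) x + pd 3 (pd 3 P) x)) x"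
      by (simp add: sum_3 pd_rules p real_polynomial_function.intros(3))
    also have "(\<lambda>x. pd 1 (pd 1 P) x + (pd 2 (pd 2 P) x + pd 3 (pd 3 P) x)) = laplacian P"
      by (simp add: laplacian_pd fun_eq_iff sum_3)
    also have "laplacian P = (\<lambda>x. 0)"
      using D(3) by (simp add: harmonic_on_iff fun_eq_iff)
    finally show ?thesis by (simp add: z)
  qed
qed

lemma solid_harmonic_coord: "solid_harmonic 1 (\<lambda>x. x $ i)" "grad (\<lambda>x. x $ i) x = axis i 1"
proof -
  have bl: "bounded_linear (\<lambda>x::real^3. x $ i)" by (rule bounded_linear_vec_nth)
  show g: "grad (\<lambda>x. x $ i) x = axis i 1" for x
    by (simp add: grad_linear[OF bl]) (simp add: vec_eq_iff axis_def)
  have z: "pd j (\<lambda>x. c) x = 0" for j c x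
    by (simp add: pd_def grad_const)
  show "solid_harmonic 1 (\<lambda>x. x $ i)"
  proof (rule solid_harmonicI)
    show "real_polynomial_function (\<lambda>x::real^3. x $ i)"
      using bl by (rule real_polynomial_function.intros(1))
    show "laplacian (\<lambda>x. x $ i) x = 0" for x
    proof -
      have "pd j (\<lambda>x. x $ i) = (\<lambda>x. axis i 1 $ j)" for j
        by (simp add: pd_def[abs_def] g)
      then show ?thesis by (simp add: laplacian_pd z)
    qed
  qed auto
qed

text \<open>The i-th coordinate is a solid harmonic of degree 1 with constant gradient. Apply
  \<open>integral_inner_grad_solid\<close> to the product of P and Q against it, and evaluate the
  radial derivative by Euler's relation.\<close>

lemma integral_pd_product:
  assumes P: "solid_harmonic n P" and Q: "solid_harmonic m Q"
  shows "(\<integral>x. pd i P x * Q x \<partial>\<sigma>) + (\<integral>x. P x * pd i Q x \<partial>\<sigma>) = (real n + real m + 2) * (\<integral>x. x $ i * P x * Q x \<partial>\<sigma>)"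
proof -
  note DP = solid_harmonicD[OF P] and DQ = solid_harmonicD[OF Q]
  define F where "F x = P x *\<^sub>R grad Q x + Q x *\<^sub>R grad P x" for x
  have der: "((\<lambda>x. P x * Q x) has_derivative (\<lambda>v. F x \<bullet> v)) (at x)" for x
    using has_derivative_mult[OF DP(6) DQ(6)] by (rule has_derivative_eq_rhs) (auto simp: F_def inner_add_left)
  have cF: "continuous_on \<S> F"
    unfolding F_def by (intro continuous_intros DP DQ)
  have "(\<integral>x. F x \<bullet> grad (\<lambda>x. x $ i) x \<partial>\<sigma>)
      = real 1 * (\<integral>x. (x \<bullet> F x) * x $ i \<partial>\<sigma>) + real 1 * (real 1 + 1) * (\<integral>x. (P x * Q x) * x $ i \<partial>\<sigma>)"
    by (rule integral_inner_grad_solid[OF solid_harmonic_coord(1) der cF])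
  moreover have "(\<integral>x. (x \<bullet> F x) * x $ i \<partial>\<sigma>) = (real n + real m) * (\<integral>x. x $ i * P x * Q x \<partial>\<sigma>)"
  proof -
    have "(x \<bullet> F x) * x $ i = (real n + real m) * (x $ i * P x * Q x)" for x
      by (simp add: F_def inner_add_right solid_harmonic_euler[OF P] solid_harmonic_euler[OF Q] algebra_simps)
    then show ?thesis by (simp only: integral_mult_right_zero)
  qed
  moreover have "(\<integral>x. (P x * Q x) * x $ i \<partial>\<sigma>) = (\<integral>x. x $ i * P x * Q x \<partial>\<sigma>)"
    by (simp add: mult_ac)
  moreover have "(\<integral>x. F x \<bullet> grad (\<lambda>x. x $ i) x \<partial>\<sigma>) = (\<integral>x. pd i P x * Q x \<partial>\<sigma>) + (\<integral>x. P x * pd i Q x \<partial>\<sigma>)"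
  proof -
    have "continuous_on \<S> (pd i P)" "continuous_on \<S> (pd i Q)"
      unfolding pd_def by (intro continuous_intros DP DQ)+
    note c = this
    have "integrable \<sigma> (\<lambda>x. pd i P x * Q x)" "integrable \<sigma> (\<lambda>x. P x * pd i Q x)"
      by (rule continuous_sphere_integrable[OF continuous_on_mult[OF c(1) DQ(5)]],
          rule continuous_sphere_integrable[OF continuous_on_mult[OF DP(5) c(2)]])
    then show ?thesis
      by (subst Bochner_Integration.integral_add[symmetric])
         (simp_all add: F_def solid_harmonic_coord(2) inner_axis pd_def mult.commute add.commute)
  qed
  ultimately show ?thesis by (simp add: algebra_simps)
qed

lemma pd_orthogonal:
  assumes P: "solid_harmonic n P" and Q: "solid_harmonic m Q" and "n \<noteq> Suc m"
  shows "(\<integral>x. pd i P x * Q x \<partial>\<sigma>) = 0"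
proof (cases n)
  case 0
  have "grad P x = 0" for x
  proof (rule grad_eqI)
    \<comment> \<open>Homogeneity of degree 0 at c = 0 reads P 0 = 0^0 P x, and 0^0 = 1.\<close>
    have "P x = P 0" for x
      using solid_harmonicD(2)[OF P, of 0 x] by (simp add: 0)
    then obtain c where c: "P = (\<lambda>_. c)" by blast
    show "(P has_derivative (\<lambda>v. 0 \<bullet> v)) (at x)"
      unfolding c by simp
  qed
  then show ?thesis by (simp add: pd_def)
next
  case (Suc k)
  then show ?thesis
    using solid_harmonic_orthogonal[OF solid_harmonic_pd Q] P assms(3) by blast
qed

text \<open>The reason: on the unit sphere the components of \<open>Gp n P\<close> are spherical harmonics of degree \<open>n + 1\<close>.\<close>

lemma Gp_component_orthogonal:
  assumes P: "solid_harmonic n P" and Q: "solid_harmonic m Q" and "m \<noteq> Suc n"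
  shows "(\<integral>x. Gp n P x $ i * Q x \<partial>\<sigma>) = 0"
proof -
  note DP = solid_harmonicD[OF P] and DQ = solid_harmonicD[OF Q]
  have "integrable \<sigma> (\<lambda>x. pd i P x * Q x)" "integrable \<sigma> (\<lambda>x. (2 * real n + 1) * (x $ i * P x * Q x))"
    unfolding pd_def by (intro continuous_sphere_integrable continuous_intros DP DQ)+
  moreover have "Gp n P x $ i * Q x = pd i P x * Q x - (2 * real n + 1) * (x $ i * P x * Q x)" for x
    by (simp add: Gp_def pd_def algebra_simps)
  ultimately have "(\<integral>x. Gp n P x $ i * Q x \<partial>\<sigma>) = (\<integral>x. pd i P x * Q x \<partial>\<sigma>) - (2 * real n + 1) * (\<integral>x. x $ i * P x * Q x \<partial>\<sigma>)"
    by (simp only: Bochner_Integration.integral_diff integral_mult_right_zero)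
  moreover have PQ: "(\<integral>x. P x * pd i Q x \<partial>\<sigma>) = 0"
    using pd_orthogonal[OF Q P assms(3)] by (simp add: mult.commute)
  moreover have "(\<integral>x. pd i P x * Q x \<partial>\<sigma>) = (2 * real n + 1) * (\<integral>x. x $ i * P x * Q x \<partial>\<sigma>)"
  proof (cases "n = Suc m")
    case True
    then show ?thesis using integral_pd_product[OF P Q, of i] PQ by simp
  next
    case False
    then have "(\<integral>x. pd i P x * Q x \<partial>\<sigma>) = 0" by (rule pd_orthogonal[OF P Q])
    moreover from this have "(real n + real m + 2) * (\<integral>x. x $ i * P x * Q x \<partial>\<sigma>) = 0"
      using integral_pd_product[OF P Q, of i] PQ by simp
    then have "(\<integral>x. x $ i * P x * Q x \<partial>\<sigma>) = 0"
      by (simp add: add_nonneg_eq_0_iff)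
    ultimately show ?thesis by simp
  qed
  ultimately show ?thesis by simp
qed

section \<open>Expansions of Hardy fields\<close>

lemma solid_harmonic_zero: "solid_harmonic n (\<lambda>_. 0)"
  by (rule solid_harmonicI) (auto simp: laplacian_pd pd_def[abs_def] grad_const intro: real_polynomial_function.intros)

lemma solid_harmonic_laplacian: "solid_harmonic n P \<Longrightarrow> laplacian P x = 0"
  by (simp add: solid_harmonic_def harmonic_on_iff)

lemma solid_harmonic_add:
  assumes P: "solid_harmonic n P" and Q: "solid_harmonic n Q"
  shows "solid_harmonic n (\<lambda>x. P x + Q x)"
proof (rule solid_harmonicI)
  note DP = solid_harmonicD[OF P] and DQ = solid_harmonicD[OF Q]
  show "real_polynomial_function (\<lambda>x. P x + Q x)"
    using DP(1) DQ(1) by (rule real_polynomial_function.intros)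
  show "P (c *\<^sub>R x) + Q (c *\<^sub>R x) = c ^ n * (P x + Q x)" for c x
    unfolding DP(2) DQ(2) by (simp add: distrib_left)
  have "laplacian (\<lambda>x. P x + Q x) x = laplacian P x + laplacian Q x" for x
    by (simp add: laplacian_pd pd_rules(1) DP(1) DQ(1) pd_polynomial sum.distrib)
  then show "laplacian (\<lambda>x. P x + Q x) x = 0" for x
    by (simp add: solid_harmonic_laplacian[OF P] solid_harmonic_laplacian[OF Q])
qed

lemma solid_harmonic_cmul:
  assumes P: "solid_harmonic n P"
  shows "solid_harmonic n (\<lambda>x. c * P x)"
proof (rule solid_harmonicI)
  note DP = solid_harmonicD[OF P]
  note const = real_polynomial_function.intros(2)[where c=c]
  show "real_polynomial_function (\<lambda>x. c * P x)"
    by (intro real_polynomial_function.intros DP(1))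
  show "c * P (d *\<^sub>R x) = d ^ n * (c * P x)" for d x
    unfolding DP(2) by simp
  have pdc: "pd i (\<lambda>x. c * f x) = (\<lambda>x. c * pd i f x)" if "real_polynomial_function f" for i f
    unfolding pd_rules(2)[OF const that] by (simp add: pd_def grad_const)
  have "laplacian (\<lambda>x. c * P x) x = c * laplacian P x" for x
    by (simp add: laplacian_pd pdc DP(1) pd_polynomial sum_distrib_left)
  then show "laplacian (\<lambda>x. c * P x) x = 0" for x
    by (simp add: solid_harmonic_laplacian[OF P])
qed

lemma solid_harmonic_sum:
  assumes "\<And>i. i \<in> F \<Longrightarrow> solid_harmonic n (P i)"
  shows "solid_harmonic n (\<lambda>x. \<Sum>i\<in>F. c i * P i x)"
  using assms
proof (induction F rule: infinite_finite_induct)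
  case (insert j F)
  have "solid_harmonic n (\<lambda>x. c j * P j x + (\<Sum>i\<in>F. c i * P i x))"
    by (rule solid_harmonic_add[OF solid_harmonic_cmul]) (use insert in auto)
  then show ?case using insert.hyps by simp
qed (simp_all add: solid_harmonic_zero)

lemma integral_vec_component:
  fixes f :: "'a \<Rightarrow> real^3"
  assumes "integrable M f"
  shows "(\<integral>x. f x \<partial>M) $ i = (\<integral>x. f x $ i \<partial>M)"
  using integral_bounded_linear[OF bounded_linear_vec_nth assms, of i] by simp

lemma norm_sq_vec:
  fixes v :: "real^3"
  shows "(norm v)\<^sup>2 = (\<Sum>i\<in>UNIV. (v $ i)\<^sup>2)"
  unfolding power2_norm_eq_inner inner_vec_def by (simp add: power2_eq_square)

lemma L2_component:
  fixes g :: "'a \<Rightarrow> real^3"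
  assumes "g \<in> L2 M"
  shows "(\<lambda>x. g x $ i) \<in> L2 M" "(L2_norm M g)\<^sup>2 = (\<Sum>i\<in>UNIV. (L2_norm M (\<lambda>x. g x $ i))\<^sup>2)"
proof -
  show c: "(\<lambda>x. g x $ i) \<in> L2 M" for i
  proof -
    have m: "(\<lambda>x. g x $ i) \<in> borel_measurable M"
      using L2D(1)[OF assms] by (simp add: cart_eq_inner_axis)
    have "integrable M (\<lambda>x. (g x $ i)\<^sup>2)"
    proof (rule Bochner_Integration.integrable_bound[OF L2D(2)[OF assms]])
      show "(\<lambda>x. (g x $ i)\<^sup>2) \<in> borel_measurable M" using m by simp
      show "AE x in M. norm ((g x $ i)\<^sup>2) \<le> norm ((norm (g x))\<^sup>2)"
        using component_le_norm_cart[of _ i] by (intro AE_I2) (simp add: abs_le_square_iff[symmetric])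
    qed
    then show ?thesis using m by (simp add: L2_def)
  qed
  have "(L2_norm M g)\<^sup>2 = (\<integral>x. (\<Sum>i\<in>UNIV. (norm (g x $ i))\<^sup>2) \<partial>M)"
    unfolding L2_norm_sq ip_def by (simp add: inner_vec_def power2_eq_square)
  also have "\<dots> = (\<Sum>i\<in>UNIV. \<integral>x. (norm (g x $ i))\<^sup>2 \<partial>M)"
    by (rule Bochner_Integration.integral_sum) (rule L2D(2)[OF c])
  also have "\<dots> = (\<Sum>i\<in>UNIV. (L2_norm M (\<lambda>x. g x $ i))\<^sup>2)"
    unfolding L2_norm_sq ip_def by (simp add: power2_eq_square)
  finally show "(L2_norm M g)\<^sup>2 = (\<Sum>i\<in>UNIV. (L2_norm M (\<lambda>x. g x $ i))\<^sup>2)" .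
qed

lemma L2_closed_span_cong:
  assumes "\<And>i x. i \<in> I \<Longrightarrow> x \<in> space M \<Longrightarrow> G i x = G' i x"
  shows "L2_closed_span M I G = L2_closed_span M I G'"
proof -
  have "L2_norm M (\<lambda>x. f x - (\<Sum>i\<in>F. c i *\<^sub>R G i x)) = L2_norm M (\<lambda>x. f x - (\<Sum>i\<in>F. c i *\<^sub>R G' i x))"
    if "F \<subseteq> I" for f F c
    unfolding L2_norm_def
    by (intro arg_cong[where f=sqrt] Bochner_Integration.integral_cong refl arg_cong[where f="\<lambda>v. (norm v)\<^sup>2"]
        arg_cong2[where f="(-)"] sum.cong arg_cong2[where f="(*\<^sub>R)"]) (use assms that in auto)
  then show ?thesis
    unfolding L2_closed_span_def by (simp cong: conj_cong)
qed

lemma ip_Gp_Gp: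
  assumes P: "solid_harmonic n P" and Q: "solid_harmonic m Q"
  shows "ip \<sigma> (Gp n P) (Gp m Q) = (if n = m then (real n + 1) * (2 * real n + 1) * ip \<sigma> P Q else 0)"
proof -
  note DP = solid_harmonicD[OF P] and DQ = solid_harmonicD[OF Q]
  have gQ: "grad Q \<in> L2 \<sigma>" by (rule continuous_L2[OF DQ(7)])
  have 1: "(\<integral>y. (y \<bullet> Gp n P y) * Q y \<partial>\<sigma>) = - (real n + 1) * ip \<sigma> P Q"
  proof -
    have "(\<integral>y. (y \<bullet> Gp n P y) * Q y \<partial>\<sigma>) = (\<integral>y. - (real n + 1) * (P y * Q y) \<partial>\<sigma>)"
      by (intro Bochner_Integration.integral_cong refl)
         (simp add: Gp_def inner_diff_right solid_harmonic_euler[OF P] dot_square_norm algebra_simps)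
    then show ?thesis by (simp add: ip_def)
  qed
  have 2: "ip \<sigma> (grad Q) (grad P) = real n * (2 * real n + 1) * ip \<sigma> P Q"
    using integral_grad_solid_solid[OF Q P] by (simp add: ip_def mult.commute)
  have 3: "(\<integral>y. (y \<bullet> grad Q y) * P y \<partial>\<sigma>) = real m * ip \<sigma> P Q"
    by (simp add: solid_harmonic_euler[OF Q] ip_def mult_ac)
  have "ip \<sigma> (Gp n P) (Gp m Q) = (real n * (2 * real n + 1) - (2 * real n + 1) * real m
      + (2 * real m + 1) * (real n + 1)) * ip \<sigma> P Q"
    unfolding ip_Gp[OF Gp_L2[OF P] Q] ip_commute[of \<sigma> "Gp n P" "grad Q"] ip_Gp[OF gQ P] 1 2 3
    by (simp add: algebra_simps)
  moreover have "ip \<sigma> P Q = 0" if "n \<noteq> m"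
    using solid_harmonic_orthogonal[OF P Q that] by (simp add: ip_def)
  ultimately show ?thesis by (simp add: algebra_simps)
qed

section \<open>Expansions in a given orthonormal basis of spherical harmonics\<close>

locale sh_base =
  fixes Y :: "nat \<Rightarrow> int \<Rightarrow> real^3 \<Rightarrow> real"
  assumes Y: "sh_basis Y"
begin

text \<open>The basis is prescribed on the sphere only. Differentiation in space needs an extension,
  and this chooses the homogeneous harmonic one.\<close>

definition Yp :: "nat \<Rightarrow> int \<Rightarrow> real^3 \<Rightarrow> real" where
  "Yp n k = (SOME P. solid_harmonic n P \<and> (\<forall>x\<in>\<S>. Y n k x = P x))"

lemma Yp:
  assumes "(n, k) \<in> sh_index"
  shows "solid_harmonic n (Yp n k)" "x \<in> \<S> \<Longrightarrow> Y n k x = Yp n k x"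
proof -
  have "spherical_harmonic n (Y n k)"
    using Y assms by (auto simp: sh_basis_def)
  then have "\<exists>P. solid_harmonic n P \<and> (\<forall>x\<in>\<S>. Y n k x = P x)"
    by (auto simp: spherical_harmonic_def solid_harmonic_def)
  from someI_ex[OF this]
  show "solid_harmonic n (Yp n k)" "x \<in> \<S> \<Longrightarrow> Y n k x = Yp n k x"
    by (auto simp: Yp_def)
qed

lemma Yp_L2: "(n, k) \<in> sh_index \<Longrightarrow> Yp n k \<in> L2 \<sigma>"
  by (intro continuous_L2 solid_harmonicD(5)[OF Yp(1)])

lemma Yp_orth:
  assumes "(n, k) \<in> sh_index" "(m, l) \<in> sh_index"
  shows "ip \<sigma> (Yp n k) (Yp m l) = (if n = m \<and> k = l then 1 else 0)"
proof -
  have "ip \<sigma> (Yp n k) (Yp m l) = (\<integral>x. Y n k x * Y m l x \<partial>\<sigma>)"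
    unfolding ip_def by (intro Bochner_Integration.integral_cong refl) (simp add: Yp(2)[OF assms(1)] Yp(2)[OF assms(2)])
  also have "\<dots> = (if n = m \<and> k = l then 1 else 0)"
    using Y assms unfolding sh_basis_def by blast
  finally show ?thesis .
qed

lemma Yp_span:
  assumes "f \<in> L2 \<sigma>"
  shows "f \<in> L2_closed_span \<sigma> sh_index (\<lambda>(n, k). Yp n k)"
proof -
  have "f \<in> L2_closed_span \<sigma> sh_index (\<lambda>(n, k). Y n k)"
    using Y assms by (auto simp: sh_basis_def)
  also have "L2_closed_span \<sigma> sh_index (\<lambda>(n, k). Y n k) = L2_closed_span \<sigma> sh_index (\<lambda>(n, k). Yp n k)"
    by (rule L2_closed_span_cong) (auto simp: Yp(2))
  finally show ?thesis .
qed

lemma scalar_expansion: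
  assumes "f \<in> L2 \<sigma>"
  shows "orthogonal_expansion \<sigma> (\<lambda>(n, k). Yp n k) (\<lambda>_. 1) f (\<lambda>(n, k). ip \<sigma> f (Yp n k))"
proof
  show "f \<in> L2 \<sigma>" by (rule assms)
  fix i assume i: "i \<in> sh_index"
  then show "(case i of (n, k) \<Rightarrow> Yp n k) \<in> L2 \<sigma>" by (cases i) (simp add: Yp_L2)
  show "ip \<sigma> f (case i of (n, k) \<Rightarrow> Yp n k) = 1 * (case i of (n, k) \<Rightarrow> ip \<sigma> f (Yp n k))"
    by (cases i) simp
  fix j assume j: "j \<in> sh_index"
  show "ip \<sigma> (case i of (n, k) \<Rightarrow> Yp n k) (case j of (n, k) \<Rightarrow> Yp n k) = (if i = j then 1 else 0)"
    using i j by (cases i, cases j) (simp add: Yp_orth)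
qed

lemma scalar_parseval:
  assumes "f \<in> L2 \<sigma>"
  shows "(\<lambda>n. \<Sum>k=-int n..int n. (ip \<sigma> f (Yp n k))\<^sup>2) sums (L2_norm \<sigma> f)\<^sup>2"
  using orthogonal_expansion.parseval[OF scalar_expansion[OF assms] Yp_span[OF assms]] by simp

lemma scalar_bessel:
  assumes "f \<in> L2 \<sigma>"
  shows "(\<Sum>n<N. \<Sum>k=-int n..int n. (ip \<sigma> f (Yp n k))\<^sup>2) \<le> (L2_norm \<sigma> f)\<^sup>2"
  using orthogonal_expansion.bessel[OF scalar_expansion[OF assms], of N] by (simp add: sum_sh_block)

definition comb :: "nat \<Rightarrow> (int \<Rightarrow> real) \<Rightarrow> real^3 \<Rightarrow> real" where
  "comb n a x = (\<Sum>k=-int n..int n. a k * Yp n k x)"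

lemma sh_indexI: "k \<in> {-int n..int n} \<Longrightarrow> (n, k) \<in> sh_index"
  by (auto simp: sh_index_def)

lemma comb_solid: "solid_harmonic n (comb n a)"
  unfolding comb_def[abs_def] by (rule solid_harmonic_sum) (rule Yp(1)[OF sh_indexI])

lemma comb_norm: "(L2_norm \<sigma> (comb n a))\<^sup>2 = (\<Sum>k=-int n..int n. (a k)\<^sup>2)"
proof -
  let ?K = "{-int n..int n}"
  have c: "comb n a = (\<lambda>x. \<Sum>k\<in>?K. a k *\<^sub>R Yp n k x)"
    by (simp add: comb_def[abs_def])
  have cL: "comb n a \<in> L2 \<sigma>"
    by (intro continuous_L2 solid_harmonicD(5)[OF comb_solid])
  have "ip \<sigma> (comb n a) (Yp n k) = a k" if "k \<in> ?K" for k
  proof -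
    have "ip \<sigma> (Yp n k) (comb n a) = (\<Sum>l\<in>?K. a l * ip \<sigma> (Yp n k) (Yp n l))"
      unfolding c by (rule ip_sum_right) (use that Yp_L2 sh_indexI in auto)
    also have "\<dots> = (\<Sum>l\<in>?K. if l = k then a k else 0)"
      by (rule sum.cong[OF refl]) (use that Yp_orth sh_indexI in auto)
    finally show ?thesis using that by (simp add: ip_commute)
  qed
  moreover have "ip \<sigma> (comb n a) (comb n a) = (\<Sum>k\<in>?K. a k * ip \<sigma> (comb n a) (Yp n k))"
    by (subst (2) c) (rule ip_sum_right[OF cL], use Yp_L2 sh_indexI in auto)
  ultimately show ?thesis
    unfolding L2_norm_sq by (simp add: power2_eq_square)
qed

text \<open>The extension of a spherical harmonic that is constant along rays is |z|^(- n) times its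
  solid harmonic; the product rule at norm 1 yields the correction.\<close>

lemma surface_grad_Y:
  assumes i: "(n, k) \<in> sh_index" and x: "x \<in> \<S>"
  shows "surface_grad (Y n k) x = grad (Yp n k) x - (real n * Yp n k x) *\<^sub>R x"
  unfolding surface_grad_def
proof (rule grad_eqI)
  \<comment> \<open>The function \<open>?D\<close> is |z|^2, written as the squared distance to the
    pole 0 so that \<open>powr_sqdist_has_derivative\<close> applies.\<close>
  let ?P = "Yp n k" and ?D = "\<lambda>z::real^3. (0 - z) \<bullet> (0 - z)"
  note DP = solid_harmonicD[OF Yp(1)[OF i]]
  have x0: "x \<noteq> 0" "0 \<noteq> x" using x by auto
  have D1: "?D x = 1" using x by (simp add: dot_square_norm)
  have "((\<lambda>z. ?D z powr (- real n / 2) * ?P z) has_derivative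
      (\<lambda>v. ?D x powr (- real n / 2) * (grad ?P x \<bullet> v)
        + (((- 2 * (- real n / 2) * ?D x powr (- real n / 2 - 1)) *\<^sub>R (0 - x)) \<bullet> v) * ?P x)) (at x)"
    by (rule has_derivative_mult[OF powr_sqdist_has_derivative[OF x0(2)] DP(6)])
  then have d: "((\<lambda>z. ?D z powr (- real n / 2) * ?P z) has_derivative
      (\<lambda>v. (grad ?P x - (real n * ?P x) *\<^sub>R x) \<bullet> v)) (at x)"
    unfolding D1 by (simp add: inner_diff_left mult_ac)
  have eq: "?D z powr (- real n / 2) * ?P z = Y n k (z /\<^sub>R norm z)" if "z \<in> - {0}" for z
  proof -
    have nz: "norm z > 0" using that by simp
    have D: "?D z = norm z powr 2" using nz by (simp add: dot_square_norm)
    have "?D z powr (- real n / 2) = norm z powr (- real n)"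
      unfolding D powr_powr by simp
    also have "\<dots> = (1 / norm z) ^ n"
      using nz by (simp add: powr_minus_divide powr_realpow power_one_over)
    finally have "?D z powr (- real n / 2) * ?P z = ?P ((1 / norm z) *\<^sub>R z)"
      unfolding DP(2) by simp
    also have "\<dots> = Y n k ((1 / norm z) *\<^sub>R z)"
      by (rule Yp(2)[OF i, symmetric]) (use nz in simp)
    finally show ?thesis by (simp only: inverse_eq_divide)
  qed
  show "((\<lambda>z. Y n k (z /\<^sub>R norm z)) has_derivative
      (\<lambda>v. (grad ?P x - (real n * ?P x) *\<^sub>R x) \<bullet> v)) (at x)"
    by (rule has_derivative_transform_within_open[OF d, where s="- {0}"]) (use x0 eq in \<open>simp_all add: open_Compl\<close>)
qed

lemma hardy_minus_span:
  "hardy_minus Y = L2_closed_span \<sigma> sh_index (\<lambda>(n, k). Gp n (Yp n k))"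
  unfolding hardy_minus_def
proof (rule L2_closed_span_cong)
  fix i x assume i: "i \<in> sh_index" and "x \<in> space \<sigma>"
  then have x: "x \<in> \<S>" by simp
  obtain n k where nk: "i = (n, k)" by (cases i)
  have "G_int Y n k x = Gp n (Yp n k) x"
    unfolding G_int_def Gp_def surface_grad_Y[OF i[unfolded nk] x] Yp(2)[OF i[unfolded nk] x]
    unfolding diff_diff_eq scaleR_add_left[symmetric]
    by (rule arg_cong[where f="\<lambda>c. grad (Yp n k) x - c *\<^sub>R x"]) (simp add: algebra_simps)
  then show "(case i of (n, k) \<Rightarrow> G_int Y n k) x = (case i of (n, k) \<Rightarrow> Gp n (Yp n k)) x"
    by (simp add: nk)
qed

text \<open>The squared norm of \<open>Gp n (Yp n k)\<close> on the sphere, by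
  \<open>ip_Gp_Gp\<close>.\<close>

definition wG :: "nat \<times> int \<Rightarrow> real" where
  "wG i = (real (fst i) + 1) * (2 * real (fst i) + 1)"

lemma wG_pos: "wG i > 0"
  by (simp add: wG_def add_nonneg_pos)

definition qm :: "(real^3 \<Rightarrow> real^3) \<Rightarrow> nat \<times> int \<Rightarrow> real" where
  "qm f = (\<lambda>(n, k). ip \<sigma> f (Gp n (Yp n k)) / wG (n, k))"

lemma minus_expansion:
  assumes "f \<in> L2 \<sigma>"
  shows "orthogonal_expansion \<sigma> (\<lambda>(n, k). Gp n (Yp n k)) wG f (qm f)"
proof
  show "f \<in> L2 \<sigma>" by (rule assms)
  fix i assume i: "i \<in> sh_index"
  then show "(case i of (n, k) \<Rightarrow> Gp n (Yp n k)) \<in> L2 \<sigma>"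
    by (cases i) (simp add: Gp_L2 Yp)
  show "ip \<sigma> f (case i of (n, k) \<Rightarrow> Gp n (Yp n k)) = wG i * qm f i"
    using wG_pos[of i] by (cases i) (simp add: qm_def)
  fix j assume j: "j \<in> sh_index"
  obtain n k m l where nk: "i = (n, k)" "j = (m, l)" by (cases i, cases j)
  show "ip \<sigma> (case i of (n, k) \<Rightarrow> Gp n (Yp n k)) (case j of (n, k) \<Rightarrow> Gp n (Yp n k)) = (if i = j then wG i else 0)"
    using ip_Gp_Gp[OF Yp(1) Yp(1), of n k m l] Yp_orth[of n k m l] i j by (auto simp: nk wG_def)
qed

end

section \<open>Vector-valued Fourier coefficients and the tail of an internal field\<close>

lemma ip_component:
  fixes g :: "real^3 \<Rightarrow> real^3"
  shows "ip \<sigma> (\<lambda>x. g x $ i) P = ip \<sigma> g (\<lambda>x. P x *\<^sub>R axis i 1)"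
  by (simp add: ip_def inner_axis mult.commute)

context sh_base
begin

definition Ye :: "nat \<Rightarrow> int \<Rightarrow> 3 \<Rightarrow> real^3 \<Rightarrow> real^3" where
  "Ye m l i x = Yp m l x *\<^sub>R axis i 1"

lemma Ye_L2: "(m, l) \<in> sh_index \<Longrightarrow> Ye m l i \<in> L2 \<sigma>"
  unfolding Ye_def[abs_def] by (intro continuous_L2 continuous_intros solid_harmonicD(5)[OF Yp(1)])

lemma norm_sh_coeff:
  fixes g :: "real^3 \<Rightarrow> real^3"
  assumes g: "g \<in> L2 \<sigma>" and ml: "(m, l) \<in> sh_index"
  shows "(norm (sh_coeff Y g m l))\<^sup>2 = (\<Sum>i\<in>UNIV. (ip \<sigma> g (Ye m l i))\<^sup>2)"
proof -
  have cY: "continuous_on \<S> (Yp m l)" by (rule solid_harmonicD(5)[OF Yp(1)[OF ml]])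
  obtain B where B: "B > 0" "\<And>x. x \<in> \<S> \<Longrightarrow> norm (Yp m l x) \<le> B"
    using continuous_sphere_bounded[OF cY] by blast
  have gi: "integrable \<sigma> g" by (rule L1_le_L2(1)[OF sigma.finite_measure_axioms g])
  have int: "integrable \<sigma> (\<lambda>x. Yp m l x *\<^sub>R g x)"
  proof (rule Bochner_Integration.integrable_bound)
    show "integrable \<sigma> (\<lambda>x. B * norm (g x))"
      by (intro integrable_mult_right integrable_norm gi)
    show "(\<lambda>x. Yp m l x *\<^sub>R g x) \<in> borel_measurable \<sigma>"
      by (intro borel_measurable_scaleR continuous_sphere_measurable cY L2D(1)[OF g])
    show "AE x in \<sigma>. norm (Yp m l x *\<^sub>R g x) \<le> norm (B * norm (g x))"
      using B by (intro AE_I2) (auto simp: abs_mult intro!: mult_right_mono)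
  qed
  have "sh_coeff Y g m l = (\<integral>x. Yp m l x *\<^sub>R g x \<partial>\<sigma>)"
    unfolding sh_coeff_def by (intro Bochner_Integration.integral_cong refl) (simp add: Yp(2)[OF ml])
  then have "sh_coeff Y g m l $ i = ip \<sigma> g (Ye m l i)" for i
    unfolding ip_component[symmetric] Ye_def[abs_def]
    by (simp add: integral_vec_component[OF int] ip_def mult.commute)
  then show ?thesis
    by (simp add: norm_sq_vec)
qed

lemma vector_parseval:
  fixes g :: "real^3 \<Rightarrow> real^3"
  assumes g: "g \<in> L2 \<sigma>"
  shows "(\<lambda>m. \<Sum>l=-int m..int m. (norm (sh_coeff Y g m l))\<^sup>2) sums (L2_norm \<sigma> g)\<^sup>2"
proof -
  have "(\<lambda>m. \<Sum>i\<in>UNIV. \<Sum>l=-int m..int m. (ip \<sigma> (\<lambda>x. g x $ i) (Yp m l))\<^sup>2) sums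
      (\<Sum>i\<in>UNIV. (L2_norm \<sigma> (\<lambda>x. g x $ i))\<^sup>2)"
    by (intro sums_sum scalar_parseval L2_component(1) g)
  also have "(\<Sum>i\<in>UNIV. (L2_norm \<sigma> (\<lambda>x. g x $ i))\<^sup>2) = (L2_norm \<sigma> g)\<^sup>2"
    by (rule L2_component(2)[OF g, symmetric])
  also have "(\<lambda>m. \<Sum>i\<in>UNIV. \<Sum>l=-int m..int m. (ip \<sigma> (\<lambda>x. g x $ i) (Yp m l))\<^sup>2)
      = (\<lambda>m. \<Sum>l=-int m..int m. (norm (sh_coeff Y g m l))\<^sup>2)"
  proof
    fix m
    have "(\<Sum>i\<in>UNIV. \<Sum>l=-int m..int m. (ip \<sigma> (\<lambda>x. g x $ i) (Yp m l))\<^sup>2)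
        = (\<Sum>l=-int m..int m. \<Sum>i\<in>UNIV. (ip \<sigma> g (Ye m l i))\<^sup>2)"
      unfolding ip_component Ye_def[abs_def] by (rule sum.swap)
    also have "\<dots> = (\<Sum>l=-int m..int m. (norm (sh_coeff Y g m l))\<^sup>2)"
      by (intro sum.cong refl norm_sh_coeff[OF g, symmetric] sh_indexI)
    finally show "(\<Sum>i\<in>UNIV. \<Sum>l=-int m..int m. (ip \<sigma> (\<lambda>x. g x $ i) (Yp m l))\<^sup>2)
        = (\<Sum>l=-int m..int m. (norm (sh_coeff Y g m l))\<^sup>2)" .
  qed
  finally show ?thesis .
qed

lemma ip_Ye_Gp:
  assumes "(m, l) \<in> sh_index" "(n, k) \<in> sh_index" "m \<noteq> Suc n"
  shows "ip \<sigma> (Ye m l i) (Gp n (Yp n k)) = 0"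
proof -
  have "ip \<sigma> (Ye m l i) (Gp n (Yp n k)) = ip \<sigma> (\<lambda>x. Gp n (Yp n k) x $ i) (Yp m l)"
    unfolding ip_component Ye_def[abs_def] by (rule ip_commute)
  then show ?thesis
    using Gp_component_orthogonal[OF Yp(1)[OF assms(2)] Yp(1)[OF assms(1)] assms(3), of i] by (simp add: ip_def)
qed

text \<open>Since \<open>Gp\<close> raises the degree of the components by exactly one, the terms n
  < N meet vector coefficients of degree at most N only, and the terms n >= N only those above. The
  remainder therefore has the coefficients of f above degree N and none below, and there the Sobolev
  weight exceeds (N + 1)^(2 tau).\<close>

lemma minus_tail:
  assumes f: "f \<in> hardy_minus Y" and sob: "f \<in> sobolev Y \<tau>" and tau: "0 \<le> \<tau>"
    and pt: "pt = orthogonal_expansion.part (\<lambda>(n, k). Gp n (Yp n k)) (qm f)"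
  shows "L2_norm \<sigma> (\<lambda>x. f x - pt N x) \<le> (real N + 1) powr (- \<tau>) * sobolev_norm Y \<tau> f"
proof -
  have fL: "f \<in> L2 \<sigma>" using sob by (simp add: sobolev_def)
  interpret E: orthogonal_expansion \<sigma> "\<lambda>(n, k). Gp n (Yp n k)" wG f "qm f"
    by (rule minus_expansion[OF fL])
  have fS: "f \<in> L2_closed_span \<sigma> sh_index (\<lambda>(n, k). Gp n (Yp n k))"
    using f hardy_minus_span by simp
  have partL: "pt N \<in> L2 \<sigma>" for N
    unfolding pt by (rule E.part_L2)
  let ?h = "\<lambda>x. f x - pt N x"
  have hL: "?h \<in> L2 \<sigma>" by (rule L2_diff[OF fL partL])
  have ipp: "ip \<sigma> (Ye m l i) (pt N') = (\<Sum>(n, k)\<in>sh_block N'. qm f (n, k) * ip \<sigma> (Ye m l i) (Gp n (Yp n k)))"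
    if ml: "(m, l) \<in> sh_index" for m l i N'
  proof -
    have "ip \<sigma> (Ye m l i) (pt N')
        = (\<Sum>j\<in>sh_block N'. qm f j * ip \<sigma> (Ye m l i) (case j of (n, k) \<Rightarrow> Gp n (Yp n k)))"
      unfolding pt E.part_def by (rule ip_sum_right[OF Ye_L2[OF ml] E.block(1)])
    then show ?thesis by (simp add: case_prod_beta)
  qed
  have stable: "ip \<sigma> (Ye m l i) (pt N') = ip \<sigma> (Ye m l i) (pt N)"
    if ml: "(m, l) \<in> sh_index" and "m \<le> N" "N \<le> N'" for m l i N N'
    unfolding ipp[OF ml]
  proof (rule sum.mono_neutral_right)
    show "\<forall>j\<in>sh_block N' - sh_block N. (case j of (n, k) \<Rightarrow> qm f (n, k) * ip \<sigma> (Ye m l i) (Gp n (Yp n k))) = 0"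
    proof
      fix j assume j: "j \<in> sh_block N' - sh_block N"
      obtain n k where nk: "j = (n, k)" by (cases j)
      have i: "(n, k) \<in> sh_index" using j sh_block(2) nk by blast
      have "\<not> n < N" using j by (auto simp: nk sh_block_def)
      then show "(case j of (n, k) \<Rightarrow> qm f (n, k) * ip \<sigma> (Ye m l i) (Gp n (Yp n k))) = 0"
        using ip_Ye_Gp[OF ml i, of i] \<open>m \<le> N\<close> by (simp add: nk)
    qed
  qed (use sh_block(1) sh_block(3)[OF \<open>N \<le> N'\<close>] in auto)
  \<comment> \<open>For m <= N the pairing with the partial sums is constant from index N on, so its
    limit, the coefficient of f, is already attained by \<open>pt N\<close>.\<close>
  have low: "ip \<sigma> ?h (Ye m l i) = 0" if ml: "(m, l) \<in> sh_index" and "m \<le> N" for m l i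
  proof -
    have "(\<lambda>N'. ip \<sigma> (Ye m l i) (pt N')) \<longlonglongrightarrow> ip \<sigma> (Ye m l i) f"
      unfolding pt by (rule E.ip_part_tendsto[OF fS Ye_L2[OF ml]])
    moreover have "(\<lambda>N'. ip \<sigma> (Ye m l i) (pt N')) \<longlonglongrightarrow> ip \<sigma> (Ye m l i) (pt N)"
      by (rule tendsto_eventually, rule eventually_sequentiallyI[of N], rule stable[OF ml \<open>m \<le> N\<close>])
    ultimately have "ip \<sigma> (Ye m l i) f = ip \<sigma> (Ye m l i) (pt N)"
      by (rule LIMSEQ_unique)
    then show ?thesis
      using ip_diff_left[OF Ye_L2[OF ml] fL partL[of N], of i] by (simp add: ip_commute)
  qed
  have high: "ip \<sigma> ?h (Ye m l i) = ip \<sigma> f (Ye m l i)" if ml: "(m, l) \<in> sh_index" and "N < m" for m l i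
  proof -
    have "ip \<sigma> (Ye m l i) (pt N) = 0"
      unfolding ipp[OF ml]
    proof (rule sum.neutral, intro ballI)
      fix j assume j: "j \<in> sh_block N"
      obtain n k where nk: "j = (n, k)" by (cases j)
      have i: "(n, k) \<in> sh_index" using j sh_block(2) nk by blast
      have "n < N" using j by (auto simp: nk sh_block_def)
      then show "(case j of (n, k) \<Rightarrow> qm f (n, k) * ip \<sigma> (Ye m l i) (Gp n (Yp n k))) = 0"
        using ip_Ye_Gp[OF ml i, of i] \<open>N < m\<close> by (simp add: nk)
    qed
    then show ?thesis
      using ip_diff_left[OF Ye_L2[OF ml] fL partL[of N], of i] by (simp add: ip_commute)
  qed
  define S where "S g m = (\<Sum>l=-int m..int m. (norm (sh_coeff Y g m l))\<^sup>2)" for g :: "real^3 \<Rightarrow> real^3" and m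
  have Sh: "S ?h m = (if m \<le> N then 0 else S f m)" for m
    unfolding S_def
    using low high by (auto intro!: sum.cong sum.neutral simp: norm_sh_coeff[OF hL sh_indexI] norm_sh_coeff[OF fL sh_indexI] sh_indexI)
  have tb: "S ?h m \<le> (real N + 1) powr (- 2 * \<tau>) * sobolev_term Y \<tau> f m" for m
  proof (cases "m \<le> N")
    case True
    then show ?thesis
      by (auto simp: Sh sobolev_term_def intro!: mult_nonneg_nonneg sum_nonneg)
  next
    case False
    have "1 = (real N + 1) powr (- 2 * \<tau>) * (real N + 1) powr (2 * \<tau>)"
      by (simp add: powr_add[symmetric])
    also have "\<dots> \<le> (real N + 1) powr (- 2 * \<tau>) * (real m + 1/2) powr (2 * \<tau>)"
      using False tau by (intro mult_left_mono powr_mono2) auto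
    finally have "1 * S f m \<le> (real N + 1) powr (- 2 * \<tau>) * (real m + 1/2) powr (2 * \<tau>) * S f m"
      by (rule mult_right_mono) (simp add: S_def sum_nonneg)
    then show ?thesis
      using False by (simp add: Sh sobolev_term_def S_def mult.assoc)
  qed
  have sm: "summable (sobolev_term Y \<tau> f)" using sob by (simp add: sobolev_def)
  have nn: "0 \<le> sobolev_term Y \<tau> f m" for m
    by (auto simp: sobolev_term_def intro!: mult_nonneg_nonneg sum_nonneg)
  have "(L2_norm \<sigma> ?h)\<^sup>2 = (\<Sum>m. S ?h m)"
    using vector_parseval[OF hL] by (simp add: S_def sums_iff)
  also have "\<dots> \<le> (\<Sum>m. (real N + 1) powr (- 2 * \<tau>) * sobolev_term Y \<tau> f m)"
    using vector_parseval[OF hL] tb sm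
    by (intro suminf_le summable_mult) (auto simp: S_def sums_iff)
  also have "\<dots> = (real N + 1) powr (- 2 * \<tau>) * (sobolev_norm Y \<tau> f)\<^sup>2"
    using sm nn by (simp add: suminf_mult sobolev_norm_def suminf_nonneg)
  also have "\<dots> = ((real N + 1) powr (- \<tau>) * sobolev_norm Y \<tau> f)\<^sup>2"
    by (simp add: power_mult_distrib powr_power)
  finally show ?thesis
    by (rule power2_le_imp_le) (use sm nn in \<open>simp add: sobolev_norm_def suminf_nonneg\<close>)
qed

end

section \<open>Single layer densities\<close>

lemma id_measurable_sphere: "(\<lambda>x. x) \<in> borel_measurable (sphere_measure r)"
  by (rule continuous_sphere_measurable) (rule continuous_on_id)

lemma measurable_norm_compose:
  fixes f :: "'a \<Rightarrow> 'b::euclidean_space"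
  shows "f \<in> borel_measurable M \<Longrightarrow> (\<lambda>x. norm (f x)) \<in> borel_measurable M"
  by measurable

lemma measurable_sqrt_compose:
  fixes f :: "'a \<Rightarrow> real"
  shows "f \<in> borel_measurable M \<Longrightarrow> (\<lambda>x. sqrt (f x)) \<in> borel_measurable M"
  by measurable

lemma measurable_abs_compose:
  fixes f :: "'a \<Rightarrow> real"
  shows "f \<in> borel_measurable M \<Longrightarrow> (\<lambda>x. \<bar>f x\<bar>) \<in> borel_measurable M"
  by measurable

lemma L2_norm_sq_real:
  fixes f :: "'a \<Rightarrow> real"
  shows "(L2_norm M f)\<^sup>2 = (\<integral>x. (f x)\<^sup>2 \<partial>M)"
  unfolding L2_norm_sq ip_def by (simp add: power2_eq_square)

text \<open>Inside the ball the potential of the uniform layer is constant, by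
  \<open>I1_I3_one\<close>. Fatou's lemma carries this value, as a bound, to the points of the
  sphere.\<close>

lemma nn_integral_newton_bound:
  assumes w: "w \<in> \<S>"
  shows "(\<integral>\<^sup>+y. ennreal (1 / norm (w - y)) \<partial>\<sigma>) \<le> ennreal total_area"
proof -
  define s where "s n = 1 - 1 / (real n + 2)" for n :: nat
  have s: "0 < s n" "s n < 1" for n by (auto simp: s_def field_simps)
  have slim: "s \<longlonglongrightarrow> 1" unfolding s_def by real_asymp
  have m: "(\<lambda>y. ennreal (1 / norm (w - s n *\<^sub>R y))) \<in> borel_measurable \<sigma>" for n
    using id_measurable_sphere[of 1] by (intro measurable_compose[OF _ measurable_ennreal] borel_measurable_divide
        measurable_norm_compose borel_measurable_diff borel_measurable_scaleR borel_measurable_const)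
  have "(\<integral>\<^sup>+y. ennreal (1 / norm (w - y)) \<partial>\<sigma>)
      \<le> (\<integral>\<^sup>+y. liminf (\<lambda>n. ennreal (1 / norm (w - s n *\<^sub>R y))) \<partial>\<sigma>)"
  proof (rule nn_integral_mono)
    fix y assume "y \<in> space \<sigma>"
    show "ennreal (1 / norm (w - y)) \<le> liminf (\<lambda>n. ennreal (1 / norm (w - s n *\<^sub>R y)))"
    \<comment> \<open>At y = w the left side is 1 / 0 = 0, so only the other points need the
      limit.\<close>
    proof (cases "w = y")
      case False
      have "(\<lambda>n. 1 / norm (w - s n *\<^sub>R y)) \<longlonglongrightarrow> 1 / norm (w - 1 *\<^sub>R y)"
        by (intro tendsto_intros slim) (use False in auto)
      then have "(\<lambda>n. ennreal (1 / norm (w - s n *\<^sub>R y))) \<longlonglongrightarrow> ennreal (1 / norm (w - y))"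
        by (intro tendsto_ennrealI) simp
      from lim_imp_Liminf[OF sequentially_bot this] show ?thesis by simp
    qed simp
  qed
  also have "\<dots> \<le> liminf (\<lambda>n. \<integral>\<^sup>+y. ennreal (1 / norm (w - s n *\<^sub>R y)) \<partial>\<sigma>)"
    by (rule nn_integral_liminf[OF m])
  also have "(\<lambda>n. \<integral>\<^sup>+y. ennreal (1 / norm (w - s n *\<^sub>R y)) \<partial>\<sigma>) = (\<lambda>n. ennreal total_area)"
  proof
    fix n
    have "integrable \<sigma> (\<lambda>y. 1 / norm (w - s n *\<^sub>R y))"
      using kernel_integrable(2)[OF w _ _ continuous_on_const, of "s n" 1] s[of n] by auto
    then have "(\<integral>\<^sup>+y. ennreal (1 / norm (w - s n *\<^sub>R y)) \<partial>\<sigma>) = ennreal (I1 (\<lambda>_. 1) w (s n))"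
      unfolding I1_def by (rule nn_integral_eq_integral) simp
    then show "(\<integral>\<^sup>+y. ennreal (1 / norm (w - s n *\<^sub>R y)) \<partial>\<sigma>) = ennreal total_area"
      using I1_I3_one(1)[OF w s] by simp
  qed
  finally show ?thesis by (simp add: Liminf_const)
qed

text \<open>The maximal function is lower semicontinuous: x lies in the approach region of y exactly
  if y lies in an open ball about x, so every superlevel set is a union of balls cut with the
  sphere.\<close>

lemma nt_maximal_measurable: "nt_maximal r F \<in> borel_measurable (sphere_measure r)"
proof (rule borel_measurableI_greater)
  fix c :: ennreal
  have "{y \<in> space (sphere_measure r). c < nt_maximal r F y}
      = (\<Union>x\<in>{x \<in> ball 0 r. c < ennreal (norm (F x))}. ball x (2 * (r - norm x))) \<inter> sphere 0 r"
    by (auto simp: nt_maximal_def less_SUP_iff nt_region_def dist_norm)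
  moreover have "open (\<Union>x\<in>{x \<in> ball 0 r. c < ennreal (norm (F x))}. ball x (2 * (r - norm x)))"
    by auto
  ultimately show "{y \<in> space (sphere_measure r). c < nt_maximal r F y} \<in> sets (sphere_measure r)"
    by (simp add: sphere_sets_iff)
qed

lemma radial_in_nt_region:
  assumes "y \<in> \<S>" "0 \<le> \<rho>" "\<rho> < r"
  shows "\<rho> *\<^sub>R y \<in> nt_region r (r *\<^sub>R y)"
proof -
  have "\<rho> *\<^sub>R y - r *\<^sub>R y = (\<rho> - r) *\<^sub>R y" by (simp add: scaleR_diff_left)
  then have "norm (\<rho> *\<^sub>R y - r *\<^sub>R y) = r - \<rho>" using assms by simp
  then show ?thesis using assms by (simp add: nt_region_def)
qed

lemma single_layer_measurable:
  assumes "0 < r" "\<phi> \<in> borel_measurable (sphere_measure r)"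
  shows "(\<lambda>y. single_layer r \<phi> (r *\<^sub>R y)) \<in> borel_measurable \<sigma>"
proof -
  interpret R: finite_measure "sphere_measure r"
    by (rule finite_measure_sphere) (use assms in simp)
  have id1: "(\<lambda>x. x) \<in> \<sigma> \<rightarrow>\<^sub>M borel" and id2: "(\<lambda>x. x) \<in> sphere_measure r \<rightarrow>\<^sub>M borel"
    by (rule id_measurable_sphere)+
  have f: "(\<lambda>z. fst z) \<in> borel_measurable (\<sigma> \<Otimes>\<^sub>M sphere_measure r)"
    "(\<lambda>z. snd z) \<in> borel_measurable (\<sigma> \<Otimes>\<^sub>M sphere_measure r)"
    "(\<lambda>z. \<phi> (snd z)) \<in> borel_measurable (\<sigma> \<Otimes>\<^sub>M sphere_measure r)"
    using measurable_compose[OF measurable_fst id1] measurable_compose[OF measurable_snd id2]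
      measurable_compose[OF measurable_snd assms(2)] by auto
  have "(\<lambda>(y, z). \<phi> z / norm (r *\<^sub>R y - z)) \<in> borel_measurable (\<sigma> \<Otimes>\<^sub>M sphere_measure r)"
    unfolding case_prod_beta
    by (intro borel_measurable_divide measurable_norm_compose borel_measurable_diff borel_measurable_scaleR
        borel_measurable_const f)
  then have "(\<lambda>y. \<integral>z. \<phi> z / norm (r *\<^sub>R y - z) \<partial>sphere_measure r) \<in> borel_measurable \<sigma>"
    by (rule R.borel_measurable_lebesgue_integral)
  then show ?thesis
    unfolding single_layer_def by (intro borel_measurable_times borel_measurable_const)
qed

text \<open>Schur's test. The kernel has bounded integrals in either variable (\<open>K1\<close> and
  \<open>K2\<close>); Cauchy-Schwarz with the kernel split into two square roots, followed by
  Tonelli's theorem, bounds the operator by the geometric mean of the two.\<close>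

lemma single_layer_L2_bound:
  assumes r: "0 < r" and phi: "\<phi> \<in> L2 (sphere_measure r)"
  shows "(\<lambda>y. single_layer r \<phi> (r *\<^sub>R y)) \<in> L2 \<sigma>"
    and "L2_norm \<sigma> (\<lambda>y. single_layer r \<phi> (r *\<^sub>R y)) \<le> total_area / (4 * pi) * L2_norm (sphere_measure r) \<phi>"
proof -
  interpret R: finite_measure "sphere_measure r"
    by (rule finite_measure_sphere) (use r in simp)
  interpret P: pair_sigma_finite \<sigma> "sphere_measure r" ..
  let ?g = "\<lambda>y. single_layer r \<phi> (r *\<^sub>R y)"
  let ?R = "sphere_measure r"
  note phim = L2D(1)[OF phi]
  have gm: "?g \<in> borel_measurable \<sigma>" by (rule single_layer_measurable[OF r phim])
  have id1: "(\<lambda>x. x) \<in> \<sigma> \<rightarrow>\<^sub>M borel" and id2: "(\<lambda>x. x) \<in> ?R \<rightarrow>\<^sub>M borel"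
    by (rule id_measurable_sphere)+
  have k2: "(\<lambda>z. 1 / norm (r *\<^sub>R y - z)) \<in> borel_measurable ?R" for y
    by (intro borel_measurable_divide measurable_norm_compose borel_measurable_diff borel_measurable_const id2)
  have K1: "(\<integral>\<^sup>+z. ennreal (1 / norm (r *\<^sub>R y - z)) \<partial>?R) \<le> ennreal (r * total_area)" if y: "y \<in> \<S>" for y
  proof -
    have "norm (r *\<^sub>R y - r *\<^sub>R z) = r * norm (y - z)" for z
      using r by (simp add: scaleR_diff_right[symmetric])
    then have e: "ennreal (1 / norm (r *\<^sub>R y - r *\<^sub>R z)) = ennreal (1 / r) * ennreal (1 / norm (y - z))" for z
      using r by (simp add: ennreal_mult[symmetric])
    have "(\<integral>\<^sup>+z. ennreal (1 / norm (r *\<^sub>R y - z)) \<partial>?R)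
        = ennreal (r\<^sup>2) * (\<integral>\<^sup>+z. ennreal (1 / r) * ennreal (1 / norm (y - z)) \<partial>\<sigma>)"
      by (subst nn_integral_sphere_scaling[OF r]) (use k2 in \<open>simp_all add: e\<close>)
    also have "\<dots> = ennreal (r\<^sup>2) * (ennreal (1 / r) * (\<integral>\<^sup>+z. ennreal (1 / norm (y - z)) \<partial>\<sigma>))"
      by (subst nn_integral_cmult)
         (intro measurable_compose[OF _ measurable_ennreal] borel_measurable_divide measurable_norm_compose
          borel_measurable_diff borel_measurable_const id1, simp)
    also have "\<dots> \<le> ennreal (r\<^sup>2) * (ennreal (1 / r) * ennreal total_area)"
      by (intro mult_left_mono nn_integral_newton_bound y) auto
    also have "\<dots> = ennreal (r * total_area)"
      using r total_area_pos by (simp add: ennreal_mult[symmetric] power2_eq_square)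
    finally show ?thesis .
  qed
  have K2: "(\<integral>\<^sup>+y. ennreal (1 / norm (r *\<^sub>R y - z)) \<partial>\<sigma>) \<le> ennreal (total_area / r)" if z: "z \<in> sphere 0 r" for z
  proof -
    define v where "v = (1 / r) *\<^sub>R z"
    have v: "v \<in> \<S>" "z = r *\<^sub>R v" using z r by (auto simp: v_def)
    have "norm (r *\<^sub>R y - z) = r * norm (v - y)" for y
      unfolding v(2) using r by (simp add: scaleR_diff_right[symmetric] norm_minus_commute)
    then have e: "ennreal (1 / norm (r *\<^sub>R y - z)) = ennreal (1 / r) * ennreal (1 / norm (v - y))" for y
      using r by (simp add: ennreal_mult[symmetric])
    have "(\<integral>\<^sup>+y. ennreal (1 / norm (r *\<^sub>R y - z)) \<partial>\<sigma>) = ennreal (1 / r) * (\<integral>\<^sup>+y. ennreal (1 / norm (v - y)) \<partial>\<sigma>)"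
      unfolding e
      by (subst nn_integral_cmult)
         (intro measurable_compose[OF _ measurable_ennreal] borel_measurable_divide measurable_norm_compose
          borel_measurable_diff borel_measurable_const id1, simp)
    also have "\<dots> \<le> ennreal (1 / r) * ennreal total_area"
      by (intro mult_left_mono nn_integral_newton_bound v) auto
    finally show ?thesis
      using r total_area_pos by (simp add: ennreal_mult[symmetric])
  qed
  define A where "A y = (\<integral>\<^sup>+z. ennreal ((\<phi> z)\<^sup>2 / norm (r *\<^sub>R y - z)) \<partial>?R)" for y
  have sq: "ennreal ((?g y)\<^sup>2) \<le> ennreal (r * total_area / (4 * pi)\<^sup>2) * A y" if y: "y \<in> \<S>" for y
  proof -
    let ?d = "\<lambda>z. norm (r *\<^sub>R y - z)"
    have "ennreal \<bar>\<integral>z. \<phi> z / ?d z \<partial>?R\<bar> \<le> (\<integral>\<^sup>+z. ennreal \<bar>\<phi> z / ?d z\<bar> \<partial>?R)"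
    \<comment> \<open>Without integrability the Bochner integral is 0 by convention and the bound is
      trivial.\<close>
    proof (cases "integrable ?R (\<lambda>z. \<phi> z / ?d z)")
      case True
      from integral_norm_bound_ennreal[OF this] show ?thesis by simp
    next
      case False
      then show ?thesis by (simp add: not_integrable_integral_eq)
    qed
    also have "\<dots> = (\<integral>\<^sup>+z. ennreal (\<bar>\<phi> z\<bar> / sqrt (?d z)) * ennreal (1 / sqrt (?d z)) \<partial>?R)"
      by (intro nn_integral_cong) (simp add: ennreal_mult[symmetric])
    finally have "(ennreal \<bar>\<integral>z. \<phi> z / ?d z \<partial>?R\<bar>)\<^sup>2
        \<le> (\<integral>\<^sup>+z. ennreal (\<bar>\<phi> z\<bar> / sqrt (?d z)) * ennreal (1 / sqrt (?d z)) \<partial>?R)\<^sup>2"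
      by (rule power_mono) simp
    also have "\<dots> \<le> (\<integral>\<^sup>+z. (ennreal (\<bar>\<phi> z\<bar> / sqrt (?d z)))\<^sup>2 \<partial>?R) * (\<integral>\<^sup>+z. (ennreal (1 / sqrt (?d z)))\<^sup>2 \<partial>?R)"
      by (rule Cauchy_Schwarz_nn_integral; intro measurable_compose[OF _ measurable_ennreal] borel_measurable_divide
          measurable_sqrt_compose measurable_abs_compose phim measurable_norm_compose borel_measurable_diff borel_measurable_const id2)
    also have "(\<integral>\<^sup>+z. (ennreal (\<bar>\<phi> z\<bar> / sqrt (?d z)))\<^sup>2 \<partial>?R) = A y"
      unfolding A_def by (intro nn_integral_cong) (simp add: ennreal_power power_divide)
    also have "(\<integral>\<^sup>+z. (ennreal (1 / sqrt (?d z)))\<^sup>2 \<partial>?R) = (\<integral>\<^sup>+z. ennreal (1 / ?d z) \<partial>?R)"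
      by (intro nn_integral_cong) (simp add: ennreal_power power_divide)
    also have "A y * (\<integral>\<^sup>+z. ennreal (1 / ?d z) \<partial>?R) \<le> A y * ennreal (r * total_area)"
      by (intro mult_left_mono K1 y) simp
    finally have 1: "ennreal ((\<integral>z. \<phi> z / ?d z \<partial>?R)\<^sup>2) \<le> A y * ennreal (r * total_area)"
      by (simp add: ennreal_power)
    have "(?g y)\<^sup>2 = (1 / (4 * pi)\<^sup>2) * (\<integral>z. \<phi> z / ?d z \<partial>?R)\<^sup>2"
      by (simp add: single_layer_def power_mult_distrib power_divide)
    then have "ennreal ((?g y)\<^sup>2) = ennreal (1 / (4 * pi)\<^sup>2) * ennreal ((\<integral>z. \<phi> z / ?d z \<partial>?R)\<^sup>2)"
      by (simp add: ennreal_mult[symmetric])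
    also have "\<dots> \<le> ennreal (1 / (4 * pi)\<^sup>2) * (A y * ennreal (r * total_area))"
      by (intro mult_left_mono 1) simp
    also have "\<dots> = (ennreal (1 / (4 * pi)\<^sup>2) * ennreal (r * total_area)) * A y"
      by (simp only: mult_ac)
    also have "ennreal (1 / (4 * pi)\<^sup>2) * ennreal (r * total_area) = ennreal (r * total_area / (4 * pi)\<^sup>2)"
      using r total_area_pos by (simp add: ennreal_mult[symmetric])
    finally show ?thesis .
  qed
  have Fm: "(\<lambda>(y, z). ennreal ((\<phi> z)\<^sup>2 / norm (r *\<^sub>R y - z))) \<in> borel_measurable (\<sigma> \<Otimes>\<^sub>M ?R)"
    unfolding case_prod_beta
    by (intro measurable_compose[OF _ measurable_ennreal] borel_measurable_divide borel_measurable_power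
        measurable_norm_compose borel_measurable_diff borel_measurable_scaleR borel_measurable_const
        measurable_compose[OF measurable_snd phim] measurable_compose[OF measurable_fst id1] measurable_compose[OF measurable_snd id2])
  have Am: "A \<in> borel_measurable \<sigma>"
    unfolding A_def using R.borel_measurable_nn_integral[OF Fm] .
  have "(\<integral>\<^sup>+y. A y \<partial>\<sigma>) = (\<integral>\<^sup>+z. \<integral>\<^sup>+y. ennreal ((\<phi> z)\<^sup>2 / norm (r *\<^sub>R y - z)) \<partial>\<sigma> \<partial>?R)"
    unfolding A_def using P.Fubini[OF Fm] by simp
  also have "\<dots> \<le> (\<integral>\<^sup>+z. ennreal (total_area / r) * ennreal ((\<phi> z)\<^sup>2) \<partial>?R)"
  proof (rule nn_integral_mono)
    fix z assume "z \<in> space ?R"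
    then have z: "z \<in> sphere 0 r" by simp
    have "(\<integral>\<^sup>+y. ennreal ((\<phi> z)\<^sup>2 / norm (r *\<^sub>R y - z)) \<partial>\<sigma>)
        = (\<integral>\<^sup>+y. ennreal ((\<phi> z)\<^sup>2) * ennreal (1 / norm (r *\<^sub>R y - z)) \<partial>\<sigma>)"
      by (intro nn_integral_cong) (simp add: ennreal_mult[symmetric])
    also have "\<dots> = ennreal ((\<phi> z)\<^sup>2) * (\<integral>\<^sup>+y. ennreal (1 / norm (r *\<^sub>R y - z)) \<partial>\<sigma>)"
      by (subst nn_integral_cmult)
         (intro measurable_compose[OF _ measurable_ennreal] borel_measurable_divide measurable_norm_compose
          borel_measurable_diff borel_measurable_scaleR borel_measurable_const id1, simp)
    also have "\<dots> \<le> ennreal ((\<phi> z)\<^sup>2) * ennreal (total_area / r)"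
      by (intro mult_left_mono K2 z) simp
    finally show "(\<integral>\<^sup>+y. ennreal ((\<phi> z)\<^sup>2 / norm (r *\<^sub>R y - z)) \<partial>\<sigma>) \<le> ennreal (total_area / r) * ennreal ((\<phi> z)\<^sup>2)"
      by (simp add: mult.commute)
  qed
  also have "\<dots> = ennreal (total_area / r) * (\<integral>\<^sup>+z. ennreal ((\<phi> z)\<^sup>2) \<partial>?R)"
    by (rule nn_integral_cmult) (intro measurable_compose[OF _ measurable_ennreal] borel_measurable_power phim)
  also have "(\<integral>\<^sup>+z. ennreal ((\<phi> z)\<^sup>2) \<partial>?R) = ennreal ((L2_norm ?R \<phi>)\<^sup>2)"
    using L2D(2)[OF phi] unfolding L2_norm_sq ip_def
    by (subst nn_integral_eq_integral) (simp_all add: power2_eq_square)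
  finally have A: "(\<integral>\<^sup>+y. A y \<partial>\<sigma>) \<le> ennreal (total_area / r) * ennreal ((L2_norm ?R \<phi>)\<^sup>2)" .
  have "(\<integral>\<^sup>+y. ennreal ((?g y)\<^sup>2) \<partial>\<sigma>) \<le> (\<integral>\<^sup>+y. ennreal (r * total_area / (4 * pi)\<^sup>2) * A y \<partial>\<sigma>)"
    by (rule nn_integral_mono) (use sq in simp)
  also have "\<dots> = ennreal (r * total_area / (4 * pi)\<^sup>2) * (\<integral>\<^sup>+y. A y \<partial>\<sigma>)"
    by (rule nn_integral_cmult[OF Am])
  also have "\<dots> \<le> ennreal (r * total_area / (4 * pi)\<^sup>2) * (ennreal (total_area / r) * ennreal ((L2_norm ?R \<phi>)\<^sup>2))"
    by (intro mult_left_mono A) simp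
  also have "\<dots> = ennreal ((r * total_area / (4 * pi)\<^sup>2) * ((total_area / r) * (L2_norm ?R \<phi>)\<^sup>2))"
    using r total_area_pos by (simp add: ennreal_mult[symmetric])
  also have "(r * total_area / (4 * pi)\<^sup>2) * ((total_area / r) * (L2_norm ?R \<phi>)\<^sup>2) = (total_area / (4 * pi) * L2_norm ?R \<phi>)\<^sup>2"
    using r by (simp add: power_mult_distrib power_divide power2_eq_square)
  finally have B: "(\<integral>\<^sup>+y. ennreal ((?g y)\<^sup>2) \<partial>\<sigma>) \<le> ennreal ((total_area / (4 * pi) * L2_norm ?R \<phi>)\<^sup>2)" .
  have int: "integrable \<sigma> (\<lambda>y. (?g y)\<^sup>2)"
  proof (rule integrableI_bounded)
    show "(\<lambda>y. (?g y)\<^sup>2) \<in> borel_measurable \<sigma>" by (intro borel_measurable_power gm)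
    have "(\<integral>\<^sup>+y. ennreal (norm ((?g y)\<^sup>2)) \<partial>\<sigma>) = (\<integral>\<^sup>+y. ennreal ((?g y)\<^sup>2) \<partial>\<sigma>)" by simp
    also have "\<dots> < \<infinity>" using B by (rule order.strict_trans1) simp
    finally show "(\<integral>\<^sup>+y. ennreal (norm ((?g y)\<^sup>2)) \<partial>\<sigma>) < \<infinity>" .
  qed
  then show gL: "?g \<in> L2 \<sigma>" using gm by (simp add: L2_def)
  have "ennreal ((L2_norm \<sigma> ?g)\<^sup>2) = (\<integral>\<^sup>+y. ennreal ((?g y)\<^sup>2) \<partial>\<sigma>)"
    using int unfolding L2_norm_sq ip_def
    by (subst nn_integral_eq_integral) (simp_all add: power2_eq_square)
  then have "ennreal ((L2_norm \<sigma> ?g)\<^sup>2) \<le> ennreal ((total_area / (4 * pi) * L2_norm ?R \<phi>)\<^sup>2)"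
    using B by (simp only:)
  then have "(L2_norm \<sigma> ?g)\<^sup>2 \<le> (total_area / (4 * pi) * L2_norm ?R \<phi>)\<^sup>2"
    by (simp only: ennreal_le_iff[OF zero_le_power2])
  then show "L2_norm \<sigma> ?g \<le> total_area / (4 * pi) * L2_norm ?R \<phi>"
    by (rule power2_le_imp_le) (use total_area_pos in \<open>simp add: L2_norm_nonneg\<close>)
qed

section \<open>Coefficients of a potential on concentric spheres\<close>

context sh_base
begin

definition ap :: "(real^3 \<Rightarrow> real) \<Rightarrow> nat \<times> int \<Rightarrow> real" where
  "ap u = (\<lambda>(n, k). ip \<sigma> u (Yp n k))"

lemma radial_coefficients:
  assumes r: "1 < r" and u: "harmonic_on (ball 0 r) u" and i: "(n, k) \<in> sh_index"
  shows "0 < \<rho> \<Longrightarrow> \<rho> < r \<Longrightarrow> ip \<sigma> (\<lambda>y. u (\<rho> *\<^sub>R y)) (Yp n k) = ap u (n, k) * \<rho> ^ n"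
    and "ip \<sigma> (\<lambda>y. y \<bullet> grad u y) (Yp n k) = real n * ap u (n, k)"
    and "ip \<sigma> (\<lambda>y. y \<bullet> hess u y y) (Yp n k) = real n * (real n - 1) * ap u (n, k)"
proof -
  interpret rad: radial r u n "Yp n k"
    using r u Yp(1)[OF i] by unfold_locales auto
  obtain a where a: "\<And>\<rho>. 0 < \<rho> \<Longrightarrow> \<rho> < r \<Longrightarrow> rad.c0 \<rho> = a * \<rho> ^ n"
    "\<And>\<rho>. 0 < \<rho> \<Longrightarrow> \<rho> < r \<Longrightarrow> \<rho> * rad.c1 \<rho> = real n * a * \<rho> ^ n"
    "\<And>\<rho>. 0 < \<rho> \<Longrightarrow> \<rho> < r \<Longrightarrow> \<rho>\<^sup>2 * rad.c2 \<rho> = real n * (real n - 1) * a * \<rho> ^ n"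
    using rad.radial_power by metis
  have "a = ap u (n, k)"
    using a(1)[of 1] r by (simp add: rad.c0_def ap_def ip_def)
  then show "0 < \<rho> \<Longrightarrow> \<rho> < r \<Longrightarrow> ip \<sigma> (\<lambda>y. u (\<rho> *\<^sub>R y)) (Yp n k) = ap u (n, k) * \<rho> ^ n"
    and "ip \<sigma> (\<lambda>y. y \<bullet> grad u y) (Yp n k) = real n * ap u (n, k)"
    and "ip \<sigma> (\<lambda>y. y \<bullet> hess u y y) (Yp n k) = real n * (real n - 1) * ap u (n, k)"
    using a(1)[of \<rho>] a(2)[of 1] a(3)[of 1] r
    by (simp_all add: rad.c0_def rad.c1_def rad.c2_def ip_def)
qed

lemma harmonic_ray_continuous:
  assumes "harmonic_on (ball 0 r) u" "\<bar>\<rho>\<bar> < r"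
  shows "continuous_on \<S> (\<lambda>y. u (\<rho> *\<^sub>R y))" "continuous_on \<S> (\<lambda>y. grad u (\<rho> *\<^sub>R y))"
    "continuous_on \<S> (\<lambda>y. hess u (\<rho> *\<^sub>R y) y)"
proof -
  interpret rad: radial r u 0 "\<lambda>_. 1"
    using assms solid_harmonic_one by unfold_locales auto
  show "continuous_on \<S> (\<lambda>y. u (\<rho> *\<^sub>R y))" "continuous_on \<S> (\<lambda>y. grad u (\<rho> *\<^sub>R y))"
    "continuous_on \<S> (\<lambda>y. hess u (\<rho> *\<^sub>R y) y)"
    by (rule rad.continuous_ray[OF assms(2)])+
qed

lemma dilation_bessel:
  assumes r: "1 < r" and u: "harmonic_on (ball 0 r) u" and \<rho>: "0 < \<rho>" "\<rho> < r"
  shows "(\<Sum>n<N. \<Sum>k=-int n..int n. (ap u (n, k) * \<rho> ^ n)\<^sup>2) \<le> (\<integral>y. (u (\<rho> *\<^sub>R y))\<^sup>2 \<partial>\<sigma>)"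
proof -
  have L: "(\<lambda>y. u (\<rho> *\<^sub>R y)) \<in> L2 \<sigma>"
    by (intro continuous_L2 harmonic_ray_continuous[OF u]) (use \<rho> in auto)
  have "(\<Sum>n<N. \<Sum>k=-int n..int n. (ap u (n, k) * \<rho> ^ n)\<^sup>2)
      = (\<Sum>n<N. \<Sum>k=-int n..int n. (ip \<sigma> (\<lambda>y. u (\<rho> *\<^sub>R y)) (Yp n k))\<^sup>2)"
    by (intro sum.cong refl) (simp add: radial_coefficients(1)[OF r u sh_indexI \<rho>])
  also have "\<dots> \<le> (L2_norm \<sigma> (\<lambda>y. u (\<rho> *\<^sub>R y)))\<^sup>2"
    by (rule scalar_bessel[OF L])
  finally show ?thesis
    unfolding L2_norm_sq_real .
qed

text \<open>The mean value theorem along the ray, which stays in the approach region of its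
  endpoint. The maximal function of the gradient thus provides one square-integrable majorant for u
  on all smaller spheres.\<close>

lemma ray_dominated:
  assumes r: "0 < r" and u: "harmonic_on (ball 0 r) u" and y: "y \<in> \<S>" and \<rho>: "0 \<le> \<rho>" "\<rho> < r"
    and fin: "nt_maximal r (grad u) (r *\<^sub>R y) < \<infinity>"
  shows "\<bar>u (\<rho> *\<^sub>R y)\<bar> \<le> \<bar>u 0\<bar> + r * enn2real (nt_maximal r (grad u) (r *\<^sub>R y))"
proof (cases "\<rho> = 0")
  case True
  then show ?thesis using r by simp
next
  case False
  have C2: "C2_on (ball 0 r) u" using u by (simp add: harmonic_on_iff)
  have D: "((\<lambda>t. u (t *\<^sub>R y)) has_field_derivative (y \<bullet> grad u (t *\<^sub>R y))) (at t)" if "0 \<le> t" "t \<le> \<rho>" for t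
    by (rule C2_ray_derivatives(1)[OF C2]) (use that \<rho> y in simp)
  obtain \<xi> where \<xi>: "0 < \<xi>" "\<xi> < \<rho>" "u (\<rho> *\<^sub>R y) - u (0 *\<^sub>R y) = (\<rho> - 0) * (y \<bullet> grad u (\<xi> *\<^sub>R y))"
    using MVT2[of 0 \<rho> "\<lambda>t. u (t *\<^sub>R y)" "\<lambda>t. y \<bullet> grad u (t *\<^sub>R y)"] D False \<rho> by auto
  have "\<xi> *\<^sub>R y \<in> nt_region r (r *\<^sub>R y)"
    by (rule radial_in_nt_region[OF y]) (use \<xi> \<rho> in auto)
  then have "ennreal (norm (grad u (\<xi> *\<^sub>R y))) \<le> nt_maximal r (grad u) (r *\<^sub>R y)"
    unfolding nt_maximal_def by (rule SUP_upper)
  then have "norm (grad u (\<xi> *\<^sub>R y)) \<le> enn2real (nt_maximal r (grad u) (r *\<^sub>R y))"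
    using fin enn2real_mono[of "ennreal (norm (grad u (\<xi> *\<^sub>R y)))" "nt_maximal r (grad u) (r *\<^sub>R y)"] by simp
  moreover have "\<bar>y \<bullet> grad u (\<xi> *\<^sub>R y)\<bar> \<le> norm (grad u (\<xi> *\<^sub>R y))"
    using Cauchy_Schwarz_ineq2[of y "grad u (\<xi> *\<^sub>R y)"] y by simp
  ultimately have "\<rho> * \<bar>y \<bullet> grad u (\<xi> *\<^sub>R y)\<bar> \<le> r * enn2real (nt_maximal r (grad u) (r *\<^sub>R y))"
    using \<rho> by (intro mult_mono) auto
  moreover have "\<bar>u (\<rho> *\<^sub>R y)\<bar> \<le> \<bar>u 0\<bar> + \<rho> * \<bar>y \<bullet> grad u (\<xi> *\<^sub>R y)\<bar>"
    using \<xi>(3) \<rho> abs_triangle_ineq[of "u 0" "\<rho> * (y \<bullet> grad u (\<xi> *\<^sub>R y))"] by (simp add: abs_mult)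
  ultimately show ?thesis by linarith
qed

text \<open>For radii rho < r this is Bessel's inequality for u on the sphere of radius rho. As rho
  tends to r, the values along each ray tend almost everywhere to the trace, which is the single
  layer; the majorant of \<open>ray_dominated\<close> lets the integrals follow, and
  \<open>single_layer_L2_bound\<close> finishes.\<close>

lemma density_coefficient_bound:
  assumes r: "1 < r" and pot: "is_potential Y r f u" and dens: "is_density r u \<phi>"
  shows "(\<Sum>n<N. \<Sum>k=-int n..int n. (ap u (n, k) * r ^ n)\<^sup>2)
    \<le> (total_area / (4 * pi) * L2_norm (sphere_measure r) \<phi>)\<^sup>2"
proof -
  have r0: "0 < r" using r by simp
  have u: "harmonic_on (ball 0 r) u" using pot by (simp add: is_potential_def)
  have phi: "\<phi> \<in> L2 (sphere_measure r)" using dens by (simp add: is_density_def)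
  define g where "g y = single_layer r \<phi> (r *\<^sub>R y)" for y
  have gL: "g \<in> L2 \<sigma>" and gb: "L2_norm \<sigma> g \<le> total_area / (4 * pi) * L2_norm (sphere_measure r) \<phi>"
    unfolding g_def[abs_def] by (rule single_layer_L2_bound[OF r0 phi])+
  have lim: "AE y in \<sigma>. (u \<longlongrightarrow> g y) (at (r *\<^sub>R y) within nt_region r (r *\<^sub>R y))"
    unfolding g_def
    by (rule AE_sphere_scaling[OF r0]) (use dens in \<open>simp add: is_density_def has_boundary_trace_def\<close>)
  define H where "H y = nt_maximal r (grad u) (r *\<^sub>R y)" for y
  have Hm: "H \<in> borel_measurable \<sigma>"
    unfolding H_def by (rule measurable_compose[OF scaling_measurable_sphere[OF r0] nt_maximal_measurable])
  have "(\<integral>\<^sup>+y. (nt_maximal r (grad u) y)\<^sup>2 \<partial>sphere_measure r) = ennreal (r\<^sup>2) * (\<integral>\<^sup>+y. (H y)\<^sup>2 \<partial>\<sigma>)"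
    unfolding H_def
    by (rule nn_integral_sphere_scaling[OF r0]) (intro borel_measurable_power_ennreal nt_maximal_measurable)
  moreover have "(\<integral>\<^sup>+y. (nt_maximal r (grad u) y)\<^sup>2 \<partial>sphere_measure r) < \<infinity>"
    using pot by (simp add: is_potential_def)
  ultimately have "ennreal (r\<^sup>2) * (\<integral>\<^sup>+y. (H y)\<^sup>2 \<partial>\<sigma>) < \<infinity>" by simp
  then have H2: "(\<integral>\<^sup>+y. (H y)\<^sup>2 \<partial>\<sigma>) < \<infinity>"
    using r by (auto simp: ennreal_mult_less_top)
  have H2m: "(\<lambda>y. (H y)\<^sup>2) \<in> borel_measurable \<sigma>" by (intro borel_measurable_power_ennreal Hm)
  have "AE y in \<sigma>. (H y)\<^sup>2 \<noteq> \<infinity>"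
    by (rule nn_integral_PInf_AE[OF H2m]) (use H2 in simp)
  then have fin: "AE y in \<sigma>. H y < \<infinity>"
    by eventually_elim (auto simp: top.not_eq_extremum power2_eq_square ennreal_mult_eq_top_iff)
  \<comment> \<open>Passing to real values changes the maximal function only where it is infinite,
    which is a null set.\<close>
  define h where "h y = enn2real (H y)" for y
  have hm: "h \<in> borel_measurable \<sigma>" unfolding h_def using Hm by simp
  have "integrable \<sigma> (\<lambda>y. (h y)\<^sup>2)"
  proof (rule integrableI_bounded)
    show "(\<lambda>y. (h y)\<^sup>2) \<in> borel_measurable \<sigma>" by (intro borel_measurable_power hm)
    have "(\<integral>\<^sup>+y. ennreal (norm ((h y)\<^sup>2)) \<partial>\<sigma>) \<le> (\<integral>\<^sup>+y. (H y)\<^sup>2 \<partial>\<sigma>)"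
    proof (rule nn_integral_mono)
      fix y
      have "ennreal (h y) \<le> H y" unfolding h_def by (cases "H y") auto
      then have "(ennreal (h y))\<^sup>2 \<le> (H y)\<^sup>2" by (rule power_mono) simp
      then show "ennreal (norm ((h y)\<^sup>2)) \<le> (H y)\<^sup>2"
        by (simp add: ennreal_power h_def)
    qed
    then show "(\<integral>\<^sup>+y. ennreal (norm ((h y)\<^sup>2)) \<partial>\<sigma>) < \<infinity>" using H2 by (rule order.strict_trans1)
  qed
  then have hL: "h \<in> L2 \<sigma>" using hm by (simp add: L2_def)
  define W where "W y = \<bar>u 0\<bar> + r * h y" for y
  have WL: "W \<in> L2 \<sigma>"
    unfolding W_def using L2_add[OF L2_norm_const(1)[OF sigma.finite_measure_axioms] L2_scaleR[OF hL, of r], of "\<bar>u 0\<bar>"]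
    by simp
  define s where "s j = r * (1 - 1 / (real j + 2))" for j :: nat
  have s: "0 < s j" "s j < r" for j
  proof -
    have "0 < 1 - 1 / (real j + 2)" "1 - 1 / (real j + 2) < 1" by (auto simp: field_simps)
    then show "0 < s j" "s j < r" using r0 by (auto simp: s_def)
  qed
  have slim: "s \<longlonglongrightarrow> r"
  proof -
    have "(\<lambda>j. 1 - 1 / (real j + 2)) \<longlonglongrightarrow> 1" by real_asymp
    from tendsto_mult[OF tendsto_const this, of r] show ?thesis by (simp add: s_def[abs_def])
  qed
  have lim1: "(\<lambda>j. \<integral>y. (u (s j *\<^sub>R y))\<^sup>2 \<partial>\<sigma>) \<longlonglongrightarrow> (\<integral>y. (g y)\<^sup>2 \<partial>\<sigma>)"
  proof (rule integral_dominated_convergence[where w="\<lambda>y. (W y)\<^sup>2"])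
    show "(\<lambda>y. (g y)\<^sup>2) \<in> borel_measurable \<sigma>" by (intro borel_measurable_power L2D(1)[OF gL])
    show "(\<lambda>y. (u (s j *\<^sub>R y))\<^sup>2) \<in> borel_measurable \<sigma>" for j
      by (intro borel_measurable_power continuous_sphere_measurable harmonic_ray_continuous[OF u])
         (use s[of j] in auto)
    show "integrable \<sigma> (\<lambda>y. (W y)\<^sup>2)" using L2D(2)[OF WL] by simp
    show "AE y in \<sigma>. (\<lambda>j. (u (s j *\<^sub>R y))\<^sup>2) \<longlonglongrightarrow> (g y)\<^sup>2"
      using lim AE_space
    proof eventually_elim
      case (elim y)
      then have y: "y \<in> \<S>" by simp
      have "filterlim (\<lambda>j. s j *\<^sub>R y) (at (r *\<^sub>R y) within nt_region r (r *\<^sub>R y)) sequentially"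
        unfolding filterlim_at
      proof
        show "\<forall>\<^sub>F j in sequentially. s j *\<^sub>R y \<in> nt_region r (r *\<^sub>R y) \<and> s j *\<^sub>R y \<noteq> r *\<^sub>R y"
        proof (rule always_eventually, rule allI, rule conjI)
          fix j
          show "s j *\<^sub>R y \<in> nt_region r (r *\<^sub>R y)"
            by (rule radial_in_nt_region[OF y]) (use s[of j] in auto)
          show "s j *\<^sub>R y \<noteq> r *\<^sub>R y"
            using s[of j] y by auto
        qed
        show "(\<lambda>j. s j *\<^sub>R y) \<longlonglongrightarrow> r *\<^sub>R y" by (intro tendsto_intros slim)
      qed
      from filterlim_compose[OF elim(1) this] show ?case by (intro tendsto_power)
    qed
    show "AE y in \<sigma>. norm ((u (s j *\<^sub>R y))\<^sup>2) \<le> (W y)\<^sup>2" for j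
      using fin AE_space
    proof eventually_elim
      case (elim y)
      then have "\<bar>u (s j *\<^sub>R y)\<bar> \<le> W y"
        unfolding W_def h_def H_def using s[of j] by (intro ray_dominated[OF r0 u]) (auto simp: H_def)
      then have "\<bar>u (s j *\<^sub>R y)\<bar>\<^sup>2 \<le> (W y)\<^sup>2" by (intro power_mono) auto
      then show ?case by simp
    qed
  qed
  have lim2: "(\<lambda>j. \<Sum>n<N. \<Sum>k=-int n..int n. (ap u (n, k) * s j ^ n)\<^sup>2)
      \<longlonglongrightarrow> (\<Sum>n<N. \<Sum>k=-int n..int n. (ap u (n, k) * r ^ n)\<^sup>2)"
    by (intro tendsto_intros slim)
  have "(\<Sum>n<N. \<Sum>k=-int n..int n. (ap u (n, k) * r ^ n)\<^sup>2) \<le> (\<integral>y. (g y)\<^sup>2 \<partial>\<sigma>)"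
    by (rule LIMSEQ_le[OF lim2 lim1], intro exI allI impI, rule dilation_bessel[OF r u s])
  also have "\<dots> = (L2_norm \<sigma> g)\<^sup>2"
    unfolding L2_norm_sq_real ..
  also have "\<dots> \<le> (total_area / (4 * pi) * L2_norm (sphere_measure r) \<phi>)\<^sup>2"
    using gb by (rule power_mono) (rule L2_norm_nonneg)
  finally show ?thesis .
qed

end

section \<open>Fields of external and of internal sources\<close>

context sh_base
begin

text \<open>The squared norm of \<open>grad (Yp n k)\<close> on the sphere; it vanishes in degree
  0.\<close>

definition wE :: "nat \<times> int \<Rightarrow> real" where
  "wE i = real (fst i) * (2 * real (fst i) + 1)"

lemma scalar_parseval_polar:
  assumes p: "p \<in> L2 \<sigma>" and q: "q \<in> L2 \<sigma>"
  shows "(\<lambda>n. \<Sum>k=-int n..int n. ip \<sigma> p (Yp n k) * ip \<sigma> q (Yp n k)) sums ip \<sigma> p q"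
proof -
  interpret E: orthogonal_expansion \<sigma> "\<lambda>(n, k). Yp n k" "\<lambda>_. 1" p "\<lambda>(n, k). ip \<sigma> p (Yp n k)"
    by (rule scalar_expansion[OF p])
  have "(\<lambda>N. ip \<sigma> q (E.part N)) \<longlonglongrightarrow> ip \<sigma> q p"
    by (rule E.ip_part_tendsto[OF Yp_span[OF p] q])
  moreover have "ip \<sigma> q (E.part N) = (\<Sum>n<N. \<Sum>k=-int n..int n. ip \<sigma> p (Yp n k) * ip \<sigma> q (Yp n k))" for N
  proof -
    have "ip \<sigma> q (E.part N) = (\<Sum>i\<in>sh_block N. (case i of (n, k) \<Rightarrow> ip \<sigma> p (Yp n k)) * ip \<sigma> q (case i of (n, k) \<Rightarrow> Yp n k))"
      unfolding E.part_def by (rule ip_sum_right[OF q E.block(1)])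
    then show ?thesis by (simp add: sum_sh_block)
  qed
  ultimately show ?thesis by (simp add: sums_def ip_commute[of \<sigma> q p])
qed

end

locale plus_field = sh_base +
  fixes r :: real and f :: "real^3 \<Rightarrow> real^3" and u :: "real^3 \<Rightarrow> real"
  assumes r: "1 < r" and fL: "f \<in> L2 \<sigma>" and u: "harmonic_on (ball 0 r) u" and fu: "AE x in \<sigma>. f x = grad u x"
begin

lemma u_C2: "C2_on (ball 0 r) u"
  using u by (simp add: harmonic_on_iff)

lemma sphere_sub: "\<S> \<subseteq> ball 0 r"
  using r by auto

lemma cont: "continuous_on \<S> u" "continuous_on \<S> (grad u)" "continuous_on \<S> (\<lambda>y. hess u y y)"
  using harmonic_ray_continuous[OF u, of 1] r by simp_all

lemma u_der: "x \<in> \<S> \<Longrightarrow> (u has_derivative (\<lambda>v. grad u x \<bullet> v)) (at x)"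
  using C2_has_derivative(1)[OF u_C2] sphere_sub by blast

lemma ip_f: "g \<in> L2 \<sigma> \<Longrightarrow> ip \<sigma> f g = ip \<sigma> (grad u) g"
proof -
  assume g: "g \<in> L2 \<sigma>"
  have gu: "grad u \<in> L2 \<sigma>" by (rule continuous_L2[OF cont(2)])
  show ?thesis
    unfolding ip_def
  proof (rule integral_cong_AE)
    show "(\<lambda>x. f x \<bullet> g x) \<in> borel_measurable \<sigma>" "(\<lambda>x. grad u x \<bullet> g x) \<in> borel_measurable \<sigma>"
      using L2D(1)[OF g] L2D(1)[OF gu] L2D(1)[OF fL] by (auto intro: borel_measurable_inner)
    show "AE x in \<sigma>. f x \<bullet> g x = grad u x \<bullet> g x"
      using fu by eventually_elim simp
  qed
qed

lemma ip_f_grad: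
  assumes i: "(n, k) \<in> sh_index"
  shows "ip \<sigma> f (grad (Yp n k)) = wE (n, k) * ap u (n, k)"
proof -
  have "ip \<sigma> f (grad (Yp n k)) = (\<integral>x. grad u x \<bullet> grad (Yp n k) x \<partial>\<sigma>)"
    unfolding ip_f[OF continuous_L2[OF solid_harmonicD(7)[OF Yp(1)[OF i]]]] by (simp add: ip_def)
  also have "\<dots> = real n * (\<integral>x. (x \<bullet> grad u x) * Yp n k x \<partial>\<sigma>) + real n * (real n + 1) * (\<integral>x. u x * Yp n k x \<partial>\<sigma>)"
    by (rule integral_inner_grad_solid[OF Yp(1)[OF i] u_der cont(2)])
  also have "(\<integral>x. (x \<bullet> grad u x) * Yp n k x \<partial>\<sigma>) = real n * ap u (n, k)"
    using radial_coefficients(2)[OF r u i] by (simp add: ip_def)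
  also have "(\<integral>x. u x * Yp n k x \<partial>\<sigma>) = ap u (n, k)"
    by (simp add: ap_def ip_def)
  finally show ?thesis by (simp add: wE_def algebra_simps)
qed

sublocale E: orthogonal_expansion \<sigma> "\<lambda>(n, k). grad (Yp n k)" wE f "ap u"
proof
  show "f \<in> L2 \<sigma>" by (rule fL)
  fix i assume i: "i \<in> sh_index"
  then show "(case i of (n, k) \<Rightarrow> grad (Yp n k)) \<in> L2 \<sigma>"
    by (cases i) (auto intro: continuous_L2 solid_harmonicD(7)[OF Yp(1)])
  show "ip \<sigma> f (case i of (n, k) \<Rightarrow> grad (Yp n k)) = wE i * ap u i"
    using i by (cases i) (simp add: ip_f_grad)
  fix j assume j: "j \<in> sh_index"
  obtain n k m l where nk: "i = (n, k)" "j = (m, l)" by (cases i, cases j)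
  have "ip \<sigma> (grad (Yp n k)) (grad (Yp m l)) = real m * (2 * real m + 1) * ip \<sigma> (Yp n k) (Yp m l)"
    using integral_grad_solid_solid[OF Yp(1) Yp(1), of n k m l] i j by (simp add: nk ip_def)
  then show "ip \<sigma> (case i of (n, k) \<Rightarrow> grad (Yp n k)) (case j of (n, k) \<Rightarrow> grad (Yp n k)) = (if i = j then wE i else 0)"
    using Yp_orth[of n k m l] i j by (auto simp: nk wE_def)
qed

text \<open>The external field is given by a potential and not as a limit of the family, so
  completeness has to be proved. Split the squared norm into the radial part and the tangential
  part, which Green's identity turns into u (u'' + 2 u') with radial derivatives; expand each scalar
  product by Parseval. The degree n factor is n^2 + n (n - 1) + 2 n, which is the weight n (2 n +
  1).\<close>

lemma norm_sums: "(\<lambda>n. \<Sum>k=-int n..int n. wE (n, k) * (ap u (n, k))\<^sup>2) sums (L2_norm \<sigma> f)\<^sup>2"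
proof -
  let ?D = "\<lambda>y. y \<bullet> grad u y" and ?H = "\<lambda>y. y \<bullet> hess u y y"
  have cD: "continuous_on \<S> ?D" and cH: "continuous_on \<S> ?H"
    by (intro continuous_intros cont)+
  have DL: "?D \<in> L2 \<sigma>" and HL: "?H \<in> L2 \<sigma>" and uL: "u \<in> L2 \<sigma>"
    by (intro continuous_L2 cD cH cont)+
  have gL: "grad u \<in> L2 \<sigma>" by (rule continuous_L2[OF cont(2)])
  have "(L2_norm \<sigma> f)\<^sup>2 = ip \<sigma> (grad u) (grad u)"
    unfolding L2_norm_sq ip_f[OF fL] ip_commute[of \<sigma> "grad u" f] ip_f[OF gL] ..
  also have "\<dots> = (\<integral>y. ?D y * ?D y + cross3 y (grad u y) \<bullet> cross3 y (grad u y) \<partial>\<sigma>)"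
    unfolding ip_def by (intro Bochner_Integration.integral_cong refl cross_inner_decomposition) simp
  also have "\<dots> = (\<integral>y. ?D y * ?D y \<partial>\<sigma>) + (\<integral>y. cross3 y (grad u y) \<bullet> cross3 y (grad u y) \<partial>\<sigma>)"
    by (intro Bochner_Integration.integral_add continuous_sphere_integrable continuous_on_mult cD
        continuous_on_inner continuous_on_cross continuous_on_id cont)
  also have "(\<integral>y. cross3 y (grad u y) \<bullet> cross3 y (grad u y) \<partial>\<sigma>)
      = (\<integral>y. u y * (?H y + 2 * ?D y - laplacian u y) \<partial>\<sigma>)"
    by (rule sphere_green[OF u_der cont(2) u_C2 sphere_sub])
  also have "\<dots> = (\<integral>y. u y * ?H y + 2 * (u y * ?D y) \<partial>\<sigma>)"
    using u sphere_sub by (intro Bochner_Integration.integral_cong refl) (auto simp: harmonic_on_def distrib_left subset_iff)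
  also have "\<dots> = (\<integral>y. u y * ?H y \<partial>\<sigma>) + (\<integral>y. 2 * (u y * ?D y) \<partial>\<sigma>)"
    by (intro Bochner_Integration.integral_add continuous_sphere_integrable continuous_on_mult cD cH cont continuous_on_const)
  also have "(\<integral>y. 2 * (u y * ?D y) \<partial>\<sigma>) = 2 * (\<integral>y. u y * ?D y \<partial>\<sigma>)"
    by (rule integral_mult_right_zero)
  finally have norm: "(L2_norm \<sigma> f)\<^sup>2 = ip \<sigma> ?D ?D + (ip \<sigma> u ?H + 2 * ip \<sigma> u ?D)"
    by (simp add: ip_def)
  have "(\<lambda>n. (\<Sum>k=-int n..int n. ip \<sigma> ?D (Yp n k) * ip \<sigma> ?D (Yp n k))
      + ((\<Sum>k=-int n..int n. ip \<sigma> u (Yp n k) * ip \<sigma> ?H (Yp n k))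
        + 2 * (\<Sum>k=-int n..int n. ip \<sigma> u (Yp n k) * ip \<sigma> ?D (Yp n k))))
     sums (ip \<sigma> ?D ?D + (ip \<sigma> u ?H + 2 * ip \<sigma> u ?D))"
    by (intro sums_add sums_mult scalar_parseval_polar DL HL uL)
  moreover have "(\<Sum>k=-int n..int n. ip \<sigma> ?D (Yp n k) * ip \<sigma> ?D (Yp n k))
      + ((\<Sum>k=-int n..int n. ip \<sigma> u (Yp n k) * ip \<sigma> ?H (Yp n k))
        + 2 * (\<Sum>k=-int n..int n. ip \<sigma> u (Yp n k) * ip \<sigma> ?D (Yp n k)))
      = (\<Sum>k=-int n..int n. wE (n, k) * (ap u (n, k))\<^sup>2)" for n
  proof -
    have "ip \<sigma> ?D (Yp n k) * ip \<sigma> ?D (Yp n k) + (ip \<sigma> u (Yp n k) * ip \<sigma> ?H (Yp n k)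
        + 2 * (ip \<sigma> u (Yp n k) * ip \<sigma> ?D (Yp n k))) = wE (n, k) * (ap u (n, k))\<^sup>2"
      if "k \<in> {-int n..int n}" for k
    proof -
      have a: "ip \<sigma> u (Yp n k) = ap u (n, k)" by (simp add: ap_def)
      show ?thesis
        unfolding a radial_coefficients(2,3)[OF r u sh_indexI[OF that]]
        by (simp add: wE_def power2_eq_square algebra_simps)
    qed
    then show ?thesis
      unfolding sum_distrib_left sum.distrib[symmetric] by (intro sum.cong refl) blast
  qed
  ultimately show ?thesis by (simp add: norm)
qed

lemma part_tendsto': "(\<lambda>N. L2_norm \<sigma> (\<lambda>x. f x - E.part N x)) \<longlonglongrightarrow> 0"
proof -
  have "(\<lambda>N. (L2_norm \<sigma> f)\<^sup>2 - (\<Sum>n<N. \<Sum>k=-int n..int n. wE (n, k) * (ap u (n, k))\<^sup>2)) \<longlonglongrightarrow> (L2_norm \<sigma> f)\<^sup>2 - (L2_norm \<sigma> f)\<^sup>2"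
    using norm_sums by (intro tendsto_diff tendsto_const) (simp add: sums_def)
  then have "(\<lambda>N. (L2_norm \<sigma> (\<lambda>x. f x - E.part N x))\<^sup>2) \<longlonglongrightarrow> 0"
    unfolding E.dist_part sum_sh_block by simp
  then have "(\<lambda>N. sqrt ((L2_norm \<sigma> (\<lambda>x. f x - E.part N x))\<^sup>2)) \<longlonglongrightarrow> sqrt 0"
    by (rule tendsto_real_sqrt)
  then show ?thesis by (simp add: L2_norm_nonneg)
qed

definition Pn :: "nat \<Rightarrow> real^3 \<Rightarrow> real" where
  "Pn n = comb n (\<lambda>k. ap u (n, k))"

lemma Top_plus_outside:
  assumes w: "w \<in> \<S>" and s: "1 < s"
  shows "Top w s f = 0"
proof -
  have s': "0 \<le> s" "s \<noteq> 1" using s by auto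
  have "Top w s (E.part N) = 0" for N
    unfolding E.part_def[abs_def]
    by (subst Top_sum[OF w s' E.block(1)]) (use subsetD[OF sh_block(2)] in \<open>auto intro!: sum.neutral Top_grad_outside[OF Yp(1) w s]\<close>)
  moreover have "(\<lambda>N. Top w s (E.part N)) \<longlonglongrightarrow> Top w s f"
    by (rule Top_tendsto[OF w s' fL E.part_L2 part_tendsto'])
  ultimately show ?thesis by (simp add: LIMSEQ_const_iff)
qed

lemma Top_plus_inside:
  assumes w: "w \<in> \<S>" and s: "0 < s" "s < 1"
  shows "(\<lambda>n. real n * Pn n w * s ^ n) sums Top w s f"
proof -
  have s': "0 \<le> s" "s \<noteq> 1" using s by auto
  have "Top w s (E.part N) = (\<Sum>n<N. real n * Pn n w * s ^ n)" for N
  proof -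
    have "Top w s (E.part N) = (\<Sum>i\<in>sh_block N. ap u i * Top w s (case i of (n, k) \<Rightarrow> grad (Yp n k)))"
      unfolding E.part_def[abs_def] by (rule Top_sum[OF w s' E.block(1)])
    also have "\<dots> = (\<Sum>n<N. \<Sum>k=-int n..int n. ap u (n, k) * (real n * Yp n k w * s ^ n))"
      unfolding sum_sh_block
      by (intro sum.cong refl) (simp add: Top_grad_inside[OF Yp(1)[OF sh_indexI] w s])
    also have "\<dots> = (\<Sum>n<N. real n * Pn n w * s ^ n)"
      by (intro sum.cong refl) (simp add: Pn_def comb_def sum_distrib_left sum_distrib_right mult_ac)
    finally show ?thesis .
  qed
  moreover have "(\<lambda>N. Top w s (E.part N)) \<longlonglongrightarrow> Top w s f"
    by (rule Top_tendsto[OF w s' fL E.part_L2 part_tendsto'])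
  ultimately show ?thesis by (simp add: sums_def)
qed

end

locale minus_field = sh_base +
  fixes f :: "real^3 \<Rightarrow> real^3"
  assumes f: "f \<in> hardy_minus Y"
begin

lemma fL: "f \<in> L2 \<sigma>"
  using f by (simp add: hardy_minus_def L2_closed_span_def)

lemma fS: "f \<in> L2_closed_span \<sigma> sh_index (\<lambda>(n, k). Gp n (Yp n k))"
  using f hardy_minus_span by simp

sublocale E: orthogonal_expansion \<sigma> "\<lambda>(n, k). Gp n (Yp n k)" wG f "qm f"
  by (rule minus_expansion[OF fL])

definition Qn :: "nat \<Rightarrow> real^3 \<Rightarrow> real" where
  "Qn n = comb n (\<lambda>k. qm f (n, k))"

lemma Top_minus_inside:
  assumes w: "w \<in> \<S>" and s: "0 < s" "s < 1"
  shows "Top w s f = 0"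
proof -
  have s': "0 \<le> s" "s \<noteq> 1" using s by auto
  have "Top w s (E.part N) = 0" for N
    unfolding E.part_def[abs_def]
    by (subst Top_sum[OF w s' E.block(1)]) (use subsetD[OF sh_block(2)] in \<open>auto intro!: sum.neutral Top_Gp_inside[OF Yp(1) w s]\<close>)
  moreover have "(\<lambda>N. Top w s (E.part N)) \<longlonglongrightarrow> Top w s f"
    by (rule Top_tendsto[OF w s' fL E.part_L2 E.part_tendsto[OF fS]])
  ultimately show ?thesis by (simp add: LIMSEQ_const_iff)
qed

lemma Top_minus_outside:
  assumes w: "w \<in> \<S>" and s: "1 < s"
  shows "(\<lambda>n. (real n + 1) * Qn n w / s ^ (n + 1)) sums Top w s f"
proof -
  have s': "0 \<le> s" "s \<noteq> 1" using s by auto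
  have "Top w s (E.part N) = (\<Sum>n<N. (real n + 1) * Qn n w / s ^ (n + 1))" for N
  proof -
    have "Top w s (E.part N) = (\<Sum>i\<in>sh_block N. qm f i * Top w s (case i of (n, k) \<Rightarrow> Gp n (Yp n k)))"
      unfolding E.part_def[abs_def] by (rule Top_sum[OF w s' E.block(1)])
    also have "\<dots> = (\<Sum>n<N. \<Sum>k=-int n..int n. qm f (n, k) * ((real n + 1) * Yp n k w / s ^ (n + 1)))"
      unfolding sum_sh_block
      by (intro sum.cong refl) (simp only: prod.case Top_Gp_outside[OF Yp(1)[OF sh_indexI] w s])
    also have "\<dots> = (\<Sum>n<N. (real n + 1) * Qn n w / s ^ (n + 1))"
      by (intro sum.cong refl) (simp add: Qn_def comb_def sum_distrib_left sum_divide_distrib mult_ac)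
    finally show ?thesis .
  qed
  moreover have "(\<lambda>N. Top w s (E.part N)) \<longlonglongrightarrow> Top w s f"
    by (rule Top_tendsto[OF w s' fL E.part_L2 E.part_tendsto[OF fS]])
  ultimately show ?thesis by (simp add: sums_def)
qed

end

text \<open>Poisson's formula at s = 1 / k, where the kernel is bounded; the factor s^n of
  \<open>I1_I3_inside\<close> returns as k^n. An exponential loss with base close to 1 is harmless,
  because the series to which it is applied have a geometric margin.\<close>

lemma solid_harmonic_sup_bound:
  assumes k: "1 < k"
  obtains C where "C > 0"
    "\<And>n P w. solid_harmonic n P \<Longrightarrow> w \<in> \<S> \<Longrightarrow> \<bar>P w\<bar> \<le> C * k ^ n * L2_norm \<sigma> P"
proof -
  define s where "s = 1 / k"
  have s: "0 < s" "s < 1" using k by (auto simp: s_def)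
  define C where "C = 1 / ((1 - s) ^ 3 * total_area) * sqrt total_area"
  have "C > 0" using s total_area_pos by (simp add: C_def)
  moreover have "\<bar>P w\<bar> \<le> C * k ^ n * L2_norm \<sigma> P" if P: "solid_harmonic n P" and w: "w \<in> \<S>" for n P w
  proof -
    have cP: "continuous_on \<S> P" by (rule solid_harmonicD(5)[OF P])
    have PL: "P \<in> L2 \<sigma>" by (rule continuous_L2[OF cP])
    have "\<bar>I3 P w s\<bar> \<le> (\<integral>y. \<bar>P y / norm (w - s *\<^sub>R y) ^ 3\<bar> \<partial>\<sigma>)"
      unfolding I3_def by (rule integral_abs_bound)
    also have "\<dots> \<le> (\<integral>y. (1 / (1 - s) ^ 3) * norm (P y) \<partial>\<sigma>)"
    proof (rule integral_mono)
      show "integrable \<sigma> (\<lambda>y. \<bar>P y / norm (w - s *\<^sub>R y) ^ 3\<bar>)"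
        using kernel_integrable(1)[OF w _ _ cP, of s 3] s by (intro integrable_abs) auto
      show "integrable \<sigma> (\<lambda>y. (1 / (1 - s) ^ 3) * norm (P y))"
        by (intro integrable_mult_right integrable_norm continuous_sphere_integrable cP)
      fix y assume "y \<in> space \<sigma>"
      then have "1 - s \<le> norm (w - s *\<^sub>R y)"
        using dist_sphere_lower[OF w, of y s] s by simp
      then have "(1 - s) ^ 3 \<le> norm (w - s *\<^sub>R y) ^ 3"
        using s by (intro power_mono) auto
      then have "\<bar>P y\<bar> / norm (w - s *\<^sub>R y) ^ 3 \<le> \<bar>P y\<bar> / (1 - s) ^ 3"
        using s by (intro divide_left_mono mult_pos_pos) (auto intro: order.strict_trans2[of 0 "(1 - s) ^ 3"])
      then show "\<bar>P y / norm (w - s *\<^sub>R y) ^ 3\<bar> \<le> (1 / (1 - s) ^ 3) * norm (P y)"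
        by (simp add: abs_divide)
    qed
    also have "\<dots> = (1 / (1 - s) ^ 3) * (\<integral>y. norm (P y) \<partial>\<sigma>)"
      by (rule integral_mult_right_zero)
    also have "\<dots> \<le> (1 / (1 - s) ^ 3) * (sqrt total_area * L2_norm \<sigma> P)"
      using L1_le_L2(2)[OF sigma.finite_measure_axioms PL] s
      by (intro mult_left_mono) (auto simp: total_area_def)
    finally have I: "\<bar>I3 P w s\<bar> \<le> (1 / (1 - s) ^ 3) * (sqrt total_area * L2_norm \<sigma> P)" .
    have "\<bar>total_area * P w * s ^ n\<bar> = \<bar>1 - s\<^sup>2\<bar> * \<bar>I3 P w s\<bar>"
      unfolding I1_I3_inside(2)[OF P w s, symmetric] by (rule abs_mult)
    also have "\<dots> \<le> 1 * ((1 / (1 - s) ^ 3) * (sqrt total_area * L2_norm \<sigma> P))"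
      using s by (intro mult_mono I) (auto simp: abs_le_iff power_le_one)
    finally have "total_area * \<bar>P w\<bar> * s ^ n \<le> (1 / (1 - s) ^ 3) * (sqrt total_area * L2_norm \<sigma> P)"
      using total_area_pos s by (simp add: abs_mult)
    then have "\<bar>P w\<bar> * (total_area * s ^ n) \<le> (1 / (1 - s) ^ 3) * (sqrt total_area * L2_norm \<sigma> P)"
      by (simp add: mult_ac)
    then have "\<bar>P w\<bar> \<le> ((1 / (1 - s) ^ 3) * (sqrt total_area * L2_norm \<sigma> P)) / (total_area * s ^ n)"
      using total_area_pos s by (simp add: pos_le_divide_eq mult_ac)
    also have "\<dots> = C * k ^ n * L2_norm \<sigma> P"
      using k by (simp add: C_def s_def power_one_over)
    finally show ?thesis .
  qed
  ultimately show ?thesis using that by blast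
qed

section \<open>Propagation of smallness\<close>

text \<open>No bound on the derivative of the integrand has to be assumed: Cauchy's inequality on
  discs of radius e supplies the majorant w / e.\<close>

lemma holomorphic_on_lebesgue_integral:
  fixes k :: "complex \<Rightarrow> 'y \<Rightarrow> complex"
  assumes S: "open S"
    and meas: "\<And>z. z \<in> S \<Longrightarrow> k z \<in> borel_measurable M"
    and hol: "\<And>y. y \<in> space M \<Longrightarrow> (\<lambda>z. k z y) holomorphic_on S"
    and bound: "\<And>z y. z \<in> S \<Longrightarrow> y \<in> space M \<Longrightarrow> norm (k z y) \<le> w y"
    and w: "integrable M w"
  shows "(\<lambda>z. \<integral>y. k z y \<partial>M) holomorphic_on S"
proof -
  have "(\<lambda>z. \<integral>y. k z y \<partial>M) field_differentiable at z0" if z0: "z0 \<in> S" for z0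
  proof -
    \<comment> \<open>Twice the radius, so that discs of radius e about all points of the e-ball
      stay inside S.\<close>
    obtain e where e: "e > 0" "cball z0 (2 * e) \<subseteq> S"
    proof -
      obtain d where "d > 0" "cball z0 d \<subseteq> S" using S z0 open_contains_cball by blast
      then show ?thesis using that[of "d / 2"] by simp
    qed
    have sub: "cball z e \<subseteq> S" if "z \<in> ball z0 e" for z
    proof
      fix x assume "x \<in> cball z e"
      then have "dist z0 x \<le> 2 * e"
        using that dist_triangle[of z0 x z] by simp
      then show "x \<in> S" using e(2) by (auto simp: subset_iff)
    qed
    have zS: "z \<in> S" if "z \<in> ball z0 e" for z using sub[OF that] e(1) by auto
    have int: "integrable M (k z)" if "z \<in> S" for z
      by (rule Bochner_Integration.integrable_bound[OF w meas[OF that]])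
         (use bound[OF that] in \<open>auto intro!: AE_I2 order_trans[OF bound[OF that] abs_ge_self]\<close>)
    have "((\<lambda>z. \<integral>y. k z y \<partial>M) has_field_derivative (\<integral>y. deriv (\<lambda>z. k z y) z0 \<partial>M)) (at z0)"
    proof (rule has_field_derivative_lebesgue_integral(2)[where S="ball z0 e" and k'="\<lambda>z y. deriv (\<lambda>z. k z y) z" and w="\<lambda>y. w y / e"])
      fix z assume z: "z \<in> ball z0 e"
      show "integrable M (k z)" by (rule int[OF zS[OF z]])
      fix y assume y: "y \<in> space M"
      show "((\<lambda>z. k z y) has_field_derivative deriv (\<lambda>z. k z y) z) (at z)"
        by (rule holomorphic_derivI[OF hol[OF y] S zS[OF z]])
      have "norm ((deriv ^^ 1) (\<lambda>z. k z y) z) \<le> fact 1 * w y / e ^ 1"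
      proof (rule Cauchy_inequality)
        show "(\<lambda>z. k z y) holomorphic_on ball z e"
          by (rule holomorphic_on_subset[OF hol[OF y]]) (use sub[OF z] in auto)
        show "continuous_on (cball z e) (\<lambda>z. k z y)"
          by (rule holomorphic_on_imp_continuous_on, rule holomorphic_on_subset[OF hol[OF y] sub[OF z]])
        show "norm (k x y) \<le> w y" if "cmod (z - x) = e" for x
          by (rule bound[OF _ y]) (use sub[OF z] that in \<open>auto simp: dist_norm\<close>)
      qed (rule e)
      then show "norm (deriv (\<lambda>z. k z y) z) \<le> w y / e" by simp
    qed (use e w in auto)
    then show ?thesis by (auto simp: field_differentiable_def)
  qed
  then show ?thesis
    by (auto simp: holomorphic_on_def intro: field_differentiable_at_within)
qed

lemma min_le_geometric_mean:
  fixes a b t M l :: real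
  assumes "0 < a" "0 < b" "0 \<le> l" "l \<le> 1" "t \<le> M * a" "t \<le> M * b" "0 \<le> M"
  shows "t \<le> M * (a powr (1 - l) * b powr l)"
proof -
  let ?m = "min a b"
  have m: "?m > 0" using assms by simp
  have "t \<le> M * ?m" using assms by (simp add: min_def)
  also have "?m = ?m powr (1 - l) * ?m powr l"
    using m by (simp add: powr_add[symmetric])
  also have "\<dots> \<le> a powr (1 - l) * b powr l"
    using assms m by (intro mult_mono powr_mono2) auto
  finally show ?thesis using assms(7) by (simp add: mult_left_mono)
qed

text \<open>Taylor coefficients at b obey two Cauchy bounds, one from M on the circle of radius 3 R
  / 4 and one from M q on the circle of radius s / 2. Their weighted geometric mean keeps the factor
  q powr l and still sums to a geometric series on the disc of radius R / 2.\<close>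

lemma three_disc:
  fixes b :: complex
  assumes s: "0 < s" "s < R"
  obtains l where "0 < l" "l \<le> 1"
    "\<And>F M q z. F holomorphic_on ball b R \<Longrightarrow> (\<forall>z\<in>ball b R. norm (F z) \<le> M) \<Longrightarrow> 0 < q \<Longrightarrow>
       (\<forall>z\<in>ball b s. norm (F z) \<le> M * q) \<Longrightarrow> z \<in> ball b (R / 2) \<Longrightarrow> norm (F z) \<le> 6 * M * q powr l"
proof -
  define X where "X = R / s"
  have X: "X > 1" using s by (simp add: X_def)
  \<comment> \<open>Chosen so that (3 X / 2)^l = 5/4. The ratio of the series is then (2/3) (5/4) =
    5/6, and its sum is the 6 of the claim.\<close>
  define l where "l = ln (5/4) / ln (3 * X / 2)"
  have lnX: "ln (3 * X / 2) > 0" "ln (5/4) \<le> ln (3 * X / 2)" using X by auto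
  have l: "0 < l" "l \<le> 1" unfolding l_def using lnX by (auto simp: divide_simps)
  have "(3 * X / 2) powr l = 5/4"
    using X lnX by (simp add: powr_def l_def)
  then have "(2/3) powr (1 - l) * X powr l = 5/6"
    using X by (simp add: powr_diff powr_mult powr_divide field_simps)
  then have r56: "(2/3) powr (1 - l) * X powr l = 5/6" .
  have main: "norm (F z) \<le> 6 * M * q powr l"
    if F: "F holomorphic_on ball b R" and M: "\<forall>z\<in>ball b R. norm (F z) \<le> M" and q: "0 < q"
      and small: "\<forall>z\<in>ball b s. norm (F z) \<le> M * q" and z: "z \<in> ball b (R / 2)" for F M q z
  proof -
    have R: "R > 0" using s by simp
    have M0: "M \<ge> 0" by (rule order_trans[OF norm_ge_zero bspec[OF M, of b]]) (use R in simp)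
    let ?c = "\<lambda>n. (deriv ^^ n) F b / fact n"
    have cauchy: "norm (?c n) \<le> B / t ^ n" if "0 < t" "t < R" "\<And>z. norm (b - z) = t \<Longrightarrow> norm (F z) \<le> B" for n t B
    proof -
      have "norm ((deriv ^^ n) F b) \<le> fact n * B / t ^ n"
      proof (rule Cauchy_inequality[OF _ _ that(1,3)])
        show "F holomorphic_on ball b t" by (rule holomorphic_on_subset[OF F]) (use that in auto)
        show "continuous_on (cball b t) F"
          by (rule holomorphic_on_imp_continuous_on, rule holomorphic_on_subset[OF F]) (use that in auto)
      qed auto
      then show ?thesis by (simp add: norm_divide field_simps)
    qed
    have c1: "norm (?c n) \<le> M / (3 * R / 4) ^ n" for n
      by (rule cauchy) (use R M in \<open>auto simp: dist_norm\<close>)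
    have c2: "norm (?c n) \<le> (M * q) / (s / 2) ^ n" for n
      by (rule cauchy) (use s small in \<open>auto simp: dist_norm\<close>)
    have zb: "norm (z - b) \<le> R / 2" using z by (simp add: dist_norm norm_minus_commute)
    have t: "norm (?c n * (z - b) ^ n) \<le> M * q powr l * (5/6) ^ n" for n
    proof -
      have "norm (?c n * (z - b) ^ n) \<le> norm (?c n) * (R / 2) ^ n"
        unfolding norm_mult norm_power using zb by (intro mult_left_mono power_mono) auto
      moreover have "norm (?c n) * (R / 2) ^ n \<le> (M / (3 * R / 4) ^ n) * (R / 2) ^ n"
        using c1 R by (intro mult_right_mono) auto
      moreover have "(M / (3 * R / 4) ^ n) * (R / 2) ^ n = M * (2/3) ^ n"
        using R by (simp add: power_divide power_mult_distrib field_simps) (simp flip: power_mult_distrib)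
      moreover have "norm (?c n) * (R / 2) ^ n \<le> ((M * q) / (s / 2) ^ n) * (R / 2) ^ n"
        using c2 R by (intro mult_right_mono) auto
      moreover have "((M * q) / (s / 2) ^ n) * (R / 2) ^ n = M * (q * X ^ n)"
        by (simp add: power_divide X_def)
      ultimately have "norm (?c n * (z - b) ^ n) \<le> M * (2/3) ^ n" "norm (?c n * (z - b) ^ n) \<le> M * (q * X ^ n)"
        by linarith+
      then have "norm (?c n * (z - b) ^ n) \<le> M * (((2/3) ^ n) powr (1 - l) * (q * X ^ n) powr l)"
        using q X l M0 by (intro min_le_geometric_mean) auto
      also have "((2/3::real) ^ n) powr (1 - l) = ((2/3) powr (1 - l)) ^ n"
        by (simp add: powr_power powr_realpow[symmetric] powr_powr mult.commute)
      also have "(q * X ^ n) powr l = q powr l * (X powr l) ^ n"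
        using q X by (simp add: powr_mult powr_power powr_realpow[symmetric] powr_powr mult.commute)
      also have "((2/3) powr (1 - l)) ^ n * (q powr l * (X powr l) ^ n) = q powr l * (5/6) ^ n"
        unfolding r56[symmetric] by (simp add: power_mult_distrib)
      finally show ?thesis by (simp add: mult.assoc)
    qed
    have gs: "(\<lambda>n. M * q powr l * (5/6) ^ n) sums (M * q powr l * (1 / (1 - 5/6)))"
      by (intro sums_mult geometric_sums) simp
    have "(\<lambda>n. ?c n * (z - b) ^ n) sums F z"
      by (rule holomorphic_power_series[OF F]) (use z R in auto)
    then have "norm (F z) = norm (\<Sum>n. ?c n * (z - b) ^ n)" by (simp add: sums_iff)
    also have "\<dots> \<le> (\<Sum>n. M * q powr l * (5/6) ^ n)"
      by (rule norm_suminf_le) (use gs t in \<open>auto simp: sums_iff\<close>)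
    also have "\<dots> = 6 * M * q powr l" using gs by (simp add: sums_iff)
    finally show ?thesis .
  qed
  show ?thesis
    by (rule that[OF l]) (rule main)
qed

text \<open>Two-constants estimate with unspecified exponent: smallness on \<open>B\<close> propagates to \<open>K\<close> inside \<open>A\<close>,
  uniformly over all bounded holomorphic functions.\<close>

definition controlled :: "complex set \<Rightarrow> complex set \<Rightarrow> complex set \<Rightarrow> bool" where
  "controlled A B K \<longleftrightarrow> (\<exists>C\<ge>1. \<exists>b>0. b \<le> 1 \<and> (\<forall>F M q. F holomorphic_on A \<longrightarrow> (\<forall>z\<in>A. norm (F z) \<le> M) \<longrightarrow>
     0 < q \<longrightarrow> q \<le> 1 \<longrightarrow> (\<forall>z\<in>B. norm (F z) \<le> M * q) \<longrightarrow> (\<forall>z\<in>K. norm (F z) \<le> C * M * q powr b)))"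

lemma controlledI:
  assumes "C \<ge> 1" "b > 0" "b \<le> 1"
    and "\<And>F M q z. F holomorphic_on A \<Longrightarrow> (\<forall>z\<in>A. norm (F z) \<le> M) \<Longrightarrow> 0 < q \<Longrightarrow> q \<le> 1 \<Longrightarrow>
       (\<forall>z\<in>B. norm (F z) \<le> M * q) \<Longrightarrow> z \<in> K \<Longrightarrow> norm (F z) \<le> C * M * q powr b"
  shows "controlled A B K"
  unfolding controlled_def
proof (intro exI conjI allI impI ballI)
  show "C \<ge> 1" "b > 0" "b \<le> 1" by (fact assms(1-3))+
qed (rule assms(4))

lemma controlledE:
  assumes "controlled A B K"
  obtains C b where "C \<ge> 1" "b > 0" "b \<le> 1"
    "\<And>F M q z. F holomorphic_on A \<Longrightarrow> (\<forall>z\<in>A. norm (F z) \<le> M) \<Longrightarrow> 0 < q \<Longrightarrow> q \<le> 1 \<Longrightarrow>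
       (\<forall>z\<in>B. norm (F z) \<le> M * q) \<Longrightarrow> z \<in> K \<Longrightarrow> norm (F z) \<le> C * M * q powr b"
proof -
  from assms obtain C b where c: "C \<ge> 1" "b > 0" "b \<le> 1"
    and all: "\<forall>F M q. F holomorphic_on A \<longrightarrow> (\<forall>z\<in>A. norm (F z) \<le> M) \<longrightarrow>
     0 < q \<longrightarrow> q \<le> 1 \<longrightarrow> (\<forall>z\<in>B. norm (F z) \<le> M * q) \<longrightarrow> (\<forall>z\<in>K. norm (F z) \<le> C * M * q powr b)"
    unfolding controlled_def by (elim exE conjE)
  show ?thesis
  proof (rule that[OF c])
    fix F M q z
    assume *: "F holomorphic_on A" "\<forall>z\<in>A. norm (F z) \<le> M" "0 < q" "q \<le> 1" "\<forall>z\<in>B. norm (F z) \<le> M * q"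
      "z \<in> K"
    show "norm (F z) \<le> C * M * q powr b"
      by (rule all[THEN spec, THEN spec, THEN spec, THEN mp, OF *(1), THEN mp, OF *(2), THEN mp, OF *(3),
            THEN mp, OF *(4), THEN mp, OF *(5), THEN bspec, OF *(6)])
  qed
qed

lemma controlled_subset:
  assumes "controlled A B K" "L \<subseteq> K"
  shows "controlled A B L"
proof (rule controlledE[OF assms(1)])
  fix C b
  assume c: "C \<ge> 1" "b > 0" "b \<le> 1"
    and all: "\<And>F M q z. F holomorphic_on A \<Longrightarrow> (\<forall>z\<in>A. norm (F z) \<le> M) \<Longrightarrow> 0 < q \<Longrightarrow> q \<le> 1 \<Longrightarrow>
       (\<forall>z\<in>B. norm (F z) \<le> M * q) \<Longrightarrow> z \<in> K \<Longrightarrow> norm (F z) \<le> C * M * q powr b"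
  show ?thesis
  proof (rule controlledI[OF c])
    fix F M q z
    assume *: "F holomorphic_on A" "\<forall>z\<in>A. norm (F z) \<le> M" "0 < q" "q \<le> 1" "\<forall>z\<in>B. norm (F z) \<le> M * q"
      and "z \<in> L"
    then have "z \<in> K" using assms(2) by blast
    then show "norm (F z) \<le> C * M * q powr b" by (rule all[of F M q z, OF *])
  qed
qed

lemma controlled_Un:
  assumes "controlled A B K" "controlled A B L" "A \<noteq> {}"
  shows "controlled A B (K \<union> L)"
proof -
  obtain C1 b1 where 1: "C1 \<ge> 1" "b1 > 0" "b1 \<le> 1"
    "\<And>F M q z. F holomorphic_on A \<Longrightarrow> (\<forall>z\<in>A. norm (F z) \<le> M) \<Longrightarrow> 0 < q \<Longrightarrow> q \<le> 1 \<Longrightarrow>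
       (\<forall>z\<in>B. norm (F z) \<le> M * q) \<Longrightarrow> z \<in> K \<Longrightarrow> norm (F z) \<le> C1 * M * q powr b1"
    by (rule controlledE[OF assms(1)], rule that)
  obtain C2 b2 where 2: "C2 \<ge> 1" "b2 > 0" "b2 \<le> 1"
    "\<And>F M q z. F holomorphic_on A \<Longrightarrow> (\<forall>z\<in>A. norm (F z) \<le> M) \<Longrightarrow> 0 < q \<Longrightarrow> q \<le> 1 \<Longrightarrow>
       (\<forall>z\<in>B. norm (F z) \<le> M * q) \<Longrightarrow> z \<in> L \<Longrightarrow> norm (F z) \<le> C2 * M * q powr b2"
    by (rule controlledE[OF assms(2)], rule that)
  show ?thesis
  proof (rule controlledI)
    show "max C1 C2 \<ge> 1" "min b1 b2 > 0" "min b1 b2 \<le> 1" using 1 2 by auto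
    fix F M q z
    assume F: "F holomorphic_on A" and M: "\<forall>z\<in>A. norm (F z) \<le> M" and q: "0 < q" "q \<le> 1"
      and small: "\<forall>z\<in>B. norm (F z) \<le> M * q" and z: "z \<in> K \<union> L"
    have M0: "M \<ge> 0" using M assms(3) norm_ge_zero order_trans by blast
    have le: "C * M * q powr b \<le> max C1 C2 * M * q powr (min b1 b2)"
      if "C = C1 \<and> b = b1 \<or> C = C2 \<and> b = b2" for C b
      using that M0 q 1 2 by (intro mult_mono powr_mono') auto
    show "norm (F z) \<le> max C1 C2 * M * q powr (min b1 b2)"
    proof (cases "z \<in> K")
      case True
      show ?thesis using order_trans[OF 1(4)[of F M q z, OF F M q small True] le] by simp
    next
      case False
      then have "z \<in> L" using z by simp
      show ?thesis using order_trans[OF 2(4)[of F M q z, OF F M q small \<open>z \<in> L\<close>] le] by simp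
    qed
  qed
qed

text \<open>\<open>three_disc\<close> with C M in place of M and q powr b in place of q; along a
  chain of discs the exponents multiply and the constants grow, both independently of F.\<close>

lemma controlled_step:
  assumes xR: "ball x R \<subseteq> A" and R: "R > 0" and x: "controlled A B (ball x s)" "s > 0"
  shows "controlled A B (ball x (R / 2))"
proof -
  obtain C b where 1: "C \<ge> 1" "b > 0" "b \<le> 1"
    "\<And>F M q z. F holomorphic_on A \<Longrightarrow> (\<forall>z\<in>A. norm (F z) \<le> M) \<Longrightarrow> 0 < q \<Longrightarrow> q \<le> 1 \<Longrightarrow>
       (\<forall>z\<in>B. norm (F z) \<le> M * q) \<Longrightarrow> z \<in> ball x s \<Longrightarrow> norm (F z) \<le> C * M * q powr b"
    by (rule controlledE[OF x(1)], rule that)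
  \<comment> \<open>The inner radius in \<open>three_disc\<close> has to be smaller than R, whereas
    s is arbitrary.\<close>
  define t where "t = min s (R / 2)"
  have t: "0 < t" "t < R" "t \<le> s" using x(2) R by (auto simp: t_def)
  obtain l where l: "0 < l" "l \<le> 1"
    "\<And>F M q z. F holomorphic_on ball x R \<Longrightarrow> (\<forall>z\<in>ball x R. norm (F z) \<le> M) \<Longrightarrow> 0 < q \<Longrightarrow>
       (\<forall>z\<in>ball x t. norm (F z) \<le> M * q) \<Longrightarrow> z \<in> ball x (R / 2) \<Longrightarrow> norm (F z) \<le> 6 * M * q powr l"
    by (rule three_disc[OF t(1,2), of x], rule that)
  show ?thesis
  proof (rule controlledI)
    show "6 * C \<ge> 1" "b * l > 0" "b * l \<le> 1" using 1 l mult_le_one[of b l] by auto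
    fix F M q z
    assume F: "F holomorphic_on A" and M: "\<forall>z\<in>A. norm (F z) \<le> M" and q: "0 < q" "q \<le> 1"
      and small: "\<forall>z\<in>B. norm (F z) \<le> M * q" and z: "z \<in> ball x (R / 2)"
    have M0: "M \<ge> 0" using M xR R centre_in_ball[of x R] norm_ge_zero[of "F x"] by (meson order_trans subsetD)
    have "norm (F z) \<le> 6 * (C * M) * (q powr b) powr l"
    proof (rule l(3)[of F "C * M" "q powr b" z, OF _ _ _ _ z])
      show "F holomorphic_on ball x R" using F xR by (rule holomorphic_on_subset)
      show "\<forall>z\<in>ball x R. norm (F z) \<le> C * M"
      proof
        fix z assume "z \<in> ball x R"
        then have "norm (F z) \<le> 1 * M" using M xR by auto
        also have "\<dots> \<le> C * M" using 1(1) M0 by (rule mult_right_mono)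
        finally show "norm (F z) \<le> C * M" .
      qed
      show "0 < q powr b" using q by simp
      show "\<forall>z\<in>ball x t. norm (F z) \<le> C * M * q powr b"
      proof
        fix z assume "z \<in> ball x t"
        then have "z \<in> ball x s" using t by simp
        then show "norm (F z) \<le> C * M * q powr b" by (rule 1(4)[of F M q z, OF F M q small])
      qed
    qed
    then show "norm (F z) \<le> 6 * C * M * q powr (b * l)"
      by (simp add: powr_powr mult.assoc)
  qed
qed

text \<open>The usual chain of discs is replaced by an induction over the connected set A: having a
  controlled neighbourhood is a property that nearby points share.\<close>

lemma controlled_connected:
  assumes A: "open A" "connected A" and B: "ball a e \<subseteq> A" "e > 0" and z: "z \<in> A"
  obtains \<rho> where "\<rho> > 0" "controlled A (ball a e) (ball z \<rho>)"
proof -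
  define P where "P z \<longleftrightarrow> (\<exists>\<rho>>0. controlled A (ball a e) (ball z \<rho>))" for z
  have "controlled A (ball a e) (ball a e)"
    by (rule controlledI[of 1 1]) auto
  then have "P a" using B(2) by (auto simp: P_def)
  moreover have "a \<in> A" using B by auto
  moreover have "\<exists>T. openin (top_of_set A) T \<and> z \<in> T \<and> (\<forall>x\<in>T. \<forall>y\<in>T. P x \<longrightarrow> P y)" if zA: "z \<in> A" for z
  proof -
    obtain d where d: "d > 0" "ball z d \<subseteq> A" by (rule openE[OF A(1) zA])
    \<comment> \<open>With x at distance less than R / 4 from z, the ball of radius R about x stays
      within distance 5 R / 4 < d of z.\<close>
    define R where "R = d / 2"
    have R: "R > 0" using d by (simp add: R_def)
    have step: "P y" if x: "x \<in> ball z (R / 4)" and y: "y \<in> ball z (R / 4)" and "P x" for x y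
    proof -
      obtain s where s: "s > 0" "controlled A (ball a e) (ball x s)" using \<open>P x\<close> by (auto simp: P_def)
      have "ball x R \<subseteq> ball z d"
      proof
        fix v assume "v \<in> ball x R"
        then have "dist z v < R / 4 + R" using x dist_triangle[of z v x] by simp
        then show "v \<in> ball z d" using R by (simp add: R_def)
      qed
      then have "ball x R \<subseteq> A" using d(2) by blast
      from controlled_step[OF this R s(2,1)] have c: "controlled A (ball a e) (ball x (R / 2))" .
      \<comment> \<open>This radius for y makes dist x v < R / 4 + dist z y + (R / 4 - dist z y) = R
        / 2.\<close>
      have "ball y (R / 4 - dist z y) \<subseteq> ball x (R / 2)"
      proof
        fix v assume v: "v \<in> ball y (R / 4 - dist z y)"
        have "dist x v \<le> dist x z + dist z y + dist y v"
          using dist_triangle[of x v z] dist_triangle[of z v y] by simp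
        then show "v \<in> ball x (R / 2)" using v x by (simp add: dist_commute)
      qed
      then have "controlled A (ball a e) (ball y (R / 4 - dist z y))"
        by (rule controlled_subset[OF c])
      then show "P y" using y unfolding P_def by (intro exI[of _ "R / 4 - dist z y"]) simp
    qed
    have "ball z (R / 4) \<subseteq> A" using d R by (auto simp: R_def subset_iff)
    then have "openin (top_of_set A) (ball z (R / 4))"
      by (simp add: openin_open_eq[OF A(1)])
    moreover have "z \<in> ball z (R / 4)" using R by simp
    ultimately show ?thesis using step by (intro exI[of _ "ball z (R / 4)"] conjI ballI impI)
  qed
  ultimately have "P z"
    by (intro connected_induction_simple[OF A(2) _ z, of a P])
  then show ?thesis using that by (auto simp: P_def)
qed

text \<open>Finitely many balls cover K, and finitely many pairs of constant and exponent have a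
  common worst case.\<close>

lemma controlled_compact:
  assumes A: "open A" "connected A" and B: "ball a e \<subseteq> A" "e > 0" and K: "compact K" "K \<subseteq> A"
  shows "controlled A (ball a e) K"
proof -
  have "\<exists>\<rho>>0. controlled A (ball a e) (ball z \<rho>)" if "z \<in> K" for z
    using controlled_connected[OF A B, of z] K(2) that by blast
  then obtain \<rho> where \<rho>: "\<And>z. z \<in> K \<Longrightarrow> \<rho> z > 0" "\<And>z. z \<in> K \<Longrightarrow> controlled A (ball a e) (ball z (\<rho> z))"
    by metis
  obtain D where D: "D \<subseteq> K" "finite D" "K \<subseteq> (\<Union>z\<in>D. ball z (\<rho> z))"
    by (rule compactE_image[OF K(1), of K "\<lambda>z. ball z (\<rho> z)"]) (use \<rho>(1) in auto)
  have "controlled A (ball a e) (\<Union>z\<in>D. ball z (\<rho> z))"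
    using D(2,1)
  proof (induction D rule: finite_induct)
    case empty
    show ?case by (rule controlledI[of 1 1]) auto
  next
    case (insert z D)
    have "A \<noteq> {}" using B centre_in_ball by blast
    moreover have "controlled A (ball a e) (\<Union>z\<in>D. ball z (\<rho> z))" "z \<in> K"
      using insert by auto
    ultimately have "controlled A (ball a e) (ball z (\<rho> z) \<union> (\<Union>z\<in>D. ball z (\<rho> z)))"
      using controlled_Un[OF \<rho>(2)] by blast
    then show ?case by simp
  qed
  then show ?thesis using D(3) by (rule controlled_subset)
qed

section \<open>Laurent coefficients and Remez inequalities\<close>

lemma integral_cis_int:
  fixes m :: int
  shows "((\<lambda>t. cis (of_int m * t)) has_integral (if m = 0 then of_real (2 * pi) else 0)) {0..2 * pi}"
proof (cases "m = 0")
  case True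
  have "((\<lambda>t. 1 :: complex) has_integral measure lborel (cbox 0 (2 * pi)) *\<^sub>R 1) (cbox 0 (2 * pi))"
    by (rule has_integral_const)
  then show ?thesis using True by (simp add: scaleR_conv_of_real)
next
  case False
  define F where "F t = cis (of_int m * t) / (\<i> * of_int m)" for t
  have "((\<lambda>t. cis (of_int m * t)) has_integral (F (2 * pi) - F 0)) {0..2 * pi}"
  proof (rule fundamental_theorem_of_calculus)
    fix t assume "t \<in> {0..2 * pi}"
    have "((\<lambda>t. exp (\<i> * of_int m * complex_of_real t)) has_vector_derivative
        exp (\<i> * of_int m * complex_of_real t) * (\<i> * of_int m)) (at t within {0..2 * pi})"
      by (rule has_vector_derivative_real_field) (auto intro!: derivative_eq_intros)
    then have "((\<lambda>t. exp (\<i> * of_int m * complex_of_real t) / (\<i> * of_int m)) has_vector_derivative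
        exp (\<i> * of_int m * complex_of_real t) * (\<i> * of_int m) / (\<i> * of_int m)) (at t within {0..2 * pi})"
      by (rule has_vector_derivative_divide)
    then show "(F has_vector_derivative cis (of_int m * t)) (at t within {0..2 * pi})"
      using False by (simp add: F_def[abs_def] cis_conv_exp mult.assoc)
  qed simp
  moreover have "F (2 * pi) = F 0"
    using cis_multiple_2pi[of "of_int m"] by (simp add: F_def mult.commute mult.left_commute)
  ultimately show ?thesis using False by simp
qed

lemma trigonometric_coefficient_bound:
  fixes c :: "int \<Rightarrow> complex"
  assumes F: "finite F" and j: "j \<in> F" and B: "\<And>t. norm (\<Sum>m\<in>F. c m * cis (of_int m * t)) \<le> B"
  shows "norm (c j) \<le> B"
proof -
  have "((\<lambda>t. \<Sum>m\<in>F. c m * cis (of_int (m - j) * t)) has_integral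
      (\<Sum>m\<in>F. c m * (if m - j = 0 then of_real (2 * pi) else 0))) {0..2 * pi}"
    by (intro has_integral_sum F has_integral_mult_right integral_cis_int)
  also have "(\<lambda>t. \<Sum>m\<in>F. c m * cis (of_int (m - j) * t)) = (\<lambda>t. cis (- of_int j * t) * (\<Sum>m\<in>F. c m * cis (of_int m * t)))"
    by (auto simp: sum_distrib_left cis_mult algebra_simps intro!: sum.cong)
  also have "(\<Sum>m\<in>F. c m * (if m - j = 0 then of_real (2 * pi) else 0)) = c j * of_real (2 * pi)"
    using F j by (simp add: if_distrib cong: if_cong)
  finally have "((\<lambda>t. cis (- of_int j * t) * (\<Sum>m\<in>F. c m * cis (of_int m * t))) has_integral c j * of_real (2 * pi))
      (cbox 0 (2 * pi))" by simp
  then have "norm (c j * of_real (2 * pi)) \<le> B * measure lborel (cbox 0 (2 * pi))"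
  proof (rule has_integral_bound[rotated])
    show "0 \<le> B" using B[of 0] norm_ge_zero order_trans by blast
    show "norm (cis (- of_int j * t) * (\<Sum>m\<in>F. c m * cis (of_int m * t))) \<le> B" for t
      using B[of t] by (simp add: norm_mult)
  qed
  then show ?thesis by (simp add: norm_mult)
qed

text \<open>On the circle the truncated series is a trigonometric polynomial that satisfies the
  bound up to the two tails. Its coefficients are bounded first, and then the truncation index tends
  to infinity, so no integral is exchanged with a series.\<close>

lemma laurent_coefficient_bound:
  fixes a b :: "nat \<Rightarrow> real" and \<rho> \<eta> :: real
  assumes \<rho>: "0 < \<rho>"
    and sa: "summable (\<lambda>n. \<bar>a n\<bar> * \<rho> ^ n)" and sb: "summable (\<lambda>n. \<bar>b n\<bar> / \<rho> ^ (n + 1))"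
    and bound: "\<And>z::complex. norm z = \<rho> \<Longrightarrow>
      norm ((\<Sum>n. of_real (a n) * z ^ n) - (\<Sum>n. of_real (b n) / z ^ (n + 1))) \<le> \<eta>"
  shows "\<bar>a j\<bar> * \<rho> ^ j \<le> \<eta>" "\<bar>b j\<bar> / \<rho> ^ (j + 1) \<le> \<eta>"
proof -
  define A where "A N = (\<Sum>n. \<bar>a (n + N)\<bar> * \<rho> ^ (n + N))" for N
  define B where "B N = (\<Sum>n. \<bar>b (n + N)\<bar> / \<rho> ^ (n + N + 1))" for N
  have A0: "A \<longlonglongrightarrow> 0" and B0: "B \<longlonglongrightarrow> 0"
    using suminf_exist_split2[OF sa] suminf_exist_split2[OF sb] by (simp_all add: A_def[abs_def] B_def[abs_def] add.assoc)
  \<comment> \<open>The coefficient b n belongs to the exponent - (n + 1), that is to the index m =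
    - n - 1.\<close>
  define c where "c m = (if m \<ge> 0 then complex_of_real (a (nat m) * \<rho> ^ nat m)
      else - complex_of_real (b (nat (- m - 1)) / \<rho> ^ nat (- m)))" for m :: int
  have part: "norm (\<Sum>m\<in>{- int N..<int N}. c m * cis (of_int m * t)) \<le> \<eta> + (A N + B N)" for N t
  proof -
    define z where "z = of_real \<rho> * cis t"
    have nz: "norm z = \<rho>" "z \<noteq> 0" using \<rho> by (auto simp: z_def norm_mult)
    have na: "norm (of_real (a n) * z ^ n) = \<bar>a n\<bar> * \<rho> ^ n" for n
      by (simp add: norm_mult norm_power nz)
    have nb: "norm (of_real (b n) / z ^ (n + 1)) = \<bar>b n\<bar> / \<rho> ^ (n + 1)" for n
      by (simp add: norm_divide norm_power nz norm_mult)
    have suma: "summable (\<lambda>n. of_real (a n) * z ^ n)"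
      by (rule summable_norm_cancel) (simp add: na sa)
    have sumb: "summable (\<lambda>n. of_real (b n) / z ^ (n + 1))"
      by (rule summable_norm_cancel) (simp only: nb sb)
    have ta: "norm ((\<Sum>n. of_real (a n) * z ^ n) - (\<Sum>n<N. of_real (a n) * z ^ n)) \<le> A N"
    proof -
      have "(\<Sum>n. of_real (a n) * z ^ n) - (\<Sum>n<N. of_real (a n) * z ^ n) = (\<Sum>n. of_real (a (n + N)) * z ^ (n + N))"
        using suminf_minus_initial_segment[OF suma, of N] by simp
      also have "norm \<dots> \<le> (\<Sum>n. norm (of_real (a (n + N)) * z ^ (n + N)))"
        by (rule summable_norm) (simp only: na summable_ignore_initial_segment[OF sa])
      finally show ?thesis by (simp only: na A_def)
    qed
    have tb: "norm ((\<Sum>n. of_real (b n) / z ^ (n + 1)) - (\<Sum>n<N. of_real (b n) / z ^ (n + 1))) \<le> B N"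
    proof -
      have "(\<Sum>n. of_real (b n) / z ^ (n + 1)) - (\<Sum>n<N. of_real (b n) / z ^ (n + 1)) = (\<Sum>n. of_real (b (n + N)) / z ^ (n + N + 1))"
        using suminf_minus_initial_segment[OF sumb, of N] by simp
      also have "norm \<dots> \<le> (\<Sum>n. norm (of_real (b (n + N)) / z ^ (n + N + 1)))"
        by (rule summable_norm) (simp only: nb summable_ignore_initial_segment[OF sb])
      finally show ?thesis by (simp only: nb B_def)
    qed
    have "(\<Sum>m\<in>{- int N..<int N}. c m * cis (of_int m * t))
        = (\<Sum>n<N. of_real (a n) * z ^ n) - (\<Sum>n<N. of_real (b n) / z ^ (n + 1))"
    proof -
      have "{- int N..<int N} = int ` {..<N} \<union> (\<lambda>n. - int n - 1) ` {..<N}"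
      proof (intro equalityI subsetI)
        fix m assume m: "m \<in> {- int N..<int N}"
        show "m \<in> int ` {..<N} \<union> (\<lambda>n. - int n - 1) ` {..<N}"
        proof (cases "m \<ge> 0")
          case True
          then show ?thesis using m by (intro UnI1 image_eqI[of _ _ "nat m"]) auto
        next
          case False
          then show ?thesis using m by (intro UnI2 image_eqI[of _ _ "nat (- m - 1)"]) auto
        qed
      qed auto
      moreover have "int ` {..<N} \<inter> (\<lambda>n. - int n - 1) ` {..<N} = {}" by auto
      ultimately have "(\<Sum>m\<in>{- int N..<int N}. c m * cis (of_int m * t))
          = (\<Sum>m\<in>int ` {..<N}. c m * cis (of_int m * t)) + (\<Sum>m\<in>(\<lambda>n. - int n - 1) ` {..<N}. c m * cis (of_int m * t))"
        by (simp add: sum.union_disjoint)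
      also have "(\<Sum>m\<in>int ` {..<N}. c m * cis (of_int m * t)) = (\<Sum>n<N. of_real (a n) * z ^ n)"
      proof -
        have "c (int n) * cis (of_int (int n) * t) = of_real (a n) * z ^ n" for n
          unfolding z_def power_mult_distrib Complex.DeMoivre by (simp add: c_def mult.assoc)
        then show ?thesis by (subst sum.reindex) (auto simp: inj_on_def)
      qed
      also have "(\<Sum>m\<in>(\<lambda>n. - int n - 1) ` {..<N}. c m * cis (of_int m * t)) = - (\<Sum>n<N. of_real (b n) / z ^ (n + 1))"
      proof -
        have "c (- int n - 1) * cis (of_int (- int n - 1) * t) = - (of_real (b n) / z ^ (n + 1))" for n
        proof -
          have "c (- int n - 1) = - complex_of_real (b n / \<rho> ^ (n + 1))"
          proof -
            have "nat (- (- int n - 1)) = n + 1" "nat (- (- int n - 1) - 1) = n" by auto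
            then show ?thesis by (simp only: c_def) simp
          qed
          moreover have "cis (of_int (- int n - 1) * t) = 1 / cis t ^ (n + 1)"
          proof -
            have "cis (of_int (- int n - 1) * t) = cis (- (real (n + 1) * t))"
              by (rule arg_cong[where f=cis]) (simp add: algebra_simps)
            then show ?thesis unfolding Complex.DeMoivre by (simp add: cis_inverse[symmetric] inverse_eq_divide)
          qed
          ultimately show ?thesis by (simp add: z_def power_mult_distrib)
        qed
        then show ?thesis
          by (subst sum.reindex) (auto simp: inj_on_def sum_negf)
      qed
      finally show ?thesis by simp
    qed
    moreover have "norm ((\<Sum>n<N. of_real (a n) * z ^ n) - (\<Sum>n<N. of_real (b n) / z ^ (n + 1)))
        \<le> norm ((\<Sum>n. of_real (a n) * z ^ n) - (\<Sum>n. of_real (b n) / z ^ (n + 1)))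
          + norm ((\<Sum>n. of_real (a n) * z ^ n) - (\<Sum>n<N. of_real (a n) * z ^ n))
          + norm ((\<Sum>n. of_real (b n) / z ^ (n + 1)) - (\<Sum>n<N. of_real (b n) / z ^ (n + 1)))"
      by norm
    ultimately show ?thesis using ta tb bound[OF nz(1)] by simp
  qed
  have lim: "(\<lambda>N. \<eta> + (A N + B N)) \<longlonglongrightarrow> \<eta> + (0 + 0)"
    by (intro tendsto_intros A0 B0)
  have cm: "norm (c m) \<le> \<eta>" for m
  proof -
    have "\<forall>\<^sub>F N in sequentially. norm (c m) \<le> \<eta> + (A N + B N)"
    proof (rule eventually_sequentiallyI)
      fix N assume "nat \<bar>m\<bar> + 1 \<le> N"
      then have "m \<in> {- int N..<int N}" by auto
      then show "norm (c m) \<le> \<eta> + (A N + B N)"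
        by (intro trigonometric_coefficient_bound[OF _ _ part]) auto
    qed
    then show ?thesis using tendsto_lowerbound[OF lim] by simp
  qed
  show "\<bar>a j\<bar> * \<rho> ^ j \<le> \<eta>"
    using cm[of "int j"] \<rho> by (simp add: c_def norm_mult norm_power)
  have "nat (- (- int j - 1)) = j + 1" "nat (- (- int j - 1) - 1) = j" "\<not> - int j - 1 \<ge> 0" by auto
  then have "c (- int j - 1) = - complex_of_real (b j / \<rho> ^ (j + 1))" by (simp only: c_def) simp
  then show "\<bar>b j\<bar> / \<rho> ^ (j + 1) \<le> \<eta>"
    using cm[of "- int j - 1"] \<rho> by (simp add: norm_divide norm_power norm_mult)
qed

section \<open>Remez-type extrapolation of polynomials\<close>

lemma prod_abs_diff_nat:
  assumes "j \<le> n"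
  shows "(\<Prod>i\<in>{..n} - {j}. \<bar>real j - real i\<bar>) = fact j * fact (n - j)"
proof -
  have eq: "{..n} - {j} = {..<j} \<union> {j<..n}" using assms by auto
  have "(\<Prod>i\<in>{..n} - {j}. \<bar>real j - real i\<bar>) = (\<Prod>i\<in>{..<j}. \<bar>real j - real i\<bar>) * (\<Prod>i\<in>{j<..n}. \<bar>real j - real i\<bar>)"
    unfolding eq by (rule prod.union_disjoint) auto
  also have "(\<Prod>i\<in>{..<j}. \<bar>real j - real i\<bar>) = (\<Prod>i\<in>{1..j}. real i)"
    by (rule prod.reindex_bij_witness[of _ "\<lambda>i. j - i" "\<lambda>i. j - i"]) auto
  also have "(\<Prod>i\<in>{j<..n}. \<bar>real j - real i\<bar>) = (\<Prod>i\<in>{1..n - j}. real i)"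
    by (rule prod.reindex_bij_witness[of _ "\<lambda>i. i + j" "\<lambda>i. i - j"]) auto
  finally show ?thesis by (simp add: fact_prod)
qed

lemma lagrange_interpolation:
  fixes p :: "real poly" and t :: "nat \<Rightarrow> real"
  assumes deg: "degree p \<le> n" and inj: "inj_on t {..n}"
  shows "poly p x = (\<Sum>j\<le>n. poly p (t j) * (\<Prod>i\<in>{..n} - {j}. (x - t i) / (t j - t i)))"
proof -
  define L where "L j = (\<Prod>i\<in>{..n} - {j}. smult (1 / (t j - t i)) [:- t i, 1:])" for j
  have polyL: "poly (L j) x = (\<Prod>i\<in>{..n} - {j}. (x - t i) / (t j - t i))" for j x
    by (simp add: L_def poly_prod diff_divide_distrib)
  have degL: "degree (L j) \<le> n" if "j \<le> n" for j
  proof -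
    have "degree (L j) \<le> (\<Sum>i\<in>{..n} - {j}. degree (smult (1 / (t j - t i)) [:- t i, 1:]))"
      unfolding L_def using degree_prod_sum_le[of "{..n} - {j}" "\<lambda>i. smult (1 / (t j - t i)) [:- t i, 1:]"] by (simp add: o_def)
    also have "\<dots> \<le> (\<Sum>i\<in>{..n} - {j}. 1)"
      by (rule sum_mono) (auto intro: order_trans[OF degree_smult_le])
    also have "\<dots> = n" using that by simp
    finally show ?thesis .
  qed
  define q where "q = p - (\<Sum>j\<le>n. smult (poly p (t j)) (L j))"
  have "degree q \<le> n"
    unfolding q_def
    by (intro degree_diff_le deg degree_sum_le) (auto intro: order_trans[OF degree_smult_le] degL)
  moreover have "poly q (t k) = 0" if k: "k \<le> n" for k
  proof -
    have "poly (L j) (t k) = (if j = k then 1 else 0)" if "j \<le> n" for j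
    proof (cases "j = k")
      case True
      have "t k - t i \<noteq> 0" if "i \<in> {..n} - {k}" for i
        using inj that k by (auto simp: inj_on_def)
      then show ?thesis using True by (simp add: polyL)
    next
      case False
      then have "k \<in> {..n} - {j}" using k by simp
      then show ?thesis using False by (auto simp: polyL intro!: prod_zero bexI[of _ k])
    qed
    then have "(\<Sum>j\<le>n. poly p (t j) * poly (L j) (t k)) = (\<Sum>j\<le>n. if j = k then poly p (t k) else 0)"
      by (intro sum.cong refl) auto
    then show ?thesis using k by (simp add: q_def poly_sum)
  qed
  ultimately have "q = 0"
  proof -
    assume dq: "degree q \<le> n" and z: "\<And>k. k \<le> n \<Longrightarrow> poly q (t k) = 0"
    show "q = 0"
    proof (rule ccontr)
      assume "q \<noteq> 0"
      have "card (t ` {..n}) \<le> card {x. poly q x = 0}"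
        by (rule card_mono) (use poly_roots_finite[OF \<open>q \<noteq> 0\<close>] z in auto)
      also have "\<dots> \<le> degree q" by (rule card_poly_roots_bound[OF \<open>q \<noteq> 0\<close>])
      finally show False using dq card_image[OF inj] by simp
    qed
  qed
  then have "poly p x = poly (\<Sum>j\<le>n. smult (poly p (t j)) (L j)) x"
    by (simp add: q_def)
  then show ?thesis by (simp add: poly_sum polyL)
qed

text \<open>A single term of the exponential series; it takes the place of Stirling's formula in
  \<open>polynomial_remez\<close>.\<close>

lemma power_le_exp_fact: "real n ^ n / fact n \<le> exp (real n)"
proof -
  have "(\<lambda>k. real n ^ k /\<^sub>R fact k) sums exp (real n)" by (rule exp_converges)
  then have s: "summable (\<lambda>k. real n ^ k / fact k)" "exp (real n) = (\<Sum>k. real n ^ k / fact k)"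
    by (auto simp: sums_iff divide_inverse mult.commute)
  have "(\<Sum>k\<in>{n}. real n ^ k / fact k) \<le> (\<Sum>k. real n ^ k / fact k)"
    by (rule sum_le_suminf[OF s(1)]) auto
  then show ?thesis using s(2) by simp
qed

text \<open>Interpolate at the n + 1 equidistant nodes s j / n. The j-th Lagrange factor at 1 is at
  most (n / s)^n / (j! (n - j)!), which is (n / s)^n / n! times a binomial coefficient; the
  binomials sum to 2^n and n^n / n! is at most exp n.\<close>

lemma polynomial_remez:
  fixes p :: "real poly"
  assumes deg: "degree p \<le> n" and s: "0 < s" "s \<le> 1" and \<eta>: "\<And>t. 0 \<le> t \<Longrightarrow> t \<le> s \<Longrightarrow> \<bar>poly p t\<bar> \<le> \<eta>"
  shows "\<bar>poly p 1\<bar> \<le> \<eta> * (2 * exp 1 / s) ^ n"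
proof (cases "n = 0")
  case True
  then have "degree p = 0" using deg by simp
  then have "poly p 1 = poly p 0" by (auto elim: degree_eq_zeroE)
  then show ?thesis using \<eta>[of 0] s True by simp
next
  case False
  then have n: "real n > 0" by simp
  define t where "t j = s * real j / real n" for j :: nat
  have inj: "inj_on t {..n}" using s n by (auto simp: inj_on_def t_def)
  have trange: "0 \<le> t j" "t j \<le> s" if "j \<le> n" for j
    using that s n by (auto simp: t_def field_simps mult_left_mono)
  have eta0: "\<eta> \<ge> 0" using \<eta>[of 0] s by simp
  have tb: "\<bar>poly p (t j) * (\<Prod>i\<in>{..n} - {j}. (1 - t i) / (t j - t i))\<bar>
      \<le> \<eta> * ((real n / s) ^ n / fact n * real (n choose j))" if j: "j \<le> n" for j
  proof -
    have "\<bar>\<Prod>i\<in>{..n} - {j}. (1 - t i) / (t j - t i)\<bar> = (\<Prod>i\<in>{..n} - {j}. \<bar>1 - t i\<bar> / \<bar>t j - t i\<bar>)"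
      by (simp add: abs_prod abs_divide)
    also have "\<dots> \<le> (\<Prod>i\<in>{..n} - {j}. (real n / s) / \<bar>real j - real i\<bar>)"
    proof (rule prod_mono, rule conjI)
      fix i assume i: "i \<in> {..n} - {j}"
      have "t j - t i = (s / real n) * (real j - real i)"
        using n by (simp add: t_def field_simps)
      then have tt: "\<bar>t j - t i\<bar> = (s / real n) * \<bar>real j - real i\<bar>"
        using s n by (simp add: abs_mult)
      have "\<bar>1 - t i\<bar> / \<bar>t j - t i\<bar> = \<bar>1 - t i\<bar> * ((real n / s) / \<bar>real j - real i\<bar>)"
        unfolding tt using s n by simp
      also have "\<dots> \<le> 1 * ((real n / s) / \<bar>real j - real i\<bar>)"
        using trange[of i] i s n by (intro mult_right_mono) auto
      finally show "\<bar>1 - t i\<bar> / \<bar>t j - t i\<bar> \<le> (real n / s) / \<bar>real j - real i\<bar>" by simp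
    qed simp
    also have "\<dots> = (real n / s) ^ n / (\<Prod>i\<in>{..n} - {j}. \<bar>real j - real i\<bar>)"
    proof -
      have "card ({..n} - {j}) = n" using j by simp
      then show ?thesis by (simp only: prod_dividef[where f="\<lambda>_. real n / s"] prod_constant)
    qed
    also have "\<dots> = (real n / s) ^ n / (fact j * fact (n - j))"
      by (simp only: prod_abs_diff_nat[OF j])
    also have "\<dots> = (real n / s) ^ n / fact n * real (n choose j)"
      using j by (simp add: binomial_fact)
    finally have "\<bar>\<Prod>i\<in>{..n} - {j}. (1 - t i) / (t j - t i)\<bar> \<le> (real n / s) ^ n / fact n * real (n choose j)" .
    then show ?thesis
      unfolding abs_mult using \<eta>[of "t j"] trange[OF j] eta0 by (intro mult_mono) auto
  qed
  have "\<bar>poly p 1\<bar> = \<bar>\<Sum>j\<le>n. poly p (t j) * (\<Prod>i\<in>{..n} - {j}. (1 - t i) / (t j - t i))\<bar>"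
    by (subst lagrange_interpolation[OF deg inj]) simp
  also have "\<dots> \<le> (\<Sum>j\<le>n. \<bar>poly p (t j) * (\<Prod>i\<in>{..n} - {j}. (1 - t i) / (t j - t i))\<bar>)"
    by (rule sum_abs)
  also have "\<dots> \<le> (\<Sum>j\<le>n. \<eta> * ((real n / s) ^ n / fact n * real (n choose j)))"
    by (rule sum_mono) (use tb in simp)
  also have "\<dots> = \<eta> * ((real n / s) ^ n / fact n * real (\<Sum>j\<le>n. n choose j))"
    by (simp add: sum_distrib_left)
  also have "\<dots> = \<eta> * ((real n ^ n / fact n) * (2 / s) ^ n)"
    by (simp add: choose_row_sum power_divide)
  also have "\<dots> \<le> \<eta> * (exp (real n) * (2 / s) ^ n)"
    using eta0 s power_le_exp_fact[of n] by (intro mult_left_mono mult_right_mono) auto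
  also have "\<dots> = \<eta> * (2 * exp 1 / s) ^ n"
    by (simp add: exp_of_nat_mult[of n 1, simplified] power_divide power_mult_distrib)
  finally show ?thesis .
qed

text \<open>A polynomial function carries no degree; homogeneity has to supply it. The restrictions
  p to the line x + t v and k to v + t x satisfy p(t) = t^n k(1 / t), and comparing degrees after
  clearing denominators gives the bound.\<close>

lemma homogeneous_line_poly:
  fixes P :: "real^3 \<Rightarrow> real"
  assumes P: "real_polynomial_function P" and hom: "\<And>c x. P (c *\<^sub>R x) = c ^ n * P x"
  obtains p where "degree p \<le> n" "\<And>t. poly p t = P (x + t *\<^sub>R v)"
proof -
  have line: "\<exists>p. \<forall>t. poly p t = P (a + t *\<^sub>R b)" for a b
  proof -
    have "polynomial_function (\<lambda>t::real. a + t *\<^sub>R b)"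
      by (intro polynomial_function_add polynomial_function_const polynomial_function_bounded_linear bounded_linear_scaleR_left)
    then have "real_polynomial_function (P \<circ> (\<lambda>t. a + t *\<^sub>R b))"
      using P by (rule real_polynomial_function_compose)
    then obtain c d where "P \<circ> (\<lambda>t. a + t *\<^sub>R b) = (\<lambda>t. \<Sum>i\<le>d. c i * t ^ i)"
      using real_polynomial_function_iff_sum by blast
    then have "P (a + t *\<^sub>R b) = (\<Sum>i\<le>d. c i * t ^ i)" for t
      by (metis comp_apply)
    then show ?thesis
      by (intro exI[of _ "\<Sum>i\<le>d. monom (c i) i"]) (simp add: poly_sum poly_monom)
  qed
  obtain p where p: "\<And>t. poly p t = P (x + t *\<^sub>R v)" using line by blast
  obtain k where k: "\<And>t. poly k t = P (v + t *\<^sub>R x)" using line by blast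
  have rel: "poly p t = t ^ n * poly k (1 / t)" if "t \<noteq> 0" for t
  proof -
    have "x + t *\<^sub>R v = t *\<^sub>R (v + (1 / t) *\<^sub>R x)" using that by (simp add: scaleR_add_right)
    then show ?thesis by (simp add: p k hom)
  qed
  \<comment> \<open>The relation with denominators cleared by t^(degree k): it holds at all t other
    than 0, hence identically.\<close>
  have "monom 1 (degree k) * p - monom 1 n * reflect_poly k = 0"
  proof (rule ccontr)
    assume "monom 1 (degree k) * p - monom 1 n * reflect_poly k \<noteq> 0"
    then have fin: "finite {t. poly (monom 1 (degree k) * p - monom 1 n * reflect_poly k) t = 0}"
      by (rule poly_roots_finite)
    have "poly (monom 1 (degree k) * p - monom 1 n * reflect_poly k) t = 0" if t: "t \<noteq> 0" for t
    proof -
      have "poly (reflect_poly k) t = t ^ degree k * poly k (inverse t)"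
        by (rule poly_reflect_poly_nz[OF t])
      then show ?thesis
        using rel[OF t] by (simp add: poly_monom inverse_eq_divide)
    qed
    then have "- {0} \<subseteq> {t. poly (monom 1 (degree k) * p - monom 1 n * reflect_poly k) t = 0}"
      by auto
    then have "finite (- {0::real})" using fin by (rule finite_subset)
    then show False
      using infinite_UNIV_char_0[where 'a=real] by (simp add: Compl_eq_Diff_UNIV)
  qed
  then have "monom 1 (degree k) * p = monom 1 n * reflect_poly k" by simp
  then have eq: "degree (monom 1 (degree k) * p) = degree (monom 1 n * reflect_poly k)" by simp
  have "degree p \<le> n"
  proof (cases "p = 0")
    case False
    have "degree k + degree p = degree (monom 1 (degree k) * p)"
      using False by (simp add: degree_mult_eq degree_monom_eq)
    also have "\<dots> \<le> degree (monom (1::real) n) + degree (reflect_poly k)"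
      unfolding eq by (rule degree_mult_le)
    also have "\<dots> \<le> n + degree k"
      by (intro add_mono degree_monom_le degree_reflect_poly_le)
    finally show ?thesis by simp
  qed simp
  then show ?thesis using p that by blast
qed

text \<open>Follow the segment from p to y. Its first points, normalized, lie in the cap, and having
  norm at most 1 they inherit the bound by homogeneity. \<open>polynomial_remez\<close> extrapolates
  along the segment to its end y.\<close>

lemma homogeneous_remez:
  fixes p :: "real^3"
  assumes p: "norm p = 1" and d: "d > 0"
  obtains K where "K \<ge> 1"
    "\<And>n P \<eta> y. real_polynomial_function P \<Longrightarrow> (\<forall>c x. P (c *\<^sub>R x) = c ^ n * P x) \<Longrightarrow>
      (\<forall>w. norm w = 1 \<longrightarrow> dist p w < d \<longrightarrow> \<bar>P w\<bar> \<le> \<eta>) \<Longrightarrow> norm y = 1 \<Longrightarrow> \<bar>P y\<bar> \<le> \<eta> * K ^ n"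
proof -
  \<comment> \<open>The bound 1/4 keeps the segment at norm at least 1/2, so it can be normalized; d
    / 8 keeps the normalized point, at distance at most 4 t from p, inside the cap.\<close>
  define s where "s = min (1/4) (d / 8)"
  have s: "0 < s" "s \<le> 1/4" "s \<le> d / 8" using d by (auto simp: s_def)
  have K1: "1 \<le> 2 * exp 1 / s"
  proof -
    have "s \<le> 2 * exp 1" using s exp_ge_add_one_self[of 1] by simp
    then show ?thesis using s by simp
  qed
  have main: "\<bar>P y\<bar> \<le> \<eta> * (2 * exp 1 / s) ^ n"
    if P: "real_polynomial_function P" and hom': "\<forall>c x. P (c *\<^sub>R x) = c ^ n * P x"
      and small: "\<forall>w. norm w = 1 \<longrightarrow> dist p w < d \<longrightarrow> \<bar>P w\<bar> \<le> \<eta>" and y: "norm y = 1" for n P \<eta> y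
  proof -
    have hom: "P (c *\<^sub>R x) = c ^ n * P x" for c x using hom' by blast
    have eta0: "\<eta> \<ge> 0"
      using small[rule_format, of p] p d by simp
    obtain q where q: "degree q \<le> n" "\<And>t. poly q t = P (p + t *\<^sub>R (y - p))"
      using homogeneous_line_poly[OF P hom] by blast
    have "\<bar>poly q t\<bar> \<le> \<eta>" if t: "0 \<le> t" "t \<le> s" for t
    proof -
      define x where "x = p + t *\<^sub>R (y - p)"
      have "norm (y - p) \<le> 2" using norm_triangle_ineq4[of y p] y p by simp
      then have xp: "norm (x - p) \<le> 2 * t" using t by (simp add: x_def mult.commute mult_left_mono)
      have "norm x \<ge> 1 - 2 * t" using xp p norm_triangle_ineq2[of p "p - x"] by (simp add: norm_minus_commute)
      then have x1: "norm x \<ge> 1/2" using t s by simp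
      have "x = (1 - t) *\<^sub>R p + t *\<^sub>R y" by (simp add: x_def algebra_simps)
      then have "norm x \<le> (1 - t) * norm p + t * norm y"
        using norm_triangle_ineq[of "(1 - t) *\<^sub>R p" "t *\<^sub>R y"] t s by simp
      then have x2: "norm x \<le> 1" using p y by simp
      define w where "w = (1 / norm x) *\<^sub>R x"
      have x0: "x \<noteq> 0" using x1 by auto
      have w: "norm w = 1" using x0 by (simp add: w_def)
      have xw: "x = norm x *\<^sub>R w" using x0 by (simp add: w_def)
      have "norm (w - x) = 1 - norm x"
      proof -
        have "w - x = (1 - norm x) *\<^sub>R w" using xw by (simp add: scaleR_diff_left)
        then show ?thesis using w x2 by simp
      qed
      also have "\<dots> \<le> 2 * t" using \<open>norm x \<ge> 1 - 2 * t\<close> by simp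
      finally have "dist p w \<le> 4 * t"
        using xp norm_triangle_ineq[of "w - x" "x - p"] by (simp add: dist_norm norm_minus_commute)
      then have "dist p w < d" using t s d by simp
      then have "\<bar>P w\<bar> \<le> \<eta>" using small w by blast
      moreover have "\<bar>P x\<bar> = norm x ^ n * \<bar>P w\<bar>"
        by (subst xw) (simp add: hom abs_mult)
      moreover have "norm x ^ n \<le> 1" using x2 by (simp add: power_le_one)
      ultimately have "\<bar>P x\<bar> \<le> 1 * \<eta>"
        using eta0 by (simp only:) (intro mult_mono, auto)
      then show ?thesis by (simp add: q(2) x_def)
    qed
    from polynomial_remez[OF q(1) s(1) _ this] s show ?thesis by (simp add: q(2))
  qed
  show ?thesis by (rule that[OF K1]) (rule main)
qed

section \<open>Power series, principal parts and the estimate for the two coefficient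
  sequences\<close>

lemma power_series_bounds:
  fixes a :: "nat \<Rightarrow> real" and R :: real
  assumes R: "0 < R" and s: "summable (\<lambda>n. \<bar>a n\<bar> * R ^ n)" "(\<Sum>n. \<bar>a n\<bar> * R ^ n) \<le> M"
  shows "(\<lambda>z. \<Sum>n. complex_of_real (a n) * z ^ n) holomorphic_on ball 0 R"
    and "norm z \<le> R \<Longrightarrow> summable (\<lambda>n. complex_of_real (a n) * z ^ n)"
    and "norm z \<le> R \<Longrightarrow> norm (\<Sum>n. complex_of_real (a n) * z ^ n) \<le> M"
proof -
  have le: "norm (complex_of_real (a n) * z ^ n) \<le> \<bar>a n\<bar> * R ^ n" if "norm z \<le> R" for n z
    using that by (simp add: norm_mult norm_power mult_left_mono power_mono)
  show sm: "summable (\<lambda>n. complex_of_real (a n) * z ^ n)" if "norm z \<le> R" for z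
    by (rule summable_comparison_test'[OF s(1), of 0]) (rule le[OF that])
  show "norm (\<Sum>n. complex_of_real (a n) * z ^ n) \<le> M" if "norm z \<le> R" for z
    by (rule order_trans[OF norm_suminf_le[OF le[OF that] s(1)] s(2)])
  show "(\<lambda>z. \<Sum>n. complex_of_real (a n) * z ^ n) holomorphic_on ball 0 R"
  proof (rule power_series_holomorphic)
    fix z assume "z \<in> ball (0::complex) R"
    then show "(\<lambda>n. complex_of_real (a n) * (z - 0) ^ n) sums (\<Sum>n. complex_of_real (a n) * z ^ n)"
      using sm[of z] by (simp add: summable_sums)
  qed
qed

text \<open>Inversion reduces this to \<open>power_series_bounds\<close>; the exponent n + 1 leaves
  one extra factor 1 / z.\<close>

lemma principal_part_bounds:
  fixes b :: "nat \<Rightarrow> real" and R :: real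
  assumes R: "0 < R" and s: "summable (\<lambda>n. \<bar>b n\<bar> / R ^ (n + 1))" "(\<Sum>n. \<bar>b n\<bar> / R ^ (n + 1)) \<le> M"
  shows "(\<lambda>z. \<Sum>n. complex_of_real (b n) / z ^ (n + 1)) holomorphic_on {z. R < norm z}"
    and "R \<le> norm z \<Longrightarrow> norm (\<Sum>n. complex_of_real (b n) / z ^ (n + 1)) \<le> M"
proof -
  have eq: "complex_of_real (b n) / z ^ (n + 1) = (1 / z) * (complex_of_real (b n) * (1 / z) ^ n)" for n z
    by (simp add: power_inverse divide_inverse)
  have s': "summable (\<lambda>n. \<bar>b n\<bar> * (1 / R) ^ n)"
  proof -
    have "\<bar>b n\<bar> * (1 / R) ^ n = R * (\<bar>b n\<bar> / R ^ (n + 1))" for n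
      using R by (simp add: power_one_over)
    then show ?thesis using summable_mult[OF s(1), of R] by (simp only:)
  qed
  have R': "0 < 1 / R" using R by simp
  note ps = power_series_bounds[OF R' s' order_refl]
  have inR: "norm (1 / z) \<le> 1 / R" if "R \<le> norm z" for z :: complex
    using that R by (simp add: norm_divide divide_simps)
  have sum_eq: "(\<Sum>n. complex_of_real (b n) / z ^ (n + 1)) = (1 / z) * (\<Sum>n. complex_of_real (b n) * (1 / z) ^ n)"
    if "R \<le> norm z" for z
    unfolding eq by (rule suminf_mult[OF ps(2)[OF inR[OF that]]])
  have "(\<lambda>z. (1 / z) * (\<Sum>n. complex_of_real (b n) * (1 / z) ^ n)) holomorphic_on {z. R < norm z}"
  proof (rule holomorphic_on_mult)
    show 1: "(\<lambda>z. 1 / z) holomorphic_on {z::complex. R < norm z}"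
      using R by (intro holomorphic_intros) auto
    have "((\<lambda>z. \<Sum>n. complex_of_real (b n) * z ^ n) \<circ> (\<lambda>z. 1 / z)) holomorphic_on {z. R < norm z}"
    proof (rule holomorphic_on_compose_gen[OF 1 ps(1)])
      show "(\<lambda>z. 1 / z) ` {z::complex. R < norm z} \<subseteq> ball 0 (1 / R)"
        using R by (auto simp: norm_divide divide_simps)
    qed
    then show "(\<lambda>z. \<Sum>n. complex_of_real (b n) * (1 / z) ^ n) holomorphic_on {z. R < norm z}"
      by (simp add: o_def)
  qed
  then show "(\<lambda>z. \<Sum>n. complex_of_real (b n) / z ^ (n + 1)) holomorphic_on {z. R < norm z}"
    by (rule holomorphic_transform) (use sum_eq in auto)
  show "norm (\<Sum>n. complex_of_real (b n) / z ^ (n + 1)) \<le> M" if z: "R \<le> norm z"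
  proof -
    have "norm (complex_of_real (b n) / z ^ (n + 1)) \<le> \<bar>b n\<bar> / R ^ (n + 1)" for n
      unfolding norm_divide norm_power norm_of_real
      using z R by (intro divide_left_mono power_mono mult_pos_pos zero_less_power) auto
    then show ?thesis
      using norm_suminf_le[OF _ s(1), of "\<lambda>n. complex_of_real (b n) / z ^ (n + 1)"] s(2) by simp
  qed
qed

text \<open>The pairing and the series are compared at real parameters only; the identity theorem
  extends the equality to the disc.\<close>

lemma holomorphic_eq_on_ball:
  assumes "f holomorphic_on ball (complex_of_real x0) e" "g holomorphic_on ball (complex_of_real x0) e" "e > 0"
    and eq: "\<And>x. \<bar>x - x0\<bar> < e \<Longrightarrow> f (complex_of_real x) = g (complex_of_real x)"
    and z: "z \<in> ball (complex_of_real x0) e"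
  shows "f z = g z"
proof -
  let ?U = "complex_of_real ` {x. \<bar>x - x0\<bar> < e}"
  have "f z - g z = 0"
  proof (rule analytic_continuation[of "\<lambda>z. f z - g z" "ball (complex_of_real x0) e" ?U "complex_of_real x0"])
    show "(\<lambda>z. f z - g z) holomorphic_on ball (complex_of_real x0) e"
      using assms by (intro holomorphic_on_diff)
    show "?U \<subseteq> ball (complex_of_real x0) e"
      by (auto simp: dist_norm abs_minus_commute simp flip: of_real_diff)
    show "complex_of_real x0 islimpt ?U"
    proof (rule islimptI)
      fix T assume T: "complex_of_real x0 \<in> T" "open T"
      then obtain d where d: "d > 0" "ball (complex_of_real x0) d \<subseteq> T" using open_contains_ball by blast
      define h where "h = min d e / 2"
      have h: "0 < h" "h < d" "h < e" using d(1) assms(3) by (auto simp: h_def)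
      have "complex_of_real (x0 + h) \<in> T"
        using d(2) h by (auto simp: subset_iff dist_norm)
      moreover have "complex_of_real (x0 + h) \<in> ?U" by (rule imageI) (use h in simp)
      moreover have "complex_of_real (x0 + h) \<noteq> complex_of_real x0" using h by simp
      ultimately show "\<exists>y\<in>?U. y \<in> T \<and> y \<noteq> complex_of_real x0" by blast
    qed
  qed (use assms(3) eq z in auto)
  then show ?thesis by simp
qed

text \<open>Near \<open>1 - d / 2\<close> the function \<open>TV - X\<close>, with \<open>X\<close> the power series, is \<open>- TU\<close>, hence small; this
  propagates inside \<open>ball 1 d\<close> to a neighbourhood of \<open>1 + d / 2\<close>. There the Laurent series \<open>W\<close> formed by both
  sequences is \<open>- (TV - X) - TU\<close>, so it is small too, and this propagates inside an annulus to the circle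
  through \<open>1 + d / 2\<close>.\<close>

lemma cap_estimate:
  fixes d R e :: real
  assumes d: "0 < d" "d \<le> 1/2" and R: "1 + d \<le> R" and e: "0 < e" "e \<le> d / 8"
  obtains C \<beta> where "C > 0" "\<beta> > 0" "\<beta> \<le> 1"
    "\<And>a b M q TV TU j.
      summable (\<lambda>n. \<bar>a n\<bar> * R ^ n) \<Longrightarrow> (\<Sum>n. \<bar>a n\<bar> * R ^ n) \<le> M \<Longrightarrow>
      summable (\<lambda>n. \<bar>b n\<bar> / (1 + d / 4) ^ (n + 1)) \<Longrightarrow> (\<Sum>n. \<bar>b n\<bar> / (1 + d / 4) ^ (n + 1)) \<le> M \<Longrightarrow>
      TV holomorphic_on ball 1 d \<Longrightarrow> (\<forall>z\<in>ball 1 d. norm (TV z) \<le> M) \<Longrightarrow>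
      TU holomorphic_on ball (of_real (1 - d / 2)) e \<Longrightarrow> TU holomorphic_on ball (of_real (1 + d / 2)) e \<Longrightarrow>
      (\<forall>z\<in>ball (of_real (1 - d / 2)) e \<union> ball (of_real (1 + d / 2)) e. norm (TU z) \<le> M * q) \<Longrightarrow>
      0 < q \<Longrightarrow> q \<le> 1 \<Longrightarrow>
      (\<forall>x. \<bar>x - (1 - d / 2)\<bar> < e \<longrightarrow> TV (complex_of_real x) + TU (of_real x) = (\<Sum>n. of_real (a n) * of_real x ^ n)) \<Longrightarrow>
      (\<forall>x. \<bar>x - (1 + d / 2)\<bar> < e \<longrightarrow> TV (complex_of_real x) + TU (of_real x) = (\<Sum>n. of_real (b n) / of_real x ^ (n + 1))) \<Longrightarrow>
      \<bar>a j\<bar> * (1 + d / 2) ^ j \<le> C * M * q powr \<beta> \<and> \<bar>b j\<bar> / (1 + d / 2) ^ (j + 1) \<le> C * M * q powr \<beta>"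
proof -
  let ?x0 = "complex_of_real (1 - d / 2)" and ?x1 = "complex_of_real (1 + d / 2)"
  \<comment> \<open>The annulus where both halves of the Laurent series are under control: the power
    series inside radius R, the principal part outside radius 1 + d / 4.\<close>
  define An where "An = {z::complex. 1 + d / 4 < norm z \<and> norm z < R}"
  have oAn: "open An"
    unfolding An_def by (intro open_Collect_conj open_Collect_less continuous_intros)
  have cAn: "connected An"
    using connected_annulus(1)[where ?r1.0 = "1 + d / 4" and a = "0::complex" and ?r2.0 = R] by (simp add: An_def)
  have near: "norm (?x0 - 1) = d / 2" "norm (?x1 - 1) = d / 2" "norm ?x1 = 1 + d / 2" "norm ?x0 = 1 - d / 2"
  proof -
    have "?x0 - 1 = complex_of_real (- (d / 2))" "?x1 - 1 = complex_of_real (d / 2)" by simp_all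
    then show "norm (?x0 - 1) = d / 2" "norm (?x1 - 1) = d / 2" "norm ?x1 = 1 + d / 2" "norm ?x0 = 1 - d / 2"
      using d by (simp_all only: norm_of_real)
  qed
  have b0: "ball ?x0 e \<subseteq> ball 1 d"
  proof
    fix z assume "z \<in> ball ?x0 e"
    then have "norm (z - 1) < e + d / 2"
      using norm_triangle_ineq[of "z - ?x0" "?x0 - 1"] near by (simp add: dist_norm norm_minus_commute)
    then show "z \<in> ball 1 d" using e d by (simp add: dist_norm norm_minus_commute)
  qed
  have b1: "cball ?x1 e \<subseteq> ball 1 d"
  proof
    fix z assume "z \<in> cball ?x1 e"
    then have "norm (z - 1) \<le> e + d / 2"
      using norm_triangle_ineq[of "z - ?x1" "?x1 - 1"] near by (simp add: dist_norm norm_minus_commute)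
    then show "z \<in> ball 1 d" using e d by (simp add: dist_norm norm_minus_commute)
  qed
  have ball_lt: "norm z < 1 + d" if "z \<in> ball 1 d" for z :: complex
    using that norm_triangle_ineq[of "z - 1" 1] by (simp add: dist_norm norm_minus_commute)
  have b2: "ball ?x1 e \<subseteq> An"
  proof
    fix z assume z: "z \<in> ball ?x1 e"
    then have "norm z > 1 + d / 2 - e"
      using norm_triangle_ineq2[of ?x1 "?x1 - z"] near by (simp add: dist_norm)
    moreover have "norm z < 1 + d" using z b1 ball_lt by (auto simp: subset_iff)
    ultimately show "z \<in> An" using e d R by (simp add: An_def)
  qed
  have c1: "controlled (ball 1 d) (ball ?x0 e) (cball ?x1 e)"
    by (rule controlled_compact[OF open_ball connected_ball b0 e(1) compact_cball b1])
  have c2: "controlled An (ball ?x1 e) (sphere 0 (1 + d / 2))"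
    by (rule controlled_compact[OF oAn cAn b2 e(1) compact_sphere]) (use d R in \<open>auto simp: An_def\<close>)
  obtain C1 b1' where 1: "C1 \<ge> 1" "b1' > 0" "b1' \<le> 1"
    "\<And>F M q z. F holomorphic_on ball 1 d \<Longrightarrow> (\<forall>z\<in>ball 1 d. norm (F z) \<le> M) \<Longrightarrow> 0 < q \<Longrightarrow> q \<le> 1 \<Longrightarrow>
       (\<forall>z\<in>ball ?x0 e. norm (F z) \<le> M * q) \<Longrightarrow> z \<in> cball ?x1 e \<Longrightarrow> norm (F z) \<le> C1 * M * q powr b1'"
    by (rule controlledE[OF c1], rule that)
  obtain C2 b2' where 2: "C2 \<ge> 1" "b2' > 0" "b2' \<le> 1"
    "\<And>F M q z. F holomorphic_on An \<Longrightarrow> (\<forall>z\<in>An. norm (F z) \<le> M) \<Longrightarrow> 0 < q \<Longrightarrow> q \<le> 1 \<Longrightarrow>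
       (\<forall>z\<in>ball ?x1 e. norm (F z) \<le> M * q) \<Longrightarrow> z \<in> sphere 0 (1 + d / 2) \<Longrightarrow> norm (F z) \<le> C2 * M * q powr b2'"
    by (rule controlledE[OF c2], rule that)
  \<comment> \<open>The 3 consists of 2 for F, whose a priori bound is 2 M, and 1 for
    \<open>TU\<close>.\<close>
  define C where "C = C2 * (3 * C1)"
  show ?thesis
  proof (rule that[of C "b1' * b2'"])
    show "C > 0" "b1' * b2' > 0" "b1' * b2' \<le> 1" using 1 2 mult_le_one[of b1' b2'] by (auto simp: C_def)
    fix a b :: "nat \<Rightarrow> real" and M q :: real and TV TU :: "complex \<Rightarrow> complex" and j :: nat
    assume sa: "summable (\<lambda>n. \<bar>a n\<bar> * R ^ n)" "(\<Sum>n. \<bar>a n\<bar> * R ^ n) \<le> M"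
      and sb: "summable (\<lambda>n. \<bar>b n\<bar> / (1 + d / 4) ^ (n + 1))" "(\<Sum>n. \<bar>b n\<bar> / (1 + d / 4) ^ (n + 1)) \<le> M"
      and TV: "TV holomorphic_on ball 1 d" "\<forall>z\<in>ball 1 d. norm (TV z) \<le> M"
      and TU: "TU holomorphic_on ball ?x0 e" "TU holomorphic_on ball ?x1 e"
        "\<forall>z\<in>ball ?x0 e \<union> ball ?x1 e. norm (TU z) \<le> M * q"
      and q: "0 < q" "q \<le> 1"
      and eq0: "\<forall>x. \<bar>x - (1 - d / 2)\<bar> < e \<longrightarrow> TV (complex_of_real x) + TU (of_real x) = (\<Sum>n. of_real (a n) * of_real x ^ n)"
      and eq1: "\<forall>x. \<bar>x - (1 + d / 2)\<bar> < e \<longrightarrow> TV (complex_of_real x) + TU (of_real x) = (\<Sum>n. of_real (b n) / of_real x ^ (n + 1))"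
    define Xp where "Xp z = (\<Sum>n. complex_of_real (a n) * z ^ n)" for z
    define Xm where "Xm z = (\<Sum>n. complex_of_real (b n) / z ^ (n + 1))" for z
    have R0: "0 < R" using R d by simp
    have k0: "0 < 1 + d / 4" using d by simp
    have hXp: "Xp holomorphic_on ball 0 R" unfolding Xp_def[abs_def] by (rule power_series_bounds(1)[OF R0 sa])
    have bXp: "norm (Xp z) \<le> M" if "norm z \<le> R" for z
      unfolding Xp_def by (rule power_series_bounds(3)[OF R0 sa that])
    have hXm: "Xm holomorphic_on {z. 1 + d / 4 < norm z}" unfolding Xm_def[abs_def] by (rule principal_part_bounds(1)[OF k0 sb])
    have bXm: "norm (Xm z) \<le> M" if "1 + d / 4 \<le> norm z" for z
      unfolding Xm_def by (rule principal_part_bounds(2)[OF k0 sb that])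
    have M0: "M \<ge> 0" using order_trans[OF norm_ge_zero bXp[of 0]] R0 by simp
    have sub: "ball 1 d \<subseteq> ball (0::complex) R"
      using ball_lt R by (force simp: subset_iff)
    define F where "F z = TV z - Xp z" for z
    have hF: "F holomorphic_on ball 1 d"
      unfolding F_def[abs_def] by (intro holomorphic_on_diff TV(1) holomorphic_on_subset[OF hXp sub])
    have bF: "\<forall>z\<in>ball 1 d. norm (F z) \<le> 2 * M"
    proof
      fix z :: complex assume z: "z \<in> ball 1 d"
      then have "norm z \<le> R" using ball_lt R by force
      then show "norm (F z) \<le> 2 * M"
        unfolding F_def using norm_triangle_ineq4[of "TV z" "Xp z"] bspec[OF TV(2) z] bXp[of z] by linarith
    qed
    have FU: "F z = - TU z" if z: "z \<in> ball ?x0 e" for z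
    proof (rule holomorphic_eq_on_ball[OF _ _ e(1) _ z])
      show "F holomorphic_on ball ?x0 e" by (rule holomorphic_on_subset[OF hF b0])
      show "(\<lambda>z. - TU z) holomorphic_on ball ?x0 e" by (intro holomorphic_on_minus TU(1))
      show "F (complex_of_real x) = - TU (complex_of_real x)" if "\<bar>x - (1 - d / 2)\<bar> < e" for x
        using eq0[rule_format, OF that] by (simp add: F_def Xp_def algebra_simps)
    qed
    have small1: "\<forall>z\<in>ball ?x0 e. norm (F z) \<le> 2 * M * q"
    proof
      fix z assume z: "z \<in> ball ?x0 e"
      have "norm (F z) \<le> M * q" using TU(3) z by (simp add: FU)
      also have "\<dots> \<le> 2 * M * q" using M0 q by simp
      finally show "norm (F z) \<le> 2 * M * q" .
    qed
    have F1: "norm (F z) \<le> C1 * (2 * M) * q powr b1'" if "z \<in> cball ?x1 e" for z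
      by (rule 1(4)[of F "2 * M" q z, OF hF bF q small1 that])
    define W where "W z = Xp z - Xm z" for z
    have hW: "W holomorphic_on An"
      unfolding W_def[abs_def]
      by (intro holomorphic_on_diff holomorphic_on_subset[OF hXp] holomorphic_on_subset[OF hXm]) (auto simp: An_def)
    have WF: "W z = - F z - TU z" if z: "z \<in> ball ?x1 e" for z
    proof (rule holomorphic_eq_on_ball[OF _ _ e(1) _ z])
      show "W holomorphic_on ball ?x1 e" by (rule holomorphic_on_subset[OF hW b2])
      show "(\<lambda>z. - F z - TU z) holomorphic_on ball ?x1 e"
        by (intro holomorphic_on_diff holomorphic_on_minus TU(2) holomorphic_on_subset[OF hF] order_trans[OF ball_subset_cball b1])
      show "W (complex_of_real x) = - F (complex_of_real x) - TU (complex_of_real x)" if "\<bar>x - (1 + d / 2)\<bar> < e" for x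
        using eq1[rule_format, OF that] by (simp add: F_def W_def Xm_def algebra_simps)
    qed
    \<comment> \<open>As q and the exponent are at most 1, the contribution of size q is absorbed by
      the propagated one of size q powr b1'.\<close>
    have qq: "q \<le> q powr b1'" "0 < q powr b1'" "q powr b1' \<le> 1"
      using q 1 powr_mono'[of b1' 1 q] powr_le1[of b1' q] by auto
    have C1M: "2 * M \<le> 3 * C1 * M"
    proof -
      have "2 * M \<le> (3 * C1) * M" by (rule mult_right_mono) (use 1(1) M0 in auto)
      then show ?thesis .
    qed
    have bW: "\<forall>z\<in>An. norm (W z) \<le> 3 * C1 * M"
    proof
      fix z assume z: "z \<in> An"
      have "norm (W z) \<le> 2 * M"
        unfolding W_def using norm_triangle_ineq4[of "Xp z" "Xm z"] bXp[of z] bXm[of z] z by (simp add: An_def)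
      then show "norm (W z) \<le> 3 * C1 * M" using C1M by linarith
    qed
    have small2: "\<forall>z\<in>ball ?x1 e. norm (W z) \<le> 3 * C1 * M * q powr b1'"
    proof
      fix z assume z: "z \<in> ball ?x1 e"
      have "norm (W z) \<le> norm (F z) + norm (TU z)"
        unfolding WF[OF z] using norm_triangle_ineq4[of "- F z" "TU z"] by simp
      also have "\<dots> \<le> C1 * (2 * M) * q powr b1' + M * q"
        using F1[of z] TU(3) z by (intro add_mono) auto
      also have "M * q \<le> C1 * M * q powr b1'"
      proof -
        have "1 * M * q \<le> C1 * M * q powr b1'"
          using 1(1) M0 q qq by (intro mult_mono) auto
        then show ?thesis by simp
      qed
      finally show "norm (W z) \<le> 3 * C1 * M * q powr b1'" by simp
    qed
    define \<eta> where "\<eta> = C2 * (3 * C1 * M) * (q powr b1') powr b2'"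
    have Wc: "norm (W z) \<le> \<eta>" if "norm z = 1 + d / 2" for z
      unfolding \<eta>_def
      by (rule 2(4)[of W "3 * C1 * M" "q powr b1'" z, OF hW bW qq(2,3) small2]) (use that in simp)
    have \<rho>0: "0 < 1 + d / 2" using d by simp
    have "summable (\<lambda>n. \<bar>a n\<bar> * (1 + d / 2) ^ n)"
      by (rule summable_comparison_test'[OF sa(1), of 0]) (use d R in \<open>auto intro!: mult_left_mono power_mono\<close>)
    moreover have "summable (\<lambda>n. \<bar>b n\<bar> / (1 + d / 2) ^ (n + 1))"
    proof (rule summable_comparison_test'[OF sb(1), of 0])
      fix n
      have "\<bar>b n\<bar> / (1 + d / 2) ^ (n + 1) \<le> \<bar>b n\<bar> / (1 + d / 4) ^ (n + 1)"
        using d by (intro divide_left_mono power_mono mult_pos_pos zero_less_power) auto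
      then show "norm (\<bar>b n\<bar> / (1 + d / 2) ^ (n + 1)) \<le> \<bar>b n\<bar> / (1 + d / 4) ^ (n + 1)"
        using d by simp
    qed
    ultimately have "\<bar>a j\<bar> * (1 + d / 2) ^ j \<le> \<eta>" "\<bar>b j\<bar> / (1 + d / 2) ^ (j + 1) \<le> \<eta>"
      using laurent_coefficient_bound[OF \<rho>0, of a b \<eta>] Wc by (auto simp: W_def Xp_def Xm_def)
    moreover have "\<eta> = C * M * q powr (b1' * b2')"
      by (simp add: \<eta>_def C_def powr_powr)
    ultimately show "\<bar>a j\<bar> * (1 + d / 2) ^ j \<le> C * M * q powr (b1' * b2') \<and>
        \<bar>b j\<bar> / (1 + d / 2) ^ (j + 1) \<le> C * M * q powr (b1' * b2')" by simp
  qed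
qed

section \<open>The complexified kernel\<close>

text \<open>The polynomial in \<open>z\<close> that equals \<open>(norm (w - z *\<^sub>R y))\<^sup>2\<close> for real \<open>z\<close>. With it, \<open>cker\<close> and
  \<open>cTop\<close> are the analytic continuations in \<open>s\<close> of \<open>tker w s y \<bullet> f y\<close> and of \<open>Top w s f\<close>, the latter
  restricted to the sources in \<open>A\<close>.\<close>

definition csqdist :: "real^3 \<Rightarrow> complex \<Rightarrow> real^3 \<Rightarrow> complex" where
  "csqdist w z y = 1 - 2 * z * of_real (w \<bullet> y) + z\<^sup>2"

definition cker :: "real^3 \<Rightarrow> (real^3 \<Rightarrow> real^3) \<Rightarrow> complex \<Rightarrow> real^3 \<Rightarrow> complex" where
  "cker w f z y = (z * of_real (w \<bullet> f y) - z\<^sup>2 * of_real (y \<bullet> f y)) * csqdist w z y powr (-3/2)"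

definition cTop :: "(real^3) set \<Rightarrow> real^3 \<Rightarrow> (real^3 \<Rightarrow> real^3) \<Rightarrow> complex \<Rightarrow> complex" where
  "cTop A w f z = (\<integral>y. indicator A y *\<^sub>R cker w f z y \<partial>\<sigma>) / of_real total_area"

lemma cker_measurable:
  assumes f: "f \<in> borel_measurable \<sigma>"
  shows "cker w f z \<in> borel_measurable \<sigma>"
proof -
  have i: "(\<lambda>y. w \<bullet> y) \<in> borel_measurable \<sigma>"
    by (rule continuous_sphere_measurable) (intro continuous_intros)
  have j: "(\<lambda>y. y \<bullet> f y) \<in> borel_measurable \<sigma>" "(\<lambda>y. w \<bullet> f y) \<in> borel_measurable \<sigma>"
    using f id_measurable_sphere[of 1] by (auto intro: borel_measurable_inner)
  have "csqdist w z \<in> borel_measurable \<sigma>"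
    unfolding csqdist_def[abs_def] using i by measurable
  then show ?thesis
    unfolding cker_def[abs_def] powr_def using j by measurable
qed

text \<open>A positive lower bound for the real part keeps the squared distance off the branch cut
  and its negative power bounded. The 6 is 2 + 2^2, from norm z <= 2.\<close>

lemma norm_cker_le:
  assumes w: "w \<in> \<S>" and y: "y \<in> \<S>" and z: "norm z \<le> 2" and m: "0 < m" "m \<le> Re (csqdist w z y)"
  shows "norm (cker w f z y) \<le> 6 * m powr (-3/2) * norm (f y)"
proof -
  have "norm (z * of_real (w \<bullet> f y)) \<le> 2 * norm (f y)"
    unfolding norm_mult norm_of_real
    using Cauchy_Schwarz_ineq2[of w "f y"] w z by (intro mult_mono) auto
  moreover have "norm (z\<^sup>2 * of_real (y \<bullet> f y)) \<le> 4 * norm (f y)"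
  proof -
    have "(norm z)\<^sup>2 \<le> 2\<^sup>2" using z by (intro power_mono) auto
    then show ?thesis
      unfolding norm_mult norm_of_real norm_power
      using Cauchy_Schwarz_ineq2[of y "f y"] y by (intro mult_mono) auto
  qed
  ultimately have n1: "norm (z * of_real (w \<bullet> f y) - z\<^sup>2 * of_real (y \<bullet> f y)) \<le> 6 * norm (f y)"
    using norm_triangle_ineq4[of "z * of_real (w \<bullet> f y)" "z\<^sup>2 * of_real (y \<bullet> f y)"] by linarith
  have "(- 3 / 2 :: complex) \<in> \<real>" by simp
  then have "norm (csqdist w z y powr (-3/2)) = norm (csqdist w z y) powr Re (-3/2)"
    by (rule norm_powr_real_powr')
  also have "\<dots> = norm (csqdist w z y) powr (-3/2)" by simp
  also have "\<dots> \<le> m powr (-3/2)"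
    using m complex_Re_le_cmod[of "csqdist w z y"] by (intro powr_mono2') auto
  finally have "norm (cker w f z y) \<le> (6 * norm (f y)) * m powr (-3/2)"
    unfolding cker_def norm_mult[of "_ - _"] using n1 by (intro mult_mono) auto
  then show ?thesis by (simp add: mult_ac)
qed

lemma indicator_L2:
  assumes "f \<in> L2 \<sigma>" "A \<in> sets \<sigma>"
  shows "(\<lambda>y. indicator A y *\<^sub>R f y) \<in> L2 \<sigma>"
proof -
  have m: "(\<lambda>y. indicator A y *\<^sub>R f y) \<in> borel_measurable \<sigma>"
    using L2D(1)[OF assms(1)] assms(2) by (intro borel_measurable_scaleR borel_measurable_indicator)
  have "integrable \<sigma> (\<lambda>y. (norm (indicator A y *\<^sub>R f y))\<^sup>2)"
    by (rule Bochner_Integration.integrable_bound[OF L2D(2)[OF assms(1)]])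
      (use measurable_norm_compose[OF m] in \<open>auto simp: indicator_def\<close>)
  then show ?thesis using m by (simp add: L2_def)
qed

text \<open>Used for the complement of U near s = 1 and for U near 1 - d / 2 and 1 + d / 2, with
  different m. Passing from the L1 to the L2 norm costs the root of the area, so after division by
  the area its inverse root remains.\<close>

lemma cTop_bounds:
  assumes w: "w \<in> \<S>" and f: "f \<in> L2 \<sigma>" and A: "A \<in> sets \<sigma>" and B: "open B"
    and z: "\<And>z. z \<in> B \<Longrightarrow> norm z \<le> 2" and m: "0 < m" "\<And>z y. z \<in> B \<Longrightarrow> y \<in> A \<Longrightarrow> m \<le> Re (csqdist w z y)"
  shows "cTop A w f holomorphic_on B"
    and "z \<in> B \<Longrightarrow> norm (cTop A w f z) \<le> 6 * m powr (-3/2) / sqrt total_area * L2_norm \<sigma> (\<lambda>y. indicator A y *\<^sub>R f y)"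
proof -
  let ?g = "\<lambda>y. indicator A y *\<^sub>R f y"
  define c where "c = 6 * m powr (-3/2)"
  have AS: "A \<subseteq> \<S>" using A sets.sets_into_space[OF A] by simp
  have gL: "?g \<in> L2 \<sigma>" by (rule indicator_L2[OF f A])
  have intg: "integrable \<sigma> (\<lambda>y. c * norm (?g y))"
    using L1_le_L2(1)[OF sigma.finite_measure_axioms L2_norm_norm(2)[OF gL]]
    by (rule Bochner_Integration.integrable_mult_right)
  have le: "norm (indicator A y *\<^sub>R cker w f z y) \<le> c * norm (?g y)" if "z \<in> B" "y \<in> \<S>" for z y
    using norm_cker_le[OF w that(2) z[OF that(1)] m(1), of f] m(2)[OF that(1), of y]
    by (auto simp: indicator_def c_def)
  have ms: "(\<lambda>y. indicator A y *\<^sub>R cker w f z y) \<in> borel_measurable \<sigma>" for z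
    using cker_measurable[OF L2D(1)[OF f]] A by (intro borel_measurable_scaleR borel_measurable_indicator)
  have "(\<lambda>z. \<integral>y. indicator A y *\<^sub>R cker w f z y \<partial>\<sigma>) holomorphic_on B"
  proof (rule holomorphic_on_lebesgue_integral[OF B ms _ _ intg])
    show "(\<lambda>z. indicator A y *\<^sub>R cker w f z y) holomorphic_on B" if "y \<in> space \<sigma>" for y
    proof (cases "y \<in> A")
      case True
      have "csqdist w z y \<notin> \<real>\<^sub>\<le>\<^sub>0" if "z \<in> B" for z
        using m(1) m(2)[OF that True] by (auto simp: complex_nonpos_Reals_iff)
      then have "(\<lambda>z. cker w f z y) holomorphic_on B"
        unfolding cker_def
        by (intro holomorphic_intros) (auto simp: csqdist_def intro!: holomorphic_intros)
      then show ?thesis using True by simp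
    qed simp
    show "norm (indicator A y *\<^sub>R cker w f z y) \<le> c * norm (?g y)" if "z \<in> B" "y \<in> space \<sigma>" for z y
      by (rule le) (use that in simp_all)
  qed
  then show "cTop A w f holomorphic_on B"
    unfolding cTop_def[abs_def]
    by (rule holomorphic_on_divide) (use total_area_pos in auto)
  assume zB: "z \<in> B"
  have "integrable \<sigma> (\<lambda>y. indicator A y *\<^sub>R cker w f z y)"
    by (rule Bochner_Integration.integrable_bound[OF intg ms[of z]], rule AE_I2)
      (use le[OF zB] in \<open>force intro: order_trans[OF _ abs_ge_self]\<close>)
  then have "norm (\<integral>y. indicator A y *\<^sub>R cker w f z y \<partial>\<sigma>) \<le> (\<integral>y. c * norm (?g y) \<partial>\<sigma>)"
    by (rule Bochner_Integration.integral_norm_bound_integral[OF _ intg]) (rule le[OF zB], simp)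
  also have "\<dots> = c * (\<integral>y. norm (?g y) \<partial>\<sigma>)" by simp
  also have "\<dots> \<le> c * (sqrt total_area * L2_norm \<sigma> ?g)"
    using L1_le_L2(2)[OF sigma.finite_measure_axioms gL]
    by (intro mult_left_mono) (auto simp: c_def total_area_def)
  finally have "norm (cTop A w f z) \<le> c * (sqrt total_area * L2_norm \<sigma> ?g) / total_area"
    unfolding cTop_def norm_divide using total_area_pos by (simp add: divide_right_mono)
  also have "\<dots> = c / sqrt total_area * L2_norm \<sigma> ?g"
    using total_area_pos real_sqrt_mult_self[of total_area] by (simp add: field_simps)
  finally show "norm (cTop A w f z) \<le> 6 * m powr (-3/2) / sqrt total_area * L2_norm \<sigma> ?g"
    by (simp add: c_def)
qed

lemma cker_real:
  assumes w: "w \<in> \<S>" and y: "y \<in> \<S>" and s: "0 < s" "s \<noteq> 1"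
  shows "cker w f (of_real s) y = of_real (tker w s y \<bullet> f y)"
proof -
  have ne: "w \<noteq> s *\<^sub>R y" using dist_sphere_nonzero[OF w y] s by simp
  have D: "csqdist w (of_real s) y = of_real ((w - s *\<^sub>R y) \<bullet> (w - s *\<^sub>R y))"
  proof -
    have "1 - 2 * s * (w \<bullet> y) + s\<^sup>2 = (w - s *\<^sub>R y) \<bullet> (w - s *\<^sub>R y)"
      using sqdist_sphere[OF w y, of s] by (simp add: power2_norm_eq_inner)
    moreover have "csqdist w (of_real s) y = of_real (1 - 2 * s * (w \<bullet> y) + s\<^sup>2)"
      by (simp add: csqdist_def)
    ultimately show ?thesis by simp
  qed
  have "csqdist w (of_real s) y powr (-3/2) = csqdist w (of_real s) y powr (of_real (-3/2))" by simp
  also have "\<dots> = of_real (((w - s *\<^sub>R y) \<bullet> (w - s *\<^sub>R y)) powr (-3/2))"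
    unfolding D by (rule powr_of_real) simp
  also have "\<dots> = of_real (1 / norm (w - s *\<^sub>R y) ^ 3)" by (simp only: sqdist_powr(2)[OF ne])
  finally have "csqdist w (of_real s) y powr (-3/2) = of_real (1 / norm (w - s *\<^sub>R y) ^ 3)" .
  then have "cker w f (of_real s) y = of_real ((s * (w \<bullet> f y) - s\<^sup>2 * (y \<bullet> f y)) * (1 / norm (w - s *\<^sub>R y) ^ 3))"
    by (simp add: cker_def)
  also have "(s * (w \<bullet> f y) - s\<^sup>2 * (y \<bullet> f y)) * (1 / norm (w - s *\<^sub>R y) ^ 3) = tker w s y \<bullet> f y"
    by (simp add: tker_def inner_diff_left power2_eq_square right_diff_distrib diff_divide_distrib mult.assoc)
  finally show ?thesis .
qed

lemma cTop_split:
  assumes w: "w \<in> \<S>" and s: "0 < s" "s \<noteq> 1" and f: "f \<in> L2 \<sigma>" and A: "A \<in> sets \<sigma>"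
  shows "cTop (\<S> - A) w f (of_real s) + cTop A w f (of_real s) = of_real (Top w s f)"
proof -
  let ?k = "\<lambda>y. tker w s y \<bullet> f y"
  have i: "integrable \<sigma> ?k"
    using L2_inner_integrable[OF tker_L2[OF w] f] s by simp
  have A': "\<S> - A \<in> sets \<sigma>" using sets.compl_sets[OF A] by simp
  have c: "cTop B w f (of_real s) = of_real ((\<integral>y. indicator B y * ?k y \<partial>\<sigma>) / total_area)" for B
  proof -
    have "(\<integral>y. indicator B y *\<^sub>R cker w f (of_real s) y \<partial>\<sigma>) = (\<integral>y. complex_of_real (indicator B y * ?k y) \<partial>\<sigma>)"
      by (rule Bochner_Integration.integral_cong[OF refl]) (auto simp: cker_real[OF w _ s] scaleR_conv_of_real)
    then show ?thesis unfolding cTop_def by (simp only: integral_complex_of_real of_real_divide)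
  qed
  have "(\<integral>y. indicator (\<S> - A) y * ?k y \<partial>\<sigma>) + (\<integral>y. indicator A y * ?k y \<partial>\<sigma>)
      = (\<integral>y. indicator (\<S> - A) y * ?k y + indicator A y * ?k y \<partial>\<sigma>)"
    by (rule Bochner_Integration.integral_add[symmetric])
      (use integrable_real_mult_indicator[OF A' i] integrable_real_mult_indicator[OF A i] in \<open>auto simp: mult.commute\<close>)
  also have "\<dots> = ip \<sigma> (tker w s) f"
    unfolding ip_def by (rule Bochner_Integration.integral_cong[OF refl]) (auto simp: indicator_def)
  finally have "(\<integral>y. indicator (\<S> - A) y * ?k y \<partial>\<sigma>) + (\<integral>y. indicator A y * ?k y \<partial>\<sigma>) = ip \<sigma> (tker w s) f" .
  then show ?thesis
    unfolding c Top_def by (simp add: add_divide_distrib[symmetric] flip: of_real_add)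
qed

text \<open>With D1 = |w - y|^2 the polynomial is (z - 1)^2 + z D1. Near z = 1 the second term has
  real part at least (1 - d) d0^2 and the first is at most d^2; the hypothesis on d says that the
  difference is at least half of d0^2.\<close>

lemma csqdist_far:
  assumes w: "w \<in> \<S>" and y: "y \<in> \<S>" and d0: "0 < d0" "d0 \<le> dist w y" and d: "0 < d" "d + d\<^sup>2 / d0\<^sup>2 \<le> 1/2"
    and z: "z \<in> ball 1 d"
  shows "d0\<^sup>2 / 2 \<le> Re (csqdist w z y)"
proof -
  define D1 where "D1 = 2 - 2 * (w \<bullet> y)"
  have "(norm (w - y))\<^sup>2 = D1" using sqdist_sphere[OF w y, of 1] by (simp add: D1_def)
  then have D1: "d0\<^sup>2 \<le> D1" using power_mono[of d0 "norm (w - y)" 2] d0 by (simp add: dist_norm)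
  have "csqdist w z y = (z - 1)\<^sup>2 + z * of_real D1"
    by (simp add: csqdist_def D1_def power2_eq_square algebra_simps)
  moreover have "\<bar>Re ((z - 1)\<^sup>2)\<bar> \<le> d\<^sup>2"
  proof -
    have "norm (z - 1) < d" using z by (simp add: dist_norm norm_minus_commute)
    then have "(norm (z - 1))\<^sup>2 \<le> d\<^sup>2" by (intro power_mono) auto
    then show ?thesis using abs_Re_le_cmod[of "(z - 1)\<^sup>2"] by (simp add: norm_power)
  qed
  moreover have "1 - d \<le> Re z"
    using z abs_Re_le_cmod[of "1 - z"] by (simp add: dist_norm)
  then have "(1 - d) * d0\<^sup>2 \<le> Re z * D1"
  proof -
    have "d \<le> 1/2" using d d0 by (smt (verit) divide_nonneg_nonneg zero_le_power2)
    then show ?thesis using \<open>1 - d \<le> Re z\<close> D1 by (intro mult_mono) auto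
  qed
  ultimately have "(1 - d) * d0\<^sup>2 - d\<^sup>2 \<le> Re (csqdist w z y)" by simp
  moreover have "(1 - d) * d0\<^sup>2 - d\<^sup>2 = (1 - (d + d\<^sup>2 / d0\<^sup>2)) * d0\<^sup>2"
    using d0 by (simp add: field_simps)
  moreover have "(1 / 2) * d0\<^sup>2 \<le> (1 - (d + d\<^sup>2 / d0\<^sup>2)) * d0\<^sup>2"
    using d by (intro mult_right_mono) auto
  ultimately show ?thesis by linarith
qed

text \<open>At the real centre x the squared distance is at least (d / 2)^2. Moving z by d^2 / 48
  changes the polynomial by at most 6 times that, d^2 / 8, so half of the bound survives. This is
  the origin of 48.\<close>

lemma csqdist_near_real:
  assumes w: "w \<in> \<S>" and y: "y \<in> \<S>" and d: "0 < d" "d \<le> 1/2" and x: "0 \<le> x" "x \<le> 5/4" "d / 2 \<le> \<bar>1 - x\<bar>"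
    and z: "z \<in> ball (complex_of_real x) (d\<^sup>2 / 48)"
  shows "d\<^sup>2 / 8 \<le> Re (csqdist w z y)"
proof -
  have "d / 2 \<le> norm (w - x *\<^sub>R y)" using dist_sphere_lower[OF w y x(1)] x(3) by simp
  then have "(d / 2)\<^sup>2 \<le> (norm (w - x *\<^sub>R y))\<^sup>2" using d by (intro power_mono) auto
  then have D0: "d\<^sup>2 / 4 \<le> Re (csqdist w (of_real x) y)"
    unfolding sqdist_sphere[OF w y] by (simp add: csqdist_def power_divide flip: of_real_power)
  have zx: "norm (z - of_real x) < d\<^sup>2 / 48" using z by (simp add: dist_norm norm_minus_commute)
  have "d\<^sup>2 \<le> 1" using d by (simp add: power_le_one)
  have "csqdist w z y - csqdist w (of_real x) y = (z - of_real x) * (z + of_real x - 2 * of_real (w \<bullet> y))"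
    by (simp add: csqdist_def power2_eq_square algebra_simps)
  moreover have "norm (z + of_real x - 2 * of_real (w \<bullet> y)) \<le> 6"
  proof -
    have "norm (z + of_real x - 2 * of_real (w \<bullet> y)) \<le> norm (z - of_real x) + norm (2 * complex_of_real x) + norm (2 * complex_of_real (w \<bullet> y))"
      using norm_triangle_ineq[of "z - of_real x" "2 * complex_of_real x"]
        norm_triangle_ineq4[of "(z - of_real x) + 2 * complex_of_real x" "2 * complex_of_real (w \<bullet> y)"]
      by (simp add: add.commute)
    also have "\<dots> \<le> 1/48 + 5/2 + 2"
      using zx x \<open>d\<^sup>2 \<le> 1\<close> Cauchy_Schwarz_ineq2[of w y] w y
      by (intro add_mono) (auto simp: norm_mult)
    finally show ?thesis by simp
  qed
  ultimately have "norm (csqdist w z y - csqdist w (of_real x) y) \<le> d\<^sup>2 / 48 * 6"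
    using zx by (simp only: norm_mult) (intro mult_mono, auto)
  then show ?thesis
    using D0 abs_Re_le_cmod[of "csqdist w z y - csqdist w (of_real x) y"] by simp
qed

section \<open>The stability estimate\<close>

lemma patch_cap:
  assumes "patch U"
  obtains p d where "norm p = 1" "d > 0"
    "\<And>w y. norm w = 1 \<Longrightarrow> dist p w < d \<Longrightarrow> y \<in> \<S> - U \<Longrightarrow> d \<le> dist w y"
proof -
  from assms have U: "U \<noteq> {}" "openin (top_of_set \<S>) U" by (auto simp: patch_def)
  obtain W where W: "open W" "U = \<S> \<inter> W" using U(2) by (auto simp: openin_open)
  obtain p where p: "p \<in> U" using U(1) by blast
  obtain e where e: "e > 0" "ball p e \<subseteq> W" using W p open_contains_ball by blast
  have "e / 2 \<le> dist w y" if "norm w = 1" "dist p w < e / 2" "y \<in> \<S> - U" for w y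
  proof (rule ccontr)
    assume "\<not> e / 2 \<le> dist w y"
    then have "dist p y < e" using that(2) dist_triangle[of p y w] by simp
    then have "y \<in> U" using e(2) W(2) that(3) by auto
    then show False using that(3) by simp
  qed
  then show ?thesis using that[of p "e / 2"] p W(2) e(1) by (simp add: dist_commute)
qed

lemma patch_sets: "patch U \<Longrightarrow> U \<in> sets \<sigma>"
  by (auto simp: patch_def openin_open sphere_sets_iff)

lemma L2_norm_restrict:
  assumes "U \<in> sets \<sigma>"
  shows "L2_norm (restrict_space \<sigma> U) f = L2_norm \<sigma> (\<lambda>y. indicator U y *\<^sub>R f y)"
proof -
  have "(\<integral>x. (norm (f x))\<^sup>2 \<partial>restrict_space \<sigma> U) = (\<integral>x. indicator U x *\<^sub>R (norm (f x))\<^sup>2 \<partial>\<sigma>)"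
    by (rule integral_restrict_space) (rule sets.Int[OF assms sets.top])
  also have "\<dots> = (\<integral>x. (norm (indicator U x *\<^sub>R f x))\<^sup>2 \<partial>\<sigma>)"
    by (rule Bochner_Integration.integral_cong[OF refl]) (simp add: indicator_def)
  finally show ?thesis by (simp only: L2_norm_def)
qed

lemma L2_norm_indicator_le:
  assumes "f \<in> L2 \<sigma>" "A \<in> sets \<sigma>"
  shows "L2_norm \<sigma> (\<lambda>y. indicator A y *\<^sub>R f y) \<le> L2_norm \<sigma> f"
  unfolding L2_norm_def
  by (intro real_sqrt_le_mono Bochner_Integration.integral_mono L2D(2) indicator_L2 assms)
    (auto simp: indicator_def)

lemma L2_norm_le_sup:
  fixes P :: "real^3 \<Rightarrow> real"
  assumes "P \<in> L2 \<sigma>" "\<And>x. x \<in> \<S> \<Longrightarrow> \<bar>P x\<bar> \<le> B"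
  shows "L2_norm \<sigma> P \<le> sqrt total_area * B"
proof -
  have "0 \<le> B" using assms(2)[of "axis 1 1"] by (auto intro: order_trans[OF abs_ge_zero])
  have "(\<integral>x. (norm (P x))\<^sup>2 \<partial>\<sigma>) \<le> (\<integral>x. B\<^sup>2 \<partial>\<sigma>)"
    by (rule Bochner_Integration.integral_mono[OF L2D(2)[OF assms(1)]])
      (use assms(2) \<open>0 \<le> B\<close> in \<open>auto simp: abs_le_square_iff[symmetric]\<close>)
  also have "\<dots> = total_area * B\<^sup>2" by (simp add: total_area_def)
  finally have "L2_norm \<sigma> P \<le> sqrt (total_area * B\<^sup>2)" unfolding L2_norm_def by (rule real_sqrt_le_mono)
  then show ?thesis using \<open>0 \<le> B\<close> by (simp add: real_sqrt_mult)
qed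

text \<open>The inequality ln v <= v - 1 at v = c x / m. The prefactor is the maximum of x^m exp(- c
  x), attained at x = m / c.\<close>

lemma powr_le_exp:
  fixes x c m :: real
  assumes "0 < x" "0 < c" "0 < m"
  shows "x powr m \<le> exp (- m - m * ln (c / m)) * exp (c * x)"
proof -
  have "ln (x * (c / m)) \<le> x * (c / m) - 1" using assms by (intro ln_le_minus_one) simp
  then have "ln x + ln (c / m) \<le> x * (c / m) - 1" using assms by (subst (asm) ln_mult) auto
  then have "m * (ln x + ln (c / m)) \<le> m * (x * (c / m) - 1)" using assms by (intro mult_left_mono) auto
  moreover have "m * (x * (c / m) - 1) = c * x - m" using assms by (simp add: right_diff_distrib)
  ultimately have "m * ln x \<le> (- m - m * ln (c / m)) + c * x" by (simp add: distrib_left)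
  then show ?thesis using assms by (simp add: powr_def flip: exp_add)
qed

text \<open>The altitude pays for any Sobolev rate: r^(2 n) beats (n + 1)^(2 + 2 tau), where 2
  accounts for the weight n (2 n + 1). External tails thus decay like those of an internal field in
  the Sobolev space of order tau.\<close>

lemma weight_power_bound:
  fixes r \<tau> :: real
  assumes r: "1 < r" and tau: "0 \<le> \<tau>"
  obtains K where "K > 0" "\<And>n::nat. real n * (2 * real n + 1) \<le> K\<^sup>2 * (real n + 1) powr (- 2 * \<tau>) * r ^ (2 * n)"
proof -
  define m where "m = 2 + 2 * \<tau>"
  define E where "E = exp (- m - m * ln (2 * ln r / m))"
  have lr: "ln r > 0" using r by simp
  have E: "E > 0" by (simp add: E_def)
  have "real n * (2 * real n + 1) \<le> (sqrt (2 * E * r\<^sup>2))\<^sup>2 * (real n + 1) powr (- 2 * \<tau>) * r ^ (2 * n)" for n :: nat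
  proof -
    have "(real n + 1) powr m \<le> E * exp (2 * ln r * (real n + 1))"
      unfolding E_def using lr tau by (intro powr_le_exp) (auto simp: m_def)
    also have "exp (2 * ln r * (real n + 1)) = r\<^sup>2 * r ^ (2 * n)"
    proof -
      have "exp (2 * ln r * (real n + 1)) = exp (real (2 + 2 * n) * ln r)" by (simp add: algebra_simps)
      also have "\<dots> = r ^ (2 + 2 * n)" using r unfolding exp_of_nat_mult by simp
      finally show ?thesis by (simp only: power_add)
    qed
    finally have 1: "(real n + 1) powr m \<le> E * (r\<^sup>2 * r ^ (2 * n))" .
    have "(real n + 1) powr 2 = (real n + 1)\<^sup>2"
      by simp
    then have 2: "(real n + 1)\<^sup>2 = (real n + 1) powr m * (real n + 1) powr (- 2 * \<tau>)"
      by (simp add: m_def flip: powr_add)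
    have "real n * (2 * real n + 1) \<le> 2 * (real n + 1)\<^sup>2" by (simp add: power2_eq_square algebra_simps)
    also have "\<dots> \<le> 2 * (E * (r\<^sup>2 * r ^ (2 * n)) * (real n + 1) powr (- 2 * \<tau>))"
      unfolding 2 using 1 by (intro mult_left_mono mult_right_mono) auto
    also have "\<dots> = (sqrt (2 * E * r\<^sup>2))\<^sup>2 * (real n + 1) powr (- 2 * \<tau>) * r ^ (2 * n)"
      using E by simp
    finally show ?thesis .
  qed
  then show ?thesis using that[of "sqrt (2 * E * r\<^sup>2)"] E r by simp
qed

section \<open>Norm estimates by splitting at degree N\<close>

context plus_field
begin

lemma Pn_norm: "(L2_norm \<sigma> (Pn n))\<^sup>2 = (\<Sum>k=-int n..int n. (ap u (n, k))\<^sup>2)"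
  unfolding Pn_def by (rule comb_norm)

text \<open>Below degree N the weight n (2 n + 1) is at most 3 n^2, so each degree contributes at
  most 3 eps^2; from N on, K trades the weight r^(2 n) of the hypothesis for the factor (N + 1)^(- 2
  tau) in the squared norm. The 2 (N + 1) is a generous upper bound for the root of 3 N.\<close>

lemma plus_norm_estimate:
  assumes S: "\<And>N. (\<Sum>n<N. \<Sum>k=-int n..int n. (ap u (n, k) * r ^ n)\<^sup>2) \<le> B\<^sup>2" and B: "0 \<le> B"
    and K: "0 \<le> K" "\<And>n::nat. real n * (2 * real n + 1) \<le> K\<^sup>2 * (real n + 1) powr (- 2 * \<tau>) * r ^ (2 * n)"
    and tau: "0 \<le> \<tau>" and low: "\<And>n. n < N \<Longrightarrow> real n * L2_norm \<sigma> (Pn n) \<le> \<epsilon>" and eps: "0 \<le> \<epsilon>"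
  shows "L2_norm \<sigma> f \<le> 2 * (real N + 1) * \<epsilon> + K * (real N + 1) powr (- \<tau>) * B"
proof -
  define A where "A n = (L2_norm \<sigma> (Pn n))\<^sup>2" for n
  have A: "0 \<le> A n" for n by (simp add: A_def)
  define T where "T = K * (real N + 1) powr (- \<tau>)"
  have T2: "T\<^sup>2 = K\<^sup>2 * (real N + 1) powr (- 2 * \<tau>)"
    by (simp add: T_def power_mult_distrib power2_eq_square flip: powr_add)
  have S': "(\<Sum>n<N'. r ^ (2 * n) * A n) \<le> B\<^sup>2" for N'
    using S[of N'] by (simp add: A_def Pn_norm power_mult_distrib sum_distrib_left power_mult[symmetric] mult.commute)
  have sums: "(\<lambda>n. real n * (2 * real n + 1) * A n) sums (L2_norm \<sigma> f)\<^sup>2"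
    using norm_sums by (simp add: wE_def A_def Pn_norm sum_distrib_left)
  have each: "real n * (2 * real n + 1) * A n \<le> (if n < N then 3 * \<epsilon>\<^sup>2 else 0) + T\<^sup>2 * (r ^ (2 * n) * A n)" for n
  proof (cases "n < N")
    case True
    have "real n * (2 * real n + 1) \<le> 3 * (real n)\<^sup>2"
      by (cases n) (auto simp: power2_eq_square algebra_simps)
    then have "real n * (2 * real n + 1) * A n \<le> 3 * (real n)\<^sup>2 * A n" by (rule mult_right_mono[OF _ A])
    also have "\<dots> = 3 * (real n * L2_norm \<sigma> (Pn n))\<^sup>2" by (simp add: A_def power_mult_distrib)
    also have "\<dots> \<le> 3 * \<epsilon>\<^sup>2"
      using low[OF True] L2_norm_nonneg[of \<sigma> "Pn n"] by (intro mult_left_mono power_mono) auto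
    also have "\<dots> \<le> 3 * \<epsilon>\<^sup>2 + T\<^sup>2 * (r ^ (2 * n) * A n)" using A[of n] r by simp
    finally show ?thesis using True by simp
  next
    case False
    have "(real n + 1) powr (- 2 * \<tau>) \<le> (real N + 1) powr (- 2 * \<tau>)"
      using False tau by (intro powr_mono2') auto
    then have "K\<^sup>2 * (real n + 1) powr (- 2 * \<tau>) * r ^ (2 * n) \<le> T\<^sup>2 * r ^ (2 * n)"
      unfolding T2 using r by (intro mult_right_mono mult_left_mono) auto
    then have "real n * (2 * real n + 1) * A n \<le> T\<^sup>2 * r ^ (2 * n) * A n"
      by (intro mult_right_mono[OF order_trans[OF K(2)] A])
    then show ?thesis using False by (simp add: mult.assoc)
  qed
  have "(\<Sum>n<N'. real n * (2 * real n + 1) * A n) \<le> real N * (3 * \<epsilon>\<^sup>2) + T\<^sup>2 * B\<^sup>2" for N'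
  proof -
    have "(\<Sum>n<N'. real n * (2 * real n + 1) * A n)
        \<le> (\<Sum>n<N'. (if n < N then 3 * \<epsilon>\<^sup>2 else 0) + T\<^sup>2 * (r ^ (2 * n) * A n))"
      by (rule sum_mono) (rule each)
    also have "\<dots> = (\<Sum>n<N'. if n < N then 3 * \<epsilon>\<^sup>2 else 0) + T\<^sup>2 * (\<Sum>n<N'. r ^ (2 * n) * A n)"
      by (simp only: sum.distrib sum_distrib_left)
    also have "(\<Sum>n<N'. if n < N then 3 * \<epsilon>\<^sup>2 else 0) = real (card ({..<N'} \<inter> {n. n < N})) * (3 * \<epsilon>\<^sup>2)"
      by (simp add: sum.If_cases)
    also have "\<dots> + T\<^sup>2 * (\<Sum>n<N'. r ^ (2 * n) * A n) \<le> real N * (3 * \<epsilon>\<^sup>2) + T\<^sup>2 * B\<^sup>2"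
    proof (intro add_mono mult_right_mono mult_left_mono S')
      have "card ({..<N'} \<inter> {n. n < N}) \<le> card {..<N}" by (rule card_mono) auto
      then show "real (card ({..<N'} \<inter> {n. n < N})) \<le> real N" by simp
    qed auto
    finally show ?thesis .
  qed
  then have "(L2_norm \<sigma> f)\<^sup>2 \<le> real N * (3 * \<epsilon>\<^sup>2) + T\<^sup>2 * B\<^sup>2"
    by (intro LIMSEQ_le_const2[OF sums[unfolded sums_def]]) auto
  also have "\<dots> \<le> (2 * (real N + 1) * \<epsilon> + T * B)\<^sup>2"
  proof -
    have "0 \<le> T * B" using K(1) B by (simp add: T_def)
    then have "0 \<le> 2 * (2 * (real N + 1) * \<epsilon>) * (T * B)" using eps by simp
    moreover have "real N * (3 * \<epsilon>\<^sup>2) \<le> (2 * (real N + 1) * \<epsilon>)\<^sup>2"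
    proof -
      have "real N * 3 \<le> (2 * (real N + 1))\<^sup>2" by (simp add: power2_eq_square algebra_simps)
      then have "(real N * 3) * \<epsilon>\<^sup>2 \<le> (2 * (real N + 1))\<^sup>2 * \<epsilon>\<^sup>2" by (rule mult_right_mono) simp
      then show ?thesis by (simp only: power_mult_distrib mult.assoc)
    qed
    ultimately show ?thesis by (simp only: power2_sum power_mult_distrib[of T B]) 
  qed
  finally have "L2_norm \<sigma> f \<le> 2 * (real N + 1) * \<epsilon> + T * B"
    by (rule power2_le_imp_le) (use K(1) B eps in \<open>simp add: T_def\<close>)
  then show ?thesis by (simp add: T_def)
qed

lemma Pn_bound:
  assumes S: "\<And>N. (\<Sum>n<N. \<Sum>k=-int n..int n. (ap u (n, k) * r ^ n)\<^sup>2) \<le> B\<^sup>2" and B: "0 \<le> B"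
  shows "L2_norm \<sigma> (Pn n) * r ^ n \<le> B"
proof -
  have "(L2_norm \<sigma> (Pn n) * r ^ n)\<^sup>2 = (\<Sum>k=-int n..int n. (ap u (n, k) * r ^ n)\<^sup>2)"
    by (simp add: Pn_norm power_mult_distrib sum_distrib_right)
  also have "\<dots> \<le> (\<Sum>n<Suc n. \<Sum>k=-int n..int n. (ap u (n, k) * r ^ n)\<^sup>2)"
    by (simp add: sum_nonneg)
  also have "\<dots> \<le> B\<^sup>2" by (rule S)
  finally show ?thesis by (rule power2_le_imp_le[OF _ B])
qed

end

context minus_field
begin

lemma Qn_norm: "(L2_norm \<sigma> (Qn n))\<^sup>2 = (\<Sum>k=-int n..int n. (qm f (n, k))\<^sup>2)"
  unfolding Qn_def by (rule comb_norm)

text \<open>By orthogonality the partial sum consists of N squares of size at most 2 eps^2, because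
  (n + 1)(2 n + 1) <= 2 (n + 1)^2. The remainder is \<open>minus_tail\<close>.\<close>

lemma minus_norm_estimate:
  assumes sob: "f \<in> sobolev Y \<tau>" and tau: "0 \<le> \<tau>"
    and low: "\<And>n. n < N \<Longrightarrow> (real n + 1) * L2_norm \<sigma> (Qn n) \<le> \<epsilon>" and eps: "0 \<le> \<epsilon>"
  shows "L2_norm \<sigma> f \<le> 2 * (real N + 1) * \<epsilon> + (real N + 1) powr (- \<tau>) * sobolev_norm Y \<tau> f"
proof -
  have "(L2_norm \<sigma> (E.part N))\<^sup>2 = (\<Sum>n<N. (real n + 1) * (2 * real n + 1) * (L2_norm \<sigma> (Qn n))\<^sup>2)"
    unfolding E.part_norm sum_sh_block Qn_norm by (simp add: wG_def sum_distrib_left)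
  also have "\<dots> \<le> (\<Sum>n<N. 2 * \<epsilon>\<^sup>2)"
  proof (rule sum_mono)
    fix n assume "n \<in> {..<N}"
    then have n: "n < N" by simp
    have "(real n + 1) * (2 * real n + 1) * (L2_norm \<sigma> (Qn n))\<^sup>2 \<le> 2 * (real n + 1)\<^sup>2 * (L2_norm \<sigma> (Qn n))\<^sup>2"
      by (rule mult_right_mono) (auto simp: power2_eq_square algebra_simps)
    also have "\<dots> = 2 * ((real n + 1) * L2_norm \<sigma> (Qn n))\<^sup>2" by (simp add: power_mult_distrib)
    also have "\<dots> \<le> 2 * \<epsilon>\<^sup>2"
      using low[OF n] L2_norm_nonneg[of \<sigma> "Qn n"] by (intro mult_left_mono power_mono) auto
    finally show "(real n + 1) * (2 * real n + 1) * (L2_norm \<sigma> (Qn n))\<^sup>2 \<le> 2 * \<epsilon>\<^sup>2" .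
  qed
  also have "\<dots> = (real N * 2) * \<epsilon>\<^sup>2" by simp
  also have "\<dots> \<le> (2 * (real N + 1))\<^sup>2 * \<epsilon>\<^sup>2"
    by (rule mult_right_mono) (auto simp: power2_eq_square algebra_simps)
  finally have "L2_norm \<sigma> (E.part N) \<le> 2 * (real N + 1) * \<epsilon>"
    unfolding power_mult_distrib[symmetric] by (rule power2_le_imp_le) (use eps in simp)
  moreover have "L2_norm \<sigma> f \<le> L2_norm \<sigma> (\<lambda>x. f x - E.part N x) + L2_norm \<sigma> (E.part N)"
    by (rule L2_norm_triangle_diff[OF fL E.part_L2])
  moreover have "L2_norm \<sigma> (\<lambda>x. f x - E.part N x) \<le> (real N + 1) powr (- \<tau>) * sobolev_norm Y \<tau> f"
    by (rule minus_tail[OF f sob tau refl])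
  ultimately show ?thesis by linarith
qed

lemma Qn_bound: "(real n + 1) * L2_norm \<sigma> (Qn n) \<le> L2_norm \<sigma> f"
proof -
  have "((real n + 1) * L2_norm \<sigma> (Qn n))\<^sup>2 \<le> (real n + 1) * (2 * real n + 1) * (L2_norm \<sigma> (Qn n))\<^sup>2"
    unfolding power_mult_distrib by (rule mult_right_mono) (auto simp: power2_eq_square algebra_simps)
  also have "\<dots> = (\<Sum>k=-int n..int n. wG (n, k) * (qm f (n, k))\<^sup>2)"
    by (simp add: Qn_norm wG_def sum_distrib_left)
  also have "\<dots> \<le> (\<Sum>n<Suc n. \<Sum>k=-int n..int n. wG (n, k) * (qm f (n, k))\<^sup>2)"
    using less_imp_le[OF wG_pos] by (auto intro!: sum_nonneg mult_nonneg_nonneg)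
  also have "\<dots> \<le> (L2_norm \<sigma> f)\<^sup>2"
    using E.bessel[of "Suc n"] by (simp only: sum_sh_block)
  finally show ?thesis by (rule power2_le_imp_le[OF _ L2_norm_nonneg])
qed

end

text \<open>Take N close to c ln (1 / q). Then \<open>\<Lambda> ^ N\<close> consumes only half of
  the power of q, and what is left, q to the power beta / 2, is smaller than any power of the
  logarithm. The bound q <= exp (-1) makes the logarithm at least 1, so its exponent may be weakened
  from tau to kappa.\<close>

lemma log_tradeoff:
  fixes D1 D2 \<Lambda> \<beta> \<tau> \<kappa> :: real
  assumes D: "0 < D1" "0 < D2" and L: "1 < \<Lambda>" and b: "0 < \<beta>" and tau: "0 < \<tau>" and k: "\<kappa> \<le> \<tau>"
  obtains C where "C > 0"
    "\<And>X q. 0 < q \<Longrightarrow> q \<le> exp (-1) \<Longrightarrow>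
      (\<forall>N::nat. X \<le> D1 * \<Lambda> ^ N * q powr \<beta> + D2 * (real N + 1) powr (- \<tau>)) \<Longrightarrow> X \<le> C * ln (1 / q) powr (- \<kappa>)"
proof -
  \<comment> \<open>Exactly the slope for which \<open>\<Lambda> ^ N\<close> is at most q to the
    power - beta / 2.\<close>
  define c where "c = \<beta> / (2 * ln \<Lambda>)"
  define E where "E = exp (- \<tau> - \<tau> * ln (\<beta> / 2 / \<tau>))"
  have lL: "0 < ln \<Lambda>" using L by simp
  have c: "0 < c" using b lL by (simp add: c_def)
  have E: "0 < E" by (simp add: E_def)
  define C where "C = D1 * E + D2 * c powr (- \<tau>)"
  show ?thesis
  proof (rule that[of C])
    show "C > 0" using D E c by (simp add: C_def add_pos_pos)
    fix X q :: real
    assume q: "0 < q" "q \<le> exp (-1)"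
      and X: "\<forall>N::nat. X \<le> D1 * \<Lambda> ^ N * q powr \<beta> + D2 * (real N + 1) powr (- \<tau>)"
    define l where "l = ln (1 / q)"
    have lq: "l = - ln q" using q by (simp add: l_def ln_div)
    have "ln q \<le> ln (exp (-1))" using q by (subst ln_le_cancel_iff) auto
    then have l1: "1 \<le> l" by (simp add: lq)
    define N where "N = nat \<lfloor>c * l\<rfloor>"
    have N: "real N \<le> c * l" "c * l \<le> real N + 1"
      using c l1 by (auto simp: N_def)
    have "\<Lambda> ^ N = exp (real N * ln \<Lambda>)" using L by (simp add: exp_of_nat_mult)
    also have "\<dots> \<le> exp (c * l * ln \<Lambda>)" using N(1) lL by simp
    also have "c * l * ln \<Lambda> = \<beta> / 2 * l" using lL by (simp add: c_def)
    finally have "\<Lambda> ^ N * q powr \<beta> \<le> exp (\<beta> / 2 * l) * exp (- (\<beta> * l))"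
      using q by (intro mult_mono) (auto simp: powr_def lq)
    also have "\<dots> = exp (- (\<beta> / 2 * l))" by (simp flip: exp_add)
    also have "\<dots> \<le> E * l powr (- \<tau>)"
    proof -
      have "l powr \<tau> \<le> E * exp (\<beta> / 2 * l)"
        unfolding E_def by (rule powr_le_exp) (use l1 b tau in auto)
      then have "l powr \<tau> * (exp (- (\<beta> / 2 * l)) * l powr (- \<tau>)) \<le> E * exp (\<beta> / 2 * l) * (exp (- (\<beta> / 2 * l)) * l powr (- \<tau>))"
        by (rule mult_right_mono) simp
      moreover have "l powr \<tau> * (exp (- (\<beta> / 2 * l)) * l powr (- \<tau>)) = exp (- (\<beta> / 2 * l)) * l powr (\<tau> + - \<tau>)"
        unfolding powr_add by simp
      moreover have "E * exp (\<beta> / 2 * l) * (exp (- (\<beta> / 2 * l)) * l powr (- \<tau>)) = E * l powr (- \<tau>)"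
        by (simp add: exp_minus field_simps)
      ultimately show ?thesis using l1 by (simp only: add.right_inverse) simp
    qed
    finally have 1: "\<Lambda> ^ N * q powr \<beta> \<le> E * l powr (- \<tau>)" .
    have "(real N + 1) powr (- \<tau>) \<le> (c * l) powr (- \<tau>)"
      using N(2) c l1 tau by (intro powr_mono2') auto
    then have 2: "(real N + 1) powr (- \<tau>) \<le> c powr (- \<tau>) * l powr (- \<tau>)"
      using c l1 by (simp add: powr_mult)
    have "X \<le> D1 * (\<Lambda> ^ N * q powr \<beta>) + D2 * (real N + 1) powr (- \<tau>)"
      using X[rule_format, of N] by (simp only: mult.assoc)
    also have "\<dots> \<le> D1 * (E * l powr (- \<tau>)) + D2 * (c powr (- \<tau>) * l powr (- \<tau>))"
      using 1 2 D by (intro add_mono mult_left_mono) auto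
    also have "\<dots> = C * l powr (- \<tau>)" by (simp add: C_def algebra_simps)
    also have "\<dots> \<le> C * l powr (- \<kappa>)"
      using \<open>C > 0\<close> l1 k by (intro mult_left_mono powr_mono) auto
    finally show "X \<le> C * ln (1 / q) powr (- \<kappa>)" by (simp only: l_def)
  qed
qed

text \<open>The majorant is the derivative of the geometric series; its linear weight covers the
  factors n and n + 1 of the pairing.\<close>

lemma weighted_series_bound:
  fixes c :: "nat \<Rightarrow> real"
  assumes x: "0 \<le> x" "x < 1" and c: "\<And>n. \<bar>c n\<bar> \<le> A * ((real n + 1) * x ^ n)"
  shows "summable (\<lambda>n. \<bar>c n\<bar>)" "(\<Sum>n. \<bar>c n\<bar>) \<le> A / (1 - x)\<^sup>2"
proof -
  have s: "(\<lambda>n. A * ((real n + 1) * x ^ n)) sums (A * (1 / (1 - x)\<^sup>2))"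
    using geometric_deriv_sums[of x] x by (intro sums_mult) (simp add: add.commute)
  show sm: "summable (\<lambda>n. \<bar>c n\<bar>)"
    by (rule summable_comparison_test'[OF sums_summable[OF s], of 0]) (use c in simp)
  show "(\<Sum>n. \<bar>c n\<bar>) \<le> A / (1 - x)\<^sup>2"
    using suminf_le[OF c sm sums_summable[OF s]] sums_unique[OF s] by simp
qed

lemma Top_add:
  assumes "w \<in> \<S>" "0 \<le> s" "s \<noteq> 1" "f \<in> L2 \<sigma>" "g \<in> L2 \<sigma>"
  shows "Top w s (\<lambda>y. f y + g y) = Top w s f + Top w s g"
  using assms by (simp add: Top_def ip_add_right tker_L2 add_divide_distrib)

lemma sup_bound_sphere:
  fixes P :: "real^3 \<Rightarrow> real"
  assumes P: "solid_harmonic n P" and B: "\<And>y. norm y = 1 \<Longrightarrow> \<bar>c * P y\<bar> \<le> B" and c: "0 \<le> c"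
  shows "c * L2_norm \<sigma> P \<le> sqrt total_area * B"
proof -
  have "L2_norm \<sigma> (\<lambda>x. c *\<^sub>R P x) \<le> sqrt total_area * B"
    by (rule L2_norm_le_sup) (use B L2_scaleR[OF continuous_L2[OF solid_harmonicD(5)[OF P]]] in auto)
  then show ?thesis using c by (simp only: L2_norm_scaleR abs_of_nonneg)
qed

text \<open>\<open>cap_estimate\<close> at each point w of the cap, with the pairings over the
  complement of U and over U as \<open>TV\<close> and \<open>TU\<close>. The constants are fixed
  before the basis, the fields and w, because the geometry of the cap and r alone determine
  them.\<close>

lemma cap_coefficients:
  fixes U :: "(real^3) set" and r :: real
  assumes U: "patch U" and r: "1 < r"
  obtains p d0 C \<beta> \<rho> where "norm p = 1" "0 < d0" "0 < C" "0 < \<beta>" "1 < \<rho>"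
    "\<And>Y f u g B q w j. plus_field Y r f u \<Longrightarrow> minus_field Y g \<Longrightarrow>
      (\<forall>n. L2_norm \<sigma> (plus_field.Pn Y u n) * r ^ n \<le> B) \<Longrightarrow> L2_norm \<sigma> f \<le> B \<Longrightarrow> L2_norm \<sigma> g \<le> B \<Longrightarrow>
      0 < q \<Longrightarrow> q \<le> 1 \<Longrightarrow> L2_norm \<sigma> (\<lambda>y. indicator U y *\<^sub>R (f y + g y)) \<le> q * B \<Longrightarrow>
      norm w = 1 \<Longrightarrow> dist p w < d0 \<Longrightarrow>
      \<bar>real j * plus_field.Pn Y u j w\<bar> \<le> C * B * q powr \<beta> \<and>
      \<bar>(real j + 1) * minus_field.Qn Y g j w\<bar> \<le> C * B * q powr \<beta> * \<rho> ^ (j + 1)"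
proof -
  obtain p d0 where p: "norm p = 1" and d0: "d0 > 0"
    and far: "\<And>w y. norm w = 1 \<Longrightarrow> dist p w < d0 \<Longrightarrow> y \<in> \<S> - U \<Longrightarrow> d0 \<le> dist w y"
    using patch_cap[OF U] by metis
  have UA: "U \<in> sets \<sigma>" by (rule patch_sets[OF U])
  then have VA: "\<S> - U \<in> sets \<sigma>" using sets.compl_sets[OF UA] by simp
  have US: "U \<subseteq> \<S>" using sets.sets_into_space[OF UA] by simp
  \<comment> \<open>The bound (r - 1) / 2 leaves the altitude room for the circle of radius 1 + d
    and for the loss k; d0^2 makes d^2 / d0^2 <= d, as \<open>csqdist_far\<close> requires; 1/4
    makes 2 d <= 1/2.\<close>
  define d where "d = min (1/4) (min ((r - 1) / 2) (d0\<^sup>2))"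
  have d: "0 < d" "d \<le> 1/4" "d \<le> (r - 1) / 2" "d \<le> d0\<^sup>2" using r d0 unfolding d_def by (simp_all only: min.cobounded1 min.coboundedI2 min.cobounded2 min_less_iff_conj) simp_all
  have dd: "d + d\<^sup>2 / d0\<^sup>2 \<le> 1/2"
  proof -
    have "d\<^sup>2 \<le> d * d0\<^sup>2" unfolding power2_eq_square[of d] using d by (intro mult_left_mono) auto
    then have "d\<^sup>2 / d0\<^sup>2 \<le> d" using d0 by (simp add: divide_le_eq)
    then show ?thesis using d(2) by linarith
  qed
  \<comment> \<open>The radius for which \<open>csqdist_near_real\<close> applies on both small
    discs.\<close>
  define e where "e = d\<^sup>2 / 48"
  have e: "0 < e" "e \<le> d / 8"
  proof -
    have "d\<^sup>2 \<le> d * 1" unfolding power2_eq_square using d by (intro mult_left_mono) auto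
    then show "0 < e" "e \<le> d / 8" using d by (auto simp: e_def)
  qed
  \<comment> \<open>The base of the exponential loss in \<open>solid_harmonic_sup_bound\<close> must
    fit both margins: k (1 + d) < r for the external series and k < 1 + d / 4 for the internal
    one.\<close>
  define k where "k = 1 + d / 8"
  have k: "1 < k" using d by (simp add: k_def)
  obtain Ck where Ck: "Ck > 0" "\<And>n P w. solid_harmonic n P \<Longrightarrow> w \<in> \<S> \<Longrightarrow> \<bar>P w\<bar> \<le> Ck * k ^ n * L2_norm \<sigma> P"
    by (rule solid_harmonic_sup_bound[OF k]) (rule that)
  define x1 where "x1 = k * (1 + d) / r"
  define x2 where "x2 = k / (1 + d / 4)"
  have x1: "0 \<le> x1" "x1 < 1"
  proof -
    have "d * d \<le> 1/4 * d" using d by (intro mult_right_mono) auto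
    moreover have "k * (1 + d) = 1 + d + d / 8 + d * d / 8" by (simp add: k_def field_simps)
    moreover have "2 * d \<le> r - 1" using d(3) by simp
    ultimately have "k * (1 + d) < r" using d(1) by argo
    then show "0 \<le> x1" "x1 < 1" using r k d by (auto simp: x1_def)
  qed
  have x2: "0 \<le> x2" "x2 < 1" using d by (auto simp: x2_def k_def)
  have d12: "d \<le> 1/2" using d by simp
  obtain C0 \<beta> where C0: "C0 > 0" "\<beta> > 0" "\<beta> \<le> 1"
    and cap: "\<And>a b M q TV TU j.
      summable (\<lambda>n. \<bar>a n\<bar> * (1 + d) ^ n) \<Longrightarrow> (\<Sum>n. \<bar>a n\<bar> * (1 + d) ^ n) \<le> M \<Longrightarrow>
      summable (\<lambda>n. \<bar>b n\<bar> / (1 + d / 4) ^ (n + 1)) \<Longrightarrow> (\<Sum>n. \<bar>b n\<bar> / (1 + d / 4) ^ (n + 1)) \<le> M \<Longrightarrow>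
      TV holomorphic_on ball 1 d \<Longrightarrow> (\<forall>z\<in>ball 1 d. norm (TV z) \<le> M) \<Longrightarrow>
      TU holomorphic_on ball (of_real (1 - d / 2)) e \<Longrightarrow> TU holomorphic_on ball (of_real (1 + d / 2)) e \<Longrightarrow>
      (\<forall>z\<in>ball (of_real (1 - d / 2)) e \<union> ball (of_real (1 + d / 2)) e. norm (TU z) \<le> M * q) \<Longrightarrow>
      0 < q \<Longrightarrow> q \<le> 1 \<Longrightarrow>
      (\<forall>x. \<bar>x - (1 - d / 2)\<bar> < e \<longrightarrow> TV (complex_of_real x) + TU (of_real x) = (\<Sum>n. of_real (a n) * of_real x ^ n)) \<Longrightarrow>
      (\<forall>x. \<bar>x - (1 + d / 2)\<bar> < e \<longrightarrow> TV (complex_of_real x) + TU (of_real x) = (\<Sum>n. of_real (b n) / of_real x ^ (n + 1))) \<Longrightarrow>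
      \<bar>a j\<bar> * (1 + d / 2) ^ j \<le> C0 * M * q powr \<beta> \<and> \<bar>b j\<bar> / (1 + d / 2) ^ (j + 1) \<le> C0 * M * q powr \<beta>"
    by (rule cap_estimate[OF d(1) d12 order_refl e]) (rule that)
  \<comment> \<open>The four constants bound the two series, the pairing over the complement and the
    pairing over U, each relative to B. In their sum the third counts twice because the norm of f +
    g is at most 2 B.\<close>
  define c1 where "c1 = Ck / (1 - x1)\<^sup>2"
  define c2 where "c2 = Ck / (1 - x2)\<^sup>2"
  define c3 where "c3 = 6 * (d0\<^sup>2 / 2) powr (-3/2) / sqrt total_area"
  define c4 where "c4 = 6 * (d\<^sup>2 / 8) powr (-3/2) / sqrt total_area"
  have c: "0 \<le> c1" "0 \<le> c2" "0 \<le> c3" "0 < c4"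
    using Ck(1) total_area_pos d by (auto simp: c1_def c2_def c3_def c4_def)
  define c where "c = c1 + c2 + 2 * c3 + c4"
  have c_le: "c1 \<le> c" "c2 \<le> c" "2 * c3 \<le> c" "c4 \<le> c" "0 < c" using c by (auto simp: c_def)
  have ball_bound: "norm z \<le> 2" if "z \<in> ball (complex_of_real x) e" "\<bar>x - 1\<bar> \<le> d / 2" for x z
  proof -
    have "norm (z - of_real x) < e" using that by (simp add: dist_norm norm_minus_commute)
    moreover have "norm (complex_of_real x) \<le> 1 + d / 2"
      using that(2) abs_triangle_ineq[of "x - 1" 1] unfolding norm_of_real by simp
    ultimately show ?thesis
      using norm_triangle_ineq[of "z - of_real x" "of_real x"] e d by simp
  qed
  show ?thesis
  proof (rule that[OF p d0, of "C0 * c" \<beta> "1 + d / 2"])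
    show "0 < C0 * c" "0 < \<beta>" "1 < 1 + d / 2" using C0 c_le d by auto
    fix Y f u g B q w j
    assume P: "plus_field Y r f u" and Mi: "minus_field Y g"
      and PB: "\<forall>n. L2_norm \<sigma> (plus_field.Pn Y u n) * r ^ n \<le> B" and fB: "L2_norm \<sigma> f \<le> B" and gB: "L2_norm \<sigma> g \<le> B"
      and q: "0 < q" "q \<le> 1" and UB: "L2_norm \<sigma> (\<lambda>y. indicator U y *\<^sub>R (f y + g y)) \<le> q * B"
      and w: "norm w = 1" "dist p w < d0"
    interpret P: plus_field Y r f u by (rule P)
    interpret Mi: minus_field Y g by (rule Mi)
    have wS: "w \<in> \<S>" using w by simp
    have B: "0 \<le> B" using fB L2_norm_nonneg[of \<sigma> f] by linarith
    define h where "h = (\<lambda>y. f y + g y)"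
    have hL: "h \<in> L2 \<sigma>" unfolding h_def by (rule L2_add[OF P.fL Mi.fL])
    define a where "a n = real n * P.Pn n w" for n
    define b where "b n = (real n + 1) * Mi.Qn n w" for n
    have an: "\<bar>\<bar>a n\<bar> * (1 + d) ^ n\<bar> \<le> Ck * B * ((real n + 1) * x1 ^ n)" for n
    proof -
      have sh: "solid_harmonic n (P.Pn n)" unfolding P.Pn_def by (rule P.comb_solid)
      have "L2_norm \<sigma> (P.Pn n) \<le> B / r ^ n"
        using PB[rule_format, of n] r by (simp add: le_divide_eq)
      then have "\<bar>P.Pn n w\<bar> \<le> Ck * k ^ n * (B / r ^ n)"
        using Ck(1) k by (intro order_trans[OF Ck(2)[OF sh wS]] mult_left_mono) auto
      then have "real n * \<bar>P.Pn n w\<bar> * (1 + d) ^ n \<le> (real n + 1) * (Ck * k ^ n * (B / r ^ n)) * (1 + d) ^ n"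
        using d by (intro mult_right_mono mult_mono) auto
      also have "\<dots> = Ck * B * ((real n + 1) * x1 ^ n)"
        by (simp add: x1_def power_divide power_mult_distrib)
      finally show ?thesis using d by (simp add: a_def abs_mult)
    qed
    have bn: "\<bar>\<bar>b n\<bar> / (1 + d / 4) ^ (n + 1)\<bar> \<le> Ck * B * ((real n + 1) * x2 ^ n)" for n
    proof -
      have sh: "solid_harmonic n (Mi.Qn n)" unfolding Mi.Qn_def by (rule P.comb_solid)
      have "(real n + 1) * \<bar>Mi.Qn n w\<bar> \<le> (real n + 1) * (Ck * k ^ n * L2_norm \<sigma> (Mi.Qn n))"
        by (intro mult_left_mono Ck(2)[OF sh wS]) auto
      also have "\<dots> = Ck * k ^ n * ((real n + 1) * L2_norm \<sigma> (Mi.Qn n))" by simp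
      also have "\<dots> \<le> Ck * k ^ n * B"
        using Ck(1) k order_trans[OF Mi.Qn_bound gB] by (intro mult_left_mono) auto
      finally have 1: "\<bar>b n\<bar> \<le> Ck * k ^ n * B" by (simp add: b_def abs_mult)
      have "(1 + d / 4) ^ n \<le> (1 + d / 4) ^ (n + 1)" using d by (intro power_increasing) auto
      then have "\<bar>b n\<bar> / (1 + d / 4) ^ (n + 1) \<le> Ck * k ^ n * B / (1 + d / 4) ^ n"
        using 1 d Ck(1) k B by (intro frac_le) auto
      also have "\<dots> = Ck * B * (1 * x2 ^ n)" by (simp add: x2_def power_divide)
      also have "\<dots> \<le> Ck * B * ((real n + 1) * x2 ^ n)"
        using Ck(1) B x2 by (intro mult_left_mono mult_right_mono) auto
      finally show ?thesis using d by simp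
    qed
    have sa: "summable (\<lambda>n. \<bar>a n\<bar> * (1 + d) ^ n)" "(\<Sum>n. \<bar>a n\<bar> * (1 + d) ^ n) \<le> c * B"
    proof -
      have "c1 * B \<le> c * B" using c_le B by (intro mult_right_mono) auto
      then show "summable (\<lambda>n. \<bar>a n\<bar> * (1 + d) ^ n)" "(\<Sum>n. \<bar>a n\<bar> * (1 + d) ^ n) \<le> c * B"
        using weighted_series_bound[OF x1 an] d by (simp_all add: c1_def abs_mult)
    qed
    have sb: "summable (\<lambda>n. \<bar>b n\<bar> / (1 + d / 4) ^ (n + 1))" "(\<Sum>n. \<bar>b n\<bar> / (1 + d / 4) ^ (n + 1)) \<le> c * B"
    proof -
      have "c2 * B \<le> c * B" using c_le B by (intro mult_right_mono) auto
      moreover have "\<bar>\<bar>b n\<bar> / (1 + d / 4) ^ (n + 1)\<bar> = \<bar>b n\<bar> / (1 + d / 4) ^ (n + 1)" for n using d by simp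
      ultimately show "summable (\<lambda>n. \<bar>b n\<bar> / (1 + d / 4) ^ (n + 1))" "(\<Sum>n. \<bar>b n\<bar> / (1 + d / 4) ^ (n + 1)) \<le> c * B"
        using weighted_series_bound[OF x2 bn] by (simp_all only: c2_def) auto
    qed
    have TVm: "d0\<^sup>2 / 2 \<le> Re (csqdist w z y)" if "z \<in> ball 1 d" "y \<in> \<S> - U" for z y
      using csqdist_far[OF wS _ d0 far[OF w that(2)] d(1) dd that(1)] that(2) by simp
    have nz: "norm z \<le> 2" if "z \<in> ball 1 d" for z :: complex
      using that norm_triangle_ineq[of "z - 1" 1] d by (simp add: dist_norm norm_minus_commute)
    have m0: "0 < d0\<^sup>2 / 2" "0 < d\<^sup>2 / 8" using d0 d by auto
    have TV: "cTop (\<S> - U) w h holomorphic_on ball 1 d"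
      "z \<in> ball 1 d \<Longrightarrow> norm (cTop (\<S> - U) w h z) \<le> c3 * L2_norm \<sigma> (\<lambda>y. indicator (\<S> - U) y *\<^sub>R h y)" for z
      unfolding c3_def by (rule cTop_bounds[OF wS hL VA open_ball _ m0(1)]; (erule nz | erule (1) TVm | assumption))+
    have TVb: "\<forall>z\<in>ball 1 d. norm (cTop (\<S> - U) w h z) \<le> c * B"
    proof
      fix z :: complex assume z: "z \<in> ball 1 d"
      have "L2_norm \<sigma> (\<lambda>y. indicator (\<S> - U) y *\<^sub>R h y) \<le> L2_norm \<sigma> h"
        by (rule L2_norm_indicator_le[OF hL VA])
      also have "\<dots> \<le> 2 * B"
        unfolding h_def using L2_norm_triangle[OF P.fL Mi.fL] fB gB by linarith
      finally have "c3 * L2_norm \<sigma> (\<lambda>y. indicator (\<S> - U) y *\<^sub>R h y) \<le> c3 * (2 * B)"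
        by (rule mult_left_mono[OF _ c(3)])
      moreover have "c3 * (2 * B) \<le> c * B"
        using mult_right_mono[OF c_le(3) B] by simp
      ultimately show "norm (cTop (\<S> - U) w h z) \<le> c * B"
        using TV(2)[OF z] by linarith
    qed
    have TUm: "d\<^sup>2 / 8 \<le> Re (csqdist w z y)"
      if "z \<in> ball (complex_of_real x) e" "x = 1 - d / 2 \<or> x = 1 + d / 2" "y \<in> U" for x z y
      by (rule csqdist_near_real[OF wS _ d(1) d12, of y x]) (use that d US in \<open>auto simp: e_def\<close>)
    have TU: "cTop U w h holomorphic_on ball (complex_of_real x) e"
      "z \<in> ball (complex_of_real x) e \<Longrightarrow> norm (cTop U w h z) \<le> c * B * q"
      if x: "x = 1 - d / 2 \<or> x = 1 + d / 2" for x z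
    proof -
      have nz: "norm z \<le> 2" if "z \<in> ball (complex_of_real x) e" for z
        by (rule ball_bound[OF that]) (use x d in auto)
      have T: "cTop U w h holomorphic_on ball (complex_of_real x) e"
        "z \<in> ball (complex_of_real x) e \<Longrightarrow> norm (cTop U w h z) \<le> c4 * L2_norm \<sigma> (\<lambda>y. indicator U y *\<^sub>R h y)" for z
        unfolding c4_def by (rule cTop_bounds[OF wS hL UA open_ball _ m0(2)]; (erule nz | erule (1) TUm[OF _ x] | assumption))+
      show "cTop U w h holomorphic_on ball (complex_of_real x) e" by (rule T(1))
      assume z: "z \<in> ball (complex_of_real x) e"
      have "c4 * L2_norm \<sigma> (\<lambda>y. indicator U y *\<^sub>R h y) \<le> c4 * (q * B)"
        using UB c(4) unfolding h_def by (intro mult_left_mono) auto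
      also have "\<dots> \<le> c * (q * B)" using c_le(4) q B by (intro mult_right_mono) auto
      finally show "norm (cTop U w h z) \<le> c * B * q"
        using T(2)[OF z] by (simp add: mult_ac)
    qed
    have eq0: "cTop (\<S> - U) w h (complex_of_real x) + cTop U w h (of_real x) = (\<Sum>n. of_real (a n) * of_real x ^ n)"
      if "\<bar>x - (1 - d / 2)\<bar> < e" for x
    proof -
      have "x < 1 - d / 2 + e" "x > 1 - d / 2 - e" using that by (auto simp: abs_if split: if_splits)
      then have x: "0 < x" "x < 1" using e d by auto
      have "Top w x h = Top w x f"
        unfolding h_def using Top_add[OF wS _ _ P.fL Mi.fL, of x] Mi.Top_minus_inside[OF wS x] x by simp
      then have "(\<lambda>n. a n * x ^ n) sums Top w x h"
        using P.Top_plus_inside[OF wS x] by (simp only: a_def)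
      then have "(\<lambda>n. complex_of_real (a n * x ^ n)) sums of_real (Top w x h)" by (rule sums_of_real)
      then have "(\<Sum>n. of_real (a n) * of_real x ^ n) = complex_of_real (Top w x h)"
        by (simp add: sums_iff)
      then show ?thesis using cTop_split[OF wS _ _ hL UA, of x] x by simp
    qed
    have eq1: "cTop (\<S> - U) w h (complex_of_real x) + cTop U w h (of_real x) = (\<Sum>n. of_real (b n) / of_real x ^ (n + 1))"
      if "\<bar>x - (1 + d / 2)\<bar> < e" for x
    proof -
      have "x > 1 + d / 2 - e" using that by (auto simp: abs_if split: if_splits)
      then have x: "1 < x" using e d by auto
      have "Top w x h = Top w x g"
        unfolding h_def using Top_add[OF wS _ _ P.fL Mi.fL, of x] P.Top_plus_outside[OF wS x] x by simp
      then have "(\<lambda>n. b n / x ^ (n + 1)) sums Top w x h"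
        using Mi.Top_minus_outside[OF wS x] by (simp only: b_def)
      then have "(\<lambda>n. complex_of_real (b n / x ^ (n + 1))) sums of_real (Top w x h)" by (rule sums_of_real)
      then have "(\<Sum>n. of_real (b n) / of_real x ^ (n + 1)) = complex_of_real (Top w x h)"
        by (simp add: sums_iff)
      then show ?thesis using cTop_split[OF wS _ _ hL UA, of x] x by simp
    qed
    have TUb: "\<forall>z\<in>ball (complex_of_real (1 - d / 2)) e \<union> ball (complex_of_real (1 + d / 2)) e. norm (cTop U w h z) \<le> c * B * q"
      using TU(2)[of "1 - d / 2"] TU(2)[of "1 + d / 2"] by blast
    have final: "\<bar>a j\<bar> * (1 + d / 2) ^ j \<le> C0 * (c * B) * q powr \<beta> \<and> \<bar>b j\<bar> / (1 + d / 2) ^ (j + 1) \<le> C0 * (c * B) * q powr \<beta>"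
      by (rule cap[OF sa sb TV(1) TVb TU(1) TU(1) TUb q]) (use eq0 eq1 in auto)
    \<comment> \<open>For the external coefficients the radius of the circle helps and is dropped;
      for the internal ones it has to be paid as a power of 1 + d / 2.\<close>
    have "\<bar>a j\<bar> * 1 \<le> \<bar>a j\<bar> * (1 + d / 2) ^ j"
      using d by (intro mult_left_mono one_le_power) auto
    moreover have "\<bar>b j\<bar> \<le> C0 * (c * B) * q powr \<beta> * (1 + d / 2) ^ (j + 1)"
      using final d by (simp add: divide_le_eq)
    ultimately show "\<bar>real j * P.Pn j w\<bar> \<le> C0 * c * B * q powr \<beta> \<and>
      \<bar>(real j + 1) * Mi.Qn j w\<bar> \<le> C0 * c * B * q powr \<beta> * (1 + d / 2) ^ (j + 1)"
      using final unfolding a_def[symmetric] b_def[symmetric] by (simp add: mult.assoc)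
  qed
qed

text \<open>The cap bounds become bounds on the whole sphere by \<open>homogeneous_remez\<close>,
  degree by degree, and enter the norm estimates split at degree N. N is left free, for the
  balancing in \<open>log_tradeoff\<close>.\<close>

lemma two_sided_estimate:
  fixes U :: "(real^3) set" and r \<tau> :: real
  assumes U: "patch U" and r: "1 < r" and tau: "0 \<le> \<tau>"
  obtains D1 D2 \<Lambda> \<beta> where "0 < D1" "0 < D2" "1 < \<Lambda>" "0 < \<beta>"
    "\<And>Y f u \<phi> g M q N. sh_basis Y \<Longrightarrow> f \<in> L2 \<sigma> \<Longrightarrow> is_potential Y r f u \<Longrightarrow> is_density r u \<phi> \<Longrightarrow>
      g \<in> hardy_minus Y \<Longrightarrow> g \<in> sobolev Y \<tau> \<Longrightarrow> sobolev_norm Y \<tau> g \<le> M \<Longrightarrow>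
      L2_norm (sphere_measure r) \<phi> \<le> M \<Longrightarrow> 0 < q \<Longrightarrow> q \<le> 1 \<Longrightarrow>
      L2_norm \<sigma> (\<lambda>y. indicator U y *\<^sub>R (f y + g y)) \<le> q * M \<Longrightarrow>
      L2_norm \<sigma> f + L2_norm \<sigma> g \<le> M * (D1 * \<Lambda> ^ N * q powr \<beta> + D2 * (real N + 1) powr (- \<tau>))"
proof -
  obtain p d0 C \<beta> \<rho> where p: "norm p = 1" and d0: "0 < d0" and C: "0 < C" and b: "0 < \<beta>" and rho: "1 < \<rho>"
    and cap: "\<And>Y f u g B q w j. plus_field Y r f u \<Longrightarrow> minus_field Y g \<Longrightarrow>
      (\<forall>n. L2_norm \<sigma> (plus_field.Pn Y u n) * r ^ n \<le> B) \<Longrightarrow> L2_norm \<sigma> f \<le> B \<Longrightarrow> L2_norm \<sigma> g \<le> B \<Longrightarrow>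
      0 < q \<Longrightarrow> q \<le> 1 \<Longrightarrow> L2_norm \<sigma> (\<lambda>y. indicator U y *\<^sub>R (f y + g y)) \<le> q * B \<Longrightarrow>
      norm w = 1 \<Longrightarrow> dist p w < d0 \<Longrightarrow>
      \<bar>real j * plus_field.Pn Y u j w\<bar> \<le> C * B * q powr \<beta> \<and>
      \<bar>(real j + 1) * minus_field.Qn Y g j w\<bar> \<le> C * B * q powr \<beta> * \<rho> ^ (j + 1)"
    by (rule cap_coefficients[OF U r]) (rule that)
  obtain KR where KR: "KR \<ge> 1"
    and remez: "\<And>n P \<eta> y. real_polynomial_function P \<Longrightarrow> (\<forall>c x. P (c *\<^sub>R x) = c ^ n * P x) \<Longrightarrow>
      (\<forall>w. norm w = 1 \<longrightarrow> dist p w < d0 \<longrightarrow> \<bar>P w\<bar> \<le> \<eta>) \<Longrightarrow> norm y = 1 \<Longrightarrow> \<bar>P y\<bar> \<le> \<eta> * KR ^ n"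
    by (rule homogeneous_remez[OF p d0]) (rule that)
  obtain K where K: "K > 0" "\<And>n::nat. real n * (2 * real n + 1) \<le> K\<^sup>2 * (real n + 1) powr (- 2 * \<tau>) * r ^ (2 * n)"
    by (rule weight_power_bound[OF r tau]) (rule that)
  \<comment> \<open>The operator bound of the single layer. The constant c6 below dominates the
    three a priori bounds, each relative to M: for the weighted coefficients of u, for the norm of f
    and for the norm of g.\<close>
  define c5 where "c5 = total_area / (4 * pi)"
  define c6 where "c6 = 1 + c5 + K * c5"
  have c5: "0 < c5" using total_area_pos by (simp add: c5_def)
  have Kc5: "0 < K * c5" using c5 K by simp
  have c6: "1 \<le> c6" "c5 \<le> c6" "K * c5 \<le> c6" "0 < c6" using c5 Kc5 by (auto simp: c6_def)
  define D1 where "D1 = 4 * sqrt total_area * C * c6 * \<rho>"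
  define D2 where "D2 = K * c5 + 1"
  define L where "L = \<rho> * KR"
  have L: "1 < L" unfolding L_def by (rule less_le_trans[OF rho]) (use rho KR in simp)
  show ?thesis
  \<comment> \<open>L collects the loss on the circle and the Remez loss per degree; the 2 absorbs
    the factor N + 1 of the norm estimates.\<close>
  proof (rule that[of D1 D2 "2 * L" \<beta>])
    show "0 < D1" "0 < D2" "1 < 2 * L" "0 < \<beta>"
      using C c6 rho total_area_pos Kc5 L b by (auto simp: D1_def D2_def)
    fix Y f u \<phi> g M q N
    assume Y: "sh_basis Y" and f: "f \<in> L2 \<sigma>" and pot: "is_potential Y r f u" and dens: "is_density r u \<phi>"
      and g: "g \<in> hardy_minus Y" and sob: "g \<in> sobolev Y \<tau>" and gM: "sobolev_norm Y \<tau> g \<le> M"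
      and phiM: "L2_norm (sphere_measure r) \<phi> \<le> M" and q: "0 < q" "q \<le> 1"
      and small: "L2_norm \<sigma> (\<lambda>y. indicator U y *\<^sub>R (f y + g y)) \<le> q * M"
    have Pl: "plus_field Y r f u"
      by unfold_locales (use Y r f pot in \<open>auto simp: is_potential_def\<close>)
    have Mi: "minus_field Y g"
      by unfold_locales (use Y g in auto)
    interpret P: plus_field Y r f u by (rule Pl)
    interpret Mi: minus_field Y g by (rule Mi)
    have M: "0 \<le> M" using phiM L2_norm_nonneg[of "sphere_measure r" \<phi>] by linarith
    have S: "(\<Sum>n<N. \<Sum>k=-int n..int n. (P.ap u (n, k) * r ^ n)\<^sup>2) \<le> (c5 * M)\<^sup>2" for N
    proof (rule order_trans[OF P.density_coefficient_bound[OF r pot dens]])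
      show "(total_area / (4 * pi) * L2_norm (sphere_measure r) \<phi>)\<^sup>2 \<le> (c5 * M)\<^sup>2"
        unfolding c5_def[symmetric]
        using c5 phiM L2_norm_nonneg[of "sphere_measure r" \<phi>]
        by (intro power_mono mult_left_mono mult_nonneg_nonneg) auto
    qed
    have c5M: "0 \<le> c5 * M" using c5 M by simp
    note fest = P.plus_norm_estimate[OF S c5M less_imp_le[OF K(1)] K(2) tau]
    note gest = Mi.minus_norm_estimate[OF sob tau]
    define B where "B = c6 * M"
    have "c5 * M \<le> B" unfolding B_def using c6 M by (intro mult_right_mono) auto
    then have PB: "\<forall>n. L2_norm \<sigma> (P.Pn n) * r ^ n \<le> B"
      by (intro allI order_trans[OF P.Pn_bound[OF S c5M]])
    have fB: "L2_norm \<sigma> f \<le> B"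
    proof -
      \<comment> \<open>With N = 0 no degree has to be small, so the splitting estimate is an a
        priori bound for the full norm.\<close>
      have "L2_norm \<sigma> f \<le> K * c5 * M" using fest[of 0 0] by simp
      also have "\<dots> \<le> B" unfolding B_def using c6 M by (intro mult_right_mono) auto
      finally show ?thesis .
    qed
    have gB: "L2_norm \<sigma> g \<le> B"
    proof -
      have "L2_norm \<sigma> g \<le> 1 * M" using gest[of 0 0] gM by simp
      also have "\<dots> \<le> B" unfolding B_def using c6 M by (intro mult_right_mono) auto
      finally show ?thesis .
    qed
    have UB: "L2_norm \<sigma> (\<lambda>y. indicator U y *\<^sub>R (f y + g y)) \<le> q * B"
    proof (rule order_trans[OF small])
      have "1 * M \<le> c6 * M" using c6 M by (intro mult_right_mono) auto
      then show "q * M \<le> q * B" unfolding B_def using q by (intro mult_left_mono) auto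
    qed
    note capB = cap[OF Pl Mi PB fB gB q UB]
    define H where "H = C * B * q powr \<beta>"
    have H: "0 \<le> H" using C c6 M by (simp add: H_def B_def)
    \<comment> \<open>A common bound for both families in all degrees below N, as the loss increases
      with the degree.\<close>
    define \<eta> where "\<eta> = H * \<rho> * L ^ N"
    have eta: "H * \<rho> ^ (j + 1) * KR ^ j \<le> \<eta>" if "j < N" for j
    proof -
      have "H * \<rho> ^ (j + 1) * KR ^ j = H * \<rho> * L ^ j" by (simp add: L_def power_mult_distrib)
      also have "\<dots> \<le> \<eta>"
        unfolding \<eta>_def using H rho L that by (intro mult_left_mono power_increasing) auto
      finally show ?thesis .
    qed
    have eta0: "0 \<le> \<eta>" using H rho L by (simp add: \<eta>_def)
    have lowP: "real j * L2_norm \<sigma> (P.Pn j) \<le> sqrt total_area * \<eta>" if j: "j < N" for j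
    proof (rule sup_bound_sphere[of j])
      show sh: "solid_harmonic j (P.Pn j)" unfolding P.Pn_def by (rule P.comb_solid)
      note sh' = solid_harmonic_cmul[OF sh, of "real j"]
      fix y :: "real^3" assume y: "norm y = 1"
      have "\<bar>real j * P.Pn j y\<bar> \<le> H * KR ^ j"
        by (rule remez[of "\<lambda>x. real j * P.Pn j x"])
          (use solid_harmonicD(1,2)[OF sh'] capB[of _ j] y in \<open>auto simp: H_def\<close>)
      also have "\<dots> \<le> H * \<rho> ^ (j + 1) * KR ^ j"
      proof -
        have "H * 1 \<le> H * \<rho> ^ (j + 1)" using H rho by (intro mult_left_mono one_le_power) auto
        then show ?thesis using KR by (intro mult_right_mono) auto
      qed
      also have "\<dots> \<le> \<eta>" by (rule eta[OF j])
      finally show "\<bar>real j * P.Pn j y\<bar> \<le> \<eta>" .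
    qed simp
    have lowQ: "(real j + 1) * L2_norm \<sigma> (Mi.Qn j) \<le> sqrt total_area * \<eta>" if j: "j < N" for j
    proof (rule sup_bound_sphere[of j])
      show sh: "solid_harmonic j (Mi.Qn j)" unfolding Mi.Qn_def by (rule P.comb_solid)
      note sh' = solid_harmonic_cmul[OF sh, of "real j + 1"]
      fix y :: "real^3" assume y: "norm y = 1"
      have "\<bar>(real j + 1) * Mi.Qn j y\<bar> \<le> H * \<rho> ^ (j + 1) * KR ^ j"
        by (rule remez[of "\<lambda>x. (real j + 1) * Mi.Qn j x"])
          (use solid_harmonicD(1,2)[OF sh'] capB[of _ j] y in \<open>auto simp: H_def\<close>)
      also have "\<dots> \<le> \<eta>" by (rule eta[OF j])
      finally show "\<bar>(real j + 1) * Mi.Qn j y\<bar> \<le> \<eta>" .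
    qed simp
    define \<epsilon> where "\<epsilon> = sqrt total_area * \<eta>"
    have eps: "0 \<le> \<epsilon>" using eta0 total_area_pos by (simp add: \<epsilon>_def)
    have F: "L2_norm \<sigma> f \<le> 2 * (real N + 1) * \<epsilon> + K * (real N + 1) powr (- \<tau>) * (c5 * M)"
      by (rule fest) (use lowP eps in \<open>simp_all add: \<epsilon>_def\<close>)
    have "L2_norm \<sigma> g \<le> 2 * (real N + 1) * \<epsilon> + (real N + 1) powr (- \<tau>) * sobolev_norm Y \<tau> g"
      by (rule gest) (use lowQ eps in \<open>simp_all add: \<epsilon>_def\<close>)
    also have "\<dots> \<le> 2 * (real N + 1) * \<epsilon> + (real N + 1) powr (- \<tau>) * M"
      using gM by (intro add_left_mono mult_left_mono) auto
    finally have G: "L2_norm \<sigma> g \<le> 2 * (real N + 1) * \<epsilon> + (real N + 1) powr (- \<tau>) * M" .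
    \<comment> \<open>The polynomial factor is hidden in the exponential one, which gives the bound
      the shape that \<open>log_tradeoff\<close> expects.\<close>
    have "real N + 1 \<le> 2 ^ N" using of_nat_mono[OF Suc_leI[OF less_exp[of N]], where 'a = real] by simp
    then have "4 * ((real N + 1) * \<epsilon>) \<le> 4 * (2 ^ N * \<epsilon>)"
      using eps by (intro mult_left_mono mult_right_mono) auto
    also have "\<dots> = M * (D1 * (2 * L) ^ N * q powr \<beta>)"
      by (simp add: \<epsilon>_def \<eta>_def H_def B_def D1_def power_mult_distrib)
    finally have 1: "4 * ((real N + 1) * \<epsilon>) \<le> M * (D1 * (2 * L) ^ N * q powr \<beta>)" .
    have 2: "K * (real N + 1) powr (- \<tau>) * (c5 * M) + (real N + 1) powr (- \<tau>) * M = M * (D2 * (real N + 1) powr (- \<tau>))"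
      by (simp add: D2_def distrib_right distrib_left)
    show "L2_norm \<sigma> f + L2_norm \<sigma> g \<le> M * (D1 * (2 * L) ^ N * q powr \<beta> + D2 * (real N + 1) powr (- \<tau>))"
    proof -
      have "2 * (real N + 1) * \<epsilon> = 2 * ((real N + 1) * \<epsilon>)" by simp
      then show ?thesis using F G 1 2 unfolding distrib_left[of M] by linarith
    qed
  qed
qed

theorem theorem14:
  fixes U :: "(real^3) set" and \<alpha> \<tau> r :: real
  assumes "patch U" and "0 < \<alpha>" and "\<alpha> < 1" and "1/2 \<le> \<tau>" and "1 < r"
  shows "\<exists>C1>0. \<exists>C2>0. \<forall>M>0. \<exists>\<delta>>0.
    \<forall>Y f_plus u_plus \<phi>_plus f_minus.
      sh_basis Y \<longrightarrow>
      f_plus \<in> hardy_plus_alt Y r \<longrightarrow>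
      is_potential Y r f_plus u_plus \<longrightarrow>
      is_density r u_plus \<phi>_plus \<longrightarrow>
      f_minus \<in> hardy_minus Y \<longrightarrow>
      f_minus \<in> sobolev Y \<tau> \<longrightarrow> sobolev_norm Y \<tau> f_minus \<le> M \<longrightarrow>
      L2_norm (sphere_measure r) \<phi>_plus \<le> M \<longrightarrow>
      L2_norm (restrict_space (sphere_measure 1) U) (\<lambda>x. f_plus x + f_minus x) < \<delta> \<longrightarrow>
      L2_norm (sphere_measure 1) f_plus + L2_norm (sphere_measure 1) f_minus
        \<le> stab_modulus C1 C2 M \<alpha> \<tau>
             (L2_norm (restrict_space (sphere_measure 1) U) (\<lambda>x. f_plus x + f_minus x))"
proof -
  have tau: "0 < \<tau>" "0 \<le> \<tau>" using assms by auto
  obtain D1 D2 \<Lambda> \<beta> where D: "0 < D1" "0 < D2" "1 < \<Lambda>" "0 < \<beta>"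
    and est: "\<And>Y f u \<phi> g M q N. sh_basis Y \<Longrightarrow> f \<in> L2 \<sigma> \<Longrightarrow> is_potential Y r f u \<Longrightarrow> is_density r u \<phi> \<Longrightarrow>
      g \<in> hardy_minus Y \<Longrightarrow> g \<in> sobolev Y \<tau> \<Longrightarrow> sobolev_norm Y \<tau> g \<le> M \<Longrightarrow>
      L2_norm (sphere_measure r) \<phi> \<le> M \<Longrightarrow> 0 < q \<Longrightarrow> q \<le> 1 \<Longrightarrow>
      L2_norm \<sigma> (\<lambda>y. indicator U y *\<^sub>R (f y + g y)) \<le> q * M \<Longrightarrow>
      L2_norm \<sigma> f + L2_norm \<sigma> g \<le> M * (D1 * \<Lambda> ^ N * q powr \<beta> + D2 * (real N + 1) powr (- \<tau>))"
    by (rule two_sided_estimate[OF assms(1,5) tau(2)]) (rule that)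
  define \<kappa> where "\<kappa> = \<alpha> * stab_exponent \<tau>"
  have kappa: "0 < \<kappa>" "\<kappa> \<le> \<tau>"
  proof -
    \<comment> \<open>The hypothesis tau >= 1/2 makes the denominator tau + 1/2 at least 1.\<close>
    have "stab_exponent \<tau> \<le> \<tau>" "0 < stab_exponent \<tau>"
      using assms(4) by (simp_all add: stab_exponent_def divide_le_eq)
    moreover from this have "\<alpha> * stab_exponent \<tau> \<le> 1 * \<tau>" using assms by (intro mult_mono) auto
    ultimately show "0 < \<kappa>" "\<kappa> \<le> \<tau>" using assms by (simp_all add: \<kappa>_def)
  qed
  obtain C where C: "C > 0"
    and trade: "\<And>X q. 0 < q \<Longrightarrow> q \<le> exp (-1) \<Longrightarrow>
      (\<forall>N::nat. X \<le> D1 * \<Lambda> ^ N * q powr \<beta> + D2 * (real N + 1) powr (- \<tau>)) \<Longrightarrow> X \<le> C * ln (1 / q) powr (- \<kappa>)"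
    by (rule log_tradeoff[OF D tau(1) kappa(2)]) (rule that)
  \<comment> \<open>The witnesses are C2 = 1 and the threshold M exp (-1): with q = t / M it says q
    <= exp (-1), the range of \<open>log_tradeoff\<close>.\<close>
  have main: "L2_norm \<sigma> f + L2_norm \<sigma> g \<le> stab_modulus C 1 M \<alpha> \<tau> (L2_norm (restrict_space \<sigma> U) (\<lambda>x. f x + g x))"
    if M: "M > 0" and H: "sh_basis Y" "f \<in> hardy_plus_alt Y r" "is_potential Y r f u" "is_density r u \<phi>"
      "g \<in> hardy_minus Y" "g \<in> sobolev Y \<tau>" "sobolev_norm Y \<tau> g \<le> M" "L2_norm (sphere_measure r) \<phi> \<le> M"
      and small: "L2_norm (restrict_space \<sigma> U) (\<lambda>x. f x + g x) < M * exp (-1)"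
    for M Y f u \<phi> g
  proof -
    define t where "t = L2_norm (restrict_space \<sigma> U) (\<lambda>x. f x + g x)"
    have t: "t = L2_norm \<sigma> (\<lambda>y. indicator U y *\<^sub>R (f y + g y))"
      unfolding t_def by (rule L2_norm_restrict[OF patch_sets[OF assms(1)]])
    define X where "X = (L2_norm \<sigma> f + L2_norm \<sigma> g) / M"
    have fL: "f \<in> L2 \<sigma>" using H(2) by (simp add: hardy_plus_alt_def)
    have X: "X \<le> C * ln (1 / q) powr (- \<kappa>)" if q: "0 < q" "q \<le> exp (-1)" "t \<le> q * M" for q
    proof (rule trade[OF q(1,2)], rule allI)
      fix N :: nat
      have "exp (-1) \<le> (1::real)" by simp
      then have "q \<le> 1" using q(2) by linarith
      then show "X \<le> D1 * \<Lambda> ^ N * q powr \<beta> + D2 * (real N + 1) powr (- \<tau>)"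
        using est[OF H(1) fL H(3-8) q(1) _ q(3)[unfolded t], of N] M
        unfolding X_def by (simp add: divide_le_eq mult.commute)
    qed
    have t0: "0 \<le> t" unfolding t by (rule L2_norm_nonneg)
    show ?thesis
    proof (cases "t = 0")
      case True
      \<comment> \<open>Exact data allow every positive q, although q = 0 itself is excluded from
        the estimate. Letting q tend to 0 gives the vanishing of both fields.\<close>
      have lim: "((\<lambda>q. C * ln (1 / q) powr (- \<kappa>)) \<longlongrightarrow> 0) (at_right 0)"
        using kappa(1) by real_asymp
      have "X \<le> 0"
      proof (rule tendsto_lowerbound[OF lim])
        have "\<forall>\<^sub>F q in at_right (0::real). q \<in> {0<..<exp (-1)}"
          by (rule eventually_at_right_real) simp
        then show "\<forall>\<^sub>F q in at_right 0. X \<le> C * ln (1 / q) powr (- \<kappa>)"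
          by eventually_elim (use X True M in auto)
      qed simp
      then have "L2_norm \<sigma> f + L2_norm \<sigma> g \<le> 0" using M by (simp add: X_def divide_le_0_iff)
      then show ?thesis using True by (simp add: stab_modulus_def flip: t_def)
    next
      case False
      then have tp: "0 < t" using t0 by simp
      \<comment> \<open>For positive data the smallest admissible q is t / M, and ln (1 / q) is the
        logarithm in the modulus with C2 = 1.\<close>
      have q: "0 < t / M" "t / M \<le> exp (-1)" "t \<le> t / M * M"
        using tp M small by (simp_all add: divide_le_eq flip: t_def) (simp add: mult.commute)
      have "M * X \<le> M * (C * ln (1 / (t / M)) powr (- \<kappa>))"
        using X[OF q] M by (intro mult_left_mono) auto
      moreover have "M * X = L2_norm \<sigma> f + L2_norm \<sigma> g" using M by (simp add: X_def)
      moreover have "0 \<le> ln (M / t)"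
      proof -
        have "t \<le> M * exp (-1)" using small unfolding t_def by simp
        also have "\<dots> \<le> M * 1" using M by (intro mult_left_mono) auto
        finally show ?thesis using tp by simp
      qed
      ultimately show ?thesis
        using False unfolding stab_modulus_def t_def[symmetric] by (simp add: \<kappa>_def mult_ac)
    qed
  qed
  show ?thesis
  proof (rule exI[of _ C], rule conjI[OF C], rule exI[of _ 1], rule conjI[OF zero_less_one], intro allI impI)
    fix M :: real assume M: "0 < M"
    show "\<exists>\<delta>>0. \<forall>Y f_plus u_plus \<phi>_plus f_minus.
      sh_basis Y \<longrightarrow>
      f_plus \<in> hardy_plus_alt Y r \<longrightarrow>
      is_potential Y r f_plus u_plus \<longrightarrow>
      is_density r u_plus \<phi>_plus \<longrightarrow>
      f_minus \<in> hardy_minus Y \<longrightarrow>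
      f_minus \<in> sobolev Y \<tau> \<longrightarrow> sobolev_norm Y \<tau> f_minus \<le> M \<longrightarrow>
      L2_norm (sphere_measure r) \<phi>_plus \<le> M \<longrightarrow>
      L2_norm (restrict_space (sphere_measure 1) U) (\<lambda>x. f_plus x + f_minus x) < \<delta> \<longrightarrow>
      L2_norm (sphere_measure 1) f_plus + L2_norm (sphere_measure 1) f_minus
        \<le> stab_modulus C 1 M \<alpha> \<tau>
             (L2_norm (restrict_space (sphere_measure 1) U) (\<lambda>x. f_plus x + f_minus x))"
    proof (rule exI[of _ "M * exp (-1)"], rule conjI, goal_cases)
      case 1 show ?case using M by simp
    next
      case 2 show ?case by (intro allI impI) (rule main[OF M])
    qed
  qed
qed

end
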